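(* Let $0<p\le\infty$, $r\in\mathbb{N}$, $0<\alpha\le r$. Let the family $\{\mathcal{L}_{n,\lambda}\}$ of linear polynomial means be bounded in $L_p$, let $w_{\mathcal{L}}\in\Omega_p$, and assume that the following equivalence holds for any $f\in L_p$ and $n\in\mathbb{N}$: $$\|f-\mathcal{L}_{n,\lambda}(f)\|_{\overline p}\asymp w_{\mathcal{L}}\left(f,\tfrac1n\right)_p .$$ Then for any $f\in H_p^{r,\alpha}$ and $n\in\mathbb{N}$ we have $$\|f-\mathcal{L}_{n,\lambda}(f)\|_{H_{\overline p}^{r,\alpha}}\asymp w_{\mathcal{L}}\left(f,\tfrac1n\right)_{H_p^{r,\alpha}}+\begin{cases}E_n(f)_{H_p^{r,\alpha}},&0<p<1,\\0,&1\le p\le\infty.\end{cases}$$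
   Context: $\mathbb{T}\cong[0,2\pi)$ is the torus; functions are complex-valued and $2\pi$-periodic. For $0<p<\infty$, $L_p=L_p(\mathbb{T})$ is the space of measurable functions with $\|f\|_p=\left(\frac1{2\pi}\int_{\mathbb{T}}|f(x)|^p\,dx\right)^{1/p}<\infty$; $L_\infty$ denotes the space of $2\pi$-periodic continuous functions with $\|f\|_\infty=\max|f|$. For $r\in\mathbb{N}=\{1,2,\dots\}$: $\Delta_h^rf(x)=\sum_{\nu=0}^r(-1)^\nu\binom r\nu f(x+\nu h)$. For $0<\alpha\le r$: $f\in H_p^{r,\alpha}$ if $f\in L_p$ and $\|f\|_{H_p^{r,\alpha}}=\|f\|_p+|f|_{H_p^{r,\alpha}}<\infty$, where $|f|_{H_p^{r,\alpha}}=\sup_{h>0}h^{-\alpha}\|\Delta_h^rf\|_p$. $\mathcal{T}_n$ is the set of trigonometric polynomials $\sum_{\nu=-n}^nc_\nu e^{i\nu x}$, $c_\nu\in\mathbb{C}$, and $E_n(f)_{H_p^{r,\alpha}}=\inf_{T\in\mathcal{T}_n}\|f-T\|_{H_p^{r,\alpha}}$. Families of linear polynomial means: for kernels $K_n(x)=\sum_{\nu=-n}^na_{\nu,n}e^{i\nu x}$ with $a_{0,n}=1$, $n\in\mathbb{N}$, $$\mathcal{L}_{n,\lambda}(f,x)=\frac1{4n+1}\sum_{j=0}^{4n}f(t_j+\lambda)K_n(x-t_j-\lambda),\quad t_j=\frac{2\pi j}{4n+1},\ \lambda\in\mathbb{R}.$$ For functions of $x\in\mathbb{T}$ depending additionally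 on $\lambda\in\mathbb{T}$, $\|\cdot\|_{\overline p}=\|\,\|\cdot\|_{p;x}\|_{p;\lambda}$ is the $p$-(quasi-)norm taken first in $x$ and then in $\lambda$. The family is bounded in $L_p$ if $\sup_n\sup_{\|f\|_p\le1}\|\mathcal{L}_{n,\lambda}(f,x)\|_{\overline p}<\infty$. Put $$\|f-\mathcal{L}_{n,\lambda}(f)\|_{H_{\overline p}^{r,\alpha}}=\|f-\mathcal{L}_{n,\lambda}(f)\|_{\overline p}+\sup_{h>0}\frac{\|\Delta_h^r(f-\mathcal{L}_{n,\lambda}(f))\|_{\overline p}}{h^\alpha},$$ with $\Delta_h^r$ acting in $x$. $w\in\Omega_p$ means that $w(\cdot,\cdot)_p$ assigns to each $f\in L_p$ and $\delta>0$ a number $w(f,\delta)_p\ge0$ such that, with a constant $C$ independent of $f,g,\delta$: $w(f,\delta)_p\le C\|f\|_p$ and $w(f+g,\delta)_p\le C(w(f,\delta)_p+w(g,\delta)_p)$ for all $f,g\in L_p$, $\delta>0$. For $w\in\Omega_p$, $$w(f,\delta)_{H_p^{r,\alpha}}=w(f,\delta)_p+\sup_{h>0}\frac{w(\Delta_h^rf,\delta)_p}{h^\alpha}.$$ $A(f,n)\asymp B(f,n)$ means that there are positive constants $c,C$ with $cA(f,n)\le B(f,n)\le CA(f,n)$ for all $f$ and $n$. *)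

theory Defs
  imports "HOL-Analysis.Analysis"
begin

text \<open>
  Functions on the torus are functions on \<^typ>\<open>real\<close> with period \<open>2 * pi\<close>. All norms take values
  in \<^typ>\<open>ennreal\<close>, so that suprema and integrals are genuine, possibly infinite, quantities.
  Elements of \<open>L\<^sub>p\<close> are functions, not classes modulo null sets.
\<close>

text \<open>Power with a positive exponent, \<open>\<infinity> ^ a = \<infinity>\<close> (the library has \<^term>\<open>(powr)\<close> only on the reals).\<close>

definition ennpowr :: "ennreal \<Rightarrow> real \<Rightarrow> ennreal" where
  "ennpowr x a = (if x = \<infinity> then \<infinity> else ennreal (enn2real x powr a))"

text \<open>
  The functional is defined on nonnegative extended functions because in the mixed norm below it is
  applied to a function whose values are themselves norms. For \<open>p = \<infinity>\<close> it is the supremum (not the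
  essential supremum), which on continuous periodic functions is the maximum.
\<close>

definition pnorm :: "ennreal \<Rightarrow> (real \<Rightarrow> ennreal) \<Rightarrow> ennreal" where
  "pnorm p F =
    (if p = \<infinity> then SUP x. F x
     else ennpowr ((\<integral>\<^sup>+x\<in>{0..2*pi}. ennpowr (F x) (enn2real p) \<partial>lebesgue) / ennreal (2*pi))
            (1 / enn2real p))"

definition Lnorm :: "ennreal \<Rightarrow> (real \<Rightarrow> complex) \<Rightarrow> ennreal" where
  "Lnorm p f = pnorm p (\<lambda>x. ennreal (norm (f x)))"

definition Lspace :: "ennreal \<Rightarrow> (real \<Rightarrow> complex) set" where
  "Lspace p =
    {f. (\<forall>x. f (x + 2*pi) = f x) \<and>
        (if p = \<infinity> then continuous_on UNIV f
         else f \<in> borel_measurable lebesgue \<and> Lnorm p f < \<infinity>)}"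

text \<open>Mixed norm of \<open>F \<lambda> x\<close>: first in the torus variable \<open>x\<close>, then in the parameter \<open>\<lambda>\<close>.\<close>

definition mixed_norm :: "ennreal \<Rightarrow> (real \<Rightarrow> real \<Rightarrow> complex) \<Rightarrow> ennreal" where
  "mixed_norm p F = pnorm p (\<lambda>l. Lnorm p (F l))"

definition diff_op :: "nat \<Rightarrow> real \<Rightarrow> (real \<Rightarrow> complex) \<Rightarrow> real \<Rightarrow> complex" where
  "diff_op r h f x = (\<Sum>\<nu>\<le>r. (-1) ^ \<nu> * of_nat (r choose \<nu>) * f (x + real \<nu> * h))"

definition Hnorm :: "ennreal \<Rightarrow> nat \<Rightarrow> real \<Rightarrow> (real \<Rightarrow> complex) \<Rightarrow> ennreal" where
  "Hnorm p r \<alpha> f =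
    Lnorm p f + (SUP h\<in>{0<..}. Lnorm p (diff_op r h f) / ennreal (h powr \<alpha>))"

definition Hspace :: "ennreal \<Rightarrow> nat \<Rightarrow> real \<Rightarrow> (real \<Rightarrow> complex) set" where
  "Hspace p r \<alpha> = {f \<in> Lspace p. Hnorm p r \<alpha> f < \<infinity>}"

definition mixed_Hnorm :: "ennreal \<Rightarrow> nat \<Rightarrow> real \<Rightarrow> (real \<Rightarrow> real \<Rightarrow> complex) \<Rightarrow> ennreal" where
  "mixed_Hnorm p r \<alpha> F =
    mixed_norm p F +
    (SUP h\<in>{0<..}. mixed_norm p (\<lambda>l. diff_op r h (F l)) / ennreal (h powr \<alpha>))"

definition trig_polys :: "nat \<Rightarrow> (real \<Rightarrow> complex) set" where
  "trig_polys n =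
    {T. \<exists>c :: int \<Rightarrow> complex. T = (\<lambda>x. \<Sum>\<nu>\<in>{- int n..int n}. c \<nu> * cis (of_int \<nu> * x))}"

definition best_approx_H :: "ennreal \<Rightarrow> nat \<Rightarrow> real \<Rightarrow> (real \<Rightarrow> complex) \<Rightarrow> nat \<Rightarrow> ennreal" where
  "best_approx_H p r \<alpha> f n = (INF T\<in>trig_polys n. Hnorm p r \<alpha> (\<lambda>x. f x - T x))"

definition kernel :: "(int \<Rightarrow> nat \<Rightarrow> complex) \<Rightarrow> nat \<Rightarrow> real \<Rightarrow> complex" where
  "kernel a n x = (\<Sum>\<nu>\<in>{- int n..int n}. a \<nu> n * cis (of_int \<nu> * x))"

definition node :: "nat \<Rightarrow> nat \<Rightarrow> real" where
  "node n j = 2 * pi * real j / real (4 * n + 1)"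

definition poly_mean ::
    "(int \<Rightarrow> nat \<Rightarrow> complex) \<Rightarrow> nat \<Rightarrow> real \<Rightarrow> (real \<Rightarrow> complex) \<Rightarrow> real \<Rightarrow> complex" where
  "poly_mean a n l f x =
    1 / of_nat (4 * n + 1) * (\<Sum>j\<le>4 * n. f (node n j + l) * kernel a n (x - node n j - l))"

definition bounded_means :: "ennreal \<Rightarrow> (int \<Rightarrow> nat \<Rightarrow> complex) \<Rightarrow> bool" where
  "bounded_means p a \<longleftrightarrow>
    (SUP n\<in>{1..}. SUP f\<in>{f \<in> Lspace p. Lnorm p f \<le> 1}.
       mixed_norm p (\<lambda>l. poly_mean a n l f)) < \<infinity>"

definition Omega_class :: "ennreal \<Rightarrow> ((real \<Rightarrow> complex) \<Rightarrow> real \<Rightarrow> real) set" where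
  "Omega_class p =
    {w. (\<forall>f\<in>Lspace p. \<forall>\<delta>>0. w f \<delta> \<ge> 0) \<and>
        (\<exists>C>0.
          (\<forall>f\<in>Lspace p. \<forall>\<delta>>0. ennreal (w f \<delta>) \<le> ennreal C * Lnorm p f) \<and>
          (\<forall>f\<in>Lspace p. \<forall>g\<in>Lspace p. \<forall>\<delta>>0. w (\<lambda>x. f x + g x) \<delta> \<le> C * (w f \<delta> + w g \<delta>)))}"

definition w_H ::
    "((real \<Rightarrow> complex) \<Rightarrow> real \<Rightarrow> real) \<Rightarrow> nat \<Rightarrow> real \<Rightarrow> (real \<Rightarrow> complex) \<Rightarrow> real \<Rightarrow> ennreal" where
  "w_H w r \<alpha> f \<delta> =
    ennreal (w f \<delta>) + (SUP h\<in>{0<..}. ennreal (w (diff_op r h f) \<delta>) / ennreal (h powr \<alpha>))"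

definition equivalent_on ::
    "(real \<Rightarrow> complex) set \<Rightarrow> ((real \<Rightarrow> complex) \<Rightarrow> nat \<Rightarrow> ennreal) \<Rightarrow>
     ((real \<Rightarrow> complex) \<Rightarrow> nat \<Rightarrow> ennreal) \<Rightarrow> bool" where
  "equivalent_on S A B \<longleftrightarrow>
    (\<exists>c>0. \<exists>C>0. \<forall>f\<in>S. \<forall>n\<ge>1. ennreal c * A f n \<le> B f n \<and> B f n \<le> ennreal C * A f n)"

end

theory Submission
  imports Defs
begin

text \<open>
  Write \<open>g\<^sub>\<lambda> = f - L\<^sub>\<lambda> f\<close>. The assumed equivalence, applied to \<open>f\<close> and to \<open>\<Delta>\<^sub>h f\<close>, compares \<open>w_H\<close> with
  the errors \<open>f - L f\<close> and \<open>\<Delta>\<^sub>h f - L \<Delta>\<^sub>h f\<close>, whereas the left-hand side involves \<open>\<Delta>\<^sub>h (f - L f)\<close>.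
  The difference of the last two is the commutator \<open>L \<Delta>\<^sub>h u - \<Delta>\<^sub>h L u\<close> with \<open>u = f - T\<close>, \<open>T\<close> an
  arbitrary polynomial of degree \<open>n\<close>, because \<open>L\<close> commutes with \<open>\<Delta>\<^sub>h\<close> on polynomials. Jackson's and
  Bernstein's inequalities bound it by \<open>h\<^sup>\<alpha>\<close> times the Hoelder seminorm of \<open>u\<close>. Hence for every \<open>p\<close> the
  two sides agree up to \<open>E\<^sub>n(f)\<close> in the Hoelder norm. For \<open>p < 1\<close> it remains to see that \<open>E\<^sub>n(f)\<close> is
  bounded by the error of the means: Jackson's inequality applied to the family \<open>g\<^sub>\<lambda>\<close> gives
  \<open>\<lambda>\<close> and \<open>Q\<close> with \<open>g\<^sub>\<lambda> - Q\<close> small, and \<open>L\<^sub>\<lambda> f + Q\<close> is a good approximant. For \<open>p \<ge> 1\<close> the average of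
  \<open>L\<^sub>\<lambda> f\<close> over \<open>\<lambda>\<close> is an approximant whose error is controlled by both sides.

  Jackson's inequality for all \<open>p > 0\<close> comes from sampling operators with smooth kernels: the
  difference of two consecutive dyadic ones is a sampling of \<open>\<Delta>\<^sup>r f\<close>, and the peaked
  kernels make these operators bounded in the mixed norm even for \<open>p < 1\<close>.
\<close>

section \<open>Averages over the torus\<close>

text \<open>Grid samples replace them. A single sample is not controlled by the norm; averaging over
  the position \<lambda> of the grid repairs this, and therefore the bounds live in the mixed norm.
  Where one polynomial is needed, a \<lambda> no worse than the average is selected.

  Three constants recur. Kernels decay like \<open>peak N x ^ \<sigma>\<close> with
  \<open>\<sigma>\<close> times \<open>p\<close> at least 1, so that their p-th powers stay summable
  over the grid. Grids have 6 n points: since 6 < 2 pi, multipliers supported in [-1, 1] give degree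
  at most n, and since pi / 3 < 11/10, frequencies up to n lie on the plateau of the Bernstein
  multiplier. Smoothness bounds hold uniformly in the step, because the step 2 pi / N varies with n.

  Sampling operators converge only if translations are continuous. This is derived from the Hoelder
  seminorm itself, by descending from differences of order r to order 1.\<close>

lemma ennpowr_ennreal: "0 \<le> x \<Longrightarrow> ennpowr (ennreal x) p = ennreal (x powr p)"
  by (simp add: ennpowr_def)

lemma ennpowr_top [simp]: "ennpowr top p = top"
  by (simp add: ennpowr_def infinity_ennreal_def)

lemma ennpowr_0 [simp]: "ennpowr 0 p = 0"
  by (simp add: ennpowr_def)

lemma ennpowr_1 [simp]: "ennpowr 1 p = 1"
  by (simp add: ennpowr_def)

lemma ennpowr_mono:
  assumes "0 \<le> p" "x \<le> y" shows "ennpowr x p \<le> ennpowr y p"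
  using assms
  by (cases x; cases y)
     (auto simp: ennpowr_def infinity_ennreal_def top_unique intro!: ennreal_leI powr_mono2)

text \<open>The degenerate cases agree for every exponent because \<open>0 powr p = 0\<close> and
  \<open>top * 0 = 0\<close>.\<close>

lemma ennpowr_mult:
  "ennpowr (x * y) p = ennpowr x p * ennpowr y p"
proof (cases x; cases y)
  fix a b assume "0 \<le> a" "x = ennreal a" "0 \<le> b" "y = ennreal b"
  then show ?thesis
    by (simp add: ennpowr_ennreal powr_mult flip: ennreal_mult)
qed (auto simp: ennpowr_def ennreal_mult_top ennreal_top_mult infinity_ennreal_def
      powr_def split: if_splits)

lemma ennpowr_ennpowr_inverse:
  assumes "0 < p" shows "ennpowr (ennpowr x p) (1 / p) = x" "ennpowr (ennpowr x (1 / p)) p = x"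
  using assms by (cases x; simp add: ennpowr_ennreal powr_powr)+

lemma ennpowr_le_iff:
  assumes "0 < p" shows "ennpowr x p \<le> ennpowr y p \<longleftrightarrow> x \<le> y"
proof
  assume "ennpowr x p \<le> ennpowr y p"
  then have "ennpowr (ennpowr x p) (1/p) \<le> ennpowr (ennpowr y p) (1/p)"
    using assms by (intro ennpowr_mono[of "1/p"]) auto
  then show "x \<le> y" unfolding ennpowr_ennpowr_inverse(1)[OF assms] .
next
  show "x \<le> y \<Longrightarrow> ennpowr x p \<le> ennpowr y p"
    using assms by (intro ennpowr_mono) auto
qed

lemma ennpowr_max:
  assumes "0 \<le> p" shows "ennpowr (max x y) p = max (ennpowr x p) (ennpowr y p)"
  using assms ennpowr_mono[of p x y] ennpowr_mono[of p y x]
  by (auto simp: max_def intro: antisym)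

text \<open>From \<open>x + y \<le> 2 * max x y\<close>. The crude constant serves exponents below
  and above 1 alike, so the quasi-norm needs no case split.\<close>

lemma ennpowr_add_le:
  assumes "0 \<le> p"
  shows "ennpowr (x + y) p \<le> ennreal (2 powr p) * (ennpowr x p + ennpowr y p)"
proof -
  have "x + y \<le> max x y + max x y"
    by (intro add_mono) auto
  then have "x + y \<le> 2 * max x y"
    by (metis mult_2)
  then have "ennpowr (x + y) p \<le> ennpowr (2 * max x y) p"
    using assms by (rule ennpowr_mono[rotated])
  also have "\<dots> = ennreal (2 powr p) * max (ennpowr x p) (ennpowr y p)"
    using assms ennpowr_ennreal[of 2 p] by (simp add: ennpowr_mult ennpowr_max)
  also have "max (ennpowr x p) (ennpowr y p) \<le> ennpowr x p + ennpowr y p"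
    by (simp add: add_increasing add_increasing2)
  finally show ?thesis by (simp add: mult_left_mono)
qed

lemma measurable_ennpowr [measurable]:
  assumes [measurable]: "F \<in> borel_measurable M"
  shows "(\<lambda>x. ennpowr (F x) p) \<in> borel_measurable M"
  unfolding ennpowr_def by measurable

lemma ennpowr_norm: "ennpowr (ennreal (norm z)) p = ennreal (norm z powr p)"
  by (simp add: ennpowr_ennreal)

lemma measurable_id_lebesgue [measurable]: "(\<lambda>x. x) \<in> lebesgue \<rightarrow>\<^sub>M borel"
  using id_borel_measurable_lebesgue by (simp add: id_def)

definition avg :: "(real \<Rightarrow> ennreal) \<Rightarrow> ennreal" where
  "avg F = (\<integral>\<^sup>+x\<in>{0..2*pi}. F x \<partial>lebesgue) / ennreal (2*pi)"

definition periodic :: "(real \<Rightarrow> 'a) \<Rightarrow> bool" where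
  "periodic f \<longleftrightarrow> (\<forall>x. f (x + 2*pi) = f x)"

lemma avg_mono: "(\<And>x. F x \<le> G x) \<Longrightarrow> avg F \<le> avg G"
  unfolding avg_def by (intro divide_right_mono_ennreal nn_integral_mono mult_right_mono) auto

lemma avg_cong_AE:
  "(AE x in lebesgue. F x = G x) \<Longrightarrow> avg F = avg G"
  unfolding avg_def by (rule arg_cong[where f="\<lambda>z. z / _"], rule nn_integral_cong_AE) auto

lemma avg_const [simp]: "avg (\<lambda>_. c) = c"
proof -
  have "avg (\<lambda>_. c) = c * ennreal (2*pi) / ennreal (2*pi)"
    unfolding avg_def by (subst nn_integral_cmult_indicator) auto
  also have "\<dots> = c"
    by (rule ennreal_mult_divide_eq) auto
  finally show ?thesis .
qed

lemma avg_add: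
  assumes [measurable]: "F \<in> borel_measurable lebesgue" "G \<in> borel_measurable lebesgue"
  shows "avg (\<lambda>x. F x + G x) = avg F + avg G"
proof -
  have "(\<integral>\<^sup>+x\<in>{0..2*pi}. F x + G x \<partial>lebesgue)
      = (\<integral>\<^sup>+x\<in>{0..2*pi}. F x \<partial>lebesgue) + (\<integral>\<^sup>+x\<in>{0..2*pi}. G x \<partial>lebesgue)"
    unfolding distrib_right by (rule nn_integral_add) measurable
  then show ?thesis unfolding avg_def by (simp only: add_divide_distrib_ennreal)
qed

lemma avg_cmult:
  assumes [measurable]: "F \<in> borel_measurable lebesgue"
  shows "avg (\<lambda>x. c * F x) = c * avg F"
proof -
  have "(\<integral>\<^sup>+x\<in>{0..2*pi}. c * F x \<partial>lebesgue) = c * (\<integral>\<^sup>+x\<in>{0..2*pi}. F x \<partial>lebesgue)"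
    unfolding mult.assoc by (rule nn_integral_cmult) measurable
  then show ?thesis unfolding avg_def by (simp only: ennreal_times_divide)
qed

lemma avg_multc:
  assumes [measurable]: "F \<in> borel_measurable lebesgue"
  shows "avg (\<lambda>x. F x * c) = avg F * c"
  using avg_cmult[OF assms, of c] by (simp add: mult.commute)

lemma avg_sum:
  assumes "finite I" "\<And>i. i \<in> I \<Longrightarrow> F i \<in> borel_measurable lebesgue"
  shows "avg (\<lambda>x. \<Sum>i\<in>I. F i x) = (\<Sum>i\<in>I. avg (F i))"
  using assms
proof (induction I)
  case (insert i I)
  then show ?case by (simp add: avg_add borel_measurable_sum)
qed simp

lemma avg_suminf:
  fixes F :: "nat \<Rightarrow> real \<Rightarrow> ennreal"
  assumes "\<And>i. F i \<in> borel_measurable lebesgue"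
  shows "avg (\<lambda>x. \<Sum>i. F i x) = (\<Sum>i. avg (F i))"
proof -
  have "(\<integral>\<^sup>+x\<in>{0..2*pi}. (\<Sum>i. F i x) \<partial>lebesgue) = (\<Sum>i. \<integral>\<^sup>+x\<in>{0..2*pi}. F i x \<partial>lebesgue)"
    using assms by (subst nn_integral_suminf[symmetric]) auto
  then show ?thesis
    unfolding avg_def by (simp add: divide_ennreal_def)
qed

lemma periodic_int:
  assumes "periodic f" shows "f (x + 2*pi * of_int k) = f x"
proof (induction k rule: int_induct[where k=0])
  case (step1 i)
  have "f (x + 2*pi * of_int (i+1)) = f ((x + 2*pi * of_int i) + 2*pi)"
    by (simp add: algebra_simps)
  then show ?case using step1 assms by (simp add: periodic_def)
next
  case (step2 i)
  have "f (x + 2*pi * of_int i) = f ((x + 2*pi * of_int (i-1)) + 2*pi)"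
    by (simp add: algebra_simps)
  then show ?case using step2 assms by (simp add: periodic_def)
qed simp

lemma measurable_shift_lebesgue: "(\<lambda>x::real. x + h) \<in> lebesgue \<rightarrow>\<^sub>M lebesgue"
proof -
  have "(\<lambda>x. h + x) \<in> lebesgue \<rightarrow>\<^sub>M lebesgue"
    using lebesgue_affine_measurable[of "\<lambda>_. 1" h] by (simp add: euclidean_representation)
  then show ?thesis by (simp add: add.commute)
qed

lemma measurable_shift:
  fixes F :: "real \<Rightarrow> 'a::topological_space"
  assumes "F \<in> borel_measurable lebesgue"
  shows "(\<lambda>x. F (x + h)) \<in> borel_measurable lebesgue"
  by (rule measurable_compose[OF measurable_shift_lebesgue assms])

lemma nn_integral_shift:
  fixes F :: "real \<Rightarrow> ennreal"
  assumes "F \<in> borel_measurable lebesgue"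
  shows "(\<integral>\<^sup>+x. F (x + h) \<partial>lebesgue) = (\<integral>\<^sup>+x. F x \<partial>lebesgue)"
  using nn_integral_real_affine_lebesgue[of F 1 h] assms by (simp add: add.commute)

text \<open>Half-open intervals can be cut and translated without counting endpoints twice.\<close>

lemma lebesgue_singleton_indicator:
  fixes F :: "real \<Rightarrow> ennreal"
  shows
  "(\<integral>\<^sup>+x\<in>{a..b}. F x \<partial>lebesgue) = (\<integral>\<^sup>+x\<in>{a..<b::real}. F x \<partial>lebesgue)"
proof (rule nn_integral_cong_AE)
  have "AE x in lebesgue. x \<noteq> b"
    by (rule AE_not_in[of "{b}", simplified]) (simp add: null_sets_completionI)
  then show "AE x in lebesgue. F x * indicator {a..b} x = F x * indicator {a..<b} x"
    by eventually_elim (auto split: split_indicator)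
qed

text \<open>The window [h, 2 pi + h) sticks out of the period by [2 pi, 2 pi + h); periodicity
  carries this piece back to [0, h).\<close>

lemma avg_shift_aux:
  assumes F [measurable]: "F \<in> borel_measurable lebesgue" and per: "periodic F"
    and h: "0 \<le> h" "h < 2*pi"
  shows "avg (\<lambda>x. F (x + h)) = avg F"
proof -
  note [measurable] = measurable_shift[OF F]
  have s1: "(\<integral>\<^sup>+x\<in>{a..<b}. F (x + c) \<partial>lebesgue) = (\<integral>\<^sup>+x\<in>{a+c..<b+c}. F x \<partial>lebesgue)" for a b c
  proof -
    have "(\<integral>\<^sup>+x\<in>{a..<b}. F (x + c) \<partial>lebesgue)
        = (\<integral>\<^sup>+x. F (x + c) * indicator {a+c..<b+c} (x + c) \<partial>lebesgue)"
      by (intro nn_integral_cong) (auto split: split_indicator)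
    also have "\<dots> = (\<integral>\<^sup>+x\<in>{a+c..<b+c}. F x \<partial>lebesgue)"
      by (rule nn_integral_shift[where F="\<lambda>x. F x * indicator {a+c..<b+c} x"]) measurable
    finally show ?thesis .
  qed
  have split: "(\<integral>\<^sup>+x\<in>{a..<c}. F x \<partial>lebesgue)
      = (\<integral>\<^sup>+x\<in>{a..<b}. F x \<partial>lebesgue) + (\<integral>\<^sup>+x\<in>{b..<c}. F x \<partial>lebesgue)"
    if "a \<le> b" "b \<le> c" for a b c
    by (subst nn_integral_add[symmetric])
       (use that in \<open>auto intro!: nn_integral_cong split: split_indicator\<close>)
  have "(\<integral>\<^sup>+x\<in>{0..<2*pi}. F (x + h) \<partial>lebesgue) = (\<integral>\<^sup>+x\<in>{h..<2*pi+h}. F x \<partial>lebesgue)"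
    using s1[where a=0 and b="2*pi" and c=h] by (simp only: add_0)
  also have "\<dots> = (\<integral>\<^sup>+x\<in>{h..<2*pi}. F x \<partial>lebesgue) + (\<integral>\<^sup>+x\<in>{2*pi..<2*pi+h}. F x \<partial>lebesgue)"
    using h by (intro split) auto
  also have "(\<integral>\<^sup>+x\<in>{2*pi..<2*pi+h}. F x \<partial>lebesgue) = (\<integral>\<^sup>+x\<in>{0..<h}. F x \<partial>lebesgue)"
    using s1[where a=0 and b=h and c="2*pi"] per[unfolded periodic_def] by (simp only: add_0 add.commute[of h])
  also have "(\<integral>\<^sup>+x\<in>{h..<2*pi}. F x \<partial>lebesgue) + \<dots> = (\<integral>\<^sup>+x\<in>{0..<2*pi}. F x \<partial>lebesgue)"
    using split[of 0 h "2*pi"] h by (simp add: add.commute)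
  finally show ?thesis
    unfolding avg_def lebesgue_singleton_indicator by simp
qed

lemma avg_shift:
  assumes F: "F \<in> borel_measurable lebesgue" and per: "periodic F"
  shows "avg (\<lambda>x. F (x + h)) = avg F"
proof -
  define k where "k = \<lfloor>h / (2*pi)\<rfloor>"
  define h' where "h' = h - 2*pi * of_int k"
  have "of_int k \<le> h / (2*pi)" "h / (2*pi) < of_int k + 1"
    unfolding k_def by linarith+
  then have h': "0 \<le> h'" "h' < 2*pi"
    by (auto simp: h'_def field_simps)
  have "F (x + h) = F (x + h')" for x
    using periodic_int[OF per, of "x + h'" k] by (simp add: h'_def algebra_simps)
  then show ?thesis using avg_shift_aux[OF F per h'] by simp
qed

text \<open>Makes Tonelli's theorem available for the product of the two completed measures. That
  product is itself not complete, so joint measurability has to be watched.\<close>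

lemma sigma_finite_lebesgue: "sigma_finite_measure (lebesgue :: real measure)"
proof
  obtain A :: "real set set" where A: "countable A" "A \<subseteq> sets lborel" "\<Union>A = space lborel"
     "\<forall>a\<in>A. emeasure lborel a \<noteq> \<infinity>"
    using lborel.sigma_finite_countable by blast
  then show "\<exists>A::real set set. countable A \<and> A \<subseteq> sets lebesgue \<and> \<Union>A = space lebesgue \<and> (\<forall>a\<in>A. emeasure lebesgue a \<noteq> \<infinity>)"
    by (intro exI[of _ A]) (auto simp: subset_eq)
qed

interpretation leb: sigma_finite_measure "lebesgue :: real measure"
  by (rule sigma_finite_lebesgue)

interpretation leb_pair: pair_sigma_finite "lebesgue :: real measure" "lebesgue :: real measure" ..

lemma avg_measurable [measurable]:
  assumes [measurable]: "(\<lambda>(x,y). F x y) \<in> borel_measurable (M \<Otimes>\<^sub>M lebesgue)"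
  shows "(\<lambda>x. avg (F x)) \<in> borel_measurable M"
proof -
  have [measurable]: "(\<lambda>(x,y). F x y * indicator {0..2*pi} y) \<in> borel_measurable (M \<Otimes>\<^sub>M lebesgue)"
    by measurable
  have "(\<lambda>x. \<integral>\<^sup>+y. F x y * indicator {0..2*pi} y \<partial>lebesgue) \<in> borel_measurable M"
    by (rule leb.borel_measurable_nn_integral) measurable
  then show ?thesis unfolding avg_def by measurable
qed

lemma avg_swap:
  assumes F [measurable]: "(\<lambda>(x,y). F x y) \<in> borel_measurable (lebesgue \<Otimes>\<^sub>M lebesgue)"
  shows "avg (\<lambda>x. avg (F x)) = avg (\<lambda>y. avg (\<lambda>x. F x y))"
proof -
  let ?I = "\<lambda>x. indicator {0..2*pi} (x::real) :: ennreal"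
  let ?c = "ennreal (2*pi)"
  have [measurable]: "(\<lambda>(y,x). F x y) \<in> borel_measurable (lebesgue \<Otimes>\<^sub>M lebesgue)"
    using measurable_pair_swap[OF F] by (simp add: case_prod_beta')
  have [measurable]: "(\<lambda>x. \<integral>\<^sup>+y. F x y * ?I y \<partial>lebesgue) \<in> borel_measurable lebesgue"
    by (rule leb.borel_measurable_nn_integral) measurable
  have [measurable]: "(\<lambda>y. \<integral>\<^sup>+x. F x y * ?I x \<partial>lebesgue) \<in> borel_measurable lebesgue"
    by (rule leb.borel_measurable_nn_integral) measurable
  have m: "F x \<in> borel_measurable lebesgue" "(\<lambda>x. F x y) \<in> borel_measurable lebesgue" for x y
    by measurable
  note [measurable] = m
  have "(\<integral>\<^sup>+x. (\<integral>\<^sup>+y. F x y * ?I y \<partial>lebesgue) * ?I x \<partial>lebesgue)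
      = (\<integral>\<^sup>+x. (\<integral>\<^sup>+y. F x y * ?I y * ?I x \<partial>lebesgue) \<partial>lebesgue)"
    by (intro nn_integral_cong nn_integral_multc[symmetric]) measurable
  also have "\<dots> = (\<integral>\<^sup>+y. (\<integral>\<^sup>+x. F x y * ?I y * ?I x \<partial>lebesgue) \<partial>lebesgue)"
    by (rule leb_pair.Fubini'[symmetric]) measurable
  also have "\<dots> = (\<integral>\<^sup>+y. (\<integral>\<^sup>+x. F x y * ?I x \<partial>lebesgue) * ?I y \<partial>lebesgue)"
    by (subst nn_integral_multc[symmetric]) (auto simp: mult.assoc mult.commute mult.left_commute)
  finally have *: "(\<integral>\<^sup>+x. (\<integral>\<^sup>+y. F x y * ?I y \<partial>lebesgue) * ?I x \<partial>lebesgue)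
     = (\<integral>\<^sup>+y. (\<integral>\<^sup>+x. F x y * ?I x \<partial>lebesgue) * ?I y \<partial>lebesgue)" .
  have d: "a / ?c * b = a * b / ?c" for a b :: ennreal
    by (simp add: divide_ennreal_def mult_ac)
  have d2: "(\<integral>\<^sup>+x. G x / ?c \<partial>lebesgue) = (\<integral>\<^sup>+x. G x \<partial>lebesgue) / ?c"
    if "G \<in> borel_measurable lebesgue" for G :: "real \<Rightarrow> ennreal"
    using that by (rule nn_integral_divide)
  show ?thesis
    unfolding avg_def d by (subst d2, measurable, subst d2, measurable, simp only: *)
qed

text \<open>Pigeonhole: a function lying above its average everywhere would have a larger average.
  This extracts a single \<lambda>, hence a single polynomial, from a bound on a mixed norm.\<close>

lemma avg_exists_le:
  assumes F [measurable]: "F \<in> borel_measurable lebesgue"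
  shows "\<exists>x. F x \<le> avg F"
proof (rule ccontr)
  assume "\<not> ?thesis"
  then have lt: "avg F < F x" for x by (auto simp: not_le)
  then have fin: "avg F < \<infinity>"
    by (metis infinity_ennreal_def less_top order_less_imp_not_eq not_less top_greatest)
  let ?I = "\<lambda>x. indicator {0..2*pi} (x::real) :: ennreal"
  have "(\<integral>\<^sup>+x. avg F * ?I x \<partial>lebesgue) < (\<integral>\<^sup>+x. F x * ?I x \<partial>lebesgue)"
  proof (rule nn_integral_less)
    show "AE x in lebesgue. avg F * ?I x \<le> F x * ?I x"
      using lt by (intro AE_I2 mult_right_mono) (auto intro: less_imp_le)
    show "integral\<^sup>N lebesgue (\<lambda>x. avg F * ?I x) \<noteq> \<infinity>"
      using fin by (subst nn_integral_cmult_indicator) (auto simp: ennreal_mult_eq_top_iff)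
    show "\<not> (AE x in lebesgue. F x * ?I x \<le> avg F * ?I x)"
    proof
      assume "AE x in lebesgue. F x * ?I x \<le> avg F * ?I x"
      then have "AE x in lebesgue. x \<notin> {0..2*pi}"
      proof eventually_elim
        case (elim x)
        then show ?case using lt[of x] by (auto split: split_indicator_asm simp: not_le)
      qed
      then have "emeasure lebesgue {0..2*pi} = 0"
        by (subst (asm) AE_iff_null_sets[symmetric]) auto
      then show False by simp
    qed
  qed measurable
  then have "avg (\<lambda>_. avg F) < avg F"
    unfolding avg_def by (subst divide_less_ennreal) (auto simp: ennreal_divide_times ennreal_mult_divide_eq)
  then show False by simp
qed

lemma periodic_comp: "periodic f \<Longrightarrow> periodic (\<lambda>x. G (f x))"
  by (simp add: periodic_def)

lemma periodic_add: "periodic f \<Longrightarrow> periodic (\<lambda>x. f (x + h))"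
  unfolding periodic_def by (metis add.assoc add.commute)

lemma periodic_diff:
  assumes "periodic f" shows "f (x - 2*pi) = f x"
  using assms periodic_def[of f] by (metis diff_add_cancel)

section \<open>Norms and mixed norms\<close>

text \<open>For \<open>p = \<infinity>\<close> the junk value \<open>1 / enn2real p = 1 / 0 = 0\<close> makes the constant \<open>2\<close>.\<close>

definition quasi_const :: "ennreal \<Rightarrow> real" where
  "quasi_const p = 2 * 2 powr (1 / enn2real p)"

lemma quasi_const_ge_1: "1 \<le> quasi_const p"
proof -
  have "1 \<le> 2 powr (1 / enn2real p)" by (rule ge_one_powr_ge_zero) auto
  then show ?thesis unfolding quasi_const_def by linarith
qed

lemma enn2real_pos: "0 < p \<Longrightarrow> p \<noteq> \<infinity> \<Longrightarrow> 0 < enn2real p"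
  by (simp add: enn2real_positive_iff less_top)

lemma pnorm_finite_exp:
  assumes "p \<noteq> \<infinity>"
  shows "pnorm p F = ennpowr (avg (\<lambda>x. ennpowr (F x) (enn2real p))) (1 / enn2real p)"
  using assms by (simp add: pnorm_def avg_def)

lemma pnorm_top_exp: "pnorm \<infinity> F = (SUP x. F x)"
  by (simp add: pnorm_def)

lemma ennpowr_pnorm:
  assumes "0 < p" "p \<noteq> \<infinity>"
  shows "ennpowr (pnorm p F) (enn2real p) = avg (\<lambda>x. ennpowr (F x) (enn2real p))"
  unfolding pnorm_finite_exp[OF assms(2)] using enn2real_pos[OF assms]
  by (rule ennpowr_ennpowr_inverse)

lemma pnorm_mono:
  assumes "0 < p" "\<And>x. F x \<le> G x" shows "pnorm p F \<le> pnorm p G"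
proof (cases "p = \<infinity>")
  case True
  then show ?thesis using assms(2) unfolding True pnorm_top_exp by (intro SUP_mono) auto
next
  case False
  then show ?thesis
    using assms enn2real_pos[OF assms(1) False]
    unfolding pnorm_finite_exp[OF False] by (intro ennpowr_mono avg_mono) auto
qed

lemma pnorm_const [simp]:
  assumes "0 < p" shows "pnorm p (\<lambda>_. c) = c"
proof (cases "p = \<infinity>")
  case True
  show ?thesis unfolding True pnorm_top_exp by simp
next
  case False
  show ?thesis unfolding pnorm_finite_exp[OF False] avg_const
    by (rule ennpowr_ennpowr_inverse(1)[OF enn2real_pos[OF assms False]])
qed

text \<open>At \<open>p = \<infinity>\<close> the functional is a supremum over all points, so the
  measurability condition concerns finite exponents; the same disjunction recurs below.\<close>

lemma pnorm_cmult:
  assumes "0 < p" "p = \<infinity> \<or> F \<in> borel_measurable lebesgue"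
  shows "pnorm p (\<lambda>x. c * F x) = c * pnorm p F"
proof (cases "p = \<infinity>")
  case True
  show ?thesis unfolding True pnorm_top_exp by (simp add: SUP_mult_left_ennreal)
next
  case False
  then have [measurable]: "F \<in> borel_measurable lebesgue" using assms by auto
  show ?thesis
    unfolding pnorm_finite_exp[OF False] ennpowr_mult
    by (subst avg_cmult) (auto simp: ennpowr_mult ennpowr_ennpowr_inverse[OF enn2real_pos[OF assms(1) False]])
qed

text \<open>The power \<open>q\<close> and the root \<open>1/q\<close> each cost one use of
  \<open>ennpowr_add_le\<close>: the first contributes \<open>(2 powr q) powr (1/q) = 2\<close>, the
  second \<open>2 powr (1/q)\<close>. The product is \<open>quasi_const p\<close>.\<close>

lemma pnorm_add_le:
  assumes "0 < p" "p = \<infinity> \<or> F \<in> borel_measurable lebesgue \<and> G \<in> borel_measurable lebesgue"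
  shows "pnorm p (\<lambda>x. F x + G x) \<le> ennreal (quasi_const p) * (pnorm p F + pnorm p G)"
proof (cases "p = \<infinity>")
  case True
  have "pnorm p (\<lambda>x. F x + G x) \<le> 1 * (pnorm p F + pnorm p G)"
    unfolding True pnorm_top_exp mult_1
    by (intro SUP_least add_mono SUP_upper) auto
  also have "\<dots> \<le> ennreal (quasi_const p) * (pnorm p F + pnorm p G)"
    using quasi_const_ge_1 by (intro mult_right_mono) auto
  finally show ?thesis .
next
  case False
  then have [measurable]: "F \<in> borel_measurable lebesgue" "G \<in> borel_measurable lebesgue"
    using assms by auto
  define q where "q = enn2real p"
  have q: "0 < q" unfolding q_def using enn2real_pos[OF assms(1) False] .
  let ?A = "avg (\<lambda>x. ennpowr (F x) q)" and ?B = "avg (\<lambda>x. ennpowr (G x) q)"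
  have "avg (\<lambda>x. ennpowr (F x + G x) q)
      \<le> avg (\<lambda>x. ennreal (2 powr q) * (ennpowr (F x) q + ennpowr (G x) q))"
    using q by (intro avg_mono ennpowr_add_le) auto
  also have "\<dots> = ennreal (2 powr q) * (?A + ?B)"
    by (simp add: avg_cmult avg_add)
  finally have "pnorm p (\<lambda>x. F x + G x) \<le> ennpowr (ennreal (2 powr q) * (?A + ?B)) (1/q)"
    unfolding pnorm_finite_exp[OF False] q_def[symmetric] using q by (intro ennpowr_mono) auto
  also have "\<dots> = 2 * ennpowr (?A + ?B) (1/q)"
    using q by (simp add: ennpowr_mult ennpowr_ennreal powr_powr)
  also have "\<dots> \<le> 2 * (ennreal (2 powr (1/q)) * (ennpowr ?A (1/q) + ennpowr ?B (1/q)))"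
    using q by (intro mult_left_mono ennpowr_add_le) auto
  also have "\<dots> = ennreal (quasi_const p) * (ennpowr ?A (1/q) + ennpowr ?B (1/q))"
    unfolding quasi_const_def q_def[symmetric] by (simp add: ennreal_mult mult.assoc)
  finally show ?thesis unfolding pnorm_finite_exp[OF False] q_def[symmetric] .
qed

lemma pnorm_shift:
  assumes "periodic F" "p = \<infinity> \<or> F \<in> borel_measurable lebesgue"
  shows "pnorm p (\<lambda>x. F (x + h)) = pnorm p F"
proof (cases "p = \<infinity>")
  case True
  have "range (\<lambda>x. F (x + h)) = range F"
    by (auto simp: image_iff) (metis diff_add_cancel)
  then show ?thesis unfolding True pnorm_top_exp by simp
next
  case False
  then have [measurable]: "F \<in> borel_measurable lebesgue" using assms by auto
  have "avg (\<lambda>x. ennpowr (F (x+h)) (enn2real p)) = avg (\<lambda>x. ennpowr (F x) (enn2real p))"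
    using assms(1) by (intro avg_shift[where F="\<lambda>x. ennpowr (F x) (enn2real p)"]) (auto intro: periodic_comp)
  then show ?thesis unfolding pnorm_finite_exp[OF False] by simp
qed

text \<open>Joint measurability is what Tonelli requires. Periodicity is asked for in
  \<open>x\<close>, the variable that gets translated; the parameter is only integrated over one
  period.\<close>

definition family :: "(real \<Rightarrow> real \<Rightarrow> complex) \<Rightarrow> bool" where
  "family F \<longleftrightarrow> (\<forall>l. periodic (F l)) \<and>
     (\<lambda>(l, x). F l x) \<in> borel_measurable (lebesgue \<Otimes>\<^sub>M lebesgue)"

lemma familyI:
  assumes "\<And>l. periodic (F l)" "(\<lambda>(l, x). F l x) \<in> borel_measurable (lebesgue \<Otimes>\<^sub>M lebesgue)"
  shows "family F"
  using assms by (simp add: family_def)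

lemma family_measurable [measurable_dest]:
  "family F \<Longrightarrow> (\<lambda>(l, x). F l x) \<in> borel_measurable (lebesgue \<Otimes>\<^sub>M lebesgue)"
  by (simp add: family_def)

lemma family_measurable1:
  assumes "family F" shows "F l \<in> borel_measurable lebesgue"
proof -
  note [measurable] = family_measurable[OF assms]
  show ?thesis by measurable
qed

lemma family_Lnorm_measurable:
  assumes "family F" "p \<noteq> \<infinity>"
  shows "(\<lambda>l. Lnorm p (F l)) \<in> borel_measurable lebesgue"
proof -
  note [measurable] = family_measurable[OF assms(1)]
  show ?thesis unfolding Lnorm_def pnorm_finite_exp[OF assms(2)] by measurable
qed

lemma family_const:
  assumes "periodic f" and [measurable]: "f \<in> borel_measurable lebesgue" shows "family (\<lambda>l. f)"
  using assms(1) by (intro familyI) measurable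

lemma family_add:
  assumes "family F" "family G" shows "family (\<lambda>l x. F l x + G l x)"
proof -
  note [measurable] = assms[THEN family_measurable]
  show ?thesis using assms by (intro familyI) (auto simp: family_def periodic_def)
qed

lemma family_diff:
  assumes "family F" "family G" shows "family (\<lambda>l x. F l x - G l x)"
proof -
  note [measurable] = assms[THEN family_measurable]
  show ?thesis using assms by (intro familyI) (auto simp: family_def periodic_def)
qed

lemma family_cmult:
  assumes "family F" shows "family (\<lambda>l x. c * F l x)"
proof -
  note [measurable] = assms[THEN family_measurable]
  show ?thesis using assms by (intro familyI) (auto simp: family_def periodic_def)
qed

lemma family_sum:
  assumes "finite I" "\<And>i. i \<in> I \<Longrightarrow> family (F i)" shows "family (\<lambda>l x. \<Sum>i\<in>I. F i l x)"
  using assms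
proof (induction I)
  case empty
  show ?case by (intro familyI) (auto simp: periodic_def)
next
  case (insert i I)
  then show ?case by (simp add: family_add)
qed

lemma family_shift:
  assumes "family F" shows "family (\<lambda>l x. F l (x + h))"
proof -
  note [measurable] = assms[THEN family_measurable] measurable_shift_lebesgue
  show ?thesis using assms by (intro familyI) (auto simp: family_def intro: periodic_add)
qed

lemma family_diff_op:
  assumes "family F" shows "family (\<lambda>l. diff_op r h (F l))"
  unfolding diff_op_def using assms
  by (intro family_sum family_cmult family_shift) auto

lemma ennpowr_mixed_norm:
  assumes "0 < p" "p \<noteq> \<infinity>"
  shows "ennpowr (mixed_norm p F) (enn2real p) = avg (\<lambda>l. avg (\<lambda>x. ennreal (norm (F l x) powr enn2real p)))"
  unfolding mixed_norm_def Lnorm_def ennpowr_pnorm[OF assms] ennpowr_norm ..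

lemma mixed_norm_top: "mixed_norm \<infinity> F = (SUP l. SUP x. ennreal (norm (F l x)))"
  unfolding mixed_norm_def Lnorm_def pnorm_top_exp ..

lemma mixed_norm_const:
  assumes "0 < p" shows "mixed_norm p (\<lambda>l. f) = Lnorm p f"
  using assms by (simp add: mixed_norm_def)

lemma mixed_norm_cong_Lnorm:
  "(\<And>l. Lnorm p (F l) = Lnorm p (G l)) \<Longrightarrow> mixed_norm p F = mixed_norm p G"
  unfolding mixed_norm_def by simp

lemma mixed_norm_le_cmult_Lnorm:
  assumes "0 < p" "family G" "\<And>l. Lnorm p (F l) \<le> c * Lnorm p (G l)"
  shows "mixed_norm p F \<le> c * mixed_norm p G"
proof -
  have "mixed_norm p F \<le> pnorm p (\<lambda>l. c * Lnorm p (G l))"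
    unfolding mixed_norm_def using assms by (intro pnorm_mono) auto
  also have "\<dots> = c * mixed_norm p G"
    unfolding mixed_norm_def
    by (intro pnorm_cmult assms) (use family_Lnorm_measurable[OF assms(2)] in blast)
  finally show ?thesis .
qed

lemma Lnorm_cmult:
  assumes "0 < p" "f \<in> borel_measurable lebesgue"
  shows "Lnorm p (\<lambda>x. c * f x) = ennreal (norm c) * Lnorm p f"
proof -
  note [measurable] = assms(2)
  show ?thesis unfolding Lnorm_def norm_mult
    by (subst pnorm_cmult[symmetric]) (use assms(1) in \<open>auto simp: ennreal_mult\<close>)
qed

lemma Lnorm_add_le:
  assumes "0 < p" "f \<in> borel_measurable lebesgue" "g \<in> borel_measurable lebesgue"
    and h: "\<And>x. norm (h x) \<le> norm (f x) + norm (g x)"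
  shows "Lnorm p h \<le> ennreal (quasi_const p) * (Lnorm p f + Lnorm p g)"
proof -
  note [measurable] = assms(2,3)
  have "Lnorm p h \<le> pnorm p (\<lambda>x. ennreal (norm (f x)) + ennreal (norm (g x)))"
    unfolding Lnorm_def
    using h by (intro pnorm_mono assms) (simp add: ennreal_leI flip: ennreal_plus)
  also have "\<dots> \<le> ennreal (quasi_const p) * (Lnorm p f + Lnorm p g)"
    unfolding Lnorm_def by (intro pnorm_add_le assms disjI2 conjI) measurable
  finally show ?thesis .
qed

lemma mixed_norm_cmult:
  assumes "0 < p" "family F"
  shows "mixed_norm p (\<lambda>l x. c * F l x) = ennreal (norm c) * mixed_norm p F"
proof -
  have "mixed_norm p (\<lambda>l x. c * F l x) = pnorm p (\<lambda>l. ennreal (norm c) * Lnorm p (F l))"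
    unfolding mixed_norm_def using assms by (simp add: Lnorm_cmult family_measurable1)
  also have "\<dots> = ennreal (norm c) * mixed_norm p F"
    unfolding mixed_norm_def
    by (intro pnorm_cmult assms) (use family_Lnorm_measurable[OF assms(2)] in blast)
  finally show ?thesis .
qed

text \<open>One factor \<open>quasi_const p\<close> is lost in the inner norm and one in the outer.
  Domination in place of equality lets sums and differences be treated alike.\<close>

lemma mixed_norm_add_le:
  assumes p: "0 < p" and F: "family F" and G: "family G"
    and H: "\<And>l x. norm (H l x) \<le> norm (F l x) + norm (G l x)"
  shows "mixed_norm p H \<le> ennreal ((quasi_const p)\<^sup>2) * (mixed_norm p F + mixed_norm p G)"
proof -
  let ?k = "ennreal (quasi_const p)"
  have "mixed_norm p H \<le> pnorm p (\<lambda>l. ?k * (Lnorm p (F l) + Lnorm p (G l)))"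
    unfolding mixed_norm_def
    using p H by (intro pnorm_mono Lnorm_add_le family_measurable1 F G) auto
  also have "\<dots> = ?k * pnorm p (\<lambda>l. Lnorm p (F l) + Lnorm p (G l))"
    using p family_Lnorm_measurable[OF F, of p] family_Lnorm_measurable[OF G, of p]
    by (intro pnorm_cmult p) (cases "p = \<infinity>"; simp)
  also have "\<dots> \<le> ?k * (?k * (mixed_norm p F + mixed_norm p G))"
    unfolding mixed_norm_def using p family_Lnorm_measurable[OF F] family_Lnorm_measurable[OF G]
    by (intro mult_left_mono pnorm_add_le) auto
  also have "\<dots> = ennreal ((quasi_const p)\<^sup>2) * (mixed_norm p F + mixed_norm p G)"
    using quasi_const_ge_1[of p] by (simp add: power2_eq_square ennreal_mult mult.assoc)
  finally show ?thesis .
qed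

lemma Lnorm_shift:
  assumes "periodic f" "f \<in> borel_measurable lebesgue"
  shows "Lnorm p (\<lambda>x. f (x + h)) = Lnorm p f"
proof -
  note [measurable] = assms(2)
  show ?thesis unfolding Lnorm_def
    by (rule pnorm_shift[where F="\<lambda>x. ennreal (norm (f x))"])
      (use assms(1) in \<open>auto intro: periodic_comp\<close>)
qed

lemma mixed_norm_shift:
  assumes "family F" shows "mixed_norm p (\<lambda>l x. F l (x + h)) = mixed_norm p F"
  using assms by (intro mixed_norm_cong_Lnorm Lnorm_shift family_measurable1) (auto simp: family_def)

lemma mixed_norm_zero [simp]: "0 < p \<Longrightarrow> mixed_norm p (\<lambda>l x. 0) = 0"
  by (simp add: mixed_norm_def Lnorm_def)

text \<open>Below exponent 1 every addition costs a factor, so the constant grows with the number of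
  terms. The lemma is applied to a fixed number of terms only; long sums go through geometric
  weights later.\<close>

lemma mixed_norm_sum_le:
  fixes m :: nat
  assumes p: "0 < p"
  shows "\<exists>K\<ge>0. \<forall>F. (\<forall>i<m. family (F i)) \<longrightarrow>
    mixed_norm p (\<lambda>l x. \<Sum>i<m. F i l x) \<le> ennreal K * (\<Sum>i<m. mixed_norm p (F i))"
proof (induction m)
  case 0
  show ?case using p by (intro exI[of _ 0]) simp
next
  case (Suc m)
  then obtain K where K: "0 \<le> K" "\<And>F. (\<forall>i<m. family (F i)) \<Longrightarrow>
    mixed_norm p (\<lambda>l x. \<Sum>i<m. F i l x) \<le> ennreal K * (\<Sum>i<m. mixed_norm p (F i))" by blast
  let ?q = "(quasi_const p)\<^sup>2"
  show ?case
  proof (intro exI[of _ "?q * max K 1"] conjI allI impI)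
    fix F :: "nat \<Rightarrow> real \<Rightarrow> real \<Rightarrow> complex" assume F: "\<forall>i<Suc m. family (F i)"
    have "mixed_norm p (\<lambda>l x. \<Sum>i<Suc m. F i l x)
        \<le> ennreal ?q * (mixed_norm p (\<lambda>l x. \<Sum>i<m. F i l x) + mixed_norm p (F m))"
      using F by (intro mixed_norm_add_le p family_sum) (auto intro: norm_triangle_ineq)
    also have "\<dots> \<le> ennreal ?q * (ennreal (max K 1) * (\<Sum>i<m. mixed_norm p (F i)) + ennreal (max K 1) * mixed_norm p (F m))"
    proof (intro mult_left_mono add_mono)
      show "mixed_norm p (\<lambda>l x. \<Sum>i<m. F i l x) \<le> ennreal (max K 1) * (\<Sum>i<m. mixed_norm p (F i))"
        using K(2)[of F] F mult_right_mono[OF ennreal_leI[of K "max K 1"], of "\<Sum>i<m. mixed_norm p (F i)"]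
        by (meson less_SucI max.cobounded1 order_trans zero_le)
      show "mixed_norm p (F m) \<le> ennreal (max K 1) * mixed_norm p (F m)"
        using mult_right_mono[of 1 "ennreal (max K 1)" "mixed_norm p (F m)"] by simp
    qed auto
    also have "\<dots> = ennreal (?q * max K 1) * (\<Sum>i<Suc m. mixed_norm p (F i))"
      by (simp add: ennreal_mult distrib_left mult.assoc)
    finally show "mixed_norm p (\<lambda>l x. \<Sum>i<Suc m. F i l x) \<le> ennreal (?q * max K 1) * (\<Sum>i<Suc m. mixed_norm p (F i))" .
  qed auto
qed

text \<open>The norm is translation invariant, so the constant depends on the binomial coefficients
  but not on \<open>h\<close>.\<close>

lemma mixed_norm_diff_op_le:
  assumes p: "0 < p"
  shows "\<exists>K\<ge>1. \<forall>F h. family F \<longrightarrow> mixed_norm p (\<lambda>l. diff_op r h (F l)) \<le> ennreal K * mixed_norm p F"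
proof -
  obtain K where K: "0 \<le> K" "\<And>F. (\<forall>i<Suc r. family (F i)) \<Longrightarrow>
    mixed_norm p (\<lambda>l x. \<Sum>i<Suc r. F i l x) \<le> ennreal K * (\<Sum>i<Suc r. mixed_norm p (F i))"
    using mixed_norm_sum_le[OF p, of "Suc r"] by blast
  let ?B = "\<Sum>i<Suc r. real (r choose i)"
  show ?thesis
  proof (intro exI[of _ "max 1 (K * ?B)"] conjI allI impI)
    fix F :: "real \<Rightarrow> real \<Rightarrow> complex" and h :: real assume F: "family F"
    have "mixed_norm p (\<lambda>l. diff_op r h (F l)) = mixed_norm p (\<lambda>l x. \<Sum>i<Suc r. (-1) ^ i * of_nat (r choose i) * F l (x + real i * h))"
      unfolding diff_op_def lessThan_Suc_atMost ..
    also have "\<dots> \<le> ennreal K * (\<Sum>i<Suc r. mixed_norm p (\<lambda>l x. (-1) ^ i * of_nat (r choose i) * F l (x + real i * h)))"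
      by (intro K allI impI family_cmult family_shift F)
    also have "(\<Sum>i<Suc r. mixed_norm p (\<lambda>l x. (-1) ^ i * of_nat (r choose i) * F l (x + real i * h)))
        = (\<Sum>i<Suc r. ennreal (real (r choose i)) * mixed_norm p F)"
      by (intro sum.cong refl)
        (simp add: mixed_norm_cmult[OF p family_shift[OF F]] mixed_norm_shift[OF F] norm_mult norm_power)
    also have "\<dots> = ennreal ?B * mixed_norm p F"
      by (simp only: sum_distrib_right[symmetric]) (simp add: sum_ennreal del: sum.lessThan_Suc)
    also have "ennreal K * \<dots> = ennreal (K * ?B) * mixed_norm p F"
      using K(1) by (simp add: ennreal_mult sum_nonneg mult.assoc del: sum.lessThan_Suc)
    also have "\<dots> \<le> ennreal (max 1 (K * ?B)) * mixed_norm p F"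
      by (intro mult_right_mono ennreal_leI) auto
    finally show "mixed_norm p (\<lambda>l. diff_op r h (F l)) \<le> ennreal (max 1 (K * ?B)) * mixed_norm p F" .
  qed auto
qed

section \<open>Closure properties of \<open>Lspace\<close>\<close>

lemma Lspace_periodic: "f \<in> Lspace p \<Longrightarrow> periodic f"
  by (simp add: Lspace_def periodic_def)

lemma continuous_measurable_lebesgue:
  fixes f :: "real \<Rightarrow> 'a::topological_space"
  assumes "continuous_on UNIV f" shows "f \<in> borel_measurable lebesgue"
  using borel_measurable_continuous_onI[OF assms]
  by (intro measurable_completion) simp

lemma Lspace_measurable: "f \<in> Lspace p \<Longrightarrow> f \<in> borel_measurable lebesgue"
  by (auto simp: Lspace_def continuous_measurable_lebesgue split: if_splits)

lemma Lspace_family: "f \<in> Lspace p \<Longrightarrow> family (\<lambda>l. f)"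
  by (intro family_const Lspace_periodic Lspace_measurable)

lemma periodic_reduce:
  assumes "periodic f" obtains y where "y \<in> {0..2*pi}" "f x = f y"
proof -
  define k where "k = \<lfloor>x / (2*pi)\<rfloor>"
  have "of_int k \<le> x / (2*pi)" "x / (2*pi) < of_int k + 1"
    unfolding k_def by linarith+
  then have "x - 2*pi * of_int k \<in> {0..2*pi}"
    by (auto simp: field_simps)
  moreover have "f x = f (x - 2*pi * of_int k)"
    using periodic_int[OF assms, of "x - 2*pi * of_int k" k] by simp
  ultimately show thesis using that by blast
qed

lemma continuous_periodic_bounded:
  fixes f :: "real \<Rightarrow> complex"
  assumes "continuous_on UNIV f" "periodic f"
  shows "\<exists>B. \<forall>x. norm (f x) \<le> B"
proof -
  have "compact (f ` {0..2*pi})"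
    using assms(1) by (intro compact_continuous_image continuous_on_subset[OF assms(1)]) auto
  then obtain B where "\<forall>y\<in>f ` {0..2*pi}. norm y \<le> B"
    using compact_imp_bounded bounded_iff by metis
  then show ?thesis
    by (metis assms(2) image_eqI periodic_reduce)
qed

lemma Lnorm_le_bound:
  assumes "0 < p" "\<And>x. norm (f x) \<le> B" shows "Lnorm p f \<le> ennreal B"
proof -
  have "Lnorm p f \<le> pnorm p (\<lambda>x. ennreal B)"
    unfolding Lnorm_def using assms by (intro pnorm_mono) (auto intro: ennreal_leI)
  then show ?thesis using assms(1) by simp
qed

lemma Lspace_finite:
  assumes "0 < p" "f \<in> Lspace p" shows "Lnorm p f < top"
proof (cases "p = \<infinity>")
  case True
  then obtain B where "\<forall>x. norm (f x) \<le> B"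
    using continuous_periodic_bounded[of f] assms Lspace_periodic[of f p] by (auto simp: Lspace_def)
  then have "Lnorm p f \<le> ennreal B" using Lnorm_le_bound[OF assms(1)] by blast
  then show ?thesis using ennreal_less_top le_less_trans by blast
qed (use assms in \<open>auto simp: Lspace_def\<close>)

lemma LspaceI:
  assumes "periodic f" "p = \<infinity> \<Longrightarrow> continuous_on UNIV f" "f \<in> borel_measurable lebesgue" "Lnorm p f < top"
  shows "f \<in> Lspace p"
  using assms by (auto simp: Lspace_def periodic_def)

lemma Lspace_continuous:
  assumes "0 < p" "continuous_on UNIV f" "periodic f" shows "f \<in> Lspace p"
proof (rule LspaceI)
  obtain B where "\<forall>x. norm (f x) \<le> B"
    using continuous_periodic_bounded[of f] assms by auto
  then have "Lnorm p f \<le> ennreal B" using Lnorm_le_bound[OF assms(1)] by blast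
  then show "Lnorm p f < top" using ennreal_less_top le_less_trans by blast
qed (use assms continuous_measurable_lebesgue in auto)

lemma Lspace_top_continuous: "f \<in> Lspace p \<Longrightarrow> p = \<infinity> \<Longrightarrow> continuous_on UNIV f"
  by (simp add: Lspace_def)

lemma Lspace_add:
  assumes p: "0 < p" and f: "f \<in> Lspace p" and g: "g \<in> Lspace p" shows "(\<lambda>x. f x + g x) \<in> Lspace p"
proof (rule LspaceI)
  note [measurable] = f[THEN Lspace_measurable] g[THEN Lspace_measurable]
  have "Lnorm p (\<lambda>x. f x + g x) \<le> ennreal (quasi_const p) * (Lnorm p f + Lnorm p g)"
    by (intro Lnorm_add_le p f[THEN Lspace_measurable] g[THEN Lspace_measurable] norm_triangle_ineq)
  also have "\<dots> < top"
    using Lspace_finite[OF p f] Lspace_finite[OF p g] by (simp add: ennreal_mult_less_top)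
  finally show "Lnorm p (\<lambda>x. f x + g x) < top" .
  show "(\<lambda>x. f x + g x) \<in> borel_measurable lebesgue" by measurable
qed (use f[THEN Lspace_periodic] g[THEN Lspace_periodic] in \<open>auto simp: periodic_def\<close>,
     use f[THEN Lspace_top_continuous] g[THEN Lspace_top_continuous] in \<open>intro continuous_intros; simp\<close>)

lemma Lspace_cmult:
  assumes p: "0 < p" and f: "f \<in> Lspace p" shows "(\<lambda>x. c * f x) \<in> Lspace p"
proof (rule LspaceI)
  note [measurable] = f[THEN Lspace_measurable]
  show "Lnorm p (\<lambda>x. c * f x) < top"
    using Lspace_finite[OF p f] by (simp add: Lnorm_cmult p ennreal_mult_less_top)
  show "(\<lambda>x. c * f x) \<in> borel_measurable lebesgue" by measurable
qed (use f[THEN Lspace_periodic] in \<open>auto simp: periodic_def\<close>,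
     use f[THEN Lspace_top_continuous] in \<open>intro continuous_intros; simp\<close>)

lemma Lspace_diff:
  assumes p: "0 < p" and f: "f \<in> Lspace p" and g: "g \<in> Lspace p" shows "(\<lambda>x. f x - g x) \<in> Lspace p"
  using Lspace_add[OF p f Lspace_cmult[OF p g, of "-1"]] by simp

lemma Lspace_shift:
  assumes p: "0 < p" and f: "f \<in> Lspace p" shows "(\<lambda>x. f (x + h)) \<in> Lspace p"
proof (rule LspaceI)
  note fm = f[THEN Lspace_measurable] and fp = f[THEN Lspace_periodic]
  show "Lnorm p (\<lambda>x. f (x + h)) < top"
    using Lspace_finite[OF p f] by (simp add: Lnorm_shift fm fp)
  show "(\<lambda>x. f (x + h)) \<in> borel_measurable lebesgue" by (rule measurable_shift[OF fm])
  show "periodic (\<lambda>x. f (x + h))" by (rule periodic_add[OF fp])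
  show "p = \<infinity> \<Longrightarrow> continuous_on UNIV (\<lambda>x. f (x + h))"
    by (rule continuous_on_compose2[OF f[THEN Lspace_top_continuous]]) (auto intro!: continuous_intros)
qed

lemma Lspace_zero: "0 < p \<Longrightarrow> (\<lambda>x. 0) \<in> Lspace p"
  by (rule Lspace_continuous) (auto simp: periodic_def)

lemma Lspace_sum:
  assumes p: "0 < p" and "finite I" "\<And>i. i \<in> I \<Longrightarrow> f i \<in> Lspace p" shows "(\<lambda>x. \<Sum>i\<in>I. f i x) \<in> Lspace p"
  using assms(2,3) by (induction I) (auto intro: Lspace_zero Lspace_add p)

lemma Lspace_diff_op:
  assumes p: "0 < p" and f: "f \<in> Lspace p" shows "diff_op r h f \<in> Lspace p"
proof -
  have "diff_op r h f = (\<lambda>x. \<Sum>i\<le>r. (-1) ^ i * of_nat (r choose i) * f (x + real i * h))"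
    by (auto simp: diff_op_def)
  also have "\<dots> \<in> Lspace p"
    by (intro Lspace_sum Lspace_cmult Lspace_shift p f) auto
  finally show ?thesis .
qed

lemma diff_op_add: "diff_op r h (\<lambda>x. f x + g x) x = diff_op r h f x + diff_op r h g x"
  by (simp add: diff_op_def distrib_left sum.distrib)

lemma diff_op_diff: "diff_op r h (\<lambda>x. f x - g x) x = diff_op r h f x - diff_op r h g x"
  by (simp add: diff_op_def right_diff_distrib sum_subtractf)

lemma diff_op_cmult: "diff_op r h (\<lambda>x. c * f x) x = c * diff_op r h f x"
  by (simp add: diff_op_def sum_distrib_left mult_ac)

lemma diff_op_sum: "diff_op r h (\<lambda>x. \<Sum>i\<in>I. f i x) x = (\<Sum>i\<in>I. diff_op r h (f i) x)"
  unfolding diff_op_def sum_distrib_left by (rule sum.swap)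

section \<open>Trigonometric polynomials and the means\<close>

abbreviation expo :: "int \<Rightarrow> real \<Rightarrow> complex" where
  "expo \<nu> \<equiv> (\<lambda>x. cis (of_int \<nu> * x))"

lemma expo_add: "expo \<nu> (x + y) = expo \<nu> x * expo \<nu> y"
  by (simp add: cis_mult distrib_left)

lemma expo_diff: "expo \<nu> (x - y) = expo \<nu> x * expo (- \<nu>) y"
  by (simp add: cis_mult algebra_simps)

lemma expo_periodic: "periodic (expo \<nu>)"
proof -
  have "expo \<nu> (x + 2*pi) = expo \<nu> x" for x
  proof -
    have "expo \<nu> (x + 2*pi) = expo \<nu> x * cis (2 * pi * of_int \<nu>)"
      unfolding expo_add by (simp add: mult.commute)
    also have "cis (2 * pi * of_int \<nu>) = 1" by (rule cis_multiple_2pi) simp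
    finally show ?thesis by simp
  qed
  then show ?thesis by (simp add: periodic_def)
qed

text \<open>The binomial theorem: differences act as Fourier multipliers. Every comparison of two
  differences below is a comparison of such multipliers.\<close>

lemma diff_op_expo: "diff_op r h (expo \<nu>) x = (1 - cis (of_int \<nu> * h)) ^ r * expo \<nu> x"
proof -
  have "diff_op r h (expo \<nu>) x = (\<Sum>k\<le>r. of_nat (r choose k) * (- cis (of_int \<nu> * h)) ^ k * 1 ^ (r - k)) * expo \<nu> x"
    unfolding diff_op_def sum_distrib_right
  proof (intro sum.cong refl)
    fix k
    have "expo \<nu> (x + real k * h) = cis (of_int \<nu> * x + real k * (of_int \<nu> * h))"
      by (rule arg_cong[where f=cis]) (simp add: algebra_simps)
    also have "\<dots> = expo \<nu> x * cis (of_int \<nu> * h) ^ k"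
      by (simp only: Complex.DeMoivre cis_mult)
    finally have "expo \<nu> (x + real k * h) = expo \<nu> x * cis (of_int \<nu> * h) ^ k" .
    moreover have "(- cis (of_int \<nu> * h)) ^ k = (- 1) ^ k * cis (of_int \<nu> * h) ^ k"
      by (rule power_minus)
    ultimately show "(- 1) ^ k * of_nat (r choose k) * expo \<nu> (x + real k * h) =
         of_nat (r choose k) * (- cis (of_int \<nu> * h)) ^ k * 1 ^ (r - k) * expo \<nu> x"
      by simp
  qed
  also have "(\<Sum>k\<le>r. of_nat (r choose k) * (- cis (of_int \<nu> * h)) ^ k * 1 ^ (r - k)) = (- cis (of_int \<nu> * h) + 1) ^ r"
    by (rule binomial_ring[symmetric])
  finally show ?thesis by simp
qed

lemma trig_polysI: "T = (\<lambda>x. \<Sum>\<nu>\<in>{- int n..int n}. c \<nu> * expo \<nu> x) \<Longrightarrow> T \<in> trig_polys n"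
  by (auto simp: trig_polys_def)

lemma trig_polys_zero: "(\<lambda>x. 0) \<in> trig_polys n"
  by (rule trig_polysI[where c="\<lambda>_. 0"]) simp

lemma trig_polys_add:
  assumes "S \<in> trig_polys n" "T \<in> trig_polys n" shows "(\<lambda>x. S x + T x) \<in> trig_polys n"
proof -
  obtain c d where "S = (\<lambda>x. \<Sum>\<nu>\<in>{- int n..int n}. c \<nu> * expo \<nu> x)" "T = (\<lambda>x. \<Sum>\<nu>\<in>{- int n..int n}. d \<nu> * expo \<nu> x)"
    using assms by (auto simp: trig_polys_def)
  then show ?thesis
    by (intro trig_polysI[where c="\<lambda>\<nu>. c \<nu> + d \<nu>"]) (simp add: distrib_right sum.distrib)
qed

lemma trig_polys_cmult:
  assumes "S \<in> trig_polys n" shows "(\<lambda>x. k * S x) \<in> trig_polys n"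
proof -
  obtain c where "S = (\<lambda>x. \<Sum>\<nu>\<in>{- int n..int n}. c \<nu> * expo \<nu> x)"
    using assms by (auto simp: trig_polys_def)
  then show ?thesis
    by (intro trig_polysI[where c="\<lambda>\<nu>. k * c \<nu>"]) (simp add: sum_distrib_left mult.assoc)
qed

lemma trig_polys_diff:
  assumes "S \<in> trig_polys n" "T \<in> trig_polys n" shows "(\<lambda>x. S x - T x) \<in> trig_polys n"
  using trig_polys_add[OF assms(1) trig_polys_cmult[OF assms(2), of "-1"]] by simp

lemma trig_polys_sum:
  assumes "finite I" "\<And>i. i \<in> I \<Longrightarrow> f i \<in> trig_polys n" shows "(\<lambda>x. \<Sum>i\<in>I. f i x) \<in> trig_polys n"
  using assms by (induction I) (auto intro: trig_polys_zero trig_polys_add)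

lemma trig_polys_shift:
  assumes "S \<in> trig_polys n" shows "(\<lambda>x. S (x + h)) \<in> trig_polys n"
proof -
  obtain c where S: "S = (\<lambda>x. \<Sum>\<nu>\<in>{- int n..int n}. c \<nu> * expo \<nu> x)"
    using assms by (auto simp: trig_polys_def)
  show ?thesis
    unfolding S expo_add by (intro trig_polysI[where c="\<lambda>\<nu>. c \<nu> * expo \<nu> h"]) (simp add: mult_ac)
qed

lemma trig_polys_diff_op:
  assumes "S \<in> trig_polys n" shows "diff_op r h S \<in> trig_polys n"
proof -
  have "diff_op r h S = (\<lambda>x. \<Sum>i\<le>r. (-1) ^ i * of_nat (r choose i) * S (x + real i * h))"
    by (auto simp: diff_op_def)
  also have "\<dots> \<in> trig_polys n"
    by (intro trig_polys_sum trig_polys_cmult trig_polys_shift assms) auto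
  finally show ?thesis .
qed

lemma trig_polys_periodic:
  assumes "T \<in> trig_polys n" shows "periodic T"
proof -
  obtain c where T: "T = (\<lambda>x. \<Sum>\<nu>\<in>{- int n..int n}. c \<nu> * expo \<nu> x)"
    using assms by (auto simp: trig_polys_def)
  have "expo \<nu> (x + 2*pi) = expo \<nu> x" for \<nu> x
    using expo_periodic[of \<nu>] unfolding periodic_def by blast
  then show ?thesis unfolding T periodic_def by simp
qed

lemma trig_polys_continuous:
  assumes "T \<in> trig_polys n" shows "continuous_on UNIV T"
proof -
  obtain c where T: "T = (\<lambda>x. \<Sum>\<nu>\<in>{- int n..int n}. c \<nu> * expo \<nu> x)"
    using assms by (auto simp: trig_polys_def)
  show ?thesis unfolding T by (intro continuous_intros)
qed

lemma trig_polys_Lspace: "0 < p \<Longrightarrow> T \<in> trig_polys n \<Longrightarrow> T \<in> Lspace p"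
  by (intro Lspace_continuous trig_polys_continuous trig_polys_periodic)

text \<open>Orthogonality of characters on the N-point grid: a geometric sum over powers of an N-th
  root of unity.\<close>

lemma sum_expo_nodes:
  assumes "0 < N"
  shows "(\<Sum>j<N. expo \<nu> (2*pi * real j / real N)) = (if int N dvd \<nu> then of_nat N else 0)"
proof -
  define z where "z = cis (2*pi * of_int \<nu> / real N)"
  have e: "expo \<nu> (2*pi * real j / real N) = z ^ j" for j
    unfolding z_def by (subst Complex.DeMoivre) (rule arg_cong[where f=cis], simp)
  have zN: "z ^ N = 1"
  proof -
    have "z ^ N = cis (2*pi * of_int \<nu>)"
      unfolding z_def by (subst Complex.DeMoivre) (use assms in simp)
    also have "\<dots> = 1" by (rule cis_multiple_2pi) simp
    finally show ?thesis .
  qed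
  show ?thesis
  proof (cases "int N dvd \<nu>")
    case True
    then obtain k where "\<nu> = int N * k" by (elim dvdE)
    then have "z = cis (2*pi * of_int k)"
      unfolding z_def by (intro arg_cong[where f=cis]) (use assms in simp)
    moreover have "cis (2*pi * of_int k) = 1" by (rule cis_multiple_2pi) simp
    ultimately have "z = 1" by (simp only:)
    then show ?thesis unfolding e using True by simp
  next
    case False
    have "z \<noteq> 1"
    proof
      assume "z = 1"
      then have "cos (2*pi * of_int \<nu> / real N) = 1" unfolding z_def by (simp add: complex_eq_iff)
      then obtain k :: int where "2*pi * of_int \<nu> / real N = of_int k * 2 * pi"
        unfolding cos_one_2pi_int by blast
      then have "2 * pi * (of_int \<nu>) = 2 * pi * (of_int k * real N)" using assms by (simp add: field_simps)
      then have "of_int \<nu> = of_int k * real N" by simp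
      then have "\<nu> = k * int N" by (metis of_int_eq_iff of_int_mult of_int_of_nat_eq)
      then show False using False by simp
    qed
    then have "(\<Sum>j<N. z ^ j) = 0" using zN by (simp add: geometric_sum)
    then show ?thesis unfolding e using False by simp
  qed
qed

text \<open>The condition on \<open>I\<close> excludes aliasing: no other frequency carried by the
  kernel agrees with \<open>\<nu>\<close> modulo \<open>N\<close>. The grid position
  \<open>l\<close> then cancels, and sampling acts as an exact multiplier.\<close>

lemma sample_expo:
  assumes "0 < N" "\<And>\<mu>. \<mu> \<in> I \<Longrightarrow> M \<mu> \<noteq> 0 \<Longrightarrow> \<mu> \<noteq> \<nu> \<Longrightarrow> \<not> int N dvd (\<nu> - \<mu>)" "finite I" "\<nu> \<in> I"
  shows "(\<Sum>j<N. expo \<nu> (l + 2*pi * real j / real N) * (\<Sum>\<mu>\<in>I. M \<mu> * expo \<mu> (x - l - 2*pi * real j / real N)))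
     = of_nat N * M \<nu> * expo \<nu> x"
proof -
  let ?t = "\<lambda>j. 2*pi * real j / real N"
  have "(\<Sum>j<N. expo \<nu> (l + ?t j) * (\<Sum>\<mu>\<in>I. M \<mu> * expo \<mu> (x - l - ?t j)))
     = (\<Sum>j<N. \<Sum>\<mu>\<in>I. M \<mu> * expo \<nu> l * expo \<mu> (x - l) * expo (\<nu> - \<mu>) (?t j))"
    unfolding sum_distrib_left
  proof (intro sum.cong refl)
    fix j \<mu>
    have "expo (\<nu> - \<mu>) (?t j) = expo \<nu> (?t j) * expo (- \<mu>) (?t j)"
      unfolding cis_mult by (rule arg_cong[where f=cis]) (simp add: field_simps diff_divide_distrib)
    then show "expo \<nu> (l + ?t j) * (M \<mu> * expo \<mu> (x - l - ?t j))
        = M \<mu> * expo \<nu> l * expo \<mu> (x - l) * expo (\<nu> - \<mu>) (?t j)"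
      unfolding expo_add expo_diff[of _ "x - l"] by (simp only: mult_ac)
  qed
  also have "\<dots> = (\<Sum>\<mu>\<in>I. M \<mu> * expo \<nu> l * expo \<mu> (x - l) * (\<Sum>j<N. expo (\<nu> - \<mu>) (?t j)))"
    unfolding sum_distrib_left by (rule sum.swap)
  also have "\<dots> = (\<Sum>\<mu>\<in>I. if \<mu> = \<nu> then M \<nu> * expo \<nu> l * expo \<nu> (x - l) * of_nat N else 0)"
    using assms(1,2) unfolding sum_expo_nodes[OF assms(1)] by (intro sum.cong) auto
  also have "\<dots> = M \<nu> * (expo \<nu> l * expo \<nu> (x - l)) * of_nat N"
    using assms(3,4) by simp
  also have "expo \<nu> l * expo \<nu> (x - l) = expo \<nu> x"
    unfolding expo_add[symmetric] by simp
  finally show ?thesis by (simp add: mult_ac)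
qed

lemma poly_mean_expo:
  assumes "\<bar>\<nu>\<bar> \<le> int n"
  shows "poly_mean a n l (expo \<nu>) x = a \<nu> n * expo \<nu> x"
proof -
  have "(\<Sum>j<4*n+1. expo \<nu> (l + 2*pi * real j / real (4*n+1)) * (\<Sum>\<mu>\<in>{- int n..int n}. a \<mu> n * expo \<mu> (x - l - 2*pi * real j / real (4*n+1))))
     = of_nat (4*n+1) * a \<nu> n * expo \<nu> x"
  proof (rule sample_expo)
    \<comment> \<open>Two frequencies of modulus at most n differ by at most 2 n, less than the
      number 4 n + 1 of nodes.\<close>
    fix \<mu> assume "\<mu> \<in> {- int n..int n}" "\<mu> \<noteq> \<nu>"
    then have "\<bar>\<nu> - \<mu>\<bar> < int (4*n+1)" "\<nu> - \<mu> \<noteq> 0" using assms by auto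
    then show "\<not> int (4*n+1) dvd (\<nu> - \<mu>)"
      using zdvd_not_zless[of "\<bar>\<nu> - \<mu>\<bar>" "int (4*n+1)"] by fastforce
  qed (use assms in auto)
  note sample = this
  have "poly_mean a n l (expo \<nu>) x = 1 / of_nat (4*n+1) * (\<Sum>j<4*n+1. expo \<nu> (l + 2*pi * real j / real (4*n+1)) * (\<Sum>\<mu>\<in>{- int n..int n}. a \<mu> n * expo \<mu> (x - l - 2*pi * real j / real (4*n+1))))"
    unfolding poly_mean_def kernel_def node_def add.commute[of _ l] cancel_ab_semigroup_add_class.diff_right_commute[of x _ l]
    by (intro arg_cong2[where f="(*)"] sum.cong refl) auto
  then show ?thesis unfolding sample by (simp del: of_nat_Suc of_nat_add)
qed

lemma poly_mean_sum: "poly_mean a n l (\<lambda>x. \<Sum>i\<in>I. f i x) x = (\<Sum>i\<in>I. poly_mean a n l (f i) x)"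
  unfolding poly_mean_def sum_distrib_right sum_distrib_left by (rule sum.swap)

lemma poly_mean_cmult: "poly_mean a n l (\<lambda>x. c * f x) x = c * poly_mean a n l f x"
  unfolding poly_mean_def sum_distrib_left by (simp add: mult_ac)

lemma poly_mean_diff: "poly_mean a n l (\<lambda>x. f x - g x) x = poly_mean a n l f x - poly_mean a n l g x"
  unfolding poly_mean_def by (simp add: left_diff_distrib sum_subtractf right_diff_distrib)

lemma poly_mean_trig_poly:
  "poly_mean a n l (\<lambda>x. \<Sum>\<nu>\<in>{- int n..int n}. c \<nu> * expo \<nu> x) x
    = (\<Sum>\<nu>\<in>{- int n..int n}. c \<nu> * a \<nu> n * expo \<nu> x)"
  unfolding poly_mean_sum poly_mean_cmult by (intro sum.cong) (auto simp: poly_mean_expo mult.assoc)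

lemma poly_mean_diff_op_trig_poly:
  assumes "T \<in> trig_polys n"
  shows "poly_mean a n l (diff_op r h T) x = diff_op r h (poly_mean a n l T) x"
proof -
  obtain c where T: "T = (\<lambda>x. \<Sum>\<nu>\<in>{- int n..int n}. c \<nu> * expo \<nu> x)"
    using assms by (auto simp: trig_polys_def)
  have 1: "diff_op r h T = (\<lambda>x. \<Sum>\<nu>\<in>{- int n..int n}. (c \<nu> * (1 - cis (of_int \<nu> * h)) ^ r) * expo \<nu> x)"
    unfolding T by (rule ext) (simp add: diff_op_sum diff_op_cmult diff_op_expo mult.assoc)
  have 2: "poly_mean a n l T = (\<lambda>x. \<Sum>\<nu>\<in>{- int n..int n}. (c \<nu> * a \<nu> n) * expo \<nu> x)"
    unfolding T by (rule ext) (rule poly_mean_trig_poly)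
  show ?thesis
    unfolding 1 2 poly_mean_trig_poly diff_op_sum diff_op_cmult diff_op_expo by (simp add: mult_ac)
qed

lemma poly_mean_in_trig_polys: "poly_mean a n l f \<in> trig_polys n"
proof -
  have "poly_mean a n l f = (\<lambda>x. 1 / of_nat (4 * n + 1) * (\<Sum>j\<le>4 * n. f (node n j + l) * (\<Sum>\<nu>\<in>{- int n..int n}. a \<nu> n * expo \<nu> (x + (- node n j - l)))))"
    unfolding poly_mean_def kernel_def by (simp only: add_diff_eq diff_conv_add_uminus add.assoc)
  also have "\<dots> \<in> trig_polys n"
  proof (rule trig_polys_cmult, rule trig_polys_sum)
    fix j
    have "(\<lambda>x. \<Sum>\<nu>\<in>{- int n..int n}. a \<nu> n * expo \<nu> x) \<in> trig_polys n"
      by (rule trig_polysI[OF refl])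
    from trig_polys_cmult[OF trig_polys_shift[OF this]]
    show "(\<lambda>x. f (node n j + l) * (\<Sum>\<nu>\<in>{- int n..int n}. a \<nu> n * expo \<nu> (x + (- node n j - l)))) \<in> trig_polys n" .
  qed simp
  finally show ?thesis .
qed

lemma family_poly_mean:
  assumes "f \<in> Lspace p" shows "family (\<lambda>l. poly_mean a n l f)"
proof (rule familyI)
  show "periodic (poly_mean a n l f)" for l
    by (rule trig_polys_periodic[OF poly_mean_in_trig_polys])
  note fm = Lspace_measurable[OF assms]
  have [measurable]: "(\<lambda>l. f (node n j + l)) \<in> borel_measurable lebesgue" for j
    using measurable_shift[OF fm, of "node n j"] by (simp add: add.commute)
  have [measurable]: "cis \<in> borel_measurable borel"
    by (intro borel_measurable_continuous_onI continuous_intros)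
  show "(\<lambda>(l, x). poly_mean a n l f x) \<in> borel_measurable (lebesgue \<Otimes>\<^sub>M lebesgue)"
    unfolding poly_mean_def kernel_def by measurable
qed

text \<open>Homogeneity turns the supremum over the unit ball into an operator bound. Elements of
  \<open>Lspace\<close> are functions and not classes, so norm zero does not force
  \<open>f = 0\<close> and needs its own argument.\<close>

lemma bounded_means_imp:
  assumes p: "0 < p" and "bounded_means p a"
  shows "\<exists>C\<ge>0. \<forall>n\<ge>1. \<forall>f\<in>Lspace p. mixed_norm p (\<lambda>l. poly_mean a n l f) \<le> ennreal C * Lnorm p f"
proof -
  define S where "S = (SUP n\<in>{1..}. SUP f\<in>{f \<in> Lspace p. Lnorm p f \<le> 1}. mixed_norm p (\<lambda>l. poly_mean a n l f))"
  have "S < \<infinity>" using assms(2) unfolding bounded_means_def S_def .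
  then obtain C where C: "0 \<le> C" "S = ennreal C" by (cases S) auto
  have unit: "mixed_norm p (\<lambda>l. poly_mean a n l f) \<le> ennreal C" if "1 \<le> n" "f \<in> Lspace p" "Lnorm p f \<le> 1" for n f
    unfolding C(2)[symmetric] S_def using that by (intro SUP_upper2[of n] SUP_upper2[of f]) auto
  have scale: "ennreal t * mixed_norm p (\<lambda>l. poly_mean a n l f) \<le> ennreal C"
    if "1 \<le> n" "f \<in> Lspace p" "ennreal t * Lnorm p f \<le> 1" "0 \<le> t" for n f t
  proof -
    have "mixed_norm p (\<lambda>l. poly_mean a n l (\<lambda>x. of_real t * f x)) \<le> ennreal C"
      using that by (intro unit Lspace_cmult p) (auto simp: Lnorm_cmult p Lspace_measurable)
    moreover have "mixed_norm p (\<lambda>l. poly_mean a n l (\<lambda>x. of_real t * f x))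
        = mixed_norm p (\<lambda>l x. of_real t * poly_mean a n l f x)"
      by (simp add: poly_mean_cmult[abs_def])
    moreover have "\<dots> = ennreal t * mixed_norm p (\<lambda>l. poly_mean a n l f)"
      using that by (subst mixed_norm_cmult[OF p family_poly_mean[OF that(2)]]) auto
    ultimately show ?thesis by simp
  qed
  show ?thesis
  proof (intro exI[of _ C] conjI allI impI ballI)
    fix n :: nat and f assume n: "1 \<le> n" and f: "f \<in> Lspace p"
    let ?X = "mixed_norm p (\<lambda>l. poly_mean a n l f)"
    obtain b where b: "0 \<le> b" "Lnorm p f = ennreal b"
      using Lspace_finite[OF p f] by (cases "Lnorm p f") auto
    have fin: "?X < top"
    proof -
      \<comment> \<open>The factor 1 / (b + 1) scales into the unit ball even when
        \<open>b = 0\<close>.\<close>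
      have "ennreal (1 / (b + 1)) * ?X \<le> ennreal C"
        using b by (intro scale n f) (auto simp flip: ennreal_mult)
      then show ?thesis using b
        by (metis ennreal_less_top ennreal_mult_top le_less_trans less_top add_nonneg_pos divide_pos_pos ennreal_0 ennreal_eq_0_iff not_le zero_less_one)
    qed
    then obtain X where X: "0 \<le> X" "?X = ennreal X" by (cases ?X) auto
    have "X \<le> C * b"
    proof (cases "b = 0")
      case True
      \<comment> \<open>All multiples of a function of norm zero lie in the unit ball, so
        \<open>X\<close> is bounded by \<open>C / t\<close> for every positive
        \<open>t\<close>.\<close>
      have "t * X \<le> C" if "0 \<le> t" for t
        using scale[OF n f, of t] that X C True b by (simp flip: ennreal_mult)
      from this[of "(C + 1) / X"] have "X = 0"
        using X C by (cases "X = 0") auto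
      then show ?thesis using True by simp
    next
      case False
      then have "1 / b * X \<le> C"
        using scale[OF n f, of "1/b"] X C b by (simp flip: ennreal_mult)
      then show ?thesis using False b by (simp add: field_simps)
    qed
    then show "?X \<le> ennreal C * Lnorm p f"
      using X b C by (simp flip: ennreal_mult add: ennreal_leI)
  qed (rule C)
qed

section \<open>Multipliers with bounded difference quotients\<close>

definition diff_quot :: "real \<Rightarrow> (real \<Rightarrow> complex) \<Rightarrow> real \<Rightarrow> complex" where
  "diff_quot e M t = (M (t + e) - M t) / of_real e"

text \<open>Uniform bounds for difference quotients with step \<open>e\<close>. They take the place of derivatives: Abel
  summation in a kernel uses exactly these quotients, and they survive products and reciprocals.\<close>

fun smooth :: "real \<Rightarrow> nat \<Rightarrow> real \<Rightarrow> (real \<Rightarrow> complex) \<Rightarrow> bool" where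
  "smooth e 0 B M \<longleftrightarrow> (\<forall>t. norm (M t) \<le> B)"
| "smooth e (Suc s) B M \<longleftrightarrow> (\<forall>t. norm (M t) \<le> B) \<and> smooth e s B (diff_quot e M)"

lemma smooth_bound: "smooth e s B M \<Longrightarrow> norm (M t) \<le> B"
  by (cases s) auto

lemma smooth_nonneg: "smooth e s B M \<Longrightarrow> 0 \<le> B"
  using smooth_bound[of e s B M 0] norm_ge_zero order_trans by blast

lemma smooth_mono: "smooth e s A M \<Longrightarrow> A \<le> B \<Longrightarrow> smooth e s B M"
  by (induction s arbitrary: M) (auto intro: order_trans)

lemma smooth_Suc: "smooth e (Suc s) B M \<Longrightarrow> smooth e s B M"
  by (induction s arbitrary: M) auto

lemma diff_quot_add: "diff_quot e (\<lambda>t. M t + M' t) = (\<lambda>t. diff_quot e M t + diff_quot e M' t)"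
  by (auto simp: diff_quot_def diff_divide_distrib add_divide_distrib)

lemma diff_quot_cmult: "diff_quot e (\<lambda>t. c * M t) = (\<lambda>t. c * diff_quot e M t)"
  by (auto simp: diff_quot_def right_diff_distrib diff_divide_distrib)

lemma diff_quot_shift: "diff_quot e (\<lambda>t. M (t + c)) = (\<lambda>t. diff_quot e M (t + c))"
  by (auto simp: diff_quot_def algebra_simps)

lemma diff_quot_mult: "diff_quot e (\<lambda>t. M t * M' t) = (\<lambda>t. diff_quot e M t * M' (t + e) + M t * diff_quot e M' t)"
  by (auto simp: diff_quot_def field_simps diff_divide_distrib)

lemma smooth_add: "smooth e s A M \<Longrightarrow> smooth e s B M' \<Longrightarrow> smooth e s (A + B) (\<lambda>t. M t + M' t)"
  by (induction s arbitrary: M M') (auto simp: diff_quot_add intro: norm_triangle_mono)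

lemma smooth_cmult: "smooth e s A M \<Longrightarrow> smooth e s (norm c * A) (\<lambda>t. c * M t)"
  by (induction s arbitrary: M) (auto simp: diff_quot_cmult norm_mult intro: mult_left_mono)

lemma smooth_diff: "smooth e s A M \<Longrightarrow> smooth e s B M' \<Longrightarrow> smooth e s (A + B) (\<lambda>t. M t - M' t)"
  using smooth_add[OF _ smooth_cmult[of e s B M' "-1"]] by simp

lemma smooth_shift: "smooth e s A M \<Longrightarrow> smooth e s A (\<lambda>t. M (t + c))"
  by (induction s arbitrary: M) (auto simp: diff_quot_shift)

lemma diff_quot_const: "diff_quot e (\<lambda>t. c) = (\<lambda>t. 0)"
  by (rule ext) (simp add: diff_quot_def)

lemma smooth_const: "smooth e s (norm c) (\<lambda>t. c)"
proof (cases s)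
  case (Suc s')
  have "smooth e s 0 (\<lambda>t. 0)" for s
    by (induction s) (auto simp: diff_quot_const)
  then have "smooth e s' (norm c) (\<lambda>t. 0)" by (rule smooth_mono) simp
  then show ?thesis using Suc by (simp add: diff_quot_const)
qed simp

text \<open>Leibniz rule for difference quotients; the shift by \<open>e\<close> in one factor is
  harmless by \<open>smooth_shift\<close>. Each order produces two summands, whence the power of
  2.\<close>

lemma smooth_mult: "smooth e s A M \<Longrightarrow> smooth e s B M' \<Longrightarrow> smooth e s (2 ^ s * A * B) (\<lambda>t. M t * M' t)"
proof (induction s arbitrary: M M')
  case 0
  then have "norm (M t) * norm (M' t) \<le> A * B" for t
    by (intro mult_mono) (auto intro: order_trans[OF norm_ge_zero])
  then show ?case by (simp add: norm_mult)
next
  case (Suc s)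
  have "smooth e s (2 ^ s * A * B) (\<lambda>t. diff_quot e M t * M' (t + e))"
    using Suc.prems by (intro Suc.IH smooth_shift) (auto intro: smooth_Suc)
  moreover have "smooth e s (2 ^ s * A * B) (\<lambda>t. M t * diff_quot e M' t)"
    using Suc.prems by (intro Suc.IH) (auto intro: smooth_Suc)
  ultimately have "smooth e s (2 ^ s * A * B + 2 ^ s * A * B) (diff_quot e (\<lambda>t. M t * M' t))"
    unfolding diff_quot_mult by (rule smooth_add)
  also have "2 ^ s * A * B + 2 ^ s * A * B = 2 ^ Suc s * A * B" by simp
  finally have "smooth e s (2 ^ Suc s * A * B) (diff_quot e (\<lambda>t. M t * M' t))" .
  moreover have "norm (M t * M' t) \<le> 2 ^ Suc s * A * B" for t
  proof -
    have "norm (M t * M' t) \<le> A * B" unfolding norm_mult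
      using Suc.prems[THEN smooth_bound] Suc.prems[THEN smooth_nonneg] by (intro mult_mono) auto
    also have "\<dots> \<le> 2 ^ Suc s * (A * B)"
      using Suc.prems[THEN smooth_nonneg] mult_right_mono[of 1 "2 ^ Suc s :: real" "A * B"]
        one_le_power[of "2::real" "Suc s"] by simp
    finally show ?thesis by (simp only: mult.assoc)
  qed
  ultimately show ?case unfolding smooth.simps by blast
qed

text \<open>Quotient rule, by induction on the order. The point of the quantifier order is that
  \<open>B\<close> depends on \<open>c\<close>, \<open>A\<close> and \<open>s\<close> only, so it
  serves all steps and all multipliers at once.\<close>

lemma smooth_inverse:
  assumes c: "0 < c"
  shows "\<exists>B. \<forall>e M. 0 < e \<longrightarrow> (\<forall>t. c \<le> norm (M t)) \<longrightarrow> smooth e s A M \<longrightarrow> smooth e s B (\<lambda>t. 1 / M t)"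
proof (induction s)
  case 0
  have "norm (1 / M t) \<le> 1 / c" if "\<forall>t. c \<le> norm (M t)" for M :: "real \<Rightarrow> complex" and t
    using c that by (simp add: norm_divide frac_le)
  then show ?case by (intro exI[of _ "1 / c"]) simp
next
  case (Suc s)
  then obtain B where B: "\<And>e M. 0 < e \<Longrightarrow> (\<forall>t. c \<le> norm (M t)) \<Longrightarrow> smooth e s A M \<Longrightarrow> smooth e s B (\<lambda>t. 1 / M t)" by blast
  let ?B = "norm (- 1 :: complex) * (2 ^ s * A * (2 ^ s * B * B))"
  show ?case
  proof (intro exI[of _ "max ?B (1 / c)"] allI impI)
    fix e M assume e: "0 < e" and M: "\<forall>t. c \<le> norm (M t)" and sm: "smooth e (Suc s) A M"
    have b: "norm (1 / M t) \<le> 1 / c" for t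
      using c M by (simp add: norm_divide frac_le)
    have sB: "smooth e s B (\<lambda>t. 1 / M t)" using e M smooth_Suc[OF sm] by (rule B)
    have nz: "M t \<noteq> 0" for t using M c by (metis norm_zero not_less)
    have "diff_quot e (\<lambda>t. 1 / M t) = (\<lambda>t. (-1) * (diff_quot e M t * (1 / M t * (1 / M (t + e)))))"
      using e nz by (auto simp: diff_quot_def field_simps)
    moreover have "smooth e s ?B (\<lambda>t. (-1) * (diff_quot e M t * (1 / M t * (1 / M (t + e)))))"
      using sm by (intro smooth_cmult smooth_mult sB smooth_shift[OF sB]) auto
    ultimately have "smooth e s (max ?B (1/c)) (diff_quot e (\<lambda>t. 1 / M t))"
      by (auto intro: smooth_mono)
    then show "smooth e (Suc s) (max ?B (1 / c)) (\<lambda>t. 1 / M t)"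
      using b by (auto intro: order_trans[OF _ max.cobounded2])
  qed
qed

text \<open>Chain rule: a step \<open>e\<close> in \<open>t\<close> is a step \<open>2 * e\<close>
  in \<open>2 * t\<close>, and each quotient gains a factor 2.\<close>

lemma smooth_double: "smooth (2 * e) s A M \<Longrightarrow> smooth e s (2 ^ s * A) (\<lambda>t. M (2 * t))"
proof (induction s arbitrary: M A)
  case (Suc s)
  have "diff_quot e (\<lambda>t. M (2 * t)) = (\<lambda>t. 2 * diff_quot (2 * e) M (2 * t))"
    by (rule ext) (cases "e = 0"; simp add: diff_quot_def field_simps)
  moreover have "smooth e s (norm (2::complex) * (2 ^ s * A)) (\<lambda>t. 2 * diff_quot (2 * e) M (2 * t))"
    using Suc by (intro smooth_cmult Suc.IH) auto
  moreover have "norm (M (2 * t)) \<le> 2 ^ Suc s * A" for t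
  proof -
    have "norm (M (2 * t)) \<le> A" using Suc.prems by auto
    also have "\<dots> \<le> 2 ^ Suc s * A"
      using smooth_nonneg[OF Suc.prems] mult_right_mono[of 1 "2 ^ Suc s :: real" A] one_le_power[of "2::real" "Suc s"] by simp
    finally show ?thesis .
  qed
  ultimately show ?case by (simp add: mult.assoc)
qed auto

lemma norm_cis_minus_1_le: "norm (cis t - 1) \<le> \<bar>t\<bar>"
proof -
  have "(norm (cis t - 1))\<^sup>2 = (cos t - 1)\<^sup>2 + (sin t)\<^sup>2"
    by (simp add: cmod_power2)
  also have "\<dots> = 2 - 2 * cos t"
    using sin_cos_squared_add[of t] by (simp add: power2_diff)
  also have "\<dots> = 4 * (sin (t / 2))\<^sup>2"
    using cos_double_sin[of "t/2"] by simp
  also have "\<dots> \<le> 4 * (t / 2)\<^sup>2"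
    using abs_sin_x_le_abs_x[of "t/2"] abs_le_square_iff[of "sin (t/2)" "t/2"] by simp
  also have "\<dots> = \<bar>t\<bar>\<^sup>2" by (simp add: power2_eq_square)
  finally show ?thesis by (rule power2_le_imp_le) simp
qed

text \<open>Taking a quotient multiplies by \<open>(cis (\<tau> * e) - 1) / e\<close>, of modulus at
  most 1 since a chord is no longer than its arc. The coefficient \<open>c\<close> makes the class
  stable under this operation.\<close>

lemma smooth_cis:
  assumes "0 < e" "\<bar>\<tau>\<bar> \<le> 1" shows "norm c \<le> 1 \<Longrightarrow> smooth e s 1 (\<lambda>t. c * cis (\<tau> * t))"
proof (induction s arbitrary: c)
  case (Suc s)
  have "diff_quot e (\<lambda>t. c * cis (\<tau> * t)) = (\<lambda>t. (c * (cis (\<tau> * e) - 1) / of_real e) * cis (\<tau> * t))"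
    by (auto simp: diff_quot_def distrib_left field_simps simp flip: cis_mult)
  moreover have "norm (c * (cis (\<tau> * e) - 1) / of_real e) \<le> 1"
  proof -
    have "norm (cis (\<tau> * e) - 1) \<le> 1 * e"
    proof -
      have "\<bar>\<tau> * e\<bar> \<le> 1 * e" unfolding abs_mult using assms by (intro mult_mono) auto
      then show ?thesis using norm_cis_minus_1_le[of "\<tau> * e"] by linarith
    qed
    then have "norm c * norm (cis (\<tau> * e) - 1) \<le> 1 * (1 * e)"
      using Suc.prems by (intro mult_mono) auto
    then show ?thesis using assms by (simp add: norm_mult norm_divide)
  qed
  ultimately have "smooth e s 1 (diff_quot e (\<lambda>t. c * cis (\<tau> * t)))"
    using Suc.IH[of "c * (cis (\<tau> * e) - 1) / of_real e"] by (simp only:)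
  then show ?case using Suc.prems by (simp add: norm_mult)
qed (simp add: norm_mult)

text \<open>The smooth substitute for \<open>(cis (\<tau> t) - 1) / (i \<tau> t)\<close> at \<open>t = 0\<close>.\<close>

definition cis_avg :: "real \<Rightarrow> real \<Rightarrow> complex" where
  "cis_avg \<tau> t = integral {0..1} (\<lambda>u. cis (\<tau> * t * u))"

lemma norm_cis_integral_le:
  assumes "continuous_on {0..1} c" "\<And>u. u \<in> {0..1} \<Longrightarrow> norm (c u) \<le> 1"
  shows "norm (integral {0..1} (\<lambda>u. c u * cis (\<tau> * t * u))) \<le> 1"
proof -
  have "continuous_on {0..1} (\<lambda>u. c u * cis (\<tau> * t * u))"
    by (intro continuous_intros assms)
  moreover have "norm (c u * cis (\<tau> * t * u)) \<le> 1" if "u \<in> {0..1}" for u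
    using assms(2)[OF that] by (simp add: norm_mult)
  ultimately show ?thesis
    using integral_bound[of 0 1 "\<lambda>u. c u * cis (\<tau> * t * u)" 1] by simp
qed

text \<open>As for \<open>smooth_cis\<close>, with the coefficient now a function of the integration
  variable; each quotient is absorbed into this weight.\<close>

lemma smooth_integral:
  assumes "0 < e" "\<bar>\<tau>\<bar> \<le> 1"
  shows "continuous_on {0..1} c \<Longrightarrow> (\<And>u. u \<in> {0..1} \<Longrightarrow> norm (c u) \<le> 1) \<Longrightarrow>
    smooth e s 1 (\<lambda>t. integral {0..1} (\<lambda>u. c u * cis (\<tau> * t * u)))"
proof (induction s arbitrary: c)
  case (Suc s)
  let ?d = "\<lambda>u. c u * (cis (\<tau> * e * u) - 1) / of_real e"
  have int: "(\<lambda>u. c u * cis (\<tau> * t * u)) integrable_on {0..1}" for t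
    using Suc.prems(1) by (intro integrable_continuous_interval continuous_intros)
  have "diff_quot e (\<lambda>t. integral {0..1} (\<lambda>u. c u * cis (\<tau> * t * u))) t = integral {0..1} (\<lambda>u. ?d u * cis (\<tau> * t * u))" for t
  proof -
    have "diff_quot e (\<lambda>t. integral {0..1} (\<lambda>u. c u * cis (\<tau> * t * u))) t
      = integral {0..1} (\<lambda>u. (c u * cis (\<tau> * (t + e) * u) - c u * cis (\<tau> * t * u)) / of_real e)"
      unfolding diff_quot_def by (simp add: Henstock_Kurzweil_Integration.integral_diff[OF int int, symmetric])
    also have "\<dots> = integral {0..1} (\<lambda>u. ?d u * cis (\<tau> * t * u))"
    proof (intro integral_cong)
      fix u
      have "cis (\<tau> * (t + e) * u) = cis (\<tau> * e * u) * cis (\<tau> * t * u)"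
        by (simp add: cis_mult algebra_simps)
      then show "(c u * cis (\<tau> * (t + e) * u) - c u * cis (\<tau> * t * u)) / of_real e = ?d u * cis (\<tau> * t * u)"
        by (simp add: algebra_simps diff_divide_distrib)
    qed
    finally show ?thesis .
  qed
  moreover have "smooth e s 1 (\<lambda>t. integral {0..1} (\<lambda>u. ?d u * cis (\<tau> * t * u)))"
  proof (rule Suc.IH)
    show "continuous_on {0..1} ?d" using Suc.prems(1) assms by (intro continuous_intros) auto
    fix u :: real assume u: "u \<in> {0..1}"
    have "\<bar>\<tau> * e * u\<bar> \<le> 1 * e * 1" unfolding abs_mult
      using u assms by (intro mult_mono) auto
    then have "norm (cis (\<tau> * e * u) - 1) \<le> e"
      using norm_cis_minus_1_le[of "\<tau> * e * u"] by simp
    then have "norm (c u) * norm (cis (\<tau> * e * u) - 1) \<le> 1 * e"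
      using Suc.prems(2)[OF u] by (intro mult_mono) auto
    then show "norm (?d u) \<le> 1" using assms by (simp add: norm_mult norm_divide)
  qed
  moreover have "norm (integral {0..1} (\<lambda>u. c u * cis (\<tau> * t * u))) \<le> 1" for t
    by (rule norm_cis_integral_le[OF Suc.prems])
  ultimately show ?case unfolding smooth.simps by presburger
next
  case 0
  then show ?case using norm_cis_integral_le[OF 0] by simp
qed

lemma smooth_cis_avg: "0 < e \<Longrightarrow> \<bar>\<tau>\<bar> \<le> 1 \<Longrightarrow> smooth e s 1 (cis_avg \<tau>)"
  using smooth_integral[of e \<tau> "\<lambda>_. 1" s] by (simp add: cis_avg_def[abs_def])

lemma cis_avg_eq: "1 - cis (\<tau> * t) = - \<i> * of_real (\<tau> * t) * cis_avg \<tau> t"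
proof -
  have "((\<lambda>u. \<i> * of_real (\<tau> * t) * cis (\<tau> * t * u)) has_integral (cis (\<tau> * t * 1) - cis (\<tau> * t * 0))) {0..1}"
  proof (rule fundamental_theorem_of_calculus)
    fix x :: real
    show "((\<lambda>u. cis (\<tau> * t * u)) has_vector_derivative \<i> * of_real (\<tau> * t) * cis (\<tau> * t * x)) (at x within {0..1})"
      by (auto simp: complex_eq_iff has_vector_derivative_complex_iff intro!: derivative_eq_intros)
  qed simp
  from integral_unique[OF this] have "integral {0..1} (\<lambda>u. \<i> * of_real (\<tau> * t) * cis (\<tau> * t * u)) = cis (\<tau> * t) - 1"
    by (simp only: mult_1_right mult_zero_right cis_zero)
  then have "\<i> * of_real (\<tau> * t) * cis_avg \<tau> t = cis (\<tau> * t) - 1"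
    unfolding cis_avg_def by simp
  then show ?thesis by (simp add: algebra_simps)
qed

text \<open>The Steklov mean of \<open>g\<close> over a window of length
  \<open>\<rho>\<close>.\<close>

definition run_avg :: "real \<Rightarrow> (real \<Rightarrow> complex) \<Rightarrow> real \<Rightarrow> complex" where
  "run_avg \<rho> g t = integral {t..t + \<rho>} g / of_real \<rho>"

lemma continuous_integrable:
  fixes g :: "real \<Rightarrow> complex"
  shows "continuous_on UNIV g \<Longrightarrow> g integrable_on {a..b}"
  using integrable_continuous_interval continuous_on_subset subset_UNIV by blast

text \<open>Window and step change roles: both sides compare the same two end pieces of an interval.
  The quotient is thus bounded by 2 / \<rho> times the bound of \<open>g\<close>, whatever the step;
  this is how a Steklov mean gains one order of smoothness.\<close>

lemma diff_quot_run_avg: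
  assumes g: "continuous_on UNIV g" and "0 < e" "0 < \<rho>"
  shows "diff_quot e (run_avg \<rho> g) = (\<lambda>t. (1 / of_real \<rho>) * (run_avg e g (t + \<rho>) - run_avg e g t))"
proof
  fix t
  have aux: "(I1 / x - I0 / x) / y = (1 / x) * (J1 / y - J0 / y)" if "I1 - I0 = J1 - J0" for I1 I0 J1 J0 x y :: complex
    using that by (simp add: mult.commute flip: diff_divide_distrib)
  have aux2: "b - d = c' - a" if "a + b = c" "d + c' = c" for a b c c' d :: complex
    using that by (metis add.commute add_diff_cancel_left)
  have 1: "integral {t..t+e} g + integral {t+e..t+e+\<rho>} g = integral {t..t+e+\<rho>} g"
    using assms by (intro Henstock_Kurzweil_Integration.integral_combine continuous_integrable) auto
  have 2: "integral {t..t+\<rho>} g + integral {t+\<rho>..t+\<rho>+e} g = integral {t..t+\<rho>+e} g"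
    using assms by (intro Henstock_Kurzweil_Integration.integral_combine continuous_integrable) auto
  have eq: "t + \<rho> + e = t + e + \<rho>" by simp
  have "integral {t+e..t+e+\<rho>} g - integral {t..t+\<rho>} g = integral {t+\<rho>..t+\<rho>+e} g - integral {t..t+e} g"
    unfolding eq by (rule aux2[OF 1 2[unfolded eq]])
  then show "diff_quot e (run_avg \<rho> g) t = (1 / of_real \<rho>) * (run_avg e g (t + \<rho>) - run_avg e g t)"
    unfolding diff_quot_def run_avg_def by (rule aux)
qed

lemma continuous_diff_quot:
  assumes "continuous_on UNIV g" "0 < e" shows "continuous_on UNIV (diff_quot e g)"
  unfolding diff_quot_def using assms
  by (intro continuous_intros continuous_on_compose2[OF assms(1)]) auto

lemma run_avg_diff_quot:
  assumes g: "continuous_on UNIV g" and "0 < e"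
  shows "diff_quot e (run_avg \<rho> g) = run_avg \<rho> (diff_quot e g)"
proof
  fix t
  have "integral {t+e..t+e+\<rho>} g = integral {t..t+\<rho>} (\<lambda>x. g (x + e))"
    using integral_shift_real_ivl[of "t+e" e "t+e+\<rho>" g] by (simp add: algebra_simps)
  moreover have "(\<lambda>x. g (x + e)) integrable_on {t..t+\<rho>}"
    by (intro continuous_integrable continuous_on_compose2[OF g]) (auto intro!: continuous_intros)
  ultimately have "integral {t..t+\<rho>} (diff_quot e g) = (integral {t+e..t+e+\<rho>} g - integral {t..t+\<rho>} g) / of_real e"
    unfolding diff_quot_def
    by (simp add: Henstock_Kurzweil_Integration.integral_diff continuous_integrable[OF g])
  then show "diff_quot e (run_avg \<rho> g) t = run_avg \<rho> (diff_quot e g) t"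
    unfolding run_avg_def diff_quot_def[of e "\<lambda>t. _ t / _"]
    by (simp add: diff_divide_distrib[symmetric] divide_divide_eq_left mult.commute)
qed

lemma norm_run_avg_le:
  assumes "continuous_on UNIV g" "\<And>t. norm (g t) \<le> B" "0 < \<rho>" shows "norm (run_avg \<rho> g t) \<le> B"
proof -
  have "norm (integral {t..t+\<rho>} g) \<le> B * (t + \<rho> - t)"
    using assms by (intro integral_bound continuous_on_subset[OF assms(1)]) auto
  then show ?thesis using assms(3) by (simp add: run_avg_def norm_divide divide_le_eq)
qed

lemma smooth_run_avg:
  assumes "0 < e" "0 < \<rho>"
  shows "continuous_on UNIV g \<Longrightarrow> smooth e s B g \<Longrightarrow> smooth e s B (run_avg \<rho> g)"
proof (induction s arbitrary: g)
  case 0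
  then show ?case using norm_run_avg_le[of g B \<rho>] assms by simp
next
  case (Suc s)
  then show ?case
    using norm_run_avg_le[of g B \<rho>] assms
    by (auto simp: run_avg_diff_quot intro!: Suc.IH continuous_diff_quot)
qed

lemma smooth_Suc_run_avg:
  assumes "0 < e" "0 < \<rho>" "continuous_on UNIV g" "smooth e s B g"
  shows "smooth e (Suc s) (B + 2 * B / \<rho>) (run_avg \<rho> g)"
proof -
  have B: "0 \<le> B" using smooth_nonneg assms by blast
  have e: "smooth e s B (run_avg e g)" using assms by (intro smooth_run_avg) auto
  have "smooth e s (norm (1 / of_real \<rho> :: complex) * (B + B)) (\<lambda>t. (1 / of_real \<rho>) * (run_avg e g (t + \<rho>) - run_avg e g t))"
    by (intro smooth_cmult smooth_diff smooth_shift e)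
  then have "smooth e s (B + 2 * B / \<rho>) (diff_quot e (run_avg \<rho> g))"
    unfolding diff_quot_run_avg[OF assms(3,1,2)]
    by (rule smooth_mono) (use B assms in \<open>simp add: norm_divide\<close>)
  moreover have "norm (run_avg \<rho> g t) \<le> B + 2 * B / \<rho>" for t
    using norm_run_avg_le[of g B \<rho> t] smooth_bound[OF assms(4)] assms B
    by (smt (verit) divide_nonneg_pos)
  ultimately show ?thesis by simp
qed

text \<open>First quotients bounded by \<open>B\<close> for every step say that \<open>M\<close> is
  Lipschitz with constant \<open>B\<close>.\<close>

lemma smooth_1_continuous:
  assumes "\<And>e. 0 < e \<Longrightarrow> smooth e (Suc 0) B M" shows "continuous_on UNIV M"
proof -
  have B: "0 \<le> B" using smooth_nonneg[OF assms[of 1]] by simp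
  have up: "norm (M y - M x) \<le> B * (y - x)" if "x < y" for x y
  proof -
    have "norm (diff_quot (y - x) M x) \<le> B" using assms[of "y - x"] that by simp
    moreover have "norm (complex_of_real (y - x)) = y - x" using that by (simp only: norm_of_real)
    ultimately show ?thesis using that unfolding diff_quot_def norm_divide by (simp add: divide_le_eq)
  qed
  have "norm (M x - M y) \<le> B * \<bar>x - y\<bar>" for x y
    using up[of x y] up[of y x] by (cases x y rule: linorder_cases) (auto simp: norm_minus_commute)
  then have "B-lipschitz_on UNIV M"
    by (intro lipschitz_onI B) (auto simp: dist_norm)
  then show ?thesis by (rule lipschitz_on_continuous_on)
qed

text \<open>A continuous trapezoid is averaged \<open>s\<close> times by Steklov means of a short
  window; each mean gains one order of smoothness and preserves values in [0, 1].\<close>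

lemma smooth_bump:
  assumes ab: "0 < a" "a < b"
  shows "\<exists>\<eta> B. (\<forall>e>0. smooth e s B (\<lambda>t. complex_of_real (\<eta> t))) \<and> (\<forall>t. 0 \<le> \<eta> t \<and> \<eta> t \<le> 1)
     \<and> (\<forall>t. \<bar>t\<bar> \<le> a \<longrightarrow> \<eta> t = 1) \<and> (\<forall>t. b \<le> \<bar>t\<bar> \<longrightarrow> \<eta> t = 0)"
proof -
  \<comment> \<open>The gap between \<open>a\<close> and \<open>b\<close> is cut into thirds: the
    linear ramp occupies the middle one, the outer two absorb the spreading caused by the
    means.\<close>
  define w where "w = (b - a) / 3"
  define \<rho> where "\<rho> = w / real (Suc s)"
  have w: "0 < w" "b - w - (a + w) = w" using ab by (auto simp: w_def field_simps)
  have \<rho>: "0 < \<rho>" using w by (simp add: \<rho>_def)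
  \<comment> \<open>After \<open>k\<close> means the value at \<open>t\<close> depends on the
    trapezoid over the window [t, t + k \<rho>], so the induction speaks of whole windows. Since
    \<open>s\<close> windows have total length at most \<open>w\<close>, the margins suffice at the
    end.\<close>
  have ex: "\<exists>\<eta> B. (\<forall>e>0. smooth e k B (\<lambda>t. complex_of_real (\<eta> t))) \<and> (\<forall>t. 0 \<le> \<eta> t \<and> \<eta> t \<le> 1) \<and> continuous_on UNIV \<eta>
     \<and> (\<forall>t. (\<forall>u\<in>{t..t + real k * \<rho>}. \<bar>u\<bar> \<le> a + w) \<longrightarrow> \<eta> t = 1) \<and> (\<forall>t. (\<forall>u\<in>{t..t + real k * \<rho>}. b - w \<le> \<bar>u\<bar>) \<longrightarrow> \<eta> t = 0)" for k
  proof (induction k)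
    case 0
    define \<eta> where "\<eta> t = max 0 (min 1 ((b - w - \<bar>t\<bar>) / w))" for t
    have "\<eta> t = 1" if "\<bar>t\<bar> \<le> a + w" for t
    proof -
      have "1 \<le> (b - w - \<bar>t\<bar>) / w" using w that by (simp add: pos_le_divide_eq)
      then show ?thesis by (simp add: \<eta>_def)
    qed
    moreover have "\<eta> t = 0" if "b - w \<le> \<bar>t\<bar>" for t
    proof -
      have "(b - w - \<bar>t\<bar>) / w \<le> 0" using w that by (simp add: divide_le_0_iff)
      then show ?thesis by (simp add: \<eta>_def)
    qed
    moreover have "continuous_on UNIV \<eta>" unfolding \<eta>_def using w by (intro continuous_intros) auto
    moreover have "0 \<le> \<eta> t \<and> \<eta> t \<le> 1" for t by (simp add: \<eta>_def)
    ultimately show ?case by (intro exI[of _ \<eta>] exI[of _ 1]) auto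
  next
    case (Suc k)
    then obtain \<eta> B where \<eta>: "\<forall>e>0. smooth e k B (\<lambda>t. complex_of_real (\<eta> t))" "\<forall>t. 0 \<le> \<eta> t \<and> \<eta> t \<le> 1" "continuous_on UNIV \<eta>"
      and one: "\<And>t. (\<forall>u\<in>{t..t + real k * \<rho>}. \<bar>u\<bar> \<le> a + w) \<Longrightarrow> \<eta> t = 1"
      and zero: "\<And>t. (\<forall>u\<in>{t..t + real k * \<rho>}. b - w \<le> \<bar>u\<bar>) \<Longrightarrow> \<eta> t = 0" by blast
    define \<theta> where "\<theta> t = integral {t..t+\<rho>} \<eta> / \<rho>" for t
    have int: "\<eta> integrable_on {t..t+\<rho>}" for t
      by (intro integrable_continuous_interval continuous_on_subset[OF \<eta>(3)]) auto
    have cont: "continuous_on UNIV (\<lambda>t. complex_of_real (\<eta> t))"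
      using \<eta>(3) by (intro continuous_intros)
    have eq: "(\<lambda>t. complex_of_real (\<theta> t)) = run_avg \<rho> (\<lambda>t. complex_of_real (\<eta> t))"
    proof
      fix t
      have "integral {t..t+\<rho>} (\<lambda>x. complex_of_real (\<eta> x)) = complex_of_real (integral {t..t+\<rho>} \<eta>)"
        using integral_linear[OF int bounded_linear_of_real] by (simp add: o_def)
      then show "complex_of_real (\<theta> t) = run_avg \<rho> (\<lambda>t. complex_of_real (\<eta> t)) t"
        by (simp only: run_avg_def \<theta>_def of_real_divide)
    qed
    have sm: "smooth e (Suc k) (B + 2 * B / \<rho>) (\<lambda>t. complex_of_real (\<theta> t))" if "0 < e" for e
      unfolding eq using that \<rho> cont \<eta>(1) by (intro smooth_Suc_run_avg) auto
    have "smooth e (Suc 0) (1 + 2 * 1 / \<rho>) (\<lambda>t. complex_of_real (\<theta> t))" if "0 < e" for e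
      unfolding eq using that \<rho> cont \<eta>(2) by (intro smooth_Suc_run_avg) auto
    then have "continuous_on UNIV (\<lambda>t. complex_of_real (\<theta> t))" by (rule smooth_1_continuous)
    then have c: "continuous_on UNIV \<theta>" using continuous_on_Re by fastforce
    have "0 \<le> \<theta> t" for t
      unfolding \<theta>_def using \<eta>(2) \<rho> by (intro divide_nonneg_pos integral_nonneg int) auto
    moreover have "\<theta> t \<le> 1" for t
    proof -
      have "integral {t..t+\<rho>} \<eta> \<le> integral {t..t+\<rho>} (\<lambda>_. 1)"
        using \<eta>(2) by (intro integral_le int) auto
      then show ?thesis using \<rho> by (simp add: \<theta>_def divide_le_eq)
    qed
    moreover have "\<theta> t = 1" if h: "\<forall>u\<in>{t..t + real (Suc k) * \<rho>}. \<bar>u\<bar> \<le> a + w" for t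
    proof -
      have "\<eta> v = 1" if "v \<in> {t..t+\<rho>}" for v
        using that by (intro one ballI h[rule_format]) (auto simp: algebra_simps)
      then have "integral {t..t+\<rho>} \<eta> = integral {t..t+\<rho>} (\<lambda>_. 1)" by (intro integral_cong) auto
      then show ?thesis using \<rho> by (simp add: \<theta>_def)
    qed
    moreover have "\<theta> t = 0" if h: "\<forall>u\<in>{t..t + real (Suc k) * \<rho>}. b - w \<le> \<bar>u\<bar>" for t
    proof -
      have "\<eta> v = 0" if "v \<in> {t..t+\<rho>}" for v
        using that by (intro zero ballI h[rule_format]) (auto simp: algebra_simps)
      then have "integral {t..t+\<rho>} \<eta> = integral {t..t+\<rho>} (\<lambda>_. 0)" by (intro integral_cong) auto
      then show ?thesis using \<rho> by (simp add: \<theta>_def)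
    qed
    ultimately show ?case using sm c by (intro exI[of _ \<theta>] exI[of _ "B + 2 * B / \<rho>"]) blast
  qed
  have s\<rho>: "real s * \<rho> \<le> w" "0 \<le> real s * \<rho>"
    using w by (auto simp: \<rho>_def field_simps)
  obtain \<eta> B where \<eta>: "\<forall>e>0. smooth e s B (\<lambda>t. complex_of_real (\<eta> t))" "\<forall>t. 0 \<le> \<eta> t \<and> \<eta> t \<le> 1"
      and one: "\<And>t. (\<forall>u\<in>{t..t + real s * \<rho>}. \<bar>u\<bar> \<le> a + w) \<Longrightarrow> \<eta> t = 1"
      and zero: "\<And>t. (\<forall>u\<in>{t..t + real s * \<rho>}. b - w \<le> \<bar>u\<bar>) \<Longrightarrow> \<eta> t = 0" using ex[of s] by blast
  have "\<eta> t = 1" if "\<bar>t\<bar> \<le> a" for t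
    by (rule one) (use that s\<rho> in auto)
  moreover have "\<eta> t = 0" if "b \<le> \<bar>t\<bar>" for t
    by (rule zero) (use that s\<rho> in auto)
  ultimately show ?thesis using \<eta> by blast
qed

section \<open>Localised kernels\<close>

lemma chord_sym: "norm (1 - cis (- x)) = norm (1 - cis x)"
  by (simp add: cmod_def)

lemma chord_mult: "norm (1 - cis x) = 2 * \<bar>sin (x / 2)\<bar>"
proof -
  have "(norm (1 - cis x))\<^sup>2 = (1 - cos x)\<^sup>2 + (sin x)\<^sup>2"
    by (simp add: cmod_power2)
  also have "\<dots> = 2 - 2 * cos x"
    using sin_cos_squared_add[of x] by (simp add: power2_diff)
  also have "\<dots> = (2 * \<bar>sin (x / 2)\<bar>)\<^sup>2"
    using cos_double_sin[of "x/2"] by (simp add: power_mult_distrib)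
  finally show ?thesis by (rule power2_eq_imp_eq) auto
qed

text \<open>Up to pi / 3 the cosine is at least 1/2, so sin t - t / 2 increases from 0. Beyond that
  sin t is at least sqrt 3 / 2, which exceeds 0.8, and t / 2 is at most pi / 4, which does
  not.\<close>

lemma sin_ge_half:
  assumes "0 \<le> t" "t \<le> pi / 2" shows "t / 2 \<le> sin t"
proof (cases "t \<le> pi / 3")
  case True
  have "(\<lambda>t. sin t - t / 2) 0 \<le> (\<lambda>t. sin t - t / 2) t"
  proof (rule DERIV_nonneg_imp_nondecreasing[OF assms(1)])
    fix x assume x: "0 \<le> x" "x \<le> t"
    have "cos (pi / 3) \<le> cos x" using x True by (intro cos_monotone_0_pi_le) auto
    then have "0 \<le> cos x - 1 / 2" by (simp add: cos_60)
    then show "\<exists>y. ((\<lambda>t. sin t - t / 2) has_real_derivative y) (at x) \<and> 0 \<le> y"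
      by (intro exI[of _ "cos x - 1/2"]) (auto intro!: derivative_eq_intros)
  qed
  then show ?thesis by simp
next
  case False
  have "sin (pi / 3) \<le> sin t" using False assms by (intro sin_monotone_2pi_le) auto
  then have "sqrt 3 / 2 \<le> sin t" by (simp add: sin_60)
  moreover have "pi / 4 \<le> 0.8" using pi_less_4 pi_approx by simp
  moreover have "0.8 \<le> sqrt 3 / 2" using real_le_rsqrt[of "1.6" 3] by (simp add: power2_eq_square)
  ultimately show ?thesis using assms by linarith
qed

lemma chord_ge:
  assumes "0 \<le> x" "x \<le> 2 * pi" shows "min x (2 * pi - x) / 2 \<le> norm (1 - cis x)"
proof (cases "x \<le> pi")
  case True
  then have "x / 2 / 2 \<le> sin (x / 2)" using assms by (intro sin_ge_half) auto
  then show ?thesis using True by (simp add: chord_mult)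
next
  case False
  then have "(pi - x / 2) / 2 \<le> sin (pi - x / 2)" using assms by (intro sin_ge_half) auto
  then show ?thesis using False by (simp add: chord_mult)
qed

lemma sum_cyclic_shift:
  fixes H :: "int \<Rightarrow> 'a::ab_group_add"
  assumes "\<And>j. H (j + int N) = H j"
  shows "(\<Sum>j<N. H (int j + k)) = (\<Sum>j<N. H (int j))"
proof -
  have step: "(\<Sum>j<N. H (int j + (k + 1))) = (\<Sum>j<N. H (int j + k))" for k
  proof -
    have "(\<Sum>j<N. H (int j + (k + 1))) - (\<Sum>j<N. H (int j + k)) = (\<Sum>j<N. H (int (Suc j) + k) - H (int j + k))"
      by (simp add: sum_subtractf algebra_simps)
    also have "\<dots> = H (int N + k) - H (int 0 + k)" by (rule sum_lessThan_telescope)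
    also have "\<dots> = 0" using assms[of k] by (simp add: add.commute)
    finally show ?thesis by simp
  qed
  show ?thesis
  proof (induction k rule: int_induct[where k=0])
    case (step1 i)
    then show ?case using step[of i] by simp
  next
    case (step2 i)
    then show ?case using step[of "i - 1"] by simp
  qed simp
qed

text \<open>The distance from \<open>x\<close> to the multiples of 2 pi is measured by the chord, in
  units of the mesh; this makes the profile periodic without reducing arguments. Its quadratic decay
  keeps sums over the grid bounded, and its powers majorise the kernels.\<close>

definition peak :: "nat \<Rightarrow> real \<Rightarrow> real" where
  "peak N x = 1 / (1 + (norm (1 - cis x) / (2 * pi / real N))\<^sup>2)"

lemma peak_pos: "0 < peak N x"
  unfolding peak_def by (intro divide_pos_pos add_pos_nonneg) auto

lemma peak_le_1: "peak N x \<le> 1"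
  unfolding peak_def by (simp add: divide_le_eq_1 add_pos_nonneg)

lemma peak_periodic: "periodic (peak N)"
  by (simp add: periodic_def peak_def cis_mult[symmetric])

lemma peak_sym: "peak N (- x) = peak N x"
  by (simp only: peak_def chord_sym)

text \<open>A cyclic shift of the grid brings \<open>y\<close> into the cell [0, \<delta>). Counted
  from either side of the circle, the j-th node is then about j meshes away, and both halves are
  compared with the convergent series of 1 / (1 + (i/2)^2).\<close>

lemma peak_sum_bounded: "\<exists>C>0. \<forall>N\<ge>1. \<forall>y. (\<Sum>j<N. peak N (y - 2 * pi * real j / real N)) \<le> C"
proof -
  let ?f = "\<lambda>i::nat. 1 / (1 + (real i / 2)\<^sup>2)"
  have sf: "summable ?f"
  proof (rule summable_comparison_test'[where N=1])
    show "summable (\<lambda>i. 4 * inverse ((real i) ^ 2))"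
      by (intro summable_mult inverse_power_summable) simp
    fix i :: nat assume "1 \<le> i"
    then show "norm (?f i) \<le> 4 * inverse ((real i) ^ 2)"
      by (simp add: field_simps add_pos_nonneg)
  qed
  have f0: "0 \<le> ?f i" for i by simp
  define C where "C = 1 + suminf ?f + suminf ?f"
  have C: "0 < C" unfolding C_def using suminf_nonneg[OF sf f0] by linarith
  show ?thesis
  proof (intro exI[of _ C] conjI allI impI C)
    fix N :: nat and y :: real assume N: "1 \<le> N"
    define \<delta> where "\<delta> = 2 * pi / real N"
    have \<delta>: "0 < \<delta>" "real N * \<delta> = 2 * pi" using N by (auto simp: \<delta>_def)
    define k where "k = \<lfloor>y / \<delta>\<rfloor>"
    define y0 where "y0 = y - of_int k * \<delta>"
    have "of_int k \<le> y / \<delta>" "y / \<delta> < of_int k + 1" unfolding k_def by linarith+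
    then have y0: "0 \<le> y0" "y0 < \<delta>" using \<delta> by (auto simp: y0_def field_simps)
    let ?H = "\<lambda>j::int. peak N (y0 - of_int j * \<delta>)"
    have per: "?H (j + int N) = ?H j" for j
    proof -
      have "y0 - of_int (j + int N) * \<delta> = y0 - of_int j * \<delta> - 2 * pi"
        using \<delta> by (simp add: algebra_simps)
      then show ?thesis by (simp only: periodic_diff[OF peak_periodic])
    qed
    have "(\<Sum>j<N. peak N (y - 2 * pi * real j / real N)) = (\<Sum>j<N. ?H (int j + (- k)))"
      by (intro sum.cong refl arg_cong[where f="peak N"]) (simp add: y0_def \<delta>_def left_diff_distrib diff_divide_distrib mult.commute)
    also have "\<dots> = (\<Sum>j<N. ?H (int j))" by (rule sum_cyclic_shift[where H="?H"]) (rule per)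
    also have "\<dots> = (\<Sum>j<N. peak N (real j * \<delta> - y0))"
      by (intro sum.cong refl) (metis minus_diff_eq of_int_of_nat_eq peak_sym)
    also have "\<dots> = peak N (- y0) + (\<Sum>j<N - 1. peak N (real (Suc j) * \<delta> - y0))"
      using N sum.lessThan_Suc_shift[of "\<lambda>j. peak N (real j * \<delta> - y0)" "N - 1"] by simp
    also have "\<dots> \<le> 1 + (\<Sum>j<N - 1. ?f j + ?f (N - 2 - j))"
    proof (intro add_mono peak_le_1 sum_mono)
      fix j assume "j \<in> {..<N - 1}"
      then have j: "j + 2 \<le> N" by auto
      let ?x = "real (Suc j) * \<delta> - y0"
      have x1: "real j * \<delta> \<le> ?x" using y0 by (simp add: algebra_simps)
      have "real (Suc j) * \<delta> \<le> real (N - 1) * \<delta>" using j \<delta> by (intro mult_right_mono) auto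
      then have x2: "?x \<le> 2 * pi" using \<delta> y0 j by (simp add: of_nat_diff algebra_simps)
      \<comment> \<open>The distance is even at least N - 1 - j meshes; giving one away makes this
        bound the reversal of the first one over \<open>{..<N - 1}\<close>, so that the two sums
        coincide.\<close>
      have x3: "real (N - 2 - j) * \<delta> \<le> 2 * pi - ?x" using \<delta> y0 j
        by (simp add: of_nat_diff algebra_simps)
      have "min ?x (2 * pi - ?x) / 2 \<le> norm (1 - cis ?x)"
      proof (rule chord_ge)
        have "0 \<le> real j * \<delta>" using \<delta> by simp
        then show "0 \<le> ?x" using x1 by linarith
      qed (rule x2)
      then consider "real j * \<delta> / 2 \<le> norm (1 - cis ?x)" | "real (N - 2 - j) * \<delta> / 2 \<le> norm (1 - cis ?x)"
        using x1 x3 by (cases "?x \<le> 2 * pi - ?x") (force simp: min_def)+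
      then show "peak N ?x \<le> ?f j + ?f (N - 2 - j)"
      proof cases
        case 1
        then have "real j / 2 \<le> norm (1 - cis ?x) / \<delta>" using \<delta> by (simp add: field_simps)
        then have "(real j / 2)\<^sup>2 \<le> (norm (1 - cis ?x) / \<delta>)\<^sup>2" by (intro power_mono) auto
        then have "peak N ?x \<le> ?f j" unfolding peak_def \<delta>_def[symmetric] by (intro frac_le) (auto intro: add_pos_nonneg)
        then show ?thesis using f0[of "N - 2 - j"] by linarith
      next
        case 2
        then have "real (N - 2 - j) / 2 \<le> norm (1 - cis ?x) / \<delta>" using \<delta> by (simp add: field_simps)
        then have "(real (N - 2 - j) / 2)\<^sup>2 \<le> (norm (1 - cis ?x) / \<delta>)\<^sup>2" by (intro power_mono) auto
        then have "peak N ?x \<le> ?f (N - 2 - j)" unfolding peak_def \<delta>_def[symmetric] by (intro frac_le) (auto intro: add_pos_nonneg)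
        then show ?thesis using f0[of j] by linarith
      qed
    qed
    also have "(\<Sum>j<N - 1. ?f j + ?f (N - 2 - j)) = (\<Sum>j<N - 1. ?f j) + (\<Sum>j<N - 1. ?f (N - 1 - Suc j))"
      by (simp add: sum.distrib)
    also have "(\<Sum>j<N - 1. ?f (N - 1 - Suc j)) = (\<Sum>j<N - 1. ?f j)" by (rule sum.nat_diff_reindex)
    also have "1 + ((\<Sum>j<N - 1. ?f j) + (\<Sum>j<N - 1. ?f j)) \<le> C"
      unfolding C_def using sum_le_suminf[OF sf, of "{..<N-1}"] f0 by simp
    finally show "(\<Sum>j<N. peak N (y - 2 * pi * real j / real N)) \<le> C" .
  qed
qed

lemma sum_int_shift:
  fixes f :: "int \<Rightarrow> 'a::comm_monoid_add"
  shows "(\<Sum>\<nu>\<in>{a..b}. f (\<nu> - 1)) = (\<Sum>\<nu>\<in>{a-1..b-1}. f \<nu>)"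
  by (rule sum.reindex_bij_witness[where i="\<lambda>\<nu>. \<nu> + 1" and j="\<lambda>\<nu>. \<nu> - 1"]) auto

definition wide_kern :: "nat \<Rightarrow> nat \<Rightarrow> (real \<Rightarrow> complex) \<Rightarrow> real \<Rightarrow> complex" where
  "wide_kern R N M x = 1 / of_nat N * (\<Sum>\<nu>\<in>{- int R..int R}. M (2 * pi * of_int \<nu> / real N) * expo \<nu> x)"

text \<open>Abel summation \<open>s\<close> times; each step moves the support by one frequency, so \<open>R\<close> leaves room for \<open>s\<close> steps.\<close>

lemma norm_wide_kern_le:
  assumes N: "1 \<le> N" and e: "e = 2 * pi / real N"
  shows "smooth e s B M \<Longrightarrow> m + s \<le> R \<Longrightarrow> (\<And>\<nu>. int m < \<bar>\<nu>\<bar> \<Longrightarrow> M (2 * pi * of_int \<nu> / real N) = 0) \<Longrightarrow>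
    norm (wide_kern R N M x) * norm (1 - cis x) ^ s \<le> real (2 * R + 1) / real N * B * e ^ s"
proof (induction s arbitrary: M m)
  case 0
  have "norm (\<Sum>\<nu>\<in>{- int R..int R}. M (2 * pi * of_int \<nu> / real N) * expo \<nu> x) \<le> (\<Sum>\<nu>\<in>{- int R..int R}. B)"
    using 0(1) by (intro sum_norm_le) (simp add: norm_mult)
  also have "\<dots> = real (2 * R + 1) * B" by simp
  finally show ?case using N by (simp add: wide_kern_def norm_mult norm_divide field_simps)
next
  case (Suc s)
  let ?t = "\<lambda>\<nu>::int. 2 * pi * of_int \<nu> / real N"
  have e0: "0 < e" using N e by simp
  have shift: "?t (\<nu> + 1) = ?t \<nu> + e" for \<nu>
    by (simp add: e add_divide_distrib distrib_left)
  have M0: "M (?t \<nu>) = 0" if "int R \<le> \<bar>\<nu>\<bar>" for \<nu> using Suc.prems(2) that by (intro Suc.prems(3)) auto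
  have "(\<Sum>\<nu>\<in>{- int R..int R}. M (?t \<nu>) * expo (\<nu> - 1) x) = (\<Sum>\<nu>\<in>{- int R..int R}. (\<lambda>\<mu>. M (?t (\<mu> + 1)) * expo \<mu> x) (\<nu> - 1))"
    by (simp only: diff_add_cancel)
  also have "\<dots> = (\<Sum>\<mu>\<in>{- int R - 1..int R - 1}. M (?t (\<mu> + 1)) * expo \<mu> x)"
    by (rule sum_int_shift)
  also have "\<dots> = (\<Sum>\<mu>\<in>{- int R - 1..int R}. M (?t (\<mu> + 1)) * expo \<mu> x)"
  proof (intro sum.mono_neutral_left ballI)
    fix \<mu> assume "\<mu> \<in> {- int R - 1..int R} - {- int R - 1..int R - 1}"
    then have "M (?t (\<mu> + 1)) = 0" by (intro M0) auto
    then show "M (?t (\<mu> + 1)) * expo \<mu> x = 0" by simp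
  qed auto
  also have "\<dots> = (\<Sum>\<mu>\<in>{- int R..int R}. M (?t (\<mu> + 1)) * expo \<mu> x)"
  proof (intro sum.mono_neutral_right ballI)
    fix \<mu> assume "\<mu> \<in> {- int R - 1..int R} - {- int R..int R}"
    then have "M (?t (\<mu> + 1)) = 0" by (intro M0) auto
    then show "M (?t (\<mu> + 1)) * expo \<mu> x = 0" by simp
  qed auto
  finally have sh: "(\<Sum>\<nu>\<in>{- int R..int R}. M (?t \<nu>) * expo (\<nu> - 1) x) = (\<Sum>\<mu>\<in>{- int R..int R}. M (?t \<mu> + e) * expo \<mu> x)"
    unfolding shift .
  have em: "expo (\<nu> - 1) x = cis (- x) * expo \<nu> x" for \<nu>
    unfolding cis_mult by (rule arg_cong[where f=cis]) (simp add: algebra_simps)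
  have "(cis (- x) - 1) * wide_kern R N M x = 1 / of_nat N * ((\<Sum>\<nu>\<in>{- int R..int R}. M (?t \<nu>) * expo (\<nu> - 1) x) - (\<Sum>\<nu>\<in>{- int R..int R}. M (?t \<nu>) * expo \<nu> x))"
  proof -
    have "(\<Sum>\<nu>\<in>{- int R..int R}. M (?t \<nu>) * expo (\<nu> - 1) x) = cis (- x) * (\<Sum>\<nu>\<in>{- int R..int R}. M (?t \<nu>) * expo \<nu> x)"
      unfolding em sum_distrib_left by (intro sum.cong refl) (simp only: mult_ac)
    then show ?thesis unfolding wide_kern_def by (simp only: left_diff_distrib right_diff_distrib mult_1_left mult_ac)
  qed
  also have "\<dots> = 1 / of_nat N * (\<Sum>\<mu>\<in>{- int R..int R}. of_real e * (diff_quot e M (?t \<mu>) * expo \<mu> x))"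
    unfolding sh sum_subtractf[symmetric]
    using e0 by (intro arg_cong[where f="\<lambda>z. _ * z"] sum.cong refl) (simp add: diff_quot_def left_diff_distrib)
  also have "\<dots> = of_real e * wide_kern R N (diff_quot e M) x"
    unfolding wide_kern_def sum_distrib_left[symmetric] by simp
  finally have "norm (cis (- x) - 1) * norm (wide_kern R N M x) = e * norm (wide_kern R N (diff_quot e M) x)"
    using e0 by (metis abs_of_pos norm_mult norm_of_real)
  moreover have "norm (cis (- x) - 1) = norm (1 - cis x)"
    using chord_sym[of x] by (simp add: norm_minus_commute)
  ultimately have *: "norm (wide_kern R N M x) * norm (1 - cis x) ^ Suc s = e * (norm (wide_kern R N (diff_quot e M) x) * norm (1 - cis x) ^ s)"
    by (simp add: mult_ac)
  have "norm (wide_kern R N (diff_quot e M) x) * norm (1 - cis x) ^ s \<le> real (2 * R + 1) / real N * B * e ^ s"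
  proof (rule Suc.IH)
    show "smooth e s B (diff_quot e M)" using Suc.prems(1) by simp
    show "Suc m + s \<le> R" using Suc.prems(2) by simp
    fix \<nu> :: int assume "int (Suc m) < \<bar>\<nu>\<bar>"
    then have "M (?t (\<nu> + 1)) = 0" "M (?t \<nu>) = 0" by (intro Suc.prems(3); linarith)+
    then show "diff_quot e M (?t \<nu>) = 0" by (simp only: diff_quot_def shift) simp
  qed
  then have "e * (norm (wide_kern R N (diff_quot e M) x) * norm (1 - cis x) ^ s) \<le> e * (real (2 * R + 1) / real N * B * e ^ s)"
    using e0 by (intro mult_left_mono) auto
  then show ?case unfolding * by (simp only: power_Suc mult_ac)
qed

definition kern :: "nat \<Rightarrow> (real \<Rightarrow> complex) \<Rightarrow> real \<Rightarrow> complex" where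
  "kern N M = wide_kern N N M"

lemma smooth_le: "smooth e s B M \<Longrightarrow> k \<le> s \<Longrightarrow> smooth e k B M"
proof (induction s)
  case (Suc s)
  then show ?case by (cases "k = Suc s") (auto dest: smooth_Suc simp del: smooth.simps)
qed simp

text \<open>Summation by parts of order \<open>2 * \<sigma>\<close> gives decay like the chord to
  the power -2\<sigma>, order 0 gives boundedness, and together they dominate the expanded power of
  the denominator of \<open>peak\<close>. The factor 4\<sigma> + 3 bounds (2 R + 1) / N.\<close>

lemma norm_kern_le:
  assumes N: "1 \<le> N" and sm: "smooth (2 * pi / real N) (2 * \<sigma>) B M" and supp: "\<And>t. 2 \<le> \<bar>t\<bar> \<Longrightarrow> M t = 0"
  shows "norm (kern N M x) \<le> 2 ^ \<sigma> * (2 * (4 * \<sigma> + 3) * B) * peak N x ^ \<sigma>"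
proof -
  define e where "e = 2 * pi / real N"
  have e0: "0 < e" using N by (simp add: e_def)
  define c where "c = (4 * real \<sigma> + 3) * B"
  have B: "0 \<le> B" using smooth_nonneg[OF sm] .
  define u where "u = norm (1 - cis x) / e"
  have u0: "0 \<le> u" using e0 by (simp add: u_def)
  \<comment> \<open>Frequencies beyond \<open>N\<close> correspond to |t| > 2 pi, outside the
    support of \<open>M\<close>. Widening the range adds zeros only and leaves room for the
    \<open>2 * \<sigma>\<close> shifts.\<close>
  define R where "R = N + 2 * \<sigma>"
  have z: "M (2 * pi * of_int \<nu> / real N) = 0" if "int N < \<bar>\<nu>\<bar>" for \<nu>
  proof (rule supp)
    have "real N \<le> \<bar>of_int \<nu>\<bar>" using that by linarith
    then have "1 * 2 \<le> (\<bar>of_int \<nu>\<bar> / real N) * (2 * pi)"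
      using N pi_ge_two by (intro mult_mono) auto
    then show "2 \<le> \<bar>2 * pi * of_int \<nu> / real N\<bar>"
      by (simp add: abs_mult mult_ac)
  qed
  have kw: "kern N M x = wide_kern R N M x"
    unfolding kern_def wide_kern_def R_def
    by (intro arg_cong[where f="\<lambda>z. _ * z"] sum.mono_neutral_left) (auto intro!: z simp: not_le)
  have RN: "real (2 * R + 1) / real N \<le> 4 * real \<sigma> + 3"
  proof -
    have "real (2 * R + 1) \<le> (4 * real \<sigma> + 3) * real N"
      using N mult_left_mono[of 1 "real N" "4 * real \<sigma> + 1"] by (simp add: R_def algebra_simps)
    then show ?thesis using N by (simp add: divide_le_eq)
  qed
  have b: "norm (kern N M x) * u ^ k \<le> c" if "k \<le> 2 * \<sigma>" for k
  proof -
    have "norm (kern N M x) * norm (1 - cis x) ^ k \<le> real (2 * R + 1) / real N * B * e ^ k"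
      unfolding kw using that z
      by (intro norm_wide_kern_le[OF N e_def, where m=N] smooth_le[OF sm[folded e_def]]) (auto simp: R_def)
    also have "\<dots> \<le> c * e ^ k" unfolding c_def using RN B e0 by (intro mult_right_mono) auto
    finally show ?thesis using e0 by (simp add: u_def power_divide divide_le_eq)
  qed
  have "(1 + u\<^sup>2) ^ \<sigma> \<le> (2 * max 1 (u\<^sup>2)) ^ \<sigma>" by (intro power_mono) auto
  also have "\<dots> \<le> 2 ^ \<sigma> * (1 + u ^ (2 * \<sigma>))"
    by (auto simp: power_mult_distrib max_def power_mult)
  finally have "norm (kern N M x) * (1 + u\<^sup>2) ^ \<sigma> \<le> norm (kern N M x) * (2 ^ \<sigma> * (1 + u ^ (2 * \<sigma>)))"
    by (rule mult_left_mono) simp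
  also have "\<dots> = 2 ^ \<sigma> * (norm (kern N M x) * u ^ 0 + norm (kern N M x) * u ^ (2 * \<sigma>))"
    by (simp add: algebra_simps)
  also have "\<dots> \<le> 2 ^ \<sigma> * (c + c)" by (intro mult_left_mono add_mono b) auto
  finally have "norm (kern N M x) * (1 + u\<^sup>2) ^ \<sigma> \<le> 2 ^ \<sigma> * (2 * (4 * \<sigma> + 3) * B)"
    by (simp add: c_def algebra_simps)
  then show ?thesis
    unfolding peak_def e_def[symmetric] u_def[symmetric]
    using add_pos_nonneg[of 1 "u\<^sup>2"] by (simp add: power_one_over field_simps)
qed

lemma smooth_power: "smooth e s A M \<Longrightarrow> smooth e s ((2 ^ s * A) ^ r) (\<lambda>t. M t ^ r)"
proof (induction r)
  case 0
  show ?case using smooth_const[of e s 1] by simp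
next
  case (Suc r)
  then show ?case using smooth_mult[OF Suc.prems Suc.IH[OF Suc.prems]] by simp
qed

lemma smooth_double_all:
  assumes "\<And>e. 0 < e \<Longrightarrow> smooth e s A M" "0 < e" shows "smooth e s (2 ^ s * A) (\<lambda>t. M (2 * t))"
  using assms by (intro smooth_double) auto

lemma norm_ge_Re: "c \<le> Re z \<Longrightarrow> c \<le> norm z"
  using complex_Re_le_cmod order_trans by blast

lemma smooth_divide_power:
  assumes "0 < c"
  shows "\<exists>B. \<forall>e M D. 0 < e \<longrightarrow> (\<forall>t. c \<le> norm (D t)) \<longrightarrow> smooth e s A D \<longrightarrow> smooth e s A' M \<longrightarrow>
    smooth e s B (\<lambda>t. M t * (1 / D t) ^ r)"
proof -
  obtain B where B: "\<And>e D. 0 < e \<Longrightarrow> (\<forall>t. c \<le> norm (D t)) \<Longrightarrow> smooth e s A D \<Longrightarrow> smooth e s B (\<lambda>t. 1 / D t)"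
    using smooth_inverse[OF assms] by blast
  have "smooth e s (2 ^ s * A' * (2 ^ s * B) ^ r) (\<lambda>t. M t * (1 / D t) ^ r)"
    if "0 < e" "\<forall>t. c \<le> norm (D t)" "smooth e s A D" "smooth e s A' M" for e M D
    using that by (intro smooth_mult smooth_power B)
  then show ?thesis by blast
qed

lemma smooth_cis1: "0 < e \<Longrightarrow> smooth e s 1 cis"
  using smooth_cis[of e 1 1 s] by simp

lemma smooth_const1: "smooth e s 1 (\<lambda>t. 1)"
  using smooth_const[of e s 1] by simp

text \<open>\<open>\<eta>\<close> is a bump function. The first factorisation turns the difference of two consecutive sampling
  operators into sampling of \<open>\<Delta>\<^sup>r f\<close>; the second one does the same for the part with
  alternating signs, which replace \<open>1 - cis t\<close> by \<open>1 + cis t\<close>.\<close>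

lemma telescoping_multipliers:
  "\<exists>\<eta> m1 m2 B. (\<forall>e>0. smooth e s B \<eta> \<and> smooth e s B m1 \<and> smooth e s B m2) \<and>
    (\<forall>t. 1 \<le> \<bar>t\<bar> \<longrightarrow> \<eta> t = 0 \<and> m1 t = 0 \<and> m2 t = 0) \<and> \<eta> 0 = 1 \<and>
    (\<forall>t. \<eta> t - \<eta> (2 * t) = m1 t * (1 - cis t) ^ r) \<and>
    (\<forall>t. \<eta> (2 * t) = m2 t * (1 + cis t) ^ r)"
proof -
  obtain \<eta> B0 where \<eta>: "\<And>e. e > 0 \<Longrightarrow> smooth e s B0 (\<lambda>t. complex_of_real (\<eta> t))" "\<And>t. 0 \<le> \<eta> t" "\<And>t. \<eta> t \<le> 1"
     "\<And>t. \<bar>t\<bar> \<le> 1/2 \<Longrightarrow> \<eta> t = 1" "\<And>t. 1 \<le> \<bar>t\<bar> \<Longrightarrow> \<eta> t = 0"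
    using smooth_bump[of "1/2" 1 s] by auto
  obtain \<psi> B2 where \<psi>: "\<And>e. e > 0 \<Longrightarrow> smooth e s B2 (\<lambda>t. complex_of_real (\<psi> t))" "\<And>t. 0 \<le> \<psi> t" "\<And>t. \<psi> t \<le> 1"
     "\<And>t. \<bar>t\<bar> \<le> 1 \<Longrightarrow> \<psi> t = 1" "\<And>t. 2 \<le> \<bar>t\<bar> \<Longrightarrow> \<psi> t = 0"
    using smooth_bump[of 1 2 s] by auto
  note s1 = \<eta>(1) and s2 = smooth_double_all[OF \<eta>(1)]
  note s8 = smooth_double_all[OF smooth_double_all[OF s2]]
  \<comment> \<open>Equal to 1 - cis t on the annulus 1/4 < |t| < 1 that carries the numerator, but
    bounded away from 0 everywhere: the dilated bump fills the zero at t = 0, the term with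
    \<open>\<psi>\<close> those at the other multiples of 2 pi.\<close>
  define D1 where "D1 t = (1 - cis t) + of_real (\<eta> (2 * (2 * (2 * t)))) + (1 - of_real (\<psi> t))" for t
  \<comment> \<open>Equal to 1 + cis t on |t| < 1/2, where the numerator lives; the added term fills
    the zeros at odd multiples of pi.\<close>
  define D2 where "D2 t = (1 + cis t) + (1 - complex_of_real (\<eta> t))" for t
  \<comment> \<open>The dilated bump equals 1 for |t| \<le> 1/16; from there up to |t| = 2 the real
    part of 1 - cis t is at least \<open>c\<close>.\<close>
  define c where "c = 1 - cos (1 / 16 :: real)"
  have "cos (1 / 16 :: real) < cos 0" using pi_ge_two by (intro cos_monotone_0_pi) auto
  then have c: "0 < c" by (simp add: c_def)
  have c1: "c \<le> 1" using cos_ge_zero[of "1/16"] pi_ge_two by (simp add: c_def)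
  have D1: "c \<le> norm (D1 t)" for t
  proof (rule norm_ge_Re)
    have e: "0 \<le> \<eta> (2 * (2 * (2 * t)))" "0 \<le> 1 - \<psi> t" using \<eta>(2) \<psi>(3) by auto
    have Re: "Re (D1 t) = (1 - cos t) + \<eta> (2 * (2 * (2 * t))) + (1 - \<psi> t)" by (simp add: D1_def)
    consider "\<bar>t\<bar> \<le> 1/16" | "1/16 \<le> \<bar>t\<bar>" "\<bar>t\<bar> \<le> 2" | "2 \<le> \<bar>t\<bar>" by linarith
    then show "c \<le> Re (D1 t)"
    proof cases
      case 1
      then have "\<eta> (2 * (2 * (2 * t))) = 1" by (intro \<eta>(4)) auto
      then show ?thesis unfolding Re using e c1 cos_le_one[of t] by linarith
    next
      case 2
      have "cos \<bar>t\<bar> \<le> cos (1/16)" using 2 pi_ge_two by (intro cos_monotone_0_pi_le) auto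
      then show ?thesis unfolding Re using e by (simp add: c_def)
    next
      case 3
      then show ?thesis unfolding Re using e c1 cos_le_one[of t] \<psi>(5)[of t] by linarith
    qed
  qed
  have D2: "1 \<le> norm (D2 t)" for t
  proof (rule norm_ge_Re)
    have Re: "Re (D2 t) = 1 + cos t + (1 - \<eta> t)" by (simp add: D2_def)
    show "1 \<le> Re (D2 t)"
    proof (cases "1 \<le> \<bar>t\<bar>")
      case True
      then show ?thesis unfolding Re using \<eta>(5)[of t] cos_ge_minus_one[of t] by linarith
    next
      case False
      then have "0 \<le> cos t" using pi_ge_two by (intro cos_ge_zero) auto
      then show ?thesis unfolding Re using \<eta>(3)[of t] by linarith
    qed
  qed
  obtain B1' where B1': "\<And>e. 0 < e \<Longrightarrow> smooth e s B1' (\<lambda>t. (of_real (\<eta> t) - of_real (\<eta> (2 * t))) * (1 / D1 t) ^ r)"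
  proof -
    have "smooth e s ((1 + 1) + 2 ^ s * (2 ^ s * (2 ^ s * B0)) + (1 + B2)) D1" if "0 < e" for e
      unfolding D1_def using that
      by (intro smooth_add smooth_diff smooth_const1 smooth_cis1 s8 \<psi>(1))
    moreover have "smooth e s (B0 + 2 ^ s * B0) (\<lambda>t. of_real (\<eta> t) - of_real (\<eta> (2 * t)))" if "0 < e" for e
      using that by (intro smooth_diff s1 s2)
    ultimately show ?thesis using that D1 smooth_divide_power[OF c] by meson
  qed
  obtain B2' where B2': "\<And>e. 0 < e \<Longrightarrow> smooth e s B2' (\<lambda>t. of_real (\<eta> (2 * t)) * (1 / D2 t) ^ r)"
  proof -
    have "smooth e s ((1 + 1) + (1 + B0)) D2" if "0 < e" for e
      unfolding D2_def using that
      by (intro smooth_add smooth_diff smooth_const1 smooth_cis1 s1)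
    moreover have "smooth e s (2 ^ s * B0) (\<lambda>t. complex_of_real (\<eta> (2 * t)))" if "0 < e" for e
      using that by (intro s2)
    ultimately show ?thesis using that D2 smooth_divide_power[of 1] by (meson zero_less_one)
  qed
  define m1 where "m1 t = (of_real (\<eta> t) - of_real (\<eta> (2 * t))) * (1 / D1 t) ^ r" for t
  define m2 where "m2 t = of_real (\<eta> (2 * t)) * (1 / D2 t) ^ r" for t
  have id1: "of_real (\<eta> t) - of_real (\<eta> (2 * t)) = m1 t * (1 - cis t) ^ r" for t
  proof (cases "\<eta> t = \<eta> (2 * t)")
    case False
    have "\<bar>t\<bar> < 1" using False \<eta>(5)[of t] \<eta>(5)[of "2*t"] by force
    moreover have "1/4 < \<bar>t\<bar>" using False \<eta>(4)[of t] \<eta>(4)[of "2*t"] by force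
    ultimately have "D1 t = 1 - cis t" unfolding D1_def using \<psi>(4)[of t] \<eta>(5)[of "2*(2*(2*t))"] by simp
    moreover have "D1 t \<noteq> 0" using D1[of t] c by auto
    ultimately show ?thesis unfolding m1_def by (simp add: power_one_over)
  qed (simp add: m1_def)
  have id2: "of_real (\<eta> (2 * t)) = m2 t * (1 + cis t) ^ r" for t
  proof (cases "\<eta> (2 * t) = 0")
    case False
    have "\<bar>t\<bar> < 1/2" using False \<eta>(5)[of "2*t"] by force
    then have "D2 t = 1 + cis t" unfolding D2_def using \<eta>(4)[of t] by simp
    moreover have "D2 t \<noteq> 0" using D2[of t] by auto
    ultimately show ?thesis unfolding m2_def by (simp add: power_one_over)
  qed (simp add: m2_def)
  have z: "\<eta> t = 0 \<and> \<eta> (2 * t) = 0" if "1 \<le> \<bar>t\<bar>" for t using \<eta>(5)[of t] \<eta>(5)[of "2*t"] that by auto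
  let ?B = "max B0 (max B1' B2')"
  have "smooth e s ?B (\<lambda>t. complex_of_real (\<eta> t)) \<and> smooth e s ?B m1 \<and> smooth e s ?B m2" if "0 < e" for e
    unfolding m1_def m2_def
    by (intro conjI smooth_mono[OF s1[OF that]] smooth_mono[OF B1'[OF that]] smooth_mono[OF B2'[OF that]]) auto
  moreover have "complex_of_real (\<eta> t) = 0 \<and> m1 t = 0 \<and> m2 t = 0" if "1 \<le> \<bar>t\<bar>" for t
    using z[OF that] by (simp add: m1_def m2_def)
  ultimately show ?thesis
    by (intro exI[of _ "\<lambda>t. complex_of_real (\<eta> t)"] exI[of _ m1] exI[of _ m2] exI[of _ ?B])
       (use id1 id2 \<eta>(4)[of 0] in auto)
qed

text \<open>Used with \<open>t = \<nu> \<delta>\<close>, \<open>\<bar>\<nu>\<bar> \<le> n\<close> and \<open>\<delta> = 2\<pi>/(6n)\<close>, so that \<open>\<bar>t\<bar> \<le> \<pi>/3 < 11/10\<close>.\<close>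

lemma bernstein_multiplier:
  "\<exists>B. \<forall>\<tau>. 0 < \<tau> \<longrightarrow> \<tau> \<le> 1 \<longrightarrow> (\<exists>m. (\<forall>e>0. smooth e s B m) \<and> (\<forall>t. 3/2 \<le> \<bar>t\<bar> \<longrightarrow> m t = 0) \<and>
    (\<forall>t. \<bar>t\<bar> \<le> 11/10 \<longrightarrow> (1 - cis (\<tau> * t)) ^ r = of_real (\<tau> ^ r) * m t * (1 - cis t) ^ r))"
proof -
  obtain \<psi> B0 where \<psi>: "\<And>e. e > 0 \<Longrightarrow> smooth e s B0 (\<lambda>t. complex_of_real (\<psi> t))" "\<And>t. 0 \<le> \<psi> t" "\<And>t. \<psi> t \<le> 1"
     "\<And>t. \<bar>t\<bar> \<le> 11/10 \<Longrightarrow> \<psi> t = 1" "\<And>t. 3/2 \<le> \<bar>t\<bar> \<Longrightarrow> \<psi> t = 0"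
    using smooth_bump[of "11/10" "3/2" s] by auto
  \<comment> \<open>The quotient of the two differences is \<open>\<tau>\<close> times
    \<open>cis_avg \<tau> t / cis_avg 1 t\<close>. Near 0 the denominator has real part at least
    1/2; beyond 3/2 it is replaced by 3 plus a number of modulus at most 1.\<close>
  define D where "D t = cis_avg 1 t + 3 * (1 - of_real (\<psi> t))" for t
  have Re: "1/2 \<le> Re (cis_avg 1 t)" if "\<bar>t\<bar> \<le> 3/2" for t
  proof (cases "t = 0")
    case True
    then show ?thesis by (simp add: cis_avg_def)
  next
    case False
    have "1 - cis t = - \<i> * of_real t * cis_avg 1 t" using cis_avg_eq[of 1 t] by simp
    then have "Im (1 - cis t) = Im (- \<i> * of_real t * cis_avg 1 t)" by (rule arg_cong)
    then have *: "sin t = t * Re (cis_avg 1 t)" by simp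
    have pi: "3/2 \<le> pi/2" using pi_gt3 by simp
    have "Re (cis_avg 1 t) = sin \<bar>t\<bar> / \<bar>t\<bar>"
      using * False by (auto simp: abs_if field_simps)
    moreover have "\<bar>t\<bar> / 2 \<le> sin \<bar>t\<bar>" using that pi by (intro sin_ge_half) auto
    ultimately show ?thesis using False by (simp add: le_divide_eq)
  qed
  have D: "1/2 \<le> norm (D t)" for t
  proof (cases "\<bar>t\<bar> \<le> 3/2")
    case True
    then have "1/2 \<le> Re (D t)" using Re[OF True] \<psi>(3)[of t] by (simp add: D_def)
    then show ?thesis by (rule norm_ge_Re)
  next
    case False
    then have "D t = cis_avg 1 t + 3" using \<psi>(5)[of t] by (simp add: D_def)
    moreover have "norm (cis_avg 1 t) \<le> 1" using smooth_bound[OF smooth_cis_avg[of 1 1 0]] by simp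
    moreover have "norm (3::complex) \<le> norm (cis_avg 1 t + 3) + norm (cis_avg 1 t)"
      by (metis add_diff_cancel_left' norm_triangle_ineq4)
    ultimately show ?thesis by simp
  qed
  obtain B where B: "\<And>e M. 0 < e \<Longrightarrow> smooth e s (2 ^ s * B0 * (2 ^ s * 1) ^ r) M \<Longrightarrow> smooth e s B (\<lambda>t. M t * (1 / D t) ^ r)"
  proof -
    have "smooth e s (1 + norm (3::complex) * (1 + B0)) D" if "0 < e" for e
      unfolding D_def using that
      by (intro smooth_add smooth_cmult smooth_diff smooth_const1 smooth_cis_avg \<psi>(1)) auto
    then show ?thesis using that D smooth_divide_power[of "1/2" s _ _ r] by (meson half_gt_zero zero_less_one)
  qed
  show ?thesis
  proof (intro exI[of _ B] allI impI)
    fix \<tau> :: real assume \<tau>: "0 < \<tau>" "\<tau> \<le> 1"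
    define m where "m t = (of_real (\<psi> t) * cis_avg \<tau> t ^ r) * (1 / D t) ^ r" for t
    have "smooth e s B m" if "0 < e" for e
      unfolding m_def using that \<tau> by (intro B smooth_mult smooth_power \<psi>(1) smooth_cis_avg) auto
    moreover have "m t = 0" if "3/2 \<le> \<bar>t\<bar>" for t using \<psi>(5)[OF that] by (simp add: m_def)
    moreover have "(1 - cis (\<tau> * t)) ^ r = of_real (\<tau> ^ r) * m t * (1 - cis t) ^ r" if t: "\<bar>t\<bar> \<le> 11/10" for t
    proof -
      have Dt: "D t = cis_avg 1 t" using \<psi>(4)[OF t] by (simp add: D_def)
      have nz: "cis_avg 1 t \<noteq> 0" using D[of t] unfolding Dt by auto
      have 1: "1 - cis t = - \<i> * of_real t * cis_avg 1 t" using cis_avg_eq[of 1 t] by simp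
      have "of_real (\<tau> ^ r) * m t * (1 - cis t) ^ r = (of_real \<tau> * cis_avg \<tau> t * (1 / cis_avg 1 t) * (- \<i> * of_real t * cis_avg 1 t)) ^ r"
        unfolding m_def Dt 1 \<psi>(4)[OF t] by (simp only: of_real_1 of_real_power power_mult_distrib mult_1_left mult_ac)
      also have "of_real \<tau> * cis_avg \<tau> t * (1 / cis_avg 1 t) * (- \<i> * of_real t * cis_avg 1 t) = - \<i> * of_real (\<tau> * t) * cis_avg \<tau> t"
        using nz by simp
      finally show ?thesis unfolding cis_avg_eq by simp
    qed
    ultimately show "\<exists>m. (\<forall>e>0. smooth e s B m) \<and> (\<forall>t. 3/2 \<le> \<bar>t\<bar> \<longrightarrow> m t = 0) \<and>
      (\<forall>t. \<bar>t\<bar> \<le> 11/10 \<longrightarrow> (1 - cis (\<tau> * t)) ^ r = of_real (\<tau> ^ r) * m t * (1 - cis t) ^ r)" by blast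
  qed
qed

text \<open>Cyclic summation by parts moves the difference from the samples to the kernel, where it
  multiplies the multiplier by \<open>(1 - s * cis t) ^ r\<close>. The sign \<open>sg\<close> is a
  character of the grid, trivial for \<open>s = 1\<close> and alternating for
  \<open>s = - 1\<close>.\<close>

lemma kern_sum_by_parts:
  fixes sg :: "int \<Rightarrow> complex" and s :: complex
  assumes N: "1 \<le> N" and f: "periodic f" and \<delta>: "\<delta> = 2 * pi / real N"
    and sg: "\<And>i. sg (i + 1) = s * sg i" "s * s = 1" "\<And>i. sg (i + int N) = sg i"
    and M: "\<And>t. M t = m t * (1 - s * cis t) ^ r"
  shows "(\<Sum>j<N. sg (int j) * diff_op r \<delta> f (l + real j * \<delta>) * kern N m (x - l - real j * \<delta>))
    = (\<Sum>j<N. sg (int j) * f (l + real j * \<delta>) * kern N M (x - l - real j * \<delta>))"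
proof -
  have sgk: "sg (i + int k) = s ^ k * sg i" for i k
  proof (induction k)
    case (Suc k)
    have "sg (i + int (Suc k)) = sg ((i + int k) + 1)" by (simp add: algebra_simps)
    then show ?case using Suc sg(1) by (simp add: mult_ac)
  qed simp
  have ss: "s ^ k * s ^ k = 1" for k by (metis power_mult_distrib power_one sg(2))
  have N\<delta>: "real N * \<delta> = 2 * pi" using N \<delta> by simp
  have kper: "periodic (kern N m)"
  proof -
    have "expo \<nu> (x + 2*pi) = expo \<nu> x" for \<nu> x
      using expo_periodic[of \<nu>] unfolding periodic_def by blast
    then show ?thesis unfolding kern_def wide_kern_def periodic_def by simp
  qed
  let ?b = "\<lambda>k. (-1) ^ k * of_nat (r choose k) :: complex"
  have key: "(\<Sum>j<N. sg (int j) * f (l + real j * \<delta> + real k * \<delta>) * kern N m (x - l - real j * \<delta>))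
     = (\<Sum>j<N. s ^ k * (sg (int j) * f (l + real j * \<delta>) * kern N m (x - l - real j * \<delta> + real k * \<delta>)))" for k
  proof -
    define H where "H i = s ^ k * (sg i * f (l + of_int i * \<delta>) * kern N m (x - l - of_int i * \<delta> + real k * \<delta>))" for i :: int
    have H: "H (i + int N) = H i" for i
    proof -
      have "l + of_int (i + int N) * \<delta> = (l + of_int i * \<delta>) + 2 * pi"
        using N\<delta> by (simp add: algebra_simps)
      moreover have "x - l - of_int (i + int N) * \<delta> + real k * \<delta> = (x - l - of_int i * \<delta> + real k * \<delta>) - 2 * pi"
        using N\<delta> by (simp add: algebra_simps)
      ultimately show ?thesis
        unfolding H_def sg(3) by (simp only: f[unfolded periodic_def] periodic_diff[OF kper])
    qed
    have "sg (int j) * f (l + real j * \<delta> + real k * \<delta>) * kern N m (x - l - real j * \<delta>) = H (int j + int k)" for j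
    proof -
      have "l + of_int (int j + int k) * \<delta> = l + real j * \<delta> + real k * \<delta>" by (simp add: algebra_simps)
      moreover have "x - l - of_int (int j + int k) * \<delta> + real k * \<delta> = x - l - real j * \<delta>" by (simp add: algebra_simps)
      ultimately have "H (int j + int k) = (s ^ k * s ^ k) * (sg (int j) * f (l + real j * \<delta> + real k * \<delta>) * kern N m (x - l - real j * \<delta>))"
        unfolding H_def sgk by (simp only: mult_ac)
      then show ?thesis unfolding ss by simp
    qed
    then have "(\<Sum>j<N. sg (int j) * f (l + real j * \<delta> + real k * \<delta>) * kern N m (x - l - real j * \<delta>)) = (\<Sum>j<N. H (int j + int k))"
      by simp
    also have "\<dots> = (\<Sum>j<N. H (int j))" by (rule sum_cyclic_shift) (rule H)
    finally show ?thesis by (simp add: H_def)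
  qed
  \<comment> \<open>On the Fourier side a shift of the kernel by \<open>k\<close> meshes is the
    factor \<open>cis t ^ k\<close>, and the binomial theorem collects the shifts.\<close>
  have kM: "(\<Sum>k\<le>r. ?b k * s ^ k * kern N m (y + real k * \<delta>)) = kern N M y" for y
  proof -
    let ?t = "\<lambda>\<nu>::int. 2 * pi * of_int \<nu> / real N"
    have "(\<Sum>k\<le>r. ?b k * s ^ k * kern N m (y + real k * \<delta>))
       = (\<Sum>k\<le>r. \<Sum>\<nu>\<in>{- int N..int N}. 1 / of_nat N * (m (?t \<nu>) * expo \<nu> y * (of_nat (r choose k) * (- (s * cis (?t \<nu>))) ^ k * 1 ^ (r - k))))"
      unfolding kern_def wide_kern_def sum_distrib_left
    proof (intro sum.cong refl)
      fix k \<nu>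
      have "expo \<nu> (real k * \<delta>) = cis (?t \<nu>) ^ k"
        unfolding Complex.DeMoivre by (rule arg_cong[where f=cis]) (simp add: \<delta>)
      moreover have "(- (s * cis (?t \<nu>))) ^ k = (-1) ^ k * s ^ k * cis (?t \<nu>) ^ k"
        by (simp only: power_minus[of "s * _"] power_mult_distrib mult.assoc)
      ultimately show "?b k * s ^ k * (1 / of_nat N * (m (?t \<nu>) * expo \<nu> (y + real k * \<delta>)))
        = 1 / of_nat N * (m (?t \<nu>) * expo \<nu> y * (of_nat (r choose k) * (- (s * cis (?t \<nu>))) ^ k * 1 ^ (r - k)))"
        unfolding expo_add by (simp only: power_one mult_1_left mult_1_right mult_ac)
    qed
    also have "\<dots> = (\<Sum>\<nu>\<in>{- int N..int N}. 1 / of_nat N * (m (?t \<nu>) * expo \<nu> y * (\<Sum>k\<le>r. of_nat (r choose k) * (- (s * cis (?t \<nu>))) ^ k * 1 ^ (r - k))))"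
      unfolding sum_distrib_left by (rule sum.swap)
    also have "\<dots> = (\<Sum>\<nu>\<in>{- int N..int N}. 1 / of_nat N * (m (?t \<nu>) * expo \<nu> y * (1 - s * cis (?t \<nu>)) ^ r))"
      unfolding binomial_ring[symmetric] by simp
    also have "\<dots> = kern N M y"
      unfolding kern_def wide_kern_def M sum_distrib_left by (intro sum.cong refl) (simp only: mult_ac)
    finally show ?thesis .
  qed
  have "(\<Sum>j<N. sg (int j) * diff_op r \<delta> f (l + real j * \<delta>) * kern N m (x - l - real j * \<delta>))
     = (\<Sum>j<N. \<Sum>k\<le>r. ?b k * (sg (int j) * f (l + real j * \<delta> + real k * \<delta>) * kern N m (x - l - real j * \<delta>)))"
    unfolding diff_op_def sum_distrib_left sum_distrib_right
    by (intro sum.cong refl) (simp only: mult_ac)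
  also have "\<dots> = (\<Sum>k\<le>r. ?b k * (\<Sum>j<N. sg (int j) * f (l + real j * \<delta> + real k * \<delta>) * kern N m (x - l - real j * \<delta>)))"
    unfolding sum_distrib_left by (rule sum.swap)
  also have "\<dots> = (\<Sum>k\<le>r. \<Sum>j<N. sg (int j) * f (l + real j * \<delta>) * (?b k * s ^ k * kern N m (x - l - real j * \<delta> + real k * \<delta>)))"
    unfolding key sum_distrib_left by (intro sum.cong refl) (simp only: mult_ac)
  also have "\<dots> = (\<Sum>j<N. sg (int j) * f (l + real j * \<delta>) * (\<Sum>k\<le>r. ?b k * s ^ k * kern N m (x - l - real j * \<delta> + real k * \<delta>)))"
    unfolding sum_distrib_left by (rule sum.swap)
  finally show ?thesis unfolding kM .
qed

section \<open>Sampling operators and Bernstein's inequality\<close>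

lemma powr_add_le:
  fixes x y :: real
  assumes "0 < P" "P \<le> 1" "0 \<le> x" "0 \<le> y"
  shows "(x + y) powr P \<le> x powr P + y powr P"
proof (cases "x + y = 0")
  case False
  then have s: "0 < x + y" using assms by linarith
  have le: "u / (x + y) \<le> (u / (x + y)) powr P" if "0 \<le> u" "u \<le> x + y" for u
    using powr_mono'[of P 1 "u / (x + y)"] that s assms by simp
  have "1 = x / (x + y) + y / (x + y)" using s by (simp flip: add_divide_distrib)
  also have "\<dots> \<le> (x / (x + y)) powr P + (y / (x + y)) powr P"
    using assms by (intro add_mono le) auto
  also have "\<dots> = (x powr P + y powr P) / (x + y) powr P"
    using assms s by (simp add: powr_divide add_divide_distrib)
  finally show ?thesis using s by (simp add: le_divide_eq)
qed (use assms in auto)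

lemma powr_sum_le:
  fixes a :: "'i \<Rightarrow> real"
  assumes "0 < P" "P \<le> 1" "finite I" "\<And>i. i \<in> I \<Longrightarrow> 0 \<le> a i"
  shows "(\<Sum>i\<in>I. a i) powr P \<le> (\<Sum>i\<in>I. a i powr P)"
  using assms(3,4)
proof (induction I)
  case (insert i I)
  have "(a i + (\<Sum>i\<in>I. a i)) powr P \<le> a i powr P + (\<Sum>i\<in>I. a i) powr P"
    using insert.prems by (intro powr_add_le assms(1,2) sum_nonneg) auto
  then show ?case using insert by simp
qed simp

text \<open>The convex power lies above its tangent at \<open>b\<close>. This follows from Young's
  inequality with the conjugate exponents \<open>P\<close> and \<open>P / (P - 1)\<close>.\<close>

lemma powr_tangent:
  fixes t b :: real
  assumes "1 \<le> P" "0 \<le> t" "0 < b"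
  shows "b powr P + P * b powr (P - 1) * (t - b) \<le> t powr P"
proof (cases "P = 1")
  case False
  then have P: "1 < P" using assms by simp
  have "t * b powr (P - 1) \<le> t powr P / P + (b powr (P - 1)) powr (P / (P - 1)) / (P / (P - 1))"
    using P assms by (intro Youngs_inequality) (auto simp: field_simps)
  also have "(b powr (P - 1)) powr (P / (P - 1)) = b powr P" using P by (simp add: powr_powr)
  finally have "P * (t * b powr (P - 1)) \<le> P * (t powr P / P + b powr P / (P / (P - 1)))"
    using P by (intro mult_left_mono) auto
  also have "\<dots> = t powr P + (P - 1) * b powr P" using P by (simp add: distrib_left)
  finally have *: "P * (t * b powr (P - 1)) \<le> t powr P + (P - 1) * b powr P" .
  have "b powr P = b powr (P - 1) * b" using assms(3) by (simp add: powr_mult_base mult.commute)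
  then have "P * b powr (P - 1) * (t - b) = P * (t * b powr (P - 1)) - P * b powr P"
    by (simp add: algebra_simps)
  then show ?thesis using * by (simp add: left_diff_distrib)
qed (use assms in simp)

text \<open>One bound for all exponents. For P \<le> 1, subadditivity produces weights to the power
  \<sigma> P, at most \<open>w j\<close> because \<sigma> P \<ge> 1. For P > 1, the power \<sigma>
  is dropped and Jensen's inequality with weights \<open>w j\<close> applies.\<close>

lemma weighted_powr_sum_le:
  fixes a w :: "nat \<Rightarrow> real" and \<sigma> :: nat
  assumes P: "0 < P" "1 \<le> real \<sigma> * P" and \<sigma>: "1 \<le> \<sigma>" and C: "1 \<le> C" and a: "\<And>j. 0 \<le> a j"
    and w: "\<And>j. 0 < w j" "\<And>j. w j \<le> 1" and W: "(\<Sum>j<N. w j) \<le> C"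
  shows "(\<Sum>j<N. a j * w j ^ \<sigma>) powr P \<le> C powr P * (\<Sum>j<N. a j powr P * w j)"
proof (cases "P \<le> 1")
  case True
  have "(\<Sum>j<N. a j * w j ^ \<sigma>) powr P \<le> (\<Sum>j<N. (a j * w j ^ \<sigma>) powr P)"
    using P True a less_imp_le[OF w(1)] by (intro powr_sum_le) auto
  also have "\<dots> \<le> (\<Sum>j<N. a j powr P * w j)"
  proof (intro sum_mono)
    fix j
    have "(w j ^ \<sigma>) powr P = w j powr (real \<sigma> * P)"
      using w(1)[of j] by (simp add: powr_powr flip: powr_realpow)
    also have "\<dots> \<le> w j powr 1" using w(1,2)[of j] P by (intro powr_mono') auto
    finally have "(w j ^ \<sigma>) powr P \<le> w j" using w(1)[of j] by simp
    then show "(a j * w j ^ \<sigma>) powr P \<le> a j powr P * w j"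
      using a[of j] less_imp_le[OF w(1)[of j]] by (simp add: powr_mult mult_left_mono)
  qed
  also have "\<dots> = 1 * (\<Sum>j<N. a j powr P * w j)" by simp
  also have "\<dots> \<le> C powr P * (\<Sum>j<N. a j powr P * w j)"
    using C P less_imp_le[OF w(1)] by (intro mult_right_mono ge_one_powr_ge_zero sum_nonneg) auto
  finally show ?thesis .
next
  case False
  then have P1: "1 \<le> P" by simp
  define S where "S = (\<Sum>j<N. a j * w j)"
  define V where "V = (\<Sum>j<N. w j)"
  have nn: "0 \<le> (\<Sum>j<N. a j powr P * w j)" using less_imp_le[OF w(1)] by (intro sum_nonneg) auto
  have "(\<Sum>j<N. a j * w j ^ \<sigma>) \<le> S" unfolding S_def
  proof (intro sum_mono mult_left_mono a)
    show "w j ^ \<sigma> \<le> w j" for j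
      using power_decreasing[of 1 \<sigma> "w j"] \<sigma> w(2)[of j] less_imp_le[OF w(1)[of j]] by simp
  qed
  moreover have "0 \<le> (\<Sum>j<N. a j * w j ^ \<sigma>)"
    using a less_imp_le[OF w(1)] by (intro sum_nonneg) auto
  ultimately have le: "(\<Sum>j<N. a j * w j ^ \<sigma>) powr P \<le> S powr P"
    using P by (intro powr_mono2) auto
  show ?thesis
  proof (cases "S = 0")
    case True
    then have "(\<Sum>j<N. a j * w j ^ \<sigma>) powr P \<le> 0" using le by simp
    then show ?thesis using nn by (meson mult_nonneg_nonneg order_trans powr_ge_zero)
  next
    case False
    have S0: "0 < S" using False a less_imp_le[OF w(1)] sum_nonneg[of "{..<N}" "\<lambda>j. a j * w j"] unfolding S_def by force
    have "N \<noteq> 0" using False unfolding S_def by (metis lessThan_0 sum.empty)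
    then have V0: "0 < V" unfolding V_def using w(1) \<open>N \<noteq> 0\<close> by (intro sum_pos) auto
    \<comment> \<open>The weighted mean of the \<open>a j\<close>. In the weighted sum of the
      tangents at this point the linear terms cancel.\<close>
    define b where "b = S / V"
    have b: "0 < b" "S = b * V" using S0 V0 by (auto simp: b_def)
    have "V * b powr P = (\<Sum>j<N. (b powr P + P * b powr (P - 1) * (a j - b)) * w j)"
    proof -
      have "(\<Sum>j<N. (b powr P + P * b powr (P - 1) * (a j - b)) * w j) = b powr P * V + P * b powr (P - 1) * (S - b * V)"
        unfolding S_def V_def
        by (simp add: distrib_right right_diff_distrib left_diff_distrib sum.distrib sum_subtractf mult.assoc flip: sum_distrib_left)
      then show ?thesis using b by simp
    qed
    also have "\<dots> \<le> (\<Sum>j<N. a j powr P * w j)"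
      using P1 a b less_imp_le[OF w(1)] by (intro sum_mono mult_right_mono powr_tangent) auto
    finally have low: "V * b powr P \<le> (\<Sum>j<N. a j powr P * w j)" .
    have "S powr P = V powr (P - 1) * (V * b powr P)"
    proof -
      have "V powr P = V * V powr (P - 1)" using V0 powr_mult_base[of V "P - 1"] by simp
      moreover have "S powr P = b powr P * V powr P" unfolding b(2) by (rule powr_mult)
      ultimately show ?thesis by simp
    qed
    also have "\<dots> \<le> C powr P * (\<Sum>j<N. a j powr P * w j)"
    proof (intro mult_mono low)
      have "V powr (P - 1) \<le> C powr (P - 1)" using V0 W P1 unfolding V_def by (intro powr_mono2) auto
      also have "\<dots> \<le> C powr P" using C by (intro powr_mono) auto
      finally show "V powr (P - 1) \<le> C powr P" .
    qed (use V0 in auto)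
    finally show ?thesis using le by linarith
  qed
qed

abbreviation mesh :: "nat \<Rightarrow> real" where "mesh N \<equiv> 2 * pi / real N"

lemma continuous_peak: "continuous_on UNIV (peak N)"
proof -
  define c where "c = inverse (mesh N)"
  have "peak N = (\<lambda>x. 1 / (1 + (norm (1 - cis x) * c)\<^sup>2))"
    by (rule ext) (simp only: peak_def c_def divide_inverse[of _ "mesh N"])
  moreover have "1 + (norm (1 - cis x) * c)\<^sup>2 \<noteq> 0" for x
    using add_pos_nonneg[of 1 "(norm (1 - cis x) * c)\<^sup>2"] by simp
  ultimately show ?thesis by (auto intro!: continuous_intros)
qed

lemma measurable_peak: "peak N \<in> borel_measurable lebesgue"
  by (rule continuous_measurable_lebesgue[OF continuous_peak])

lemma peak_sum_mesh: "\<exists>C\<ge>1. \<forall>N\<ge>1. \<forall>y. (\<Sum>j<N. peak N (y - real j * mesh N)) \<le> C"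
proof -
  obtain C where C: "0 < C" "\<And>N y. 1 \<le> N \<Longrightarrow> (\<Sum>j<N. peak N (y - 2 * pi * real j / real N)) \<le> C"
    using peak_sum_bounded by blast
  have "(\<Sum>j<N. peak N (y - real j * mesh N)) \<le> max 1 C" if "1 \<le> N" for N y
    using C(2)[OF that, of y] by (simp add: mult.commute)
  then show ?thesis by (intro exI[of _ "max 1 C"]) auto
qed

text \<open>The N grid translates of the profile have equal averages and a sum bounded by
  \<open>C\<close>; a single profile thus has mass of order 1 / N.\<close>

lemma avg_peak:
  assumes N: "1 \<le> N" and C: "\<And>y. (\<Sum>j<N. peak N (y - real j * mesh N)) \<le> C"
  shows "ennreal (real N) * avg (\<lambda>x. ennreal (peak N x)) \<le> ennreal C"
proof -
  note [measurable] = measurable_peak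
  have "avg (\<lambda>x. ennreal (peak N (x + (- (real j * mesh N))))) = avg (\<lambda>x. ennreal (peak N x))" for j
    by (rule avg_shift[where F="\<lambda>x. ennreal (peak N x)"]) (auto intro: periodic_comp[OF peak_periodic])
  then have "ennreal (real N) * avg (\<lambda>x. ennreal (peak N x)) = (\<Sum>j<N. avg (\<lambda>x. ennreal (peak N (x + (- (real j * mesh N))))))"
    by (simp add: ennreal_of_nat_eq_real_of_nat)
  also have "\<dots> = avg (\<lambda>x. \<Sum>j<N. ennreal (peak N (x + (- (real j * mesh N)))))"
    using measurable_shift[OF measurable_peak] by (intro avg_sum[symmetric] measurable_compose[OF _ measurable_ennreal]) (simp, blast)
  also have "\<dots> \<le> avg (\<lambda>x. ennreal C)"
    using C less_imp_le[OF peak_pos] by (intro avg_mono) (simp add: sum_ennreal ennreal_leI)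
  finally show ?thesis by simp
qed

lemma Lnorm_top_bound:
  assumes "f \<in> Lspace \<infinity>" shows "ennreal (norm (f x)) \<le> Lnorm \<infinity> f"
  unfolding Lnorm_def pnorm_top_exp by (rule SUP_upper) simp

text \<open>The mixed norm is essential here. Integration in \<open>x\<close> leaves the mass 1 / N
  of each peak, integration in \<open>l\<close> turns each sample into the norm of \<open>F\<close>,
  and the N nodes cancel the 1 / N.\<close>

lemma sampling_bound:
  fixes \<sigma> :: nat
  assumes p: "0 < p" and \<sigma>: "1 \<le> \<sigma>" "p \<noteq> \<infinity> \<Longrightarrow> 1 \<le> real \<sigma> * enn2real p"
  shows "\<exists>C\<ge>0. \<forall>N\<ge>1. \<forall>F\<in>Lspace p. \<forall>G. \<forall>B\<ge>0.
    (\<forall>l x. norm (G l x) \<le> B * (\<Sum>j<N. norm (F (l + real j * mesh N)) * peak N (x - l - real j * mesh N) ^ \<sigma>)) \<longrightarrow>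
    mixed_norm p G \<le> ennreal (C * B) * Lnorm p F"
proof -
  obtain C where C: "1 \<le> C" "\<And>N y. 1 \<le> N \<Longrightarrow> (\<Sum>j<N. peak N (y - real j * mesh N)) \<le> C"
    using peak_sum_mesh by blast
  show ?thesis
  proof (cases "p = \<infinity>")
    case True
    show ?thesis
    proof (intro exI[of _ C] conjI allI impI ballI)
      fix N :: nat and F and G :: "real \<Rightarrow> real \<Rightarrow> complex" and B :: real
      assume N: "1 \<le> N" and F: "F \<in> Lspace p" and B: "0 \<le> B"
        and G: "\<forall>l x. norm (G l x) \<le> B * (\<Sum>j<N. norm (F (l + real j * mesh N)) * peak N (x - l - real j * mesh N) ^ \<sigma>)"
      obtain b where b: "0 \<le> b" "Lnorm p F = ennreal b"
        using Lspace_finite[OF p F] by (cases "Lnorm p F") auto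
      have Fb: "norm (F x) \<le> b" for x
        using Lnorm_top_bound[of F x] F b True by simp
      have "norm (G l x) \<le> C * B * b" for l x
      proof -
        have "(\<Sum>j<N. norm (F (l + real j * mesh N)) * peak N (x - l - real j * mesh N) ^ \<sigma>)
           \<le> (\<Sum>j<N. b * peak N (x - l - real j * mesh N))"
        proof (intro sum_mono mult_mono Fb b)
          show "peak N y ^ \<sigma> \<le> peak N y" for y
            using power_decreasing[of 1 \<sigma> "peak N y"] \<sigma>(1) peak_le_1[of N y] less_imp_le[OF peak_pos[of N y]] by simp
        qed (simp add: less_imp_le[OF peak_pos])
        also have "\<dots> \<le> b * C" unfolding sum_distrib_left[symmetric]
          using C(2)[OF N] b by (intro mult_left_mono) auto
        finally have "B * (\<Sum>j<N. norm (F (l + real j * mesh N)) * peak N (x - l - real j * mesh N) ^ \<sigma>) \<le> B * (b * C)"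
          using B by (rule mult_left_mono)
        then show ?thesis using G[rule_format, of l x] by (simp add: mult_ac)
      qed
      then have "mixed_norm p G \<le> ennreal (C * B * b)"
        unfolding True mixed_norm_top by (intro SUP_least ennreal_leI)
      then show "mixed_norm p G \<le> ennreal (C * B) * Lnorm p F"
        using b B C(1) by (simp add: ennreal_mult)
    qed (use C in simp)
  next
    case False
    define P where "P = enn2real p"
    have P: "0 < P" unfolding P_def by (rule enn2real_pos[OF p False])
    \<comment> \<open>The P-th root of \<open>C powr P * C\<close>: one factor stems from
      \<open>weighted_powr_sum_le\<close>, the other from \<open>avg_peak\<close>.\<close>
    define C' where "C' = C * C powr (1 / P)"
    show ?thesis
    proof (intro exI[of _ C'] conjI allI impI ballI)
      fix N :: nat and F and G :: "real \<Rightarrow> real \<Rightarrow> complex" and B :: real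
      assume N: "1 \<le> N" and F: "F \<in> Lspace p" and B: "0 \<le> B"
        and G: "\<forall>l x. norm (G l x) \<le> B * (\<Sum>j<N. norm (F (l + real j * mesh N)) * peak N (x - l - real j * mesh N) ^ \<sigma>)"
      note Fm [measurable] = Lspace_measurable[OF F]
      note [measurable] = measurable_peak
      let ?K = "B powr P * C powr P"
      let ?F = "\<lambda>l j. ennreal (norm (F (l + real j * mesh N)) powr P)"
      have pw: "norm (G l x) powr P \<le> (\<Sum>j<N. (?K * norm (F (l + real j * mesh N)) powr P) * peak N (x - l - real j * mesh N))" for l x
      proof -
        let ?S = "\<Sum>j<N. norm (F (l + real j * mesh N)) * peak N (x - l - real j * mesh N) ^ \<sigma>"
        have S: "0 \<le> ?S" using less_imp_le[OF peak_pos] by (intro sum_nonneg) auto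
        have "norm (G l x) powr P \<le> (B * ?S) powr P"
          using G P by (intro powr_mono2) auto
        also have "\<dots> = B powr P * ?S powr P" using B S by (simp add: powr_mult)
        also have "\<dots> \<le> B powr P * (C powr P * (\<Sum>j<N. norm (F (l + real j * mesh N)) powr P * peak N (x - l - real j * mesh N)))"
          using P \<sigma>(1) \<sigma>(2)[OF False, folded P_def] C peak_pos peak_le_1 N
          by (intro mult_left_mono weighted_powr_sum_le) auto
        finally show ?thesis by (simp add: sum_distrib_left mult_ac)
      qed
      have inner: "avg (\<lambda>x. ennreal (norm (G l x) powr P)) \<le> (\<Sum>j<N. ?F l j) * (ennreal ?K * avg (\<lambda>x. ennreal (peak N x)))" for l
      proof -
        have "avg (\<lambda>x. ennreal (norm (G l x) powr P))
           \<le> avg (\<lambda>x. \<Sum>j<N. (ennreal ?K * ?F l j) * ennreal (peak N (x + (- l - real j * mesh N))))"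
        proof (rule avg_mono)
          fix x
          have "ennreal (norm (G l x) powr P) \<le> ennreal (\<Sum>j<N. (?K * norm (F (l + real j * mesh N)) powr P) * peak N (x - l - real j * mesh N))"
            by (intro ennreal_leI pw)
          also have "\<dots> = (\<Sum>j<N. (ennreal ?K * ?F l j) * ennreal (peak N (x + (- l - real j * mesh N))))"
            using B less_imp_le[OF peak_pos] by (subst sum_ennreal[symmetric]) (auto simp: ennreal_mult algebra_simps)
          finally show "ennreal (norm (G l x) powr P) \<le> \<dots>" .
        qed
        also have "\<dots> = (\<Sum>j<N. (ennreal ?K * ?F l j) * avg (\<lambda>x. ennreal (peak N x)))"
        proof (subst avg_sum)
          have m: "(\<lambda>x. ennreal (peak N (x + h))) \<in> borel_measurable lebesgue" for h
            using measurable_shift[OF measurable_peak, of N h] by measurable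
          show "(\<lambda>x. (ennreal ?K * ?F l j) * ennreal (peak N (x + (- l - real j * mesh N)))) \<in> borel_measurable lebesgue" for j
            using m by measurable
          have "avg (\<lambda>x. ennreal (peak N (x + h))) = avg (\<lambda>x. ennreal (peak N x))" for h
            by (rule avg_shift[where F="\<lambda>x. ennreal (peak N x)"]) (auto intro: periodic_comp[OF peak_periodic])
          then show "(\<Sum>j<N. avg (\<lambda>x. (ennreal ?K * ?F l j) * ennreal (peak N (x + (- l - real j * mesh N))))) = (\<Sum>j<N. (ennreal ?K * ?F l j) * avg (\<lambda>x. ennreal (peak N x)))"
            using m by (simp add: avg_cmult)
        qed simp
        also have "\<dots> = (\<Sum>j<N. ?F l j) * (ennreal ?K * avg (\<lambda>x. ennreal (peak N x)))"
          unfolding sum_distrib_right by (intro sum.cong refl) (simp only: mult_ac)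
        finally show ?thesis .
      qed
      have mF: "(\<lambda>l. ?F l j) \<in> borel_measurable lebesgue" for j
        using measurable_shift[OF Fm, of "real j * mesh N"] by measurable
      have "ennpowr (mixed_norm p G) P = avg (\<lambda>l. avg (\<lambda>x. ennreal (norm (G l x) powr P)))"
        unfolding P_def by (rule ennpowr_mixed_norm[OF p False])
      also have "\<dots> \<le> avg (\<lambda>l. (\<Sum>j<N. ?F l j) * (ennreal ?K * avg (\<lambda>x. ennreal (peak N x))))"
        by (intro avg_mono inner)
      also have "\<dots> = (\<Sum>j<N. avg (\<lambda>l. ?F l j)) * (ennreal ?K * avg (\<lambda>x. ennreal (peak N x)))"
      proof -
        have "avg (\<lambda>l. (\<Sum>j<N. ?F l j) * c) = avg (\<lambda>l. \<Sum>j<N. ?F l j) * c" for c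
          by (intro avg_multc borel_measurable_sum mF)
        moreover have "avg (\<lambda>l. \<Sum>j<N. ?F l j) = (\<Sum>j<N. avg (\<lambda>l. ?F l j))"
          by (intro avg_sum mF) simp
        ultimately show ?thesis by (simp only:)
      qed
      also have "(\<Sum>j<N. avg (\<lambda>l. ?F l j)) = ennreal (real N) * ennpowr (Lnorm p F) P"
      proof -
        have "avg (\<lambda>l. ?F l j) = ennpowr (Lnorm p F) P" for j
        proof -
          have "avg (\<lambda>l. ?F l j) = avg (\<lambda>x. ennreal (norm (F x) powr P))"
            by (rule avg_shift[where F="\<lambda>x. ennreal (norm (F x) powr P)"]) (auto intro: periodic_comp[OF Lspace_periodic[OF F]])
          then show ?thesis unfolding Lnorm_def P_def ennpowr_pnorm[OF p False] ennpowr_norm .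
        qed
        then show ?thesis by (simp add: ennreal_of_nat_eq_real_of_nat)
      qed
      also have "ennreal (real N) * ennpowr (Lnorm p F) P * (ennreal ?K * avg (\<lambda>x. ennreal (peak N x)))
         = ennpowr (Lnorm p F) P * (ennreal ?K * (ennreal (real N) * avg (\<lambda>x. ennreal (peak N x))))"
        by (simp only: mult_ac)
      also have "\<dots> \<le> ennpowr (Lnorm p F) P * (ennreal ?K * ennreal C)"
        using avg_peak[OF N C(2)[OF N]] by (intro mult_left_mono) auto
      also have "ennreal ?K * ennreal C = ennpowr (ennreal (C' * B)) P"
        using B C(1) P by (simp add: C'_def ennpowr_ennreal powr_mult powr_powr ennreal_mult[symmetric] mult_ac)
      also have "ennpowr (Lnorm p F) P * \<dots> = ennpowr (ennreal (C' * B) * Lnorm p F) P"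
        by (simp add: ennpowr_mult mult.commute)
      finally show "mixed_norm p G \<le> ennreal (C' * B) * Lnorm p F"
        using P ennpowr_le_iff by blast
    qed (use C in \<open>simp add: C'_def\<close>)
  qed
qed

lemma exists_sigma:
  assumes "0 < p" shows "\<exists>\<sigma>::nat. 1 \<le> \<sigma> \<and> (p \<noteq> \<infinity> \<longrightarrow> 1 \<le> real \<sigma> * enn2real p)"
proof (cases "p = \<infinity>")
  case True
  then show ?thesis by (intro exI[of _ 1]) simp
next
  case False
  have P: "0 < enn2real p" by (rule enn2real_pos[OF assms False])
  obtain k :: nat where k: "1 / enn2real p \<le> real k" using real_arch_simple by blast
  have "1 \<le> real (Suc k) * enn2real p"
    using k P by (simp add: divide_le_eq algebra_simps)
  then show ?thesis by (intro exI[of _ "Suc k"]) simp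
qed

definition sample_op :: "nat \<Rightarrow> (real \<Rightarrow> complex) \<Rightarrow> (real \<Rightarrow> complex) \<Rightarrow> real \<Rightarrow> real \<Rightarrow> complex" where
  "sample_op N M f l x = (\<Sum>j<N. f (l + real j * mesh N) * kern N M (x - l - real j * mesh N))"

text \<open>The order is \<open>s = 2 * \<sigma>\<close>, which yields the decay
  \<open>peak ^ \<sigma>\<close>. Asking only for domination of \<open>G\<close> allows functions
  independent of \<open>l\<close>, and the factor \<open>k\<close> stays visible for Bernstein's
  inequality.\<close>

lemma sample_op_bound:
  assumes p: "0 < p"
  shows "\<exists>s. \<forall>B\<ge>0. \<exists>C\<ge>0. \<forall>N\<ge>1. \<forall>M f k G. f \<in> Lspace p \<longrightarrow> 0 \<le> k \<longrightarrow> smooth (mesh N) s B M \<longrightarrow>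
     (\<forall>t. 2 \<le> \<bar>t\<bar> \<longrightarrow> M t = 0) \<longrightarrow>
     (\<forall>l x. norm (G l x) \<le> k * (\<Sum>j<N. norm (f (l + real j * mesh N)) * norm (kern N M (x - l - real j * mesh N)))) \<longrightarrow>
     mixed_norm p G \<le> ennreal (C * k) * Lnorm p f"
proof -
  obtain \<sigma> :: nat where \<sigma>: "1 \<le> \<sigma>" "p \<noteq> \<infinity> \<Longrightarrow> 1 \<le> real \<sigma> * enn2real p" using exists_sigma[OF p] by blast
  obtain C where C: "0 \<le> C" "\<And>N F G B. 1 \<le> N \<Longrightarrow> F \<in> Lspace p \<Longrightarrow> 0 \<le> B \<Longrightarrow>
    (\<forall>l x. norm (G l x) \<le> B * (\<Sum>j<N. norm (F (l + real j * mesh N)) * peak N (x - l - real j * mesh N) ^ \<sigma>)) \<Longrightarrow>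
    mixed_norm p G \<le> ennreal (C * B) * Lnorm p F"
    using sampling_bound[OF p \<sigma>] by blast
  show ?thesis
  proof (intro exI[of _ "2 * \<sigma>"] allI impI)
    fix B :: real assume B: "0 \<le> B"
    define c where "c = 2 ^ \<sigma> * (2 * (4 * real \<sigma> + 3) * B)"
    have c: "0 \<le> c" using B by (simp add: c_def)
    have "mixed_norm p G \<le> ennreal (C * c * k) * Lnorm p f"
      if N: "1 \<le> N" and f: "f \<in> Lspace p" and k: "0 \<le> k" and M: "smooth (mesh N) (2 * \<sigma>) B M" "\<forall>t. 2 \<le> \<bar>t\<bar> \<longrightarrow> M t = 0"
        and G: "\<forall>l x. norm (G l x) \<le> k * (\<Sum>j<N. norm (f (l + real j * mesh N)) * norm (kern N M (x - l - real j * mesh N)))"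
      for N M f k G
    proof -
      have "norm (G l x) \<le> (c * k) * (\<Sum>j<N. norm (f (l + real j * mesh N)) * peak N (x - l - real j * mesh N) ^ \<sigma>)" for l x
      proof -
        have kb: "norm (kern N M y) \<le> c * peak N y ^ \<sigma>" for y
          unfolding c_def by (rule norm_kern_le[OF N M(1)]) (use M(2) in blast)
        have "norm (G l x) \<le> k * (\<Sum>j<N. norm (f (l + real j * mesh N)) * norm (kern N M (x - l - real j * mesh N)))"
          using G by blast
        also have "\<dots> \<le> k * (\<Sum>j<N. norm (f (l + real j * mesh N)) * (c * peak N (x - l - real j * mesh N) ^ \<sigma>))"
          using k by (intro mult_left_mono sum_mono kb) auto
        finally show ?thesis by (simp add: sum_distrib_left mult_ac)
      qed
      then have "mixed_norm p G \<le> ennreal (C * (c * k)) * Lnorm p f"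
        using c k by (intro C(2)[OF N f]) auto
      then show ?thesis by (simp add: mult.assoc)
    qed
    moreover have "0 \<le> C * c" using C(1) c by simp
    ultimately show "\<exists>C\<ge>0. \<forall>N\<ge>1. \<forall>M f k G. f \<in> Lspace p \<longrightarrow> 0 \<le> k \<longrightarrow> smooth (mesh N) (2 * \<sigma>) B M \<longrightarrow>
       (\<forall>t. 2 \<le> \<bar>t\<bar> \<longrightarrow> M t = 0) \<longrightarrow>
       (\<forall>l x. norm (G l x) \<le> k * (\<Sum>j<N. norm (f (l + real j * mesh N)) * norm (kern N M (x - l - real j * mesh N)))) \<longrightarrow>
       mixed_norm p G \<le> ennreal (C * k) * Lnorm p f"
      by (intro exI[of _ "C * c"]) blast
  qed
qed

text \<open>Support in |t| < 3/2 means |\<mu>| < 3 N / 8. With |\<nu>| \<le> N / 6 the difference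
  stays below N, so there is no aliasing.\<close>

lemma sample_op_expo:
  assumes N: "1 \<le> N" and M: "\<And>t. 3/2 \<le> \<bar>t\<bar> \<Longrightarrow> M t = 0" and \<nu>: "6 * \<bar>\<nu>\<bar> \<le> int N"
  shows "sample_op N M (expo \<nu>) l x = M (of_int \<nu> * mesh N) * expo \<nu> x"
proof -
  let ?M = "\<lambda>\<mu>::int. 1 / of_nat N * M (2 * pi * of_int \<mu> / real N)"
  have "sample_op N M (expo \<nu>) l x = (\<Sum>j<N. expo \<nu> (l + 2 * pi * real j / real N) * (\<Sum>\<mu>\<in>{- int N..int N}. ?M \<mu> * expo \<mu> (x - l - 2 * pi * real j / real N)))"
    unfolding sample_op_def kern_def wide_kern_def sum_distrib_left
    by (intro sum.cong refl) (simp add: mult_ac)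
  also have "\<dots> = of_nat N * ?M \<nu> * expo \<nu> x"
  proof (rule sample_expo)
    fix \<mu> assume \<mu>: "?M \<mu> \<noteq> 0" "\<mu> \<noteq> \<nu>"
    have "\<bar>2 * pi * of_int \<mu> / real N\<bar> < 3/2" using \<mu>(1) M[of "2 * pi * of_int \<mu> / real N"] by force
    then have "2 * pi * \<bar>of_int \<mu>\<bar> < 3/2 * real N" using N by (simp add: abs_mult divide_less_eq)
    moreover have "4 * \<bar>of_int \<mu>\<bar> \<le> 2 * pi * \<bar>real_of_int \<mu>\<bar>"
      using pi_ge_two by (intro mult_right_mono) auto
    ultimately have "8 * \<bar>real_of_int \<mu>\<bar> < 3 * real N" by linarith
    then have "real_of_int (8 * \<bar>\<mu>\<bar>) < real_of_int (3 * int N)" by simp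
    then have "8 * \<bar>\<mu>\<bar> < 3 * int N" by (simp only: of_int_less_iff)
    then have "\<bar>\<nu> - \<mu>\<bar> < int N" "\<nu> - \<mu> \<noteq> 0" using \<nu> \<mu>(2) N by linarith+
    then show "\<not> int N dvd (\<nu> - \<mu>)"
      using zdvd_not_zless[of "\<bar>\<nu> - \<mu>\<bar>" "int N"] by simp
  qed (use N \<nu> in auto)
  also have "\<dots> = M (of_int \<nu> * mesh N) * expo \<nu> x" using N by (simp add: mult_ac)
  finally show ?thesis .
qed

text \<open>With \<open>\<tau>\<close> the ratio of the steps, the difference with step
  \<open>h\<close> is \<open>\<tau> ^ r\<close> times a sampling of the difference with step
  \<open>mesh (6 * n)\<close>, by a multiplier whose smoothness bound is independent of
  \<open>\<tau>\<close>. The result does not depend on the grid position, so its mixed norm is the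
  ordinary one.\<close>

lemma bernstein:
  assumes p: "0 < p"
  shows "\<exists>C\<ge>0. \<forall>n\<ge>1. \<forall>T\<in>trig_polys n. \<forall>h. 0 < h \<longrightarrow> h \<le> mesh (6 * n) \<longrightarrow>
    Lnorm p (diff_op r h T) \<le> ennreal (C * (h / mesh (6 * n)) ^ r) * Lnorm p (diff_op r (mesh (6 * n)) T)"
proof -
  obtain s where s: "\<And>B. 0 \<le> B \<Longrightarrow> \<exists>C\<ge>0. \<forall>N\<ge>1. \<forall>M f k G. f \<in> Lspace p \<longrightarrow> 0 \<le> k \<longrightarrow> smooth (mesh N) s B M \<longrightarrow>
     (\<forall>t. 2 \<le> \<bar>t\<bar> \<longrightarrow> M t = 0) \<longrightarrow>
     (\<forall>l x. norm (G l x) \<le> k * (\<Sum>j<N. norm (f (l + real j * mesh N)) * norm (kern N M (x - l - real j * mesh N)))) \<longrightarrow>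
     mixed_norm p G \<le> ennreal (C * k) * Lnorm p f"
    using sample_op_bound[OF p] by blast
  obtain B where B: "\<And>\<tau>. 0 < \<tau> \<Longrightarrow> \<tau> \<le> 1 \<Longrightarrow> (\<exists>m. (\<forall>e>0. smooth e s B m) \<and> (\<forall>t. 3/2 \<le> \<bar>t\<bar> \<longrightarrow> m t = 0) \<and>
    (\<forall>t. \<bar>t\<bar> \<le> 11/10 \<longrightarrow> (1 - cis (\<tau> * t)) ^ r = of_real (\<tau> ^ r) * m t * (1 - cis t) ^ r))"
    using bernstein_multiplier[of s r] by blast
  have B0: "0 \<le> B" using B[of 1] smooth_nonneg zero_less_one by blast
  obtain C where C: "0 \<le> C" "\<And>N M f k G. 1 \<le> N \<Longrightarrow> f \<in> Lspace p \<Longrightarrow> 0 \<le> k \<Longrightarrow> smooth (mesh N) s B M \<Longrightarrow>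
     (\<forall>t. 2 \<le> \<bar>t\<bar> \<longrightarrow> M t = 0) \<Longrightarrow>
     (\<forall>l x. norm (G l x) \<le> k * (\<Sum>j<N. norm (f (l + real j * mesh N)) * norm (kern N M (x - l - real j * mesh N)))) \<Longrightarrow>
     mixed_norm p G \<le> ennreal (C * k) * Lnorm p f"
    using s[OF B0] by blast
  show ?thesis
  proof (intro exI[of _ C] conjI allI ballI impI C(1))
    fix n :: nat and T h assume n: "1 \<le> n" and T: "T \<in> trig_polys n" and h: "0 < h" "h \<le> mesh (6 * n)"
    define N where "N = 6 * n"
    have N: "1 \<le> N" using n by (simp add: N_def)
    define \<tau> where "\<tau> = h / mesh N"
    have m0: "0 < mesh N" using N by simp
    have \<tau>: "0 < \<tau>" "\<tau> \<le> 1" "\<tau> * mesh N = h"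
    proof -
      have "0 < h / d \<and> h / d \<le> 1 \<and> h / d * d = h" if "0 < d" "h \<le> d" for d
        using that h(1) by simp
      from this[OF m0 h(2)[folded N_def]] show "0 < \<tau>" "\<tau> \<le> 1" "\<tau> * mesh N = h"
        unfolding \<tau>_def by blast+
    qed
    obtain m where m: "\<forall>e>0. smooth e s B m" "\<And>t. 3/2 \<le> \<bar>t\<bar> \<Longrightarrow> m t = 0"
      "\<And>t. \<bar>t\<bar> \<le> 11/10 \<Longrightarrow> (1 - cis (\<tau> * t)) ^ r = of_real (\<tau> ^ r) * m t * (1 - cis t) ^ r"
      using B[OF \<tau>(1,2)] by blast
    obtain c where Tc: "T = (\<lambda>x. \<Sum>\<nu>\<in>{- int n..int n}. c \<nu> * expo \<nu> x)"
      using T by (auto simp: trig_polys_def)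
    have D: "diff_op r d T x = (\<Sum>\<nu>\<in>{- int n..int n}. c \<nu> * (1 - cis (of_int \<nu> * d)) ^ r * expo \<nu> x)" for d x
      unfolding Tc by (simp add: diff_op_sum diff_op_cmult diff_op_expo mult.assoc)
    have rep: "diff_op r h T x = of_real (\<tau> ^ r) * sample_op N m (diff_op r (mesh N) T) l x" for l x
    proof -
      have "sample_op N m (diff_op r (mesh N) T) l x = (\<Sum>\<nu>\<in>{- int n..int n}. c \<nu> * (1 - cis (of_int \<nu> * mesh N)) ^ r * sample_op N m (expo \<nu>) l x)"
        unfolding sample_op_def D sum_distrib_left sum_distrib_right
        by (subst sum.swap) (simp only: mult_ac)
      also have "of_real (\<tau> ^ r) * \<dots> = (\<Sum>\<nu>\<in>{- int n..int n}. c \<nu> * (1 - cis (of_int \<nu> * h)) ^ r * expo \<nu> x)"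
        unfolding sum_distrib_left
      proof (intro sum.cong refl)
        fix \<nu> assume "\<nu> \<in> {- int n..int n}"
        then have \<nu>: "\<bar>\<nu>\<bar> \<le> int n" by auto
        then have 1: "sample_op N m (expo \<nu>) l x = m (of_int \<nu> * mesh N) * expo \<nu> x"
          using m(2) by (intro sample_op_expo N) (auto simp: N_def)
        have "\<bar>of_int \<nu>\<bar> \<le> real n" using \<nu> by linarith
        then have "\<bar>of_int \<nu> * mesh N\<bar> \<le> real n * mesh N" using mult_right_mono[OF _ less_imp_le[OF m0]] m0 by (simp only: abs_mult abs_of_pos)
        also have "\<dots> = pi / 3" using n by (simp add: N_def)
        also have "\<dots> \<le> 11/10" using pi_less_4 pi_approx by simp
        finally have "(1 - cis (\<tau> * (of_int \<nu> * mesh N))) ^ r = of_real (\<tau> ^ r) * m (of_int \<nu> * mesh N) * (1 - cis (of_int \<nu> * mesh N)) ^ r"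
          by (rule m(3))
        moreover have "\<tau> * (of_int \<nu> * mesh N) = of_int \<nu> * h" using \<tau>(3) by (metis mult.left_commute)
        ultimately show "of_real (\<tau> ^ r) * (c \<nu> * (1 - cis (of_int \<nu> * mesh N)) ^ r * sample_op N m (expo \<nu>) l x) = c \<nu> * (1 - cis (of_int \<nu> * h)) ^ r * expo \<nu> x"
          unfolding 1 by (simp only: mult_ac)
      qed
      finally show ?thesis unfolding D[of h] by simp
    qed
    have "mixed_norm p (\<lambda>l. diff_op r h T) \<le> ennreal (C * \<tau> ^ r) * Lnorm p (diff_op r (mesh N) T)"
    proof (rule C(2)[OF N _ _ _, where M=m])
      show "diff_op r (mesh N) T \<in> Lspace p"
        by (rule trig_polys_Lspace[OF p trig_polys_diff_op[OF T]])
      show "0 \<le> \<tau> ^ r" using \<tau> by simp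
      show "smooth (mesh N) s B m" using m(1) m0 by blast
      show "\<forall>t. 2 \<le> \<bar>t\<bar> \<longrightarrow> m t = 0" using m(2) by auto
      show "\<forall>l x. norm (diff_op r h T x) \<le> \<tau> ^ r * (\<Sum>j<N. norm (diff_op r (mesh N) T (l + real j * mesh N)) * norm (kern N m (x - l - real j * mesh N)))"
      proof (intro allI)
        fix l x
        have "norm (diff_op r h T x) = \<tau> ^ r * norm (sample_op N m (diff_op r (mesh N) T) l x)"
          unfolding rep[of x l] using \<tau> by (simp add: norm_mult norm_power)
        also have "\<dots> \<le> \<tau> ^ r * (\<Sum>j<N. norm (diff_op r (mesh N) T (l + real j * mesh N)) * norm (kern N m (x - l - real j * mesh N)))"
          unfolding sample_op_def using \<tau> by (intro mult_left_mono sum_norm_le) (auto simp: norm_mult)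
        finally show "norm (diff_op r h T x) \<le> \<dots>" .
      qed
    qed
    then show "Lnorm p (diff_op r h T) \<le> ennreal (C * (h / mesh (6 * n)) ^ r) * Lnorm p (diff_op r (mesh (6 * n)) T)"
      unfolding mixed_norm_const[OF p] \<tau>_def N_def .
  qed
qed

section \<open>Differences of lower order\<close>

lemma diff_op_0: "diff_op 0 h f = f"
  by (rule ext) (simp add: diff_op_def)

lemma diff_op_Suc: "diff_op (Suc r) h f = (\<lambda>x. diff_op r h f x - diff_op r h f (x + h))"
proof
  fix x
  let ?F = "\<lambda>k. f (x + real k * h)"
  have "diff_op (Suc r) h f x = ?F 0 + (\<Sum>k\<le>r. (-1) ^ Suc k * of_nat (Suc r choose Suc k) * ?F (Suc k))"
    unfolding diff_op_def by (subst sum.atMost_Suc_shift) simp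
  also have "(\<Sum>k\<le>r. (-1) ^ Suc k * of_nat (Suc r choose Suc k) * ?F (Suc k))
     = (\<Sum>k\<le>r. (-1) ^ Suc k * of_nat (r choose Suc k) * ?F (Suc k)) - (\<Sum>k\<le>r. (-1) ^ k * of_nat (r choose k) * ?F (Suc k))"
    unfolding sum_subtractf[symmetric] by (intro sum.cong refl) (simp add: algebra_simps)
  also have "?F 0 + \<dots> = (?F 0 + (\<Sum>k\<le>r. (-1) ^ Suc k * of_nat (r choose Suc k) * ?F (Suc k))) - (\<Sum>k\<le>r. (-1) ^ k * of_nat (r choose k) * ?F (Suc k))"
    by simp
  also have "?F 0 + (\<Sum>k\<le>r. (-1) ^ Suc k * of_nat (r choose Suc k) * ?F (Suc k)) = (\<Sum>k\<le>Suc r. (-1) ^ k * of_nat (r choose k) * ?F k)"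
    by (subst sum.atMost_Suc_shift) simp
  also have "\<dots> = diff_op r h f x" unfolding diff_op_def by simp
  also have "(\<Sum>k\<le>r. (-1) ^ k * of_nat (r choose k) * ?F (Suc k)) = diff_op r h f (x + h)"
    unfolding diff_op_def by (simp add: algebra_simps)
  finally show "diff_op (Suc r) h f x = diff_op r h f x - diff_op r h f (x + h)" .
qed

lemma Lspace_norm_add_le:
  assumes "0 < p" "f \<in> Lspace p" "g \<in> Lspace p" "\<And>x. norm (h x) \<le> norm (f x) + norm (g x)"
  shows "Lnorm p h \<le> ennreal (quasi_const p) * (Lnorm p f + Lnorm p g)"
  using assms by (intro Lnorm_add_le) (auto intro: Lspace_measurable)

text \<open>With S the shift by \<open>h\<close>, this is the cofactor 1 + S + ... + S^(m-1) of 1 -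
  S in 1 - S^m.\<close>

definition shift_sum :: "nat \<Rightarrow> real \<Rightarrow> (real \<Rightarrow> complex) \<Rightarrow> real \<Rightarrow> complex" where
  "shift_sum m h f x = (\<Sum>i<m. f (x + real i * h))"

lemma Lspace_shift_sum: "0 < p \<Longrightarrow> f \<in> Lspace p \<Longrightarrow> shift_sum m h f \<in> Lspace p"
proof -
  assume "0 < p" "f \<in> Lspace p"
  then have "(\<lambda>x. \<Sum>i<m. f (x + real i * h)) \<in> Lspace p"
    by (intro Lspace_sum Lspace_shift) auto
  then show ?thesis by (simp add: shift_sum_def[abs_def])
qed

lemma Lspace_norm_sum_le:
  fixes m :: nat
  assumes p: "0 < p"
  shows "\<exists>K\<ge>0. \<forall>F. (\<forall>i<m. F i \<in> Lspace p) \<longrightarrow>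
    Lnorm p (\<lambda>x. \<Sum>i<m. F i x) \<le> ennreal K * (\<Sum>i<m. Lnorm p (F i))"
proof -
  obtain K where K: "0 \<le> K" "\<And>F. (\<forall>i<m. family (F i)) \<Longrightarrow>
    mixed_norm p (\<lambda>l x. \<Sum>i<m. F i l x) \<le> ennreal K * (\<Sum>i<m. mixed_norm p (F i))"
    using mixed_norm_sum_le[OF p, of m] by blast
  show ?thesis
  proof (intro exI[of _ K] conjI K(1) allI impI)
    fix F assume "\<forall>i<m. F i \<in> Lspace p"
    then have "mixed_norm p (\<lambda>l x. \<Sum>i<m. F i x) \<le> ennreal K * (\<Sum>i<m. mixed_norm p (\<lambda>l. F i))"
      by (intro K(2)) (auto intro: Lspace_family)
    then show "Lnorm p (\<lambda>x. \<Sum>i<m. F i x) \<le> ennreal K * (\<Sum>i<m. Lnorm p (F i))"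
      by (simp add: mixed_norm_const[OF p])
  qed
qed

lemma Lnorm_shift_sum_le:
  assumes p: "0 < p"
  shows "\<exists>K\<ge>0. \<forall>f h. f \<in> Lspace p \<longrightarrow> Lnorm p (shift_sum m h f) \<le> ennreal K * Lnorm p f"
proof -
  obtain K where K: "0 \<le> K" "\<And>F. (\<forall>i<m. F i \<in> Lspace p) \<Longrightarrow>
    Lnorm p (\<lambda>x. \<Sum>i<m. F i x) \<le> ennreal K * (\<Sum>i<m. Lnorm p (F i))"
    using Lspace_norm_sum_le[OF p, of m] by blast
  have "Lnorm p (shift_sum m h f) \<le> ennreal (K * real m) * Lnorm p f" if f: "f \<in> Lspace p" for f h
  proof -
    have "Lnorm p (\<lambda>x. \<Sum>i<m. f (x + real i * h)) \<le> ennreal K * (\<Sum>i<m. Lnorm p (\<lambda>x. f (x + real i * h)))"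
      using f p by (intro K(2)) (auto intro: Lspace_shift)
    also have "\<dots> = ennreal (K * real m) * Lnorm p f"
      using f K(1) by (simp add: Lnorm_shift[OF Lspace_periodic Lspace_measurable] ennreal_mult ennreal_of_nat_eq_real_of_nat mult.assoc)
    finally show ?thesis by (simp add: shift_sum_def[abs_def])
  qed
  then show ?thesis using K(1) by (intro exI[of _ "K * real m"]) auto
qed

lemma shift_sum_telescope:
  fixes f :: "real \<Rightarrow> complex"
  shows
  "(\<Sum>i<m. f (x + real i * h) - f (x + real (Suc i) * h)) = f x - f (x + real m * h)"
  using sum_lessThan_telescope[of "\<lambda>i. - f (x + real i * h)" m] by simp

lemma shift_sum_diff_op: "shift_sum m h (diff_op (Suc 0) h f) = diff_op (Suc 0) (real m * h) f"
proof
  fix x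
  have "shift_sum m h (diff_op (Suc 0) h f) x = (\<Sum>i<m. f (x + real i * h) - f (x + real (Suc i) * h))"
    unfolding shift_sum_def diff_op_Suc diff_op_0 by (intro sum.cong refl) (simp add: algebra_simps)
  then show "shift_sum m h (diff_op (Suc 0) h f) x = diff_op (Suc 0) (real m * h) f x"
    unfolding shift_sum_telescope by (simp add: diff_op_Suc diff_op_0)
qed

text \<open>Each S^i - 1 is divisible by 1 - S, S being the shift by \<open>h\<close>.\<close>

lemma shift_sum_minus:
  "shift_sum m h f x - of_nat m * f x = (\<Sum>i<m. (-1) * shift_sum i h (diff_op (Suc 0) h f) x)"
  unfolding shift_sum_diff_op by (simp add: shift_sum_def diff_op_Suc diff_op_0 sum_subtractf)

text \<open>With A the operator \<open>shift_sum m h\<close>, A^(s+1) - m^(s+1) = A (A^s - m^s) +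
  m^s (A - m). Inductively the first difference is a factor, and the remaining factor is bounded
  uniformly in \<open>h\<close>.\<close>

lemma shift_sum_power_minus:
  assumes p: "0 < p"
  shows "\<exists>C\<ge>0. \<forall>f h. f \<in> Lspace p \<longrightarrow>
    Lnorm p (\<lambda>x. (shift_sum m h ^^ s) f x - of_nat m ^ s * f x) \<le> ennreal C * Lnorm p (diff_op (Suc 0) h f)"
proof (induction s)
  case 0
  have "Lnorm p (\<lambda>x. 0) = 0" using p by (simp add: Lnorm_def)
  then show ?case by (intro exI[of _ 0]) simp
next
  case (Suc s)
  then obtain C where C: "0 \<le> C" "\<And>f h. f \<in> Lspace p \<Longrightarrow>
    Lnorm p (\<lambda>x. (shift_sum m h ^^ s) f x - of_nat m ^ s * f x) \<le> ennreal C * Lnorm p (diff_op (Suc 0) h f)" by blast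
  obtain A where A: "0 \<le> A" "\<And>f h. f \<in> Lspace p \<Longrightarrow> Lnorm p (shift_sum m h f) \<le> ennreal A * Lnorm p f"
    using Lnorm_shift_sum_le[OF p, of m] by blast
  obtain B where B: "0 \<le> B" "\<And>f h. f \<in> Lspace p \<Longrightarrow> Lnorm p (\<lambda>x. shift_sum m h f x - of_nat m * f x) \<le> ennreal B * Lnorm p (diff_op (Suc 0) h f)"
  proof -
    obtain K where K: "0 \<le> K" "\<And>F. (\<forall>i<m. F i \<in> Lspace p) \<Longrightarrow>
      Lnorm p (\<lambda>x. \<Sum>i<m. F i x) \<le> ennreal K * (\<Sum>i<m. Lnorm p (F i))"
      using Lspace_norm_sum_le[OF p, of m] by blast
    have "\<forall>i. \<exists>A\<ge>0. \<forall>f h. f \<in> Lspace p \<longrightarrow> Lnorm p (shift_sum i h f) \<le> ennreal A * Lnorm p f"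
      using Lnorm_shift_sum_le[OF p] by blast
    then obtain A where A: "\<And>i. 0 \<le> A i" "\<And>i f h. f \<in> Lspace p \<Longrightarrow> Lnorm p (shift_sum i h f) \<le> ennreal (A i) * Lnorm p f"
      by metis
    have "Lnorm p (\<lambda>x. shift_sum m h f x - of_nat m * f x) \<le> ennreal (K * (\<Sum>i<m. A i)) * Lnorm p (diff_op (Suc 0) h f)"
      if f: "f \<in> Lspace p" for f h
    proof -
      note D = Lspace_diff_op[OF p f, of "Suc 0" h]
      have "Lnorm p (\<lambda>x. shift_sum m h f x - of_nat m * f x) \<le> ennreal K * (\<Sum>i<m. Lnorm p (\<lambda>x. (-1) * shift_sum i h (diff_op (Suc 0) h f) x))"
        unfolding shift_sum_minus by (intro K(2) allI impI Lspace_cmult Lspace_shift_sum p D)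
      also have "\<dots> \<le> ennreal K * (\<Sum>i<m. ennreal (A i) * Lnorm p (diff_op (Suc 0) h f))"
      proof (intro mult_left_mono sum_mono)
        fix i
        have "Lnorm p (\<lambda>x. (-1) * shift_sum i h (diff_op (Suc 0) h f) x) = Lnorm p (shift_sum i h (diff_op (Suc 0) h f))"
          by (simp add: Lnorm_def)
        then show "Lnorm p (\<lambda>x. (-1) * shift_sum i h (diff_op (Suc 0) h f) x) \<le> ennreal (A i) * Lnorm p (diff_op (Suc 0) h f)"
          using A(2)[OF D] by simp
      qed simp
      also have "\<dots> = ennreal (K * (\<Sum>i<m. A i)) * Lnorm p (diff_op (Suc 0) h f)"
        using K(1) A(1) by (simp add: sum_distrib_right[symmetric] sum_ennreal ennreal_mult sum_nonneg mult.assoc)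
      finally show ?thesis .
    qed
    then show ?thesis using that[of "K * (\<Sum>i<m. A i)"] K(1) A(1) by (simp add: sum_nonneg)
  qed
  let ?q = "quasi_const p"
  have "Lnorm p (\<lambda>x. (shift_sum m h ^^ Suc s) f x - of_nat m ^ Suc s * f x) \<le> ennreal (?q * (A * C + real m ^ s * B)) * Lnorm p (diff_op (Suc 0) h f)"
    if f: "f \<in> Lspace p" for f h
  proof -
    let ?g = "\<lambda>x. (shift_sum m h ^^ s) f x - of_nat m ^ s * f x"
    let ?e = "\<lambda>x. of_nat m ^ s * (shift_sum m h f x - of_nat m * f x)"
    have pw: "(shift_sum m h ^^ s) f \<in> Lspace p" for s
      by (induction s) (auto intro: f Lspace_shift_sum p)
    have g: "?g \<in> Lspace p" by (intro Lspace_diff Lspace_cmult p f pw)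
    have e0: "(\<lambda>x. shift_sum m h f x - of_nat m * f x) \<in> Lspace p"
      by (intro Lspace_diff Lspace_cmult Lspace_shift_sum p f)
    have "(shift_sum m h ^^ Suc s) f x - of_nat m ^ Suc s * f x = shift_sum m h ?g x + ?e x" for x
      by (simp add: shift_sum_def sum_subtractf sum_distrib_left algebra_simps)
    then have "Lnorm p (\<lambda>x. (shift_sum m h ^^ Suc s) f x - of_nat m ^ Suc s * f x) \<le> ennreal ?q * (Lnorm p (shift_sum m h ?g) + Lnorm p ?e)"
      by (intro Lspace_norm_add_le p Lspace_shift_sum g Lspace_cmult e0) (simp only: norm_triangle_ineq)
    also have "\<dots> \<le> ennreal ?q * (ennreal A * (ennreal C * Lnorm p (diff_op (Suc 0) h f)) + ennreal (real m ^ s) * (ennreal B * Lnorm p (diff_op (Suc 0) h f)))"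
    proof (intro mult_left_mono add_mono)
      show "Lnorm p (shift_sum m h ?g) \<le> ennreal A * (ennreal C * Lnorm p (diff_op (Suc 0) h f))"
        using A(2)[OF g, of h] C(2)[OF f, of h] by (meson mult_left_mono order_trans zero_le)
      have "Lnorm p ?e = ennreal (real m ^ s) * Lnorm p (\<lambda>x. shift_sum m h f x - of_nat m * f x)"
        by (subst Lnorm_cmult[OF p Lspace_measurable[OF e0]]) (simp add: norm_power)
      then show "Lnorm p ?e \<le> ennreal (real m ^ s) * (ennreal B * Lnorm p (diff_op (Suc 0) h f))"
        using B(2)[OF f, of h] by (simp add: mult_left_mono)
    qed simp
    also have "\<dots> = ennreal (?q * (A * C + real m ^ s * B)) * Lnorm p (diff_op (Suc 0) h f)"
      using A(1) B(1) C(1) quasi_const_ge_1[of p] by (simp add: ennreal_mult ennreal_plus distrib_left distrib_right mult.assoc)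
    finally show ?thesis .
  qed
  then show ?case using A(1) B(1) C(1) quasi_const_ge_1[of p]
    by (intro exI[of _ "?q * (A * C + real m ^ s * B)"]) auto
qed

lemma diff_op_shift: "diff_op s h (\<lambda>x. f (x + c)) x = diff_op s h f (x + c)"
  by (simp add: diff_op_def algebra_simps)

lemma diff_op_Suc': "diff_op (Suc s) h f = diff_op s h (diff_op (Suc 0) h f)"
  by (rule ext) (simp add: diff_op_Suc diff_op_0 diff_op_diff diff_op_shift)

lemma diff_op_Suc'': "diff_op (Suc s) h f = diff_op (Suc 0) h (diff_op s h f)"
  by (rule ext) (simp add: diff_op_Suc diff_op_0)

lemma diff_op_shift_sum: "diff_op s h (shift_sum m k f) = shift_sum m k (diff_op s h f)"
  by (rule ext) (simp add: shift_sum_def[abs_def] diff_op_sum diff_op_shift)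

text \<open>The s-th power of the factorisation of 1 - S^m.\<close>

lemma shift_sum_power_diff_op: "(shift_sum m h ^^ s) (diff_op s h f) = diff_op s (real m * h) f"
proof (induction s arbitrary: f)
  case (Suc s)
  have "(shift_sum m h ^^ Suc s) (diff_op (Suc s) h f) = shift_sum m h ((shift_sum m h ^^ s) (diff_op s h (diff_op (Suc 0) h f)))"
    by (simp add: diff_op_Suc'[of s h f])
  also have "\<dots> = diff_op s (real m * h) (shift_sum m h (diff_op (Suc 0) h f))"
    unfolding Suc.IH diff_op_shift_sum ..
  also have "\<dots> = diff_op (Suc s) (real m * h) f"
    unfolding shift_sum_diff_op by (rule diff_op_Suc'[symmetric])
  finally show ?case .
qed (simp add: diff_op_0)

definition vanishing :: "(real \<Rightarrow> ennreal) \<Rightarrow> bool" where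
  "vanishing \<phi> \<longleftrightarrow> (\<forall>e>0. \<exists>\<rho>>0. \<forall>h. 0 < h \<longrightarrow> h \<le> \<rho> \<longrightarrow> \<phi> h \<le> ennreal e)"

text \<open>A Marchaud-type argument: \<open>m\<^sup>s \<Delta>\<^sub>h\<^sup>s - \<Delta>\<^sub>m\<^sub>h\<^sup>s\<close> factors through \<open>\<Delta>\<^sub>h\<^sup>s\<^sup>+\<^sup>1\<close>, and \<open>m\<close> is taken
  so large that \<open>m\<^sup>s\<close> beats the constant of the quasi-triangle inequality.\<close>

lemma vanishing_diff_op_down:
  assumes p: "0 < p" and f: "f \<in> Lspace p" and s: "1 \<le> s"
    and v: "vanishing (\<lambda>h. Lnorm p (diff_op (Suc s) h f))"
  shows "vanishing (\<lambda>h. Lnorm p (diff_op s h f))"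
proof -
  let ?q = "quasi_const p"
  \<comment> \<open>With this choice the constant of the quasi-triangle inequality divided by
    \<open>m ^ s\<close> is at most 1/4.\<close>
  obtain m :: nat where m: "4 * ?q \<le> real m" using real_arch_simple by blast
  have "0 < real m" using m quasi_const_ge_1[of p] by linarith
  then have m1: "1 \<le> m" by simp
  from shift_sum_power_minus[OF p, where m=m and s=s]
  obtain C where C: "0 \<le> C" "\<forall>f h. f \<in> Lspace p \<longrightarrow>
    Lnorm p (\<lambda>x. (shift_sum m h ^^ s) f x - of_nat m ^ s * f x) \<le> ennreal C * Lnorm p (diff_op (Suc 0) h f)"
    by (elim exE conjE)
  let ?\<phi> = "\<lambda>h. Lnorm p (diff_op s h f)" and ?\<psi> = "\<lambda>h. Lnorm p (diff_op (Suc s) h f)"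
  have rec: "?\<phi> h \<le> ennreal (1/4) * ?\<phi> (real m * h) + ennreal C * ?\<psi> h" for h
  proof -
    let ?g = "diff_op s h f"
    have g: "?g \<in> Lspace p" "diff_op s (real m * h) f \<in> Lspace p" by (intro Lspace_diff_op p f)+
    have e: "(\<lambda>x. (shift_sum m h ^^ s) ?g x - of_nat m ^ s * ?g x) \<in> Lspace p"
      unfolding shift_sum_power_diff_op by (intro Lspace_diff Lspace_cmult p g)
    have "ennreal (real m ^ s) * ?\<phi> h = Lnorm p (\<lambda>x. of_nat m ^ s * ?g x)"
      by (subst Lnorm_cmult[OF p Lspace_measurable[OF g(1)]]) (simp add: norm_power)
    also have "\<dots> \<le> ennreal ?q * (Lnorm p (diff_op s (real m * h) f) + Lnorm p (\<lambda>x. (shift_sum m h ^^ s) ?g x - of_nat m ^ s * ?g x))"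
    proof (intro Lspace_norm_add_le p g e)
      fix x
      show "norm (of_nat m ^ s * ?g x) \<le> norm (diff_op s (real m * h) f x) + norm ((shift_sum m h ^^ s) ?g x - of_nat m ^ s * ?g x)"
        unfolding shift_sum_power_diff_op by (metis diff_diff_eq2 add_diff_cancel_left' norm_triangle_ineq4)
    qed
    also have "Lnorm p (\<lambda>x. (shift_sum m h ^^ s) ?g x - of_nat m ^ s * ?g x) \<le> ennreal C * ?\<psi> h"
      using C(2)[rule_format, OF g(1), of h] unfolding diff_op_Suc''[symmetric] .
    finally have "ennreal (real m ^ s) * ?\<phi> h \<le> ennreal ?q * (?\<phi> (real m * h) + ennreal C * ?\<psi> h)"
      by (simp add: mult_left_mono add_left_mono)
    then have "ennreal (1 / real m ^ s) * (ennreal (real m ^ s) * ?\<phi> h) \<le> ennreal (1 / real m ^ s) * (ennreal ?q * (?\<phi> (real m * h) + ennreal C * ?\<psi> h))"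
      by (rule mult_left_mono) simp
    moreover have "ennreal (1 / real m ^ s) * (ennreal (real m ^ s) * ?\<phi> h) = ?\<phi> h"
      using m1 by (simp add: mult.assoc[symmetric] ennreal_mult[symmetric])
    moreover have "ennreal (1 / real m ^ s) * (ennreal ?q * X) = ennreal (?q / real m ^ s) * X" for X
      using quasi_const_ge_1[of p] by (simp add: mult.assoc[symmetric] ennreal_mult[symmetric])
    moreover have q: "?q / real m ^ s \<le> 1/4"
    proof -
      have "real m ^ 1 \<le> real m ^ s" using m1 s by (intro power_increasing) auto
      then have "real m \<le> real m ^ s" by (simp only: power_one_right)
      then have "4 * ?q \<le> real m ^ s" using m by linarith
      then show ?thesis using m1 by (simp add: divide_le_eq)
    qed
    ultimately have "?\<phi> h \<le> ennreal (?q / real m ^ s) * (?\<phi> (real m * h) + ennreal C * ?\<psi> h)" by simp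
    also have "\<dots> \<le> ennreal (1/4) * (?\<phi> (real m * h) + ennreal C * ?\<psi> h)"
      using q by (intro mult_right_mono ennreal_leI) auto
    also have "\<dots> \<le> ennreal (1/4) * ?\<phi> (real m * h) + 1 * (ennreal C * ?\<psi> h)"
      unfolding distrib_left by (intro add_left_mono mult_right_mono) auto
    finally show ?thesis by simp
  qed
  \<comment> \<open>The iteration needs a finite starting value, valid for all steps.\<close>
  obtain M where M: "0 < M" "\<And>h. ?\<phi> h \<le> ennreal M"
  proof -
    obtain K where K: "1 \<le> K" "\<And>F h. family F \<Longrightarrow> mixed_norm p (\<lambda>l. diff_op s h (F l)) \<le> ennreal K * mixed_norm p F"
      using mixed_norm_diff_op_le[OF p] by blast
    obtain b where b: "0 \<le> b" "Lnorm p f = ennreal b"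
      using Lspace_finite[OF p f] by (cases "Lnorm p f") auto
    have "?\<phi> h \<le> ennreal (K * b + 1)" for h
    proof -
      have "?\<phi> h \<le> ennreal K * Lnorm p f"
        using K(2)[OF Lspace_family[OF f], of h] by (simp add: mixed_norm_const[OF p])
      also have "\<dots> \<le> ennreal (K * b + 1)" using b K(1) by (simp add: ennreal_mult[symmetric] ennreal_leI)
      finally show ?thesis .
    qed
    moreover have "0 < K * b + 1" using K(1) b(1) by (intro add_nonneg_pos mult_nonneg_nonneg) auto
    ultimately show ?thesis using that by blast
  qed
  have small: "\<exists>\<rho>>0. \<forall>h. 0 < h \<longrightarrow> h \<le> \<rho> \<longrightarrow> ?\<phi> h \<le> ennreal (M / 2 ^ k)" for k
  proof (induction k)
    case 0
    show ?case using M by (intro exI[of _ 1]) auto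
  next
    case (Suc k)
    then obtain \<rho>1 where \<rho>1: "0 < \<rho>1" "\<And>h. 0 < h \<Longrightarrow> h \<le> \<rho>1 \<Longrightarrow> ?\<phi> h \<le> ennreal (M / 2 ^ k)" by blast
    \<comment> \<open>Makes the term with the higher difference at most a quarter of the current
      bound; with the other quarter from \<open>rec\<close> the bound is halved, at the price of
      replacing the admissible step by a fraction of it.\<close>
    have "0 < M / 2 ^ k / (4 * (C + 1))" using M C(1) by simp
    then obtain \<rho>2 where \<rho>2: "0 < \<rho>2" "\<And>h. 0 < h \<Longrightarrow> h \<le> \<rho>2 \<Longrightarrow> ?\<psi> h \<le> ennreal (M / 2 ^ k / (4 * (C + 1)))"
      using v unfolding vanishing_def by blast
    show ?case
    proof (intro exI[of _ "min (\<rho>1 / real m) \<rho>2"] conjI allI impI)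
      show "0 < min (\<rho>1 / real m) \<rho>2" using \<rho>1 \<rho>2 m1 by simp
      fix h :: real assume h: "0 < h" "h \<le> min (\<rho>1 / real m) \<rho>2"
      then have mh: "0 < real m * h" "real m * h \<le> \<rho>1" using m1 by (auto simp: le_divide_eq mult.commute)
      have "?\<phi> h \<le> ennreal (1/4) * ?\<phi> (real m * h) + ennreal C * ?\<psi> h" by (rule rec)
      also have "\<dots> \<le> ennreal (1/4) * ennreal (M / 2 ^ k) + ennreal C * ennreal (M / 2 ^ k / (4 * (C + 1)))"
        using h by (intro add_mono mult_left_mono \<rho>1(2)[OF mh] \<rho>2(2)) auto
      also have "\<dots> = ennreal (1/4 * (M / 2 ^ k) + C * (M / 2 ^ k / (4 * (C + 1))))"
        using M C(1) by (simp add: ennreal_mult[symmetric] ennreal_plus[symmetric] del: ennreal_plus)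
      also have "\<dots> \<le> ennreal (M / 2 ^ Suc k)"
      proof (rule ennreal_leI)
        have aux: "1/4 * X + C * (X / (4 * (C + 1))) \<le> X / 2" if "0 \<le> X" for X
        proof -
          have "C * (X / (4 * (C + 1))) = (C * X) / (4 * (C + 1))" by simp
          also have "\<dots> \<le> ((C + 1) * X) / (4 * (C + 1))"
            using C(1) that by (intro divide_right_mono mult_right_mono) auto
          also have "\<dots> = X / 4"
          proof -
            have "(d * X) / (4 * d) = X / 4" if "d \<noteq> 0" for d using that by simp
            from this[of "C + 1"] show ?thesis using C(1) by linarith
          qed
          finally show ?thesis by linarith
        qed
        show "1/4 * (M / 2 ^ k) + C * (M / 2 ^ k / (4 * (C + 1))) \<le> M / 2 ^ Suc k"
          using aux[of "M / 2 ^ k"] M by simp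
      qed
      finally show "?\<phi> h \<le> ennreal (M / 2 ^ Suc k)" .
    qed
  qed
  show ?thesis
    unfolding vanishing_def
  proof (intro allI impI)
    fix e :: real assume e: "0 < e"
    obtain k where "M / e < 2 ^ k" using real_arch_pow[of 2 "M / e"] by auto
    then have "M / 2 ^ k \<le> e" using e by (simp add: field_simps)
    then have "ennreal (M / 2 ^ k) \<le> ennreal e" by (rule ennreal_leI)
    then show "\<exists>\<rho>>0. \<forall>h. 0 < h \<longrightarrow> h \<le> \<rho> \<longrightarrow> ?\<phi> h \<le> ennreal e"
      using small[of k] order_trans by blast
  qed
qed

lemma vanishing_diff_op_1:
  assumes p: "0 < p" and f: "f \<in> Lspace p" and "1 \<le> r" "vanishing (\<lambda>h. Lnorm p (diff_op r h f))"
  shows "vanishing (\<lambda>h. Lnorm p (diff_op (Suc 0) h f))"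
  using assms(3,4)
proof (induction r)
  case (Suc r)
  then show ?case
    using vanishing_diff_op_down[OF p f, of r] by (cases "r = 0") auto
qed simp

text \<open>Smallness of \<open>u\<close> is measured by the chord, hence modulo 2 pi and for both
  signs; this is the distance that \<open>peak\<close> depends on.\<close>

definition translation_continuous :: "ennreal \<Rightarrow> (real \<Rightarrow> complex) \<Rightarrow> bool" where
  "translation_continuous p f \<longleftrightarrow>
     (\<forall>e>0. \<exists>\<rho>>0. \<forall>u. norm (1 - cis u) < \<rho> \<longrightarrow> Lnorm p (\<lambda>x. f x - f (x + u)) \<le> ennreal e)"

text \<open>Modulo 2 pi a shift with small chord is a small positive or a small negative one. The
  negative case has the same norm as the positive, by translation.\<close>

lemma translation_continuousI:
  assumes p: "0 < p" and f: "f \<in> Lspace p" and v: "vanishing (\<lambda>h. Lnorm p (diff_op (Suc 0) h f))"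
  shows "translation_continuous p f"
  unfolding translation_continuous_def
proof (intro allI impI)
  fix e :: real assume "0 < e"
  then obtain \<rho> where \<rho>: "0 < \<rho>" "\<And>h. 0 < h \<Longrightarrow> h \<le> \<rho> \<Longrightarrow> Lnorm p (diff_op (Suc 0) h f) \<le> ennreal e"
    using v unfolding vanishing_def by blast
  have pos: "Lnorm p (\<lambda>x. f x - f (x + h)) \<le> ennreal e" if "0 \<le> h" "h \<le> \<rho>" for h
  proof (cases "h = 0")
    case True
    then show ?thesis using p by (simp add: Lnorm_def)
  next
    case False
    then show ?thesis using \<rho>(2)[of h] that by (simp add: diff_op_Suc diff_op_0)
  qed
  have neg: "Lnorm p (\<lambda>x. f x - f (x + - h)) \<le> ennreal e" if "0 \<le> h" "h \<le> \<rho>" for h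
  proof -
    let ?g = "\<lambda>x. f x - f (x + h)"
    have g: "?g \<in> Lspace p" by (intro Lspace_diff Lspace_shift p f)
    have "Lnorm p (\<lambda>x. f x - f (x + - h)) = Lnorm p (\<lambda>x. ?g (x + - h))"
      unfolding Lnorm_def by (simp add: norm_minus_commute)
    also have "\<dots> = Lnorm p ?g" by (rule Lnorm_shift[OF Lspace_periodic[OF g] Lspace_measurable[OF g]])
    finally show ?thesis using pos[OF that] by simp
  qed
  show "\<exists>\<rho>>0. \<forall>u. norm (1 - cis u) < \<rho> \<longrightarrow> Lnorm p (\<lambda>x. f x - f (x + u)) \<le> ennreal e"
  proof (intro exI[of _ "\<rho> / 2"] conjI allI impI)
    show "0 < \<rho> / 2" using \<rho> by simp
    fix u assume u: "norm (1 - cis u) < \<rho> / 2"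
    define k where "k = \<lfloor>u / (2*pi)\<rfloor>"
    define v where "v = u - 2*pi * of_int k"
    have "of_int k \<le> u / (2*pi)" "u / (2*pi) < of_int k + 1" unfolding k_def by linarith+
    then have v: "0 \<le> v" "v \<le> 2*pi" by (auto simp: v_def field_simps)
    have "periodic (\<lambda>x. norm (1 - cis x))" by (simp add: periodic_def cis_mult[symmetric])
    from periodic_int[OF this, of v k] have "norm (1 - cis v) = norm (1 - cis u)" by (simp add: v_def)
    then have "min v (2*pi - v) / 2 < \<rho> / 2" using chord_ge[OF v] u by (metis order.strict_trans1)
    then have "min v (2*pi - v) < \<rho>" by simp
    then consider "v \<le> \<rho>" | "2*pi - v \<le> \<rho>" by (auto simp: min_less_iff_disj)
    moreover have fu: "f (x + u) = f (x + v)" "f (x + u) = f (x + - (2*pi - v))" for x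
      using periodic_int[OF Lspace_periodic[OF f], of "x + v" k] periodic_diff[OF Lspace_periodic[OF f], of "x + v"]
      by (simp_all add: v_def algebra_simps)
    ultimately show "Lnorm p (\<lambda>x. f x - f (x + u)) \<le> ennreal e"
    proof cases
      case 1
      then show ?thesis unfolding fu(1) using v by (intro pos) auto
    next
      case 2
      then show ?thesis unfolding fu(2) using v by (intro neg) auto
    qed
  qed
qed

section \<open>Convergence of sampling operators\<close>

lemma peak_far:
  assumes "1 \<le> N" "0 < \<rho>" "\<rho> \<le> norm (1 - cis x)" shows "peak N x \<le> (mesh N / \<rho>)\<^sup>2"
proof -
  define d where "d = mesh N"
  have d: "0 < d" using assms(1) by (simp add: d_def)
  have h: "(\<rho> / d)\<^sup>2 \<le> (norm (1 - cis x) / d)\<^sup>2"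
    using assms d by (intro power_mono divide_right_mono) auto
  have "peak N x \<le> 1 / (\<rho> / d)\<^sup>2"
    unfolding peak_def d_def[symmetric]
  proof (rule frac_le)
    show "0 < (\<rho> / d)\<^sup>2" using assms d by simp
    show "(\<rho> / d)\<^sup>2 \<le> 1 + (norm (1 - cis x) / d)\<^sup>2" using h by linarith
  qed auto
  also have "1 / (\<rho> / d)\<^sup>2 = (d / \<rho>)\<^sup>2" by (simp add: power_divide)
  finally show ?thesis unfolding d_def .
qed

text \<open>Since 6 \<le> 2 pi, a frequency beyond \<open>n\<close> has |t| \<ge> 1 on the grid of
  \<open>6 * n\<close> points, where \<open>M\<close> vanishes.\<close>

lemma sample_op_in_trig_polys:
  assumes n: "1 \<le> n" and M: "\<And>t. 1 \<le> \<bar>t\<bar> \<Longrightarrow> M t = 0"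
  shows "sample_op (6 * n) M f l \<in> trig_polys n"
proof -
  let ?N = "6 * n"
  let ?t = "\<lambda>\<nu>::int. 2 * pi * of_int \<nu> / real ?N"
  have z: "M (?t \<nu>) = 0" if "int n < \<bar>\<nu>\<bar>" for \<nu>
  proof (rule M)
    have "real n \<le> \<bar>real_of_int \<nu>\<bar>" using that by linarith
    moreover have "6 \<le> 2 * pi" using pi_gt3 by simp
    ultimately have "6 * real n \<le> 2 * pi * \<bar>real_of_int \<nu>\<bar>" by (intro mult_mono) auto
    then show "1 \<le> \<bar>?t \<nu>\<bar>" using n by (simp add: abs_mult le_divide_eq)
  qed
  have kt: "kern ?N M \<in> trig_polys n"
  proof (rule trig_polysI)
    have "(\<Sum>\<nu>\<in>{- int ?N..int ?N}. M (?t \<nu>) * expo \<nu> x) = (\<Sum>\<nu>\<in>{- int n..int n}. M (?t \<nu>) * expo \<nu> x)" for x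
    proof (intro sum.mono_neutral_right ballI)
      fix \<nu> assume "\<nu> \<in> {- int ?N..int ?N} - {- int n..int n}"
      then have "M (?t \<nu>) = 0" by (intro z) auto
      then show "M (?t \<nu>) * expo \<nu> x = 0" by (simp only: mult_zero_left)
    qed auto
    then show "kern ?N M = (\<lambda>x. \<Sum>\<nu>\<in>{- int n..int n}. (1 / of_nat ?N * M (?t \<nu>)) * expo \<nu> x)"
      unfolding kern_def wide_kern_def[abs_def] by (simp only: sum_distrib_left mult.assoc)
  qed
  have "sample_op ?N M f l = (\<lambda>x. \<Sum>j<?N. f (l + real j * mesh ?N) * kern ?N M (x + (- l - real j * mesh ?N)))"
    unfolding sample_op_def[abs_def] by (simp only: add_diff_eq diff_conv_add_uminus add.assoc)
  also have "\<dots> \<in> trig_polys n"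
    by (rule trig_polys_sum) (auto intro: trig_polys_cmult[OF trig_polys_shift[OF kt]] simp del: of_nat_mult)
  finally show ?thesis .
qed

lemma continuous_kern: "continuous_on UNIV (kern N M)"
  unfolding kern_def wide_kern_def[abs_def] by (intro continuous_intros)

lemma kern_periodic: "periodic (kern N M)"
proof -
  have "expo \<nu> (x + 2*pi) = expo \<nu> x" for \<nu> x
    using expo_periodic[of \<nu>] unfolding periodic_def by blast
  then show ?thesis unfolding kern_def wide_kern_def periodic_def by simp
qed

lemma family_sample_op:
  assumes "f \<in> Lspace p" shows "family (sample_op N M f)"
proof (rule familyI)
  show "periodic (sample_op N M f l)" for l
  proof -
    have "kern N M (x + 2*pi - l - real j * mesh N) = kern N M (x - l - real j * mesh N)" for x j
      using kern_periodic[of N M, unfolded periodic_def, rule_format, of "x - l - real j * mesh N"]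
      by (simp add: algebra_simps)
    then show ?thesis by (simp add: periodic_def sample_op_def)
  qed
  note fm = Lspace_measurable[OF assms]
  have [measurable]: "(\<lambda>l. f (l + real j * mesh N)) \<in> borel_measurable lebesgue" for j
    using measurable_shift[OF fm, of "real j * mesh N"] by simp
  have [measurable]: "kern N M \<in> borel_measurable borel"
    by (intro borel_measurable_continuous_onI continuous_kern)
  show "(\<lambda>(l, x). sample_op N M f l x) \<in> borel_measurable (lebesgue \<Otimes>\<^sub>M lebesgue)"
    unfolding sample_op_def by measurable
qed

lemma avg_periodic_shift_norm:
  assumes g: "g \<in> Lspace p" and p: "0 < p" "p \<noteq> \<infinity>"
  shows "avg (\<lambda>l. ennreal (norm (g (x + l + c) - g (l + c)) powr enn2real p))
    = ennpowr (Lnorm p (\<lambda>y. g y - g (y + x))) (enn2real p)"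
proof -
  let ?P = "enn2real p"
  let ?H = "\<lambda>l. ennreal (norm (g l - g (l + x)) powr ?P)"
  note gm [measurable] = Lspace_measurable[OF g] and [measurable] = measurable_shift[OF Lspace_measurable[OF g]]
  have "avg (\<lambda>l. ?H (l + c)) = avg ?H"
  proof (rule avg_shift)
    show "?H \<in> borel_measurable lebesgue" by measurable
    show "periodic ?H" using Lspace_periodic[OF g] periodic_add[OF Lspace_periodic[OF g], of x]
      by (simp add: periodic_def)
  qed
  moreover have "?H (l + c) = ennreal (norm (g (x + l + c) - g (l + c)) powr ?P)" for l
    by (simp add: norm_minus_commute add_ac)
  ultimately show ?thesis unfolding Lnorm_def ennpowr_pnorm[OF p] ennpowr_norm by simp
qed

text \<open>Substituting x + l + c for x frees the peak from \<open>l\<close>. Tonelli then allows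
  integrating in \<open>l\<close> first, which leaves the translation error of \<open>g\<close>
  weighted by the peak.\<close>

lemma sample_op_error_avg:
  assumes g: "g \<in> Lspace p" and p: "0 < p" "p \<noteq> \<infinity>" and gb: "g \<in> borel_measurable borel" and N: "1 \<le> N"
  shows "avg (\<lambda>l. avg (\<lambda>x. \<Sum>j<N. ennreal (norm (g x - g (l + real j * mesh N)) powr enn2real p * peak N (x - l - real j * mesh N))))
    = ennreal (real N) * avg (\<lambda>x. ennpowr (Lnorm p (\<lambda>y. g y - g (y + x))) (enn2real p) * ennreal (peak N x))"
proof -
  let ?P = "enn2real p"
  note [measurable] = gb
  have pkb [measurable]: "peak N \<in> borel_measurable borel" by (intro borel_measurable_continuous_onI continuous_peak)
  have one: "avg (\<lambda>l. avg (\<lambda>x. ennreal (norm (g x - g (l + c)) powr ?P * peak N (x - l - c))))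
     = avg (\<lambda>x. ennpowr (Lnorm p (\<lambda>y. g y - g (y + x))) ?P * ennreal (peak N x))" for c
  proof -
    have "avg (\<lambda>x. ennreal (norm (g x - g (l + c)) powr ?P * peak N (x - l - c)))
       = avg (\<lambda>x. ennreal (norm (g (x + l + c) - g (l + c)) powr ?P * peak N x))" for l
    proof -
      let ?H = "\<lambda>x. ennreal (norm (g x - g (l + c)) powr ?P * peak N (x - l - c))"
      have "avg (\<lambda>x. ?H (x + (l + c))) = avg ?H"
      proof (rule avg_shift)
        show "?H \<in> borel_measurable lebesgue" by measurable
        show "periodic ?H"
          using Lspace_periodic[OF g] periodic_add[OF peak_periodic[of N], of "- l - c"]
          by (simp add: periodic_def algebra_simps)
      qed
      then show ?thesis by (simp add: add.assoc)
    qed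
    then have "avg (\<lambda>l. avg (\<lambda>x. ennreal (norm (g x - g (l + c)) powr ?P * peak N (x - l - c))))
      = avg (\<lambda>l. avg (\<lambda>x. ennreal (norm (g (x + l + c) - g (l + c)) powr ?P * peak N x)))" by simp
    also have "\<dots> = avg (\<lambda>x. avg (\<lambda>l. ennreal (norm (g (x + l + c) - g (l + c)) powr ?P * peak N x)))"
      by (rule avg_swap) measurable
    also have "\<dots> = avg (\<lambda>x. avg (\<lambda>l. ennreal (norm (g (x + l + c) - g (l + c)) powr ?P)) * ennreal (peak N x))"
    proof -
      have "avg (\<lambda>l. ennreal (norm (g (x + l + c) - g (l + c)) powr ?P * peak N x))
        = avg (\<lambda>l. ennreal (norm (g (x + l + c) - g (l + c)) powr ?P)) * ennreal (peak N x)" for x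
        using less_imp_le[OF peak_pos] by (subst avg_multc[symmetric]) (auto simp: ennreal_mult)
      then show ?thesis by simp
    qed
    finally show ?thesis unfolding avg_periodic_shift_norm[OF g p] .
  qed
  have "avg (\<lambda>l. avg (\<lambda>x. \<Sum>j<N. ennreal (norm (g x - g (l + real j * mesh N)) powr ?P * peak N (x - l - real j * mesh N))))
     = avg (\<lambda>l. \<Sum>j<N. avg (\<lambda>x. ennreal (norm (g x - g (l + real j * mesh N)) powr ?P * peak N (x - l - real j * mesh N))))"
  proof -
    have "(\<lambda>x. ennreal (norm (g x - g (l + c)) powr ?P * peak N (x - l - c))) \<in> borel_measurable lebesgue" for l c
      by measurable
    then show ?thesis by (subst avg_sum) auto
  qed
  also have "\<dots> = (\<Sum>j<N. avg (\<lambda>l. avg (\<lambda>x. ennreal (norm (g x - g (l + real j * mesh N)) powr ?P * peak N (x - l - real j * mesh N)))))"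
  proof (rule avg_sum)
    show "(\<lambda>l. avg (\<lambda>x. ennreal (norm (g x - g (l + real j * mesh N)) powr ?P * peak N (x - l - real j * mesh N)))) \<in> borel_measurable lebesgue" for j
      by (rule avg_measurable) measurable
  qed simp
  also have "\<dots> = ennreal (real N) * avg (\<lambda>x. ennpowr (Lnorm p (\<lambda>y. g y - g (y + x))) ?P * ennreal (peak N x))"
    unfolding one by (simp add: ennreal_of_nat_eq_real_of_nat)
  finally show ?thesis .
qed

lemma translation_bound:
  assumes p: "0 < p" and g: "g \<in> Lspace p"
  shows "\<exists>b>0. \<forall>u. Lnorm p (\<lambda>x. g x - g (x + u)) \<le> ennreal b"
proof -
  obtain b where b: "0 \<le> b" "Lnorm p g = ennreal b"
    using Lspace_finite[OF p g] by (cases "Lnorm p g") auto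
  let ?q = "quasi_const p"
  have "Lnorm p (\<lambda>x. g x - g (x + u)) \<le> ennreal (?q * (b + b) + 1)" for u
  proof -
    have "Lnorm p (\<lambda>x. g x - g (x + u)) \<le> ennreal ?q * (Lnorm p g + Lnorm p (\<lambda>x. g (x + u)))"
      by (intro Lspace_norm_add_le p g Lspace_shift norm_triangle_ineq4)
    also have "Lnorm p (\<lambda>x. g (x + u)) = Lnorm p g"
      by (rule Lnorm_shift[OF Lspace_periodic[OF g] Lspace_measurable[OF g]])
    also have "ennreal ?q * (Lnorm p g + Lnorm p g) = ennreal (?q * (b + b))"
      using quasi_const_ge_1[of p] by (simp only: b(2) ennreal_plus[OF b(1) b(1), symmetric]) (simp add: ennreal_mult b(1))
    also have "\<dots> \<le> ennreal (?q * (b + b) + 1)" by (intro ennreal_leI) simp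
    finally show ?thesis .
  qed
  moreover have "0 < ?q * (b + b) + 1"
    using b(1) quasi_const_ge_1[of p] by (intro add_nonneg_pos mult_nonneg_nonneg) auto
  ultimately show ?thesis by blast
qed

lemma half_cancel:
  fixes x y :: real
  assumes "0 \<le> x" shows "(x + 1) * (y / (2 * (x + 1))) = y / 2"
proof -
  have "d * (y / (2 * d)) = y / 2" if "d \<noteq> 0" for d using that by simp
  from this[of "x + 1"] show ?thesis using assms by linarith
qed

text \<open>Approximate identity: nodes near \<open>x\<close> are handled by continuity of
  translations, for the far ones the peak is of order 1 / N^2, which beats their number N.\<close>

lemma sample_op_converges:
  fixes \<sigma> :: nat
  assumes p: "0 < p" and g: "g \<in> Lspace p" and tc: "translation_continuous p g"
    and gb: "p \<noteq> \<infinity> \<Longrightarrow> g \<in> borel_measurable borel"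
    and \<eta>: "\<eta> 0 = 1" "\<And>t. 1 \<le> \<bar>t\<bar> \<Longrightarrow> \<eta> t = 0"
    and \<sigma>: "1 \<le> \<sigma>" "p \<noteq> \<infinity> \<Longrightarrow> 1 \<le> real \<sigma> * enn2real p" and B: "0 \<le> B"
    and kb: "\<And>N x. 1 \<le> N \<Longrightarrow> norm (kern N \<eta> x) \<le> B * peak N x ^ \<sigma>" and e: "0 < e"
  shows "\<exists>N0. \<forall>N\<ge>N0. 1 \<le> N \<longrightarrow> mixed_norm p (\<lambda>l x. g x - sample_op N \<eta> g l x) \<le> ennreal e"
proof -
  obtain C where C: "1 \<le> C" "\<And>N y. 1 \<le> N \<Longrightarrow> (\<Sum>j<N. peak N (y - real j * mesh N)) \<le> C"
    using peak_sum_mesh by blast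
  obtain b where b: "0 < b" "\<And>u. Lnorm p (\<lambda>x. g x - g (x + u)) \<le> ennreal b"
    using translation_bound[OF p g] by blast
  have pk0: "0 \<le> peak N x" for N x by (rule less_imp_le[OF peak_pos])
  have pw: "norm (g x - sample_op N \<eta> g l x) \<le> B * (\<Sum>j<N. norm (g x - g (l + real j * mesh N)) * peak N (x - l - real j * mesh N) ^ \<sigma>)"
    if N: "1 \<le> N" for N l x
  proof -
    \<comment> \<open>Sampling the constant function shows that the kernels at the nodes sum to
      \<open>\<eta> 0 = 1\<close>, so \<open>g x\<close> can be brought under the sum.\<close>
    have "sample_op N \<eta> (expo 0) l x = \<eta> (of_int 0 * mesh N) * expo 0 x"
      by (rule sample_op_expo) (use N \<eta>(2) in auto)
    then have "(\<Sum>j<N. kern N \<eta> (x - l - real j * mesh N)) = 1"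
      using \<eta>(1) by (simp add: sample_op_def)
    then have eq: "g x - sample_op N \<eta> g l x = (\<Sum>j<N. (g x - g (l + real j * mesh N)) * kern N \<eta> (x - l - real j * mesh N))"
      unfolding sample_op_def left_diff_distrib sum_subtractf sum_distrib_left[symmetric] by simp
    have "norm (g x - sample_op N \<eta> g l x) \<le> (\<Sum>j<N. norm (g x - g (l + real j * mesh N)) * (B * peak N (x - l - real j * mesh N) ^ \<sigma>))"
      unfolding eq
    proof (rule sum_norm_le)
      fix j
      show "norm ((g x - g (l + real j * mesh N)) * kern N \<eta> (x - l - real j * mesh N))
        \<le> norm (g x - g (l + real j * mesh N)) * (B * peak N (x - l - real j * mesh N) ^ \<sigma>)"
        unfolding norm_mult by (rule mult_left_mono[OF kb[OF N]]) simp
    qed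
    also have "\<dots> = B * (\<Sum>j<N. norm (g x - g (l + real j * mesh N)) * peak N (x - l - real j * mesh N) ^ \<sigma>)"
      unfolding sum_distrib_left by (intro sum.cong refl) (simp only: mult_ac)
    finally show ?thesis .
  qed
  show ?thesis
  proof (cases "p = \<infinity>")
    case True
    \<comment> \<open>The near nodes contribute at most \<open>B * C * e'\<close>, which is to be at
      most half of \<open>e\<close>; the 1 guards against \<open>B * C = 0\<close>. For finite
      exponents \<open>d\<close> below plays the same part.\<close>
    define e' where "e' = e / (2 * (B * C + 1))"
    have BC: "0 \<le> B * C" using B C(1) by simp
    have e': "0 < e'" "B * (e' * C) \<le> e / 2"
    proof -
      show "0 < e'" using e BC by (simp add: e'_def)
      have "B * C * e' \<le> (B * C + 1) * e'" using \<open>0 < e'\<close> by (intro mult_right_mono) auto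
      also have "\<dots> = e / 2" unfolding e'_def by (rule half_cancel[OF BC])
      finally show "B * (e' * C) \<le> e / 2" by (simp add: mult_ac)
    qed
    obtain \<rho> where \<rho>: "0 < \<rho>" "\<And>u. norm (1 - cis u) < \<rho> \<Longrightarrow> Lnorm p (\<lambda>x. g x - g (x + u)) \<le> ennreal e'"
      using tc e'(1) unfolding translation_continuous_def by blast
    have pt: "norm (g y - g (y + u)) \<le> c" if "Lnorm p (\<lambda>x. g x - g (x + u)) \<le> ennreal c" "0 < c" for y u c
    proof -
      have "(\<lambda>x. g x - g (x + u)) \<in> Lspace \<infinity>" using g True p by (intro Lspace_diff Lspace_shift) auto
      then have "ennreal (norm (g y - g (y + u))) \<le> ennreal c"
        using Lnorm_top_bound[of "\<lambda>x. g x - g (x + u)" y] that(1) True order_trans by auto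
      then show ?thesis using that(2) by (simp add: ennreal_le_iff)
    qed
    \<comment> \<open>Each far term carries \<open>(mesh N / \<rho>)\<close> squared, that is 4 pi^2
      / (\<rho> N)^2; all N of them together give \<open>T / N\<close>.\<close>
    define T where "T = B * (b * (4 * pi\<^sup>2 / \<rho>\<^sup>2))"
    have T: "0 \<le> T" using B b by (simp add: T_def)
    obtain N0 :: nat where N0: "2 * T / e \<le> real N0" using real_arch_simple by blast
    show ?thesis
    proof (intro exI[of _ N0] allI impI)
      fix N assume N: "N0 \<le> N" "1 \<le> N"
      have "norm (g x - sample_op N \<eta> g l x) \<le> e" for l x
      proof -
        have term_le: "norm (g x - g (l + real j * mesh N)) * peak N (x - l - real j * mesh N) ^ \<sigma>
          \<le> e' * peak N (x - l - real j * mesh N) + b * (mesh N / \<rho>)\<^sup>2" for j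
        proof -
          define y where "y = l + real j * mesh N"
          define v where "v = x - l - real j * mesh N"
          have xy: "x = y + v" by (simp add: y_def v_def)
          have pv: "peak N v ^ \<sigma> \<le> peak N v"
            using power_decreasing[of 1 \<sigma> "peak N v"] \<sigma>(1) peak_le_1[of N v] pk0[of N v] by simp
          have "norm (g x - g y) * peak N v ^ \<sigma> \<le> e' * peak N v + b * (mesh N / \<rho>)\<^sup>2"
          proof (cases "norm (1 - cis v) < \<rho>")
            case True
            have "norm (g y - g (y + v)) \<le> e'" by (rule pt[OF \<rho>(2)[OF True] e'(1)])
            then have "norm (g x - g y) * peak N v ^ \<sigma> \<le> e' * peak N v"
              unfolding xy norm_minus_commute[of "g (y + v)"] using pv pk0 e'(1) by (intro mult_mono) auto
            then show ?thesis using b(1) by (simp add: add_increasing2)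
          next
            case False
            have "norm (g y - g (y + v)) \<le> b" by (rule pt[OF b(2) b(1)])
            moreover have "peak N v ^ \<sigma> \<le> (mesh N / \<rho>)\<^sup>2"
              using pv peak_far[OF N(2) \<rho>(1), of v] False by linarith
            ultimately have "norm (g x - g y) * peak N v ^ \<sigma> \<le> b * (mesh N / \<rho>)\<^sup>2"
              unfolding xy norm_minus_commute[of "g (y + v)"] using pk0 b(1) by (intro mult_mono) auto
            then show ?thesis using e'(1) pk0[of N v] by (simp add: add_increasing)
          qed
          then show ?thesis by (simp only: y_def v_def)
        qed
        have "norm (g x - sample_op N \<eta> g l x) \<le> B * (\<Sum>j<N. e' * peak N (x - l - real j * mesh N) + b * (mesh N / \<rho>)\<^sup>2)"
          using pw[OF N(2), of x l] mult_left_mono[OF sum_mono[OF term_le] B] by (rule order_trans)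
        also have "\<dots> = B * (e' * (\<Sum>j<N. peak N (x - l - real j * mesh N))) + T / real N"
          using N(2) by (simp add: sum.distrib sum_distrib_left[symmetric] distrib_left T_def power2_eq_square)
        also have "\<dots> \<le> B * (e' * C) + e / 2"
        proof (intro add_mono mult_left_mono C(2) N B)
          have "2 * T / e \<le> real N" using N0 N(1) by linarith
          then show "T / real N \<le> e / 2" using e N(2) by (simp add: field_simps)
        qed (use e'(1) in auto)
        finally show ?thesis using e'(2) by linarith
      qed
      then show "mixed_norm p (\<lambda>l x. g x - sample_op N \<eta> g l x) \<le> ennreal e"
        unfolding True mixed_norm_top by (intro SUP_least ennreal_leI)
    qed
  next
    case False
    define P where "P = enn2real p"
    have P: "0 < P" unfolding P_def by (rule enn2real_pos[OF p False])
    define A where "A = B powr P * C powr P"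
    have A: "0 \<le> A" by (simp add: A_def)
    define d where "d = e powr P / (2 * (A * C + 1))"
    have AC: "0 \<le> A * C" using A C(1) by simp
    have d: "0 < d" "A * (d * C) \<le> e powr P / 2"
    proof -
      show "0 < d" using e AC by (simp add: d_def)
      have "A * C * d \<le> (A * C + 1) * d" using \<open>0 < d\<close> by (intro mult_right_mono) auto
      also have "\<dots> = e powr P / 2" unfolding d_def by (rule half_cancel[OF AC])
      finally show "A * (d * C) \<le> e powr P / 2" by (simp add: mult_ac)
    qed
    have "0 < d powr (1 / P)" using d(1) by simp
    then obtain \<rho> where \<rho>: "0 < \<rho>" "\<And>u. norm (1 - cis u) < \<rho> \<Longrightarrow> Lnorm p (\<lambda>x. g x - g (x + u)) \<le> ennreal (d powr (1 / P))"
      using tc unfolding translation_continuous_def by blast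
    let ?\<tau> = "\<lambda>u. ennpowr (Lnorm p (\<lambda>x. g x - g (x + u))) P"
    have \<tau>1: "?\<tau> u \<le> ennreal d" if "norm (1 - cis u) < \<rho>" for u
    proof -
      have "?\<tau> u \<le> ennpowr (ennreal (d powr (1 / P))) P" using \<rho>(2)[OF that] P by (intro ennpowr_mono) auto
      also have "\<dots> = ennreal d" using P d(1) by (simp add: ennpowr_ennreal powr_powr)
      finally show ?thesis .
    qed
    have \<tau>2: "?\<tau> u \<le> ennreal (b powr P)" for u
    proof -
      have "?\<tau> u \<le> ennpowr (ennreal b) P" using b(2) P by (intro ennpowr_mono) auto
      also have "\<dots> = ennreal (b powr P)" using b(1) by (simp add: ennpowr_ennreal)
      finally show ?thesis .
    qed
    define T where "T = A * (b powr P * (4 * pi\<^sup>2 / \<rho>\<^sup>2))"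
    have T: "0 \<le> T" using A by (simp add: T_def)
    obtain N0 :: nat where N0: "2 * T / e powr P \<le> real N0" using real_arch_simple by blast
    show ?thesis
    proof (intro exI[of _ N0] allI impI)
      fix N assume N: "N0 \<le> N" "1 \<le> N"
      let ?S = "\<lambda>l x. \<Sum>j<N. norm (g x - g (l + real j * mesh N)) powr P * peak N (x - l - real j * mesh N)"
      have S0: "0 \<le> ?S l x" for l x using pk0 by (intro sum_nonneg) auto
      have pwP: "norm (g x - sample_op N \<eta> g l x) powr P \<le> A * ?S l x" for l x
      proof -
        let ?U = "\<Sum>j<N. norm (g x - g (l + real j * mesh N)) * peak N (x - l - real j * mesh N) ^ \<sigma>"
        have U: "0 \<le> ?U" using pk0 by (intro sum_nonneg) auto
        have "norm (g x - sample_op N \<eta> g l x) powr P \<le> (B * ?U) powr P"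
          using pw[OF N(2)] P by (intro powr_mono2) auto
        also have "\<dots> = B powr P * ?U powr P" using B U by (simp add: powr_mult)
        also have "\<dots> \<le> B powr P * (C powr P * ?S l x)"
          using P \<sigma>(1) \<sigma>(2)[OF False, folded P_def] C peak_pos peak_le_1 N(2)
          by (intro mult_left_mono weighted_powr_sum_le) auto
        finally show ?thesis by (simp add: A_def mult.assoc)
      qed
      have m: "(\<lambda>(l, x). \<Sum>j<N. ennreal (norm (g x - g (l + real j * mesh N)) powr P * peak N (x - l - real j * mesh N))) \<in> borel_measurable (lebesgue \<Otimes>\<^sub>M lebesgue)"
      proof -
        note [measurable] = gb[OF False]
        have [measurable]: "peak N \<in> borel_measurable borel" by (intro borel_measurable_continuous_onI continuous_peak)
        show ?thesis by measurable
      qed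
      have m1: "(\<lambda>x. \<Sum>j<N. ennreal (norm (g x - g (l + real j * mesh N)) powr P * peak N (x - l - real j * mesh N))) \<in> borel_measurable lebesgue" for l
      proof -
        note [measurable] = gb[OF False]
        have [measurable]: "peak N \<in> borel_measurable borel" by (intro borel_measurable_continuous_onI continuous_peak)
        show ?thesis by measurable
      qed
      have "ennpowr (mixed_norm p (\<lambda>l x. g x - sample_op N \<eta> g l x)) P
         = avg (\<lambda>l. avg (\<lambda>x. ennreal (norm (g x - sample_op N \<eta> g l x) powr P)))"
        unfolding P_def by (rule ennpowr_mixed_norm[OF p False])
      also have "\<dots> \<le> avg (\<lambda>l. avg (\<lambda>x. ennreal A * (\<Sum>j<N. ennreal (norm (g x - g (l + real j * mesh N)) powr P * peak N (x - l - real j * mesh N)))))"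
      proof (intro avg_mono)
        fix l x
        have "ennreal (norm (g x - sample_op N \<eta> g l x) powr P) \<le> ennreal (A * ?S l x)" by (intro ennreal_leI pwP)
        also have "\<dots> = ennreal A * ennreal (?S l x)" using A S0 by (intro ennreal_mult) auto
        also have "ennreal (?S l x) = (\<Sum>j<N. ennreal (norm (g x - g (l + real j * mesh N)) powr P * peak N (x - l - real j * mesh N)))"
          using pk0 by (intro sum_ennreal[symmetric]) auto
        finally show "ennreal (norm (g x - sample_op N \<eta> g l x) powr P) \<le> ennreal A * \<dots>" .
      qed
      also have "\<dots> = ennreal A * avg (\<lambda>l. avg (\<lambda>x. \<Sum>j<N. ennreal (norm (g x - g (l + real j * mesh N)) powr P * peak N (x - l - real j * mesh N))))"
        unfolding avg_cmult[OF m1] by (rule avg_cmult[OF avg_measurable[OF m]])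
      also have "\<dots> = ennreal A * (ennreal (real N) * avg (\<lambda>x. ?\<tau> x * ennreal (peak N x)))"
        unfolding P_def sample_op_error_avg[OF g p False gb[OF False] N(2)] ..
      also have "\<dots> \<le> ennreal A * (ennreal (real N) * avg (\<lambda>x. ennreal d * ennreal (peak N x) + ennreal (b powr P * (mesh N / \<rho>)\<^sup>2)))"
      proof (intro mult_left_mono avg_mono)
        fix x
        show "?\<tau> x * ennreal (peak N x) \<le> ennreal d * ennreal (peak N x) + ennreal (b powr P * (mesh N / \<rho>)\<^sup>2)"
        proof (cases "norm (1 - cis x) < \<rho>")
          case True
          then have "?\<tau> x * ennreal (peak N x) \<le> ennreal d * ennreal (peak N x)" by (intro mult_right_mono \<tau>1) auto
          then show ?thesis by (simp add: add_increasing2)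
        next
          case False
          then have "?\<tau> x * ennreal (peak N x) \<le> ennreal (b powr P) * ennreal ((mesh N / \<rho>)\<^sup>2)"
            using \<rho>(1) by (intro mult_mono \<tau>2 ennreal_leI peak_far N) auto
          then show ?thesis by (simp add: ennreal_mult add_increasing)
        qed
      qed auto
      also have "avg (\<lambda>x. ennreal d * ennreal (peak N x) + ennreal (b powr P * (mesh N / \<rho>)\<^sup>2))
         = ennreal d * avg (\<lambda>x. ennreal (peak N x)) + ennreal (b powr P * (mesh N / \<rho>)\<^sup>2)"
      proof -
        note [measurable] = measurable_peak
        show ?thesis by (simp add: avg_add avg_cmult)
      qed
      also have "ennreal A * (ennreal (real N) * \<dots>) = ennreal A * (ennreal d * (ennreal (real N) * avg (\<lambda>x. ennreal (peak N x)))) + ennreal A * (ennreal (real N) * ennreal (b powr P * (mesh N / \<rho>)\<^sup>2))"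
        by (simp only: distrib_left mult_ac)
      also have "\<dots> \<le> ennreal A * (ennreal d * ennreal C) + ennreal (T / real N)"
      proof (intro add_mono mult_left_mono avg_peak N C)
        have "ennreal A * (ennreal (real N) * ennreal (b powr P * (mesh N / \<rho>)\<^sup>2)) = ennreal (A * (real N * (b powr P * (mesh N / \<rho>)\<^sup>2)))"
          using A by (simp add: ennreal_mult)
        also have "A * (real N * (b powr P * (mesh N / \<rho>)\<^sup>2)) = T / real N"
          using N(2) by (simp add: T_def power2_eq_square field_simps)
        finally show "ennreal A * (ennreal (real N) * ennreal (b powr P * (mesh N / \<rho>)\<^sup>2)) \<le> ennreal (T / real N)" by simp
      qed auto
      also have "\<dots> = ennreal (A * (d * C) + T / real N)"
        using A d(1) C(1) T by (simp add: ennreal_mult ennreal_plus)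
      also have "\<dots> \<le> ennreal (e powr P)"
      proof (rule ennreal_leI)
        have "2 * T / e powr P \<le> real N" using N0 N(1) by linarith
        then have "T / real N \<le> e powr P / 2" using e N(2) by (simp add: field_simps)
        then show "A * (d * C) + T / real N \<le> e powr P" using d(2) by linarith
      qed
      also have "\<dots> = ennpowr (ennreal e) P" using e by (simp add: ennpowr_ennreal)
      finally show "mixed_norm p (\<lambda>l x. g x - sample_op N \<eta> g l x) \<le> ennreal e"
        using P ennpowr_le_iff by blast
    qed
  qed
qed

text \<open>The coarse grid consists of the even nodes of the fine one, selected by the weight 1 +
  (-1)^j. The alternating half is what makes a second factorisation necessary.\<close>

lemma sum_even_doubling:
  fixes G :: "nat \<Rightarrow> complex"
  shows "(\<Sum>i<N. 2 * G (2 * i)) = (\<Sum>j<2 * N. (1 + (if even j then 1 else - 1)) * G j)"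
  by (induction N) auto

text \<open>The same frequency sits at half the value of \<open>t\<close> on the grid with twice as
  many points; the factor 2 is the ratio of the normalisations 1 / N.\<close>

lemma kern_double:
  assumes N: "1 \<le> N" and \<eta>: "\<And>t. 1 \<le> \<bar>t\<bar> \<Longrightarrow> \<eta> t = 0"
  shows "kern N \<eta> x = 2 * kern (2 * N) (\<lambda>t. \<eta> (2 * t)) x"
proof -
  have z: "\<eta> (2 * pi * of_int \<nu> / real N) = 0" if "int N < \<bar>\<nu>\<bar>" for \<nu>
  proof (rule \<eta>)
    have "real N \<le> \<bar>real_of_int \<nu>\<bar>" using that by linarith
    then have "1 * real N \<le> 2 * pi * \<bar>real_of_int \<nu>\<bar>" using pi_ge_two by (intro mult_mono) auto
    then show "1 \<le> \<bar>2 * pi * of_int \<nu> / real N\<bar>" using N by (simp add: abs_mult le_divide_eq)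
  qed
  have s: "(\<Sum>\<nu>\<in>{- int N..int N}. \<eta> (2 * pi * of_int \<nu> / real N) * expo \<nu> x) = (\<Sum>\<nu>\<in>{- int (2 * N)..int (2 * N)}. \<eta> (2 * pi * of_int \<nu> / real N) * expo \<nu> x)"
  proof (intro sum.mono_neutral_left ballI)
    fix \<nu> assume "\<nu> \<in> {- int (2 * N)..int (2 * N)} - {- int N..int N}"
    then have "\<eta> (2 * pi * of_int \<nu> / real N) = 0" by (intro z) auto
    then show "\<eta> (2 * pi * of_int \<nu> / real N) * expo \<nu> x = 0" by (simp only: mult_zero_left)
  qed auto
  have e: "2 * (2 * pi * real_of_int \<nu> / real (2 * N)) = 2 * pi * of_int \<nu> / real N" for \<nu> :: int by simp
  have "1 / of_nat N * S = 2 * (1 / of_nat (2 * N) * S)" for S :: complex by simp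
  then show ?thesis unfolding kern_def wide_kern_def s e .
qed

text \<open>Telescoping over dyadic grids needs a bound for consecutive differences and convergence
  to the function, for one and the same \<open>\<eta>\<close>.\<close>

lemma sampling_scheme:
  assumes p: "0 < p"
  shows "\<exists>\<eta> C. 0 \<le> C \<and> (\<forall>t. 1 \<le> \<bar>t\<bar> \<longrightarrow> \<eta> t = 0) \<and>
    (\<forall>N\<ge>1. \<forall>f\<in>Lspace p. mixed_norm p (\<lambda>l x. sample_op (2 * N) \<eta> f l x - sample_op N \<eta> f l x) \<le> ennreal C * Lnorm p (diff_op r (mesh (2 * N)) f)) \<and>
    (\<forall>g\<in>Lspace p. translation_continuous p g \<longrightarrow> (p \<noteq> \<infinity> \<longrightarrow> g \<in> borel_measurable borel) \<longrightarrow>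
      (\<forall>e>0. \<exists>N0. \<forall>N\<ge>N0. 1 \<le> N \<longrightarrow> mixed_norm p (\<lambda>l x. g x - sample_op N \<eta> g l x) \<le> ennreal e))"
proof -
  obtain \<sigma> :: nat where \<sigma>: "1 \<le> \<sigma>" "p \<noteq> \<infinity> \<Longrightarrow> 1 \<le> real \<sigma> * enn2real p" using exists_sigma[OF p] by blast
  from telescoping_multipliers[where s="2 * \<sigma>" and r=r]
  obtain \<eta> m1 m2 B where mult: "\<forall>e>0. smooth e (2 * \<sigma>) B \<eta> \<and> smooth e (2 * \<sigma>) B m1 \<and> smooth e (2 * \<sigma>) B m2"
    "\<forall>t. 1 \<le> \<bar>t\<bar> \<longrightarrow> \<eta> t = 0 \<and> m1 t = 0 \<and> m2 t = 0" "\<eta> 0 = 1"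
    "\<forall>t. \<eta> t - \<eta> (2 * t) = m1 t * (1 - cis t) ^ r" "\<forall>t. \<eta> (2 * t) = m2 t * (1 + cis t) ^ r"
    by (elim exE conjE)
  have sm: "\<And>e. e > 0 \<Longrightarrow> smooth e (2 * \<sigma>) B \<eta>" "\<And>e. e > 0 \<Longrightarrow> smooth e (2 * \<sigma>) B m1" "\<And>e. e > 0 \<Longrightarrow> smooth e (2 * \<sigma>) B m2"
    and z: "\<And>t. 1 \<le> \<bar>t\<bar> \<Longrightarrow> \<eta> t = 0" "\<And>t. 1 \<le> \<bar>t\<bar> \<Longrightarrow> m1 t = 0" "\<And>t. 1 \<le> \<bar>t\<bar> \<Longrightarrow> m2 t = 0" and \<eta>0: "\<eta> 0 = 1"
    and m1: "\<And>t. \<eta> t - \<eta> (2 * t) = m1 t * (1 - cis t) ^ r" and m2: "\<And>t. \<eta> (2 * t) = m2 t * (1 + cis t) ^ r"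
    using mult by auto
  define b where "b = 2 ^ \<sigma> * (2 * (4 * real \<sigma> + 3) * B)"
  have B: "0 \<le> B" using smooth_nonneg[OF sm(1)[of 1]] by simp
  then have b: "0 \<le> b" by (simp add: b_def)
  have kb: "norm (kern N M x) \<le> b * peak N x ^ \<sigma>" if "1 \<le> N" "\<And>e. e > 0 \<Longrightarrow> smooth e (2 * \<sigma>) B M" "\<And>t. 1 \<le> \<bar>t\<bar> \<Longrightarrow> M t = 0" for N M x
    unfolding b_def by (rule norm_kern_le) (use that in auto)
  obtain C where C: "0 \<le> C" "\<And>N F G B. 1 \<le> N \<Longrightarrow> F \<in> Lspace p \<Longrightarrow> 0 \<le> B \<Longrightarrow>
    (\<forall>l x. norm (G l x) \<le> B * (\<Sum>j<N. norm (F (l + real j * mesh N)) * peak N (x - l - real j * mesh N) ^ \<sigma>)) \<Longrightarrow>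
    mixed_norm p G \<le> ennreal (C * B) * Lnorm p F"
    using sampling_bound[OF p \<sigma>] by blast
  have step: "mixed_norm p (\<lambda>l x. sample_op (2 * N) \<eta> f l x - sample_op N \<eta> f l x) \<le> ennreal (C * (2 * b)) * Lnorm p (diff_op r (mesh (2 * N)) f)"
    if N: "1 \<le> N" and f: "f \<in> Lspace p" for N f
  proof (rule C(2))
    define N' where "N' = 2 * N"
    define \<delta> where "\<delta> = mesh N'"
    have N': "1 \<le> N'" using N by (simp add: N'_def)
    show "1 \<le> 2 * N" using N by simp
    show "diff_op r (mesh (2 * N)) f \<in> Lspace p" by (rule Lspace_diff_op[OF p f])
    show "0 \<le> 2 * b" using b by simp
    show "\<forall>l x. norm (sample_op (2 * N) \<eta> f l x - sample_op N \<eta> f l x)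
      \<le> 2 * b * (\<Sum>j<2 * N. norm (diff_op r (mesh (2 * N)) f (l + real j * mesh (2 * N))) * peak (2 * N) (x - l - real j * mesh (2 * N)) ^ \<sigma>)"
      unfolding N'_def[symmetric] \<delta>_def[symmetric]
    proof (intro allI)
      fix l x
      let ?\<eta>2 = "\<lambda>t. \<eta> (2 * t)"
      let ?y = "\<lambda>j. l + real j * \<delta>" and ?v = "\<lambda>j. x - l - real j * \<delta>"
      let ?sg = "\<lambda>i::int. if even i then 1 else - 1 :: complex"
      have mN: "mesh N = 2 * \<delta>" using N by (simp add: \<delta>_def N'_def)
      have kd2: "kern N \<eta> v = 2 * kern N' ?\<eta>2 v" for v
        unfolding N'_def by (rule kern_double[OF N z(1)])
      have arg: "real i * (2 * \<delta>) = real (2 * i) * \<delta>" for i by simp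
      have "sample_op N \<eta> f l x = (\<Sum>i<N. 2 * (f (?y (2 * i)) * kern N' ?\<eta>2 (?v (2 * i))))"
        unfolding sample_op_def mN arg by (intro sum.cong refl) (simp only: kd2 mult.left_commute)
      also have "\<dots> = (\<Sum>j<N'. (1 + (if even j then 1 else - 1)) * (f (?y j) * kern N' ?\<eta>2 (?v j)))"
        unfolding N'_def by (rule sum_even_doubling)
      finally have s1: "sample_op N \<eta> f l x = (\<Sum>j<N'. (1 + (if even j then 1 else - 1)) * (f (?y j) * kern N' ?\<eta>2 (?v j)))" .
      have kd: "kern N' (\<lambda>t. \<eta> t - ?\<eta>2 t) v = kern N' \<eta> v - kern N' ?\<eta>2 v" for v
        unfolding kern_def wide_kern_def by (simp add: left_diff_distrib sum_subtractf right_diff_distrib)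
      have s2: "sample_op N' \<eta> f l x = (\<Sum>j<N'. f (?y j) * kern N' \<eta> (?v j))"
        by (simp only: sample_op_def \<delta>_def)
      \<comment> \<open>The trivial character carries the multiplier
        \<open>\<eta> t - \<eta> (2 * t)\<close>, the alternating one carries
        \<open>\<eta> (2 * t)\<close>; each has its own factorisation.\<close>
      have "sample_op N' \<eta> f l x - sample_op N \<eta> f l x
         = (\<Sum>j<N'. 1 * f (?y j) * kern N' (\<lambda>t. \<eta> t - ?\<eta>2 t) (?v j)) - (\<Sum>j<N'. ?sg (int j) * f (?y j) * kern N' ?\<eta>2 (?v j))"
        unfolding s1 s2 kd sum_subtractf[symmetric]
        by (intro sum.cong refl) (auto simp: algebra_simps)
      also have "(\<Sum>j<N'. 1 * f (?y j) * kern N' (\<lambda>t. \<eta> t - ?\<eta>2 t) (?v j)) = (\<Sum>j<N'. 1 * diff_op r \<delta> f (?y j) * kern N' m1 (?v j))"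
        by (rule kern_sum_by_parts[where sg="\<lambda>_. 1" and s=1, symmetric, OF N' Lspace_periodic[OF f] \<delta>_def])
           (auto simp: m1)
      also have "(\<Sum>j<N'. ?sg (int j) * f (?y j) * kern N' ?\<eta>2 (?v j)) = (\<Sum>j<N'. ?sg (int j) * diff_op r \<delta> f (?y j) * kern N' m2 (?v j))"
        by (rule kern_sum_by_parts[where sg="?sg" and s="-1", symmetric, OF N' Lspace_periodic[OF f] \<delta>_def])
           (auto simp: m2 N'_def)
      finally have eq: "sample_op N' \<eta> f l x - sample_op N \<eta> f l x = (\<Sum>j<N'. 1 * diff_op r \<delta> f (?y j) * kern N' m1 (?v j)) - (\<Sum>j<N'. ?sg (int j) * diff_op r \<delta> f (?y j) * kern N' m2 (?v j))" .
      have "norm ((\<Sum>j<N'. 1 * diff_op r \<delta> f (?y j) * kern N' m1 (?v j)) - (\<Sum>j<N'. ?sg (int j) * diff_op r \<delta> f (?y j) * kern N' m2 (?v j)))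
         \<le> (\<Sum>j<N'. norm (diff_op r \<delta> f (?y j)) * (b * peak N' (?v j) ^ \<sigma>)) + (\<Sum>j<N'. norm (diff_op r \<delta> f (?y j)) * (b * peak N' (?v j) ^ \<sigma>))"
      proof (rule order_trans[OF norm_triangle_ineq4], intro add_mono sum_norm_le)
        fix j
        show "norm (1 * diff_op r \<delta> f (?y j) * kern N' m1 (?v j)) \<le> norm (diff_op r \<delta> f (?y j)) * (b * peak N' (?v j) ^ \<sigma>)"
          using kb[OF N' sm(2) z(2), of "?v j"] by (simp add: norm_mult mult_left_mono)
        show "norm (?sg (int j) * diff_op r \<delta> f (?y j) * kern N' m2 (?v j)) \<le> norm (diff_op r \<delta> f (?y j)) * (b * peak N' (?v j) ^ \<sigma>)"
          using kb[OF N' sm(3) z(3), of "?v j"] by (simp add: norm_mult mult_left_mono)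
      qed
      also have "\<dots> = 2 * b * (\<Sum>j<N'. norm (diff_op r \<delta> f (?y j)) * peak N' (?v j) ^ \<sigma>)"
        by (simp add: sum_distrib_left mult_ac)
      finally show "norm (sample_op N' \<eta> f l x - sample_op N \<eta> f l x) \<le> 2 * b * (\<Sum>j<N'. norm (diff_op r \<delta> f (?y j)) * peak N' (?v j) ^ \<sigma>)"
        unfolding eq .
    qed
  qed
  have conv: "\<exists>N0. \<forall>N\<ge>N0. 1 \<le> N \<longrightarrow> mixed_norm p (\<lambda>l x. g x - sample_op N \<eta> g l x) \<le> ennreal e"
    if "g \<in> Lspace p" "translation_continuous p g" "p \<noteq> \<infinity> \<longrightarrow> g \<in> borel_measurable borel" "0 < e" for g e
    by (rule sample_op_converges[OF p that(1,2) _ \<eta>0 z(1) \<sigma> b kb[OF _ sm(1) z(1)] that(4)]) (use that(3) in auto)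
  have "0 \<le> C * (2 * b)" using C(1) b by simp
  then show ?thesis using step conv z(1) by (intro exI[of _ \<eta>] exI[of _ "C * (2 * b)"]) blast
qed

section \<open>Jackson's inequality\<close>

text \<open>Geometric weights replace the triangle inequality, which is not available for \<open>p < 1\<close>.\<close>

lemma powr_sum_geometric:
  assumes "0 < \<gamma>" "0 < P"
  shows "\<exists>C\<ge>0. \<forall>J a. (\<forall>k. 0 \<le> a k) \<longrightarrow>
    (\<Sum>k<J. a k) powr P \<le> C * (\<Sum>k<J. 2 powr (real k * \<gamma> * P) * a k powr P)"
proof -
  define x where "x = 2 powr (- \<gamma>)"
  have x: "0 < x" "x < 1" using assms(1) by (auto simp: x_def powr_less_one)
  have xk: "2 powr (- (real k * \<gamma>)) = x ^ k" for k
    unfolding x_def by (simp add: powr_powr mult.commute flip: powr_realpow)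
  have S: "(\<Sum>k<J. x ^ k) \<le> 1 / (1 - x)" for J
    using sum_le_suminf[OF summable_geometric, of x "{..<J}"] x by (simp add: suminf_geometric)
  show ?thesis
  proof (intro exI[of _ "(1 / (1 - x)) powr P"] conjI allI impI)
    fix J and a :: "nat \<Rightarrow> real" assume a: "\<forall>k. 0 \<le> a k"
    let ?R = "\<Sum>k<J. 2 powr (real k * \<gamma> * P) * a k powr P"
    show "(\<Sum>k<J. a k) powr P \<le> (1 / (1 - x)) powr P * ?R"
    proof (cases "J = 0")
      case False
      define b where "b k = 2 powr (real k * \<gamma>) * a k" for k
      have b0: "0 \<le> b k" for k using a by (simp add: b_def)
      \<comment> \<open>Comparison with the largest weighted term leaves a geometric series, and the
        P-th power of that term is one summand of the right-hand side.\<close>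
      define m where "m = Max (b ` {..<J})"
      have "m \<in> b ` {..<J}" unfolding m_def using False by (intro Max_in) auto
      then obtain k0 where k0: "k0 < J" "m = b k0" by auto
      have le: "b k \<le> m" if "k < J" for k unfolding m_def using that by (intro Max_ge) auto
      have ak: "a k = x ^ k * b k" for k
        unfolding b_def xk[symmetric] by (simp add: powr_minus field_simps)
      have "(\<Sum>k<J. a k) \<le> (\<Sum>k<J. x ^ k * m)"
        unfolding ak using x le by (intro sum_mono mult_left_mono) auto
      also have "\<dots> \<le> 1 / (1 - x) * m"
        unfolding sum_distrib_right[symmetric] using S b0 k0 by (intro mult_right_mono) auto
      finally have "(\<Sum>k<J. a k) powr P \<le> (1 / (1 - x) * m) powr P"
        using assms a by (intro powr_mono2 sum_nonneg) auto
      also have "\<dots> = (1 / (1 - x)) powr P * m powr P" by (rule powr_mult)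
      also have "m powr P = 2 powr (real k0 * \<gamma> * P) * a k0 powr P"
        unfolding k0 b_def by (simp add: powr_mult powr_powr)
      also have "\<dots> \<le> ?R"
        using k0 by (intro member_le_sum[of k0 _ "\<lambda>k. 2 powr (real k * \<gamma> * P) * a k powr P"]) auto
      finally show ?thesis by (simp add: mult_left_mono)
    qed (simp add: assms)
  qed simp
qed

text \<open>Stated for powers of the norm, which integrate termwise in both variables. In contrast
  to \<open>mixed_norm_sum_le\<close> the constant is independent of the number of terms.\<close>

lemma mixed_norm_sum_powr:
  assumes p: "0 < p" "p \<noteq> \<infinity>" and "0 < \<gamma>"
  shows "\<exists>C\<ge>0. \<forall>J D. (\<forall>k. family (D k)) \<longrightarrow>
    ennpowr (mixed_norm p (\<lambda>l x. \<Sum>k<J. D k l x)) (enn2real p)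
    \<le> ennreal C * (\<Sum>k<J. ennreal (2 powr (real k * \<gamma> * enn2real p)) * ennpowr (mixed_norm p (D k)) (enn2real p))"
proof -
  let ?P = "enn2real p"
  have P: "0 < ?P" by (rule enn2real_pos[OF p])
  obtain C where C: "0 \<le> C" "\<And>J a. (\<forall>k. 0 \<le> a k) \<Longrightarrow>
    (\<Sum>k<J. a k) powr ?P \<le> C * (\<Sum>k<J. 2 powr (real k * \<gamma> * ?P) * a k powr ?P)"
    using powr_sum_geometric[OF assms(3) P] by metis
  show ?thesis
  proof (intro exI[of _ C] conjI allI impI C(1))
    fix J and D :: "nat \<Rightarrow> real \<Rightarrow> real \<Rightarrow> complex" assume fam: "\<forall>k. family (D k)"
    let ?w = "\<lambda>k. ennreal (2 powr (real k * \<gamma> * ?P))"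
    let ?d = "\<lambda>k l x. ennreal (norm (D k l x) powr ?P)"
    have m2: "(\<lambda>(l, x). ?d k l x) \<in> borel_measurable (lebesgue \<Otimes>\<^sub>M lebesgue)" for k
    proof -
      note [measurable] = family_measurable[OF fam[rule_format, of k]]
      show ?thesis by measurable
    qed
    have m1: "?d k l \<in> borel_measurable lebesgue" for k l
    proof -
      note [measurable] = family_measurable1[OF fam[rule_format, of k], of l]
      show ?thesis by measurable
    qed
    note m3 = avg_measurable[OF m2]
    have lin: "avg (\<lambda>y. c * (\<Sum>k<J. w k * e k y)) = c * (\<Sum>k<J. w k * avg (e k))"
      if [measurable]: "\<And>k. e k \<in> borel_measurable lebesgue" for c w and e :: "nat \<Rightarrow> real \<Rightarrow> ennreal"
    proof -
      have "avg (\<lambda>y. c * (\<Sum>k<J. w k * e k y)) = c * avg (\<lambda>y. \<Sum>k<J. w k * e k y)"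
        by (rule avg_cmult) measurable
      also have "avg (\<lambda>y. \<Sum>k<J. w k * e k y) = (\<Sum>k<J. avg (\<lambda>y. w k * e k y))"
        by (rule avg_sum) measurable
      also have "\<dots> = (\<Sum>k<J. w k * avg (e k))" by (intro sum.cong refl avg_cmult that)
      finally show ?thesis .
    qed
    have "ennpowr (mixed_norm p (\<lambda>l x. \<Sum>k<J. D k l x)) ?P = avg (\<lambda>l. avg (\<lambda>x. ennreal (norm (\<Sum>k<J. D k l x) powr ?P)))"
      by (rule ennpowr_mixed_norm[OF p])
    also have "\<dots> \<le> avg (\<lambda>l. avg (\<lambda>x. ennreal C * (\<Sum>k<J. ?w k * ?d k l x)))"
    proof (intro avg_mono)
      fix l x
      have "norm (\<Sum>k<J. D k l x) powr ?P \<le> (\<Sum>k<J. norm (D k l x)) powr ?P"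
        using P by (intro powr_mono2 norm_sum) auto
      also have "\<dots> \<le> C * (\<Sum>k<J. 2 powr (real k * \<gamma> * ?P) * norm (D k l x) powr ?P)"
        by (rule C(2)) simp
      finally have "ennreal (norm (\<Sum>k<J. D k l x) powr ?P) \<le> ennreal \<dots>" by (rule ennreal_leI)
      also have "\<dots> = ennreal C * (\<Sum>k<J. ?w k * ?d k l x)"
        using C(1) by (simp add: ennreal_mult sum_nonneg sum_ennreal[symmetric])
      finally show "ennreal (norm (\<Sum>k<J. D k l x) powr ?P) \<le> ennreal C * (\<Sum>k<J. ?w k * ?d k l x)" .
    qed
    also have "\<dots> = ennreal C * (\<Sum>k<J. ?w k * avg (\<lambda>l. avg (?d k l)))"
      unfolding lin[OF m1] by (rule lin[OF m3])
    also have "(\<Sum>k<J. ?w k * avg (\<lambda>l. avg (?d k l))) = (\<Sum>k<J. ?w k * ennpowr (mixed_norm p (D k)) ?P)"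
      unfolding ennpowr_mixed_norm[OF p] ..
    finally show "ennpowr (mixed_norm p (\<lambda>l x. \<Sum>k<J. D k l x)) ?P \<le> ennreal C * (\<Sum>k<J. ?w k * ennpowr (mixed_norm p (D k)) ?P)" .
  qed
qed

text \<open>The operators on the grids 6 n 2^k telescope from k = 0, where they produce polynomials
  of degree n, up to a level at which convergence makes the remainder arbitrarily small. The series
  may be infinite, in which case nothing is claimed.\<close>

lemma jackson_series_borel:
  assumes p: "0 < p" "p \<noteq> \<infinity>" and \<gamma>: "0 < \<gamma>"
  shows "\<exists>C\<ge>0. \<forall>n\<ge>1. \<forall>g\<in>Lspace p. translation_continuous p g \<longrightarrow> g \<in> borel_measurable borel \<longrightarrow>
    (\<exists>Q\<in>trig_polys n. ennpowr (Lnorm p (\<lambda>x. g x - Q x)) (enn2real p)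
      \<le> ennreal C * (\<Sum>k. ennreal (2 powr (real k * \<gamma> * enn2real p)) * ennpowr (Lnorm p (diff_op r (mesh (2 * (6 * n * 2 ^ k))) g)) (enn2real p)))"
proof -
  let ?P = "enn2real p"
  have P: "0 < ?P" by (rule enn2real_pos[OF p])
  from sampling_scheme[OF p(1), where r=r]
  obtain \<eta> C0 where sch: "0 \<le> C0" "\<forall>t. 1 \<le> \<bar>t\<bar> \<longrightarrow> \<eta> t = 0"
    "\<forall>N\<ge>1. \<forall>f\<in>Lspace p. mixed_norm p (\<lambda>l x. sample_op (2 * N) \<eta> f l x - sample_op N \<eta> f l x) \<le> ennreal C0 * Lnorm p (diff_op r (mesh (2 * N)) f)"
    "\<forall>g\<in>Lspace p. translation_continuous p g \<longrightarrow> (p \<noteq> \<infinity> \<longrightarrow> g \<in> borel_measurable borel) \<longrightarrow>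
      (\<forall>e>0. \<exists>N0. \<forall>N\<ge>N0. 1 \<le> N \<longrightarrow> mixed_norm p (\<lambda>l x. g x - sample_op N \<eta> g l x) \<le> ennreal e)"
    by (elim exE conjE)
  from mixed_norm_sum_powr[OF p \<gamma>]
  obtain C1 where C1: "0 \<le> C1" "\<forall>J D. (\<forall>k. family (D k)) \<longrightarrow>
    ennpowr (mixed_norm p (\<lambda>l x. \<Sum>k<J. D k l x)) ?P
    \<le> ennreal C1 * (\<Sum>k<J. ennreal (2 powr (real k * \<gamma> * ?P)) * ennpowr (mixed_norm p (D k)) ?P)"
    by (elim exE conjE)
  let ?q = "(quasi_const p)\<^sup>2"
  have q: "1 \<le> ?q" using quasi_const_ge_1[of p] by (simp add: one_le_power)
  define C where "C = ?q powr ?P * (C1 * C0 powr ?P)"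
  have C0: "0 \<le> C" using C1(1) by (simp add: C_def)
  show ?thesis
  proof (intro exI[of _ C] conjI allI ballI impI C0)
    fix n :: nat and g assume n: "1 \<le> n" and g: "g \<in> Lspace p" and tc: "translation_continuous p g" and gb: "g \<in> borel_measurable borel"
    define N where "N k = 6 * n * 2 ^ k" for k
    have N1: "1 \<le> N k" for k using n by (simp add: N_def)
    let ?T = "\<lambda>k. sample_op (N k) \<eta> g"
    let ?D = "\<lambda>k l x. ?T (Suc k) l x - ?T k l x"
    let ?w = "\<lambda>k. ennreal (2 powr (real k * \<gamma> * ?P))"
    define X where "X = (\<Sum>k. ?w k * ennpowr (Lnorm p (diff_op r (mesh (2 * N k)) g)) ?P)"
    define Y where "Y = ennpowr (ennreal (C1 * C0 powr ?P) * X) (1 / ?P)"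
    have YP: "ennpowr Y ?P = ennreal (C1 * C0 powr ?P) * X"
      unfolding Y_def by (rule ennpowr_ennpowr_inverse(2)[OF P])
    have famT: "family (?T k)" for k by (rule family_sample_op[OF g])
    have famD: "family (?D k)" for k by (intro family_diff famT)
    have Dk: "ennpowr (mixed_norm p (?D k)) ?P \<le> ennreal (C0 powr ?P) * ennpowr (Lnorm p (diff_op r (mesh (2 * N k)) g)) ?P" for k
    proof -
      have "N (Suc k) = 2 * N k" by (simp add: N_def)
      then have "mixed_norm p (?D k) \<le> ennreal C0 * Lnorm p (diff_op r (mesh (2 * N k)) g)"
        using sch(3) N1 g by simp
      then have "ennpowr (mixed_norm p (?D k)) ?P \<le> ennpowr (ennreal C0 * Lnorm p (diff_op r (mesh (2 * N k)) g)) ?P"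
        using P by (intro ennpowr_mono) auto
      then show ?thesis using sch(1) by (simp add: ennpowr_mult ennpowr_ennreal)
    qed
    have sumD: "mixed_norm p (\<lambda>l x. \<Sum>k<J. ?D k l x) \<le> Y" for J
    proof -
      have "ennpowr (mixed_norm p (\<lambda>l x. \<Sum>k<J. ?D k l x)) ?P \<le> ennreal C1 * (\<Sum>k<J. ?w k * ennpowr (mixed_norm p (?D k)) ?P)"
        using C1(2)[rule_format, of ?D J] famD by blast
      also have "\<dots> \<le> ennreal C1 * (\<Sum>k<J. ?w k * (ennreal (C0 powr ?P) * ennpowr (Lnorm p (diff_op r (mesh (2 * N k)) g)) ?P))"
        by (intro mult_left_mono sum_mono Dk) auto
      also have "\<dots> = ennreal (C1 * C0 powr ?P) * (\<Sum>k<J. ?w k * ennpowr (Lnorm p (diff_op r (mesh (2 * N k)) g)) ?P)"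
        using C1(1) unfolding sum_distrib_left by (simp only: ennreal_mult[OF _ powr_ge_zero] mult_ac)
      also have "\<dots> \<le> ennreal (C1 * C0 powr ?P) * X"
        unfolding X_def by (intro mult_left_mono sum_le_suminf) auto
      finally show ?thesis unfolding YP[symmetric] using ennpowr_le_iff[OF P] by blast
    qed
    have main: "mixed_norm p (\<lambda>l x. g x - ?T 0 l x) \<le> ennreal ?q * Y"
    proof (rule ennreal_le_epsilon)
      fix e :: real assume e: "0 < e"
      have "0 < e / ?q" by (intro divide_pos_pos) (use e q in linarith)+
      then obtain N0 where N0: "\<And>N. N0 \<le> N \<Longrightarrow> 1 \<le> N \<Longrightarrow> mixed_norm p (\<lambda>l x. g x - sample_op N \<eta> g l x) \<le> ennreal (e / ?q)"
        using sch(4) g tc gb by meson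
      \<comment> \<open>Level \<open>N0\<close> itself is late enough, since dyadic grids outgrow
        their index.\<close>
      have "N0 \<le> 2 ^ N0" by (rule less_imp_le[OF less_exp])
      also have "\<dots> \<le> N N0" using n by (simp add: N_def)
      finally have lim: "mixed_norm p (\<lambda>l x. g x - ?T N0 l x) \<le> ennreal (e / ?q)" by (intro N0 N1)
      have "mixed_norm p (\<lambda>l x. g x - ?T 0 l x) \<le> ennreal ?q * (mixed_norm p (\<lambda>l x. g x - ?T N0 l x) + mixed_norm p (\<lambda>l x. \<Sum>k<N0. ?D k l x))"
      proof (rule mixed_norm_add_le[OF p(1)])
        show "family (\<lambda>l x. g x - ?T N0 l x)" by (intro family_diff famT Lspace_family[OF g])
        show "family (\<lambda>l x. \<Sum>k<N0. ?D k l x)" by (intro family_sum famD) simp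
        fix l x
        have "(\<Sum>k<N0. ?D k l x) = ?T N0 l x - ?T 0 l x" by (rule sum_lessThan_telescope)
        then have "g x - ?T 0 l x = (g x - ?T N0 l x) + (\<Sum>k<N0. ?D k l x)" by simp
        then show "norm (g x - ?T 0 l x) \<le> norm (g x - ?T N0 l x) + norm (\<Sum>k<N0. ?D k l x)"
          by (simp only: norm_triangle_ineq)
      qed
      also have "\<dots> \<le> ennreal ?q * (ennreal (e / ?q) + Y)"
        by (intro mult_left_mono add_mono lim sumD) simp
      also have "\<dots> = ennreal ?q * Y + ennreal e"
      proof -
        have "x * (e / x) = e" if "1 \<le> x" for x using that by simp
        from this[OF q] have "ennreal ?q * ennreal (e / ?q) = ennreal e"
          using q e by (subst ennreal_mult[symmetric]) (simp_all only: divide_nonneg_nonneg less_imp_le zero_le_power2)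
        then show ?thesis by (simp add: distrib_left add.commute)
      qed
      finally show "mixed_norm p (\<lambda>l x. g x - ?T 0 l x) \<le> ennreal ?q * Y + ennreal e" .
    qed
    have fam0: "family (\<lambda>l x. g x - ?T 0 l x)" by (intro family_diff famT Lspace_family[OF g])
    \<comment> \<open>From here on one grid position is fixed; its operator supplies
      \<open>Q\<close>.\<close>
    have "\<exists>l. ennpowr (Lnorm p (\<lambda>x. g x - ?T 0 l x)) ?P \<le> avg (\<lambda>l. ennpowr (Lnorm p (\<lambda>x. g x - ?T 0 l x)) ?P)"
      by (intro avg_exists_le measurable_ennpowr family_Lnorm_measurable[OF fam0 p(2)])
    then obtain l where l: "ennpowr (Lnorm p (\<lambda>x. g x - ?T 0 l x)) ?P \<le> avg (\<lambda>l. ennpowr (Lnorm p (\<lambda>x. g x - ?T 0 l x)) ?P)" ..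
    note l
    also have "avg (\<lambda>l. ennpowr (Lnorm p (\<lambda>x. g x - ?T 0 l x)) ?P) = ennpowr (mixed_norm p (\<lambda>l x. g x - ?T 0 l x)) ?P"
      unfolding mixed_norm_def by (rule ennpowr_pnorm[OF p, symmetric])
    also have "\<dots> \<le> ennpowr (ennreal ?q * Y) ?P" using P by (intro ennpowr_mono main) auto
    also have "\<dots> = ennreal C * X"
      using q C1(1) by (simp add: ennpowr_mult YP C_def ennpowr_ennreal ennreal_mult mult.assoc)
    finally have "ennpowr (Lnorm p (\<lambda>x. g x - ?T 0 l x)) ?P \<le> ennreal C * X" .
    moreover have "?T 0 l \<in> trig_polys n"
      using sample_op_in_trig_polys[OF n, of \<eta> g l] sch(2) by (simp add: N_def)
    ultimately show "\<exists>Q\<in>trig_polys n. ennpowr (Lnorm p (\<lambda>x. g x - Q x)) ?P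
      \<le> ennreal C * (\<Sum>k. ?w k * ennpowr (Lnorm p (diff_op r (mesh (2 * (6 * n * 2 ^ k))) g)) ?P)"
      unfolding X_def N_def by blast
  qed
qed

lemma AE_lebesgue_shift:
  fixes Q :: "real \<Rightarrow> bool"
  assumes "AE x in lebesgue. Q x" shows "AE x in lebesgue. Q (x + c)"
proof -
  from assms have "AE x in lborel. Q x" by (simp add: AE_completion_iff)
  then obtain N where N: "{x. \<not> Q x} \<subseteq> N" "N \<in> null_sets lborel" by (auto simp: eventually_ae_filter)
  have "{x. x - (- c) \<in> N} \<in> null_sets lborel" by (rule null_sets_translation[OF N(2)])
  moreover have "{x. \<not> Q (x + c)} \<subseteq> {x. x - (- c) \<in> N}" using N(1) by auto
  ultimately have "AE x in lborel. Q (x + c)" by (auto simp: eventually_ae_filter)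
  then show ?thesis by (simp add: AE_completion_iff)
qed

lemma Lnorm_cong_AE:
  assumes "p \<noteq> \<infinity>" "AE x in lebesgue. f x = g x" shows "Lnorm p f = Lnorm p g"
proof -
  have "avg (\<lambda>x. ennpowr (ennreal (norm (f x))) (enn2real p)) = avg (\<lambda>x. ennpowr (ennreal (norm (g x))) (enn2real p))"
    using assms(2) by (intro avg_cong_AE) (auto elim: eventually_mono)
  then show ?thesis unfolding Lnorm_def pnorm_finite_exp[OF assms(1)] by simp
qed

lemma diff_op_cong_AE:
  assumes "AE x in lebesgue. f x = g x" shows "AE x in lebesgue. diff_op r h f x = diff_op r h g x"
proof -
  have "AE x in lebesgue. \<forall>i\<in>{..r}. f (x + real i * h) = g (x + real i * h)"
    by (intro AE_finite_allI AE_lebesgue_shift[OF assms]) auto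
  then show ?thesis by eventually_elim (simp add: diff_op_def)
qed

text \<open>For a merely Lebesgue measurable \<open>g\<close> the map \<open>(\<lambda>, x) \<mapsto> g (x + \<lambda>)\<close> need not be measurable for
  the (uncompleted) product \<open>\<sigma>\<close>-algebra, so convergence is obtained for Borel functions first.\<close>

lemma periodic_borel_representative:
  assumes p: "0 < p" "p \<noteq> \<infinity>" and g: "g \<in> Lspace p"
  shows "\<exists>g'\<in>Lspace p. g' \<in> borel_measurable borel \<and> (AE x in lebesgue. g x = g' x)"
proof -
  note [measurable] = Lspace_measurable[OF g]
  have "(\<lambda>x. Re (g x)) \<in> borel_measurable lebesgue" "(\<lambda>x. Im (g x)) \<in> borel_measurable lebesgue" by measurable
  then obtain u v where uv: "u \<in> borel_measurable lborel" "v \<in> borel_measurable lborel"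
    "AE x in lborel. Re (g x) = u x" "AE x in lborel. Im (g x) = v x"
    using completion_ex_borel_measurable_real by metis
  from uv(3,4) have "AE x in lborel. g x = Complex (u x) (v x)"
    by eventually_elim (simp add: complex_eq_iff)
  then obtain N where N: "{x. g x \<noteq> Complex (u x) (v x)} \<subseteq> N" "N \<in> null_sets lborel"
    by (auto simp: eventually_ae_filter)
  \<comment> \<open>All translates of the exceptional null set by multiples of 2 pi: setting the
    function to 0 there keeps it periodic, and a countable union stays null.\<close>
  define S where "S = (\<Union>k::int. {x. x - 2*pi * of_int k \<in> N})"
  have S0: "S \<in> null_sets lborel" unfolding S_def by (intro null_sets_UN null_sets_translation N)
  have Sper: "x + 2*pi \<in> S \<longleftrightarrow> x \<in> S" for x
  proof
    assume "x + 2*pi \<in> S"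
    then obtain k where "x + 2*pi - 2*pi * of_int k \<in> N" by (auto simp: S_def)
    then have "x - 2*pi * of_int (k - 1) \<in> N" by (simp add: algebra_simps)
    then show "x \<in> S" unfolding S_def by blast
  next
    assume "x \<in> S"
    then obtain k where "x - 2*pi * of_int k \<in> N" by (auto simp: S_def)
    then have "x + 2*pi - 2*pi * of_int (k + 1) \<in> N" by (simp add: algebra_simps)
    then show "x + 2*pi \<in> S" unfolding S_def by blast
  qed
  have NS: "x \<in> S" if "x \<in> N" for x unfolding S_def using that by (auto intro!: exI[of _ 0])
  define g' where "g' x = (if x \<in> S then 0 else Complex (u x) (v x))" for x
  have g'g: "g' x = g x" if "x \<notin> S" for x
  proof -
    have "x \<notin> N" using that NS by blast
    then have "g x = Complex (u x) (v x)" using N(1) by blast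
    then show ?thesis using that by (simp add: g'_def)
  qed
  have AE: "AE x in lebesgue. g x = g' x"
  proof -
    have "AE x in lborel. x \<notin> S" by (rule AE_not_in[OF S0])
    then have "AE x in lborel. g x = g' x" by eventually_elim (simp add: g'g)
    then show ?thesis by (simp add: AE_completion_iff)
  qed
  have "S \<in> sets borel" using S0 by auto
  moreover have "(\<lambda>x. Complex (u x) (v x)) \<in> borel_measurable borel"
    using uv(1,2) by (simp add: borel_measurable_complex_iff)
  ultimately have b: "g' \<in> borel_measurable borel" unfolding g'_def by measurable
  have "g' \<in> Lspace p"
  proof (rule LspaceI)
    show "periodic g'" unfolding periodic_def
    proof
      fix x
      show "g' (x + 2*pi) = g' x"
        using Sper[of x] g'g[of x] g'g[of "x + 2*pi"] Lspace_periodic[OF g]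
        by (cases "x \<in> S") (auto simp: g'_def periodic_def)
    qed
    show "g' \<in> borel_measurable lebesgue" using b by (intro measurable_completion) simp
    show "Lnorm p g' < top" using Lnorm_cong_AE[OF p(2) AE] Lspace_finite[OF p(1) g] by simp
  qed (use p in simp)
  then show ?thesis using b AE by blast
qed

text \<open>Neither side changes when \<open>g\<close> is modified on a null set, so the polynomial
  of a Borel representative serves \<open>g\<close> as well.\<close>

lemma jackson_series:
  assumes p: "0 < p" "p \<noteq> \<infinity>" and \<gamma>: "0 < \<gamma>"
  shows "\<exists>C\<ge>0. \<forall>n\<ge>1. \<forall>g\<in>Lspace p. translation_continuous p g \<longrightarrow>
    (\<exists>Q\<in>trig_polys n. ennpowr (Lnorm p (\<lambda>x. g x - Q x)) (enn2real p)
      \<le> ennreal C * (\<Sum>k. ennreal (2 powr (real k * \<gamma> * enn2real p)) * ennpowr (Lnorm p (diff_op r (mesh (2 * (6 * n * 2 ^ k))) g)) (enn2real p)))"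
proof -
  let ?P = "enn2real p"
  let ?X = "\<lambda>n g. \<Sum>k. ennreal (2 powr (real k * \<gamma> * ?P)) * ennpowr (Lnorm p (diff_op r (mesh (2 * (6 * n * 2 ^ k))) g)) ?P"
  from jackson_series_borel[OF p \<gamma>, where r=r]
  obtain C where C: "0 \<le> C" "\<forall>n\<ge>1. \<forall>g\<in>Lspace p. translation_continuous p g \<longrightarrow> g \<in> borel_measurable borel \<longrightarrow>
    (\<exists>Q\<in>trig_polys n. ennpowr (Lnorm p (\<lambda>x. g x - Q x)) ?P \<le> ennreal C * ?X n g)"
    by (elim exE conjE)
  show ?thesis
  proof (intro exI[of _ C] conjI allI ballI impI C(1))
    fix n :: nat and g assume n: "1 \<le> n" and g: "g \<in> Lspace p" and tc: "translation_continuous p g"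
    obtain g' where g': "g' \<in> Lspace p" "g' \<in> borel_measurable borel" "AE x in lebesgue. g x = g' x"
      using periodic_borel_representative[OF p g] by blast
    have "Lnorm p (\<lambda>x. g' x - g' (x + u)) = Lnorm p (\<lambda>x. g x - g (x + u))" for u
    proof (rule Lnorm_cong_AE[OF p(2)])
      show "AE x in lebesgue. g' x - g' (x + u) = g x - g (x + u)"
        using g'(3) AE_lebesgue_shift[OF g'(3), of u] by eventually_elim simp
    qed
    then have "translation_continuous p g'" using tc by (simp add: translation_continuous_def)
    then obtain Q where Q: "Q \<in> trig_polys n" "ennpowr (Lnorm p (\<lambda>x. g' x - Q x)) ?P \<le> ennreal C * ?X n g'"
      using C(2) n g' by meson
    have "Lnorm p (\<lambda>x. g' x - Q x) = Lnorm p (\<lambda>x. g x - Q x)"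
    proof (rule Lnorm_cong_AE[OF p(2)])
      show "AE x in lebesgue. g' x - Q x = g x - Q x" using g'(3) by eventually_elim simp
    qed
    moreover have "Lnorm p (diff_op r h g') = Lnorm p (diff_op r h g)" for h
    proof (rule Lnorm_cong_AE[OF p(2)])
      show "AE x in lebesgue. diff_op r h g' x = diff_op r h g x"
        using diff_op_cong_AE[OF g'(3), of r h] by eventually_elim simp
    qed
    ultimately show "\<exists>Q\<in>trig_polys n. ennpowr (Lnorm p (\<lambda>x. g x - Q x)) ?P \<le> ennreal C * ?X n g"
      using Q by auto
  qed
qed

lemma mesh_dyadic: "mesh (2 * (6 * n * 2 ^ k)) = mesh (6 * n) / 2 ^ Suc k"
  by simp

text \<open>Only the mixed norm of the differences is bounded, so no single \<open>F l\<close> can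
  be treated at the outset. The series is first averaged over \<open>l\<close>, where the Hoelder
  bound makes it geometric, and then some \<open>l\<close> below the average is chosen.\<close>

lemma jackson_mixed:
  assumes p: "0 < p" "p \<noteq> \<infinity>" and \<alpha>: "0 < \<alpha>"
  shows "\<exists>C\<ge>0. \<forall>n\<ge>1. \<forall>F. \<forall>M\<ge>0. family F \<longrightarrow> (\<forall>l. F l \<in> Lspace p \<and> translation_continuous p (F l)) \<longrightarrow>
    (\<forall>h>0. mixed_norm p (\<lambda>l. diff_op r h (F l)) \<le> ennreal (M * h powr \<alpha>)) \<longrightarrow>
    (\<exists>l. \<exists>Q\<in>trig_polys n. Lnorm p (\<lambda>x. F l x - Q x) \<le> ennreal (C * M * mesh (6 * n) powr \<alpha>))"
proof -
  let ?P = "enn2real p"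
  have P: "0 < ?P" by (rule enn2real_pos[OF p])
  \<comment> \<open>The weights grow like 2^(k \<gamma> P) while the differences decay like 2^(-k
    \<alpha> P); half of \<alpha> leaves the convergent factor 2^(-k \<gamma> P).\<close>
  define \<gamma> where "\<gamma> = \<alpha> / 2"
  have \<gamma>: "0 < \<gamma>" using \<alpha> by (simp add: \<gamma>_def)
  let ?w = "\<lambda>k. 2 powr (real k * \<gamma> * ?P)"
  let ?X = "\<lambda>n g. \<Sum>k. ennreal (?w k) * ennpowr (Lnorm p (diff_op r (mesh (2 * (6 * n * 2 ^ k))) g)) ?P"
  from jackson_series[OF p \<gamma>, where r=r]
  obtain C where C: "0 \<le> C" "\<forall>n\<ge>1. \<forall>g\<in>Lspace p. translation_continuous p g \<longrightarrow>
    (\<exists>Q\<in>trig_polys n. ennpowr (Lnorm p (\<lambda>x. g x - Q x)) ?P \<le> ennreal C * ?X n g)"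
    by (elim exE conjE)
  define y where "y = 2 powr (- (\<gamma> * ?P))"
  have y: "0 < y" "y < 1" using \<gamma> P by (auto simp: y_def powr_less_one)
  have yk: "2 powr (- (real k * \<gamma> * ?P)) = y ^ k" for k
    unfolding y_def by (simp add: powr_powr mult_ac flip: powr_realpow)
  define C' where "C' = (C / (1 - y)) powr (1 / ?P)"
  show ?thesis
  proof (rule exI[of _ C'], intro conjI allI impI)
    show "0 \<le> C'" by (simp add: C'_def)
    fix n :: nat and F and M :: real assume n: "1 \<le> n" and M: "0 \<le> M" and fam: "family F"
      and F: "\<forall>l. F l \<in> Lspace p \<and> translation_continuous p (F l)"
      and bd: "\<forall>h>0. mixed_norm p (\<lambda>l. diff_op r h (F l)) \<le> ennreal (M * h powr \<alpha>)"
    define \<delta> where "\<delta> = mesh (6 * n)"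
    have \<delta>: "0 < \<delta>" using n by (simp add: \<delta>_def)
    let ?L = "\<lambda>k l. ennpowr (Lnorm p (diff_op r (\<delta> / 2 ^ Suc k) (F l))) ?P"
    define R where "R l = (\<Sum>k. ennreal (?w k) * ?L k l)" for l
    have mL: "?L k \<in> borel_measurable lebesgue" for k
      by (intro measurable_ennpowr family_Lnorm_measurable[OF _ p(2)] family_diff_op fam)
    have "avg R = (\<Sum>k. ennreal (?w k) * avg (?L k))"
      unfolding R_def using mL by (simp add: avg_suminf avg_cmult)
    also have "\<dots> \<le> (\<Sum>k. ennreal ((M * \<delta> powr \<alpha>) powr ?P * y ^ k))"
    proof (intro suminf_le allI)
      fix k
      let ?h = "\<delta> / 2 ^ Suc k"
      have h: "0 < ?h" using \<delta> by simp
      have "avg (?L k) = ennpowr (mixed_norm p (\<lambda>l. diff_op r ?h (F l))) ?P"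
        unfolding mixed_norm_def by (rule ennpowr_pnorm[OF p, symmetric])
      also have "\<dots> \<le> ennpowr (ennreal (M * ?h powr \<alpha>)) ?P"
        using bd[rule_format, OF h] P by (intro ennpowr_mono) auto
      also have "\<dots> = ennreal ((M * ?h powr \<alpha>) powr ?P)" using M by (simp add: ennpowr_ennreal)
      finally have "ennreal (?w k) * avg (?L k) \<le> ennreal (?w k) * ennreal ((M * ?h powr \<alpha>) powr ?P)"
        by (rule mult_left_mono) simp
      also have "\<dots> = ennreal (?w k * (M * ?h powr \<alpha>) powr ?P)" by (rule ennreal_mult[symmetric]) auto
      also have "\<dots> \<le> ennreal ((M * \<delta> powr \<alpha>) powr ?P * y ^ k)"
      proof (rule ennreal_leI)
        have "?h powr \<alpha> = \<delta> powr \<alpha> / (2 ^ Suc k) powr \<alpha>" by (rule powr_divide)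
        also have "(2 ^ Suc k :: real) powr \<alpha> = 2 powr (real (Suc k) * \<alpha>)"
          by (subst powr_realpow[symmetric]) (simp_all add: powr_powr)
        also have "\<delta> powr \<alpha> / \<dots> = \<delta> powr \<alpha> * 2 powr (- (real (Suc k) * \<alpha>))"
          by (simp add: powr_minus divide_inverse)
        finally have "(M * ?h powr \<alpha>) powr ?P = ((M * \<delta> powr \<alpha>) * 2 powr (- (real (Suc k) * \<alpha>))) powr ?P"
          by (simp only: mult.assoc)
        also have "\<dots> = (M * \<delta> powr \<alpha>) powr ?P * 2 powr (- (real (Suc k) * \<alpha> * ?P))"
          by (subst powr_mult) (simp add: powr_powr)
        finally have "?w k * (M * ?h powr \<alpha>) powr ?P = (M * \<delta> powr \<alpha>) powr ?P * (2 powr (real k * \<gamma> * ?P) * 2 powr (- (real (Suc k) * \<alpha> * ?P)))"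
          by (simp only: mult_ac)
        also have "2 powr (real k * \<gamma> * ?P) * 2 powr (- (real (Suc k) * \<alpha> * ?P)) = 2 powr (real k * \<gamma> * ?P - real (Suc k) * \<alpha> * ?P)"
          by (simp add: powr_add[symmetric])
        also have "\<dots> \<le> 2 powr (- (real k * \<gamma> * ?P))"
        proof (rule powr_mono)
          have "real k * \<gamma> * ?P + real k * \<gamma> * ?P = real k * \<alpha> * ?P" by (simp add: \<gamma>_def)
          also have "\<dots> \<le> real (Suc k) * \<alpha> * ?P" using \<alpha> P by (intro mult_right_mono) auto
          finally show "real k * \<gamma> * ?P - real (Suc k) * \<alpha> * ?P \<le> - (real k * \<gamma> * ?P)" by linarith
        qed simp
        finally show "?w k * (M * ?h powr \<alpha>) powr ?P \<le> (M * \<delta> powr \<alpha>) powr ?P * y ^ k"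
          unfolding yk by (simp add: mult_left_mono)
      qed
      finally show "ennreal (?w k) * avg (?L k) \<le> ennreal ((M * \<delta> powr \<alpha>) powr ?P * y ^ k)" .
    qed auto
    also have "\<dots> = ennreal ((M * \<delta> powr \<alpha>) powr ?P * (1 / (1 - y)))"
      using y by (intro suminf_ennreal_eq sums_mult geometric_sums) auto
    finally have avgR: "avg R \<le> ennreal ((M * \<delta> powr \<alpha>) powr ?P * (1 / (1 - y)))" .
    have "R \<in> borel_measurable lebesgue"
      unfolding R_def using mL by (intro borel_measurable_suminf_order borel_measurable_times) auto
    then obtain l where l: "R l \<le> avg R" using avg_exists_le by blast
    obtain Q where Q: "Q \<in> trig_polys n" "ennpowr (Lnorm p (\<lambda>x. F l x - Q x)) ?P \<le> ennreal C * ?X n (F l)"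
      using C(2) n F by meson
    note Q(2)
    also have "?X n (F l) = R l" unfolding R_def mesh_dyadic \<delta>_def ..
    also have "ennreal C * R l \<le> ennreal C * ennreal ((M * \<delta> powr \<alpha>) powr ?P * (1 / (1 - y)))"
      using l avgR by (intro mult_left_mono) auto
    also have "\<dots> = ennreal (C / (1 - y) * (M * \<delta> powr \<alpha>) powr ?P)"
      using C(1) y by (subst ennreal_mult[symmetric]) (auto simp: mult_ac)
    also have "\<dots> = ennpowr (ennreal (C' * M * \<delta> powr \<alpha>)) ?P"
    proof -
      have "C' powr ?P = C / (1 - y)" using P C(1) y by (simp add: C'_def powr_powr)
      then have "C / (1 - y) * (M * \<delta> powr \<alpha>) powr ?P = (C' * (M * \<delta> powr \<alpha>)) powr ?P"
        by (simp only: powr_mult)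
      then show ?thesis using M by (subst ennpowr_ennreal) (auto simp: C'_def mult.assoc)
    qed
    finally have "Lnorm p (\<lambda>x. F l x - Q x) \<le> ennreal (C' * M * \<delta> powr \<alpha>)"
      using ennpowr_le_iff[OF P] by blast
    then show "\<exists>l. \<exists>Q\<in>trig_polys n. Lnorm p (\<lambda>x. F l x - Q x) \<le> ennreal (C' * M * mesh (6 * n) powr \<alpha>)"
      using Q(1) unfolding \<delta>_def by blast
  qed
qed

text \<open>At \<open>p = \<infinity>\<close> the errors are bounded uniformly in the grid position
  and the triangle inequality holds, so a geometric series of ratio
  \<open>2 powr (- \<alpha>)\<close> replaces averaging and weights.\<close>

lemma jackson_top:
  assumes \<alpha>: "0 < \<alpha>"
  shows "\<exists>C\<ge>0. \<forall>n\<ge>1. \<forall>g\<in>Lspace \<infinity>. \<forall>A\<ge>0. translation_continuous \<infinity> g \<longrightarrow>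
    (\<forall>h>0. Lnorm \<infinity> (diff_op r h g) \<le> ennreal (A * h powr \<alpha>)) \<longrightarrow>
    (\<exists>Q\<in>trig_polys n. Lnorm \<infinity> (\<lambda>x. g x - Q x) \<le> ennreal (C * A * mesh (6 * n) powr \<alpha>))"
proof -
  have p: "(0::ennreal) < \<infinity>" by simp
  from sampling_scheme[OF p, where r=r]
  obtain \<eta> C0 where sch: "0 \<le> C0" "\<forall>t. 1 \<le> \<bar>t\<bar> \<longrightarrow> \<eta> t = 0"
    "\<forall>N\<ge>1. \<forall>f\<in>Lspace \<infinity>. mixed_norm \<infinity> (\<lambda>l x. sample_op (2 * N) \<eta> f l x - sample_op N \<eta> f l x) \<le> ennreal C0 * Lnorm \<infinity> (diff_op r (mesh (2 * N)) f)"
    "\<forall>g\<in>Lspace \<infinity>. translation_continuous \<infinity> g \<longrightarrow> ((\<infinity>::ennreal) \<noteq> \<infinity> \<longrightarrow> g \<in> borel_measurable borel) \<longrightarrow>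
      (\<forall>e>0. \<exists>N0. \<forall>N\<ge>N0. 1 \<le> N \<longrightarrow> mixed_norm \<infinity> (\<lambda>l x. g x - sample_op N \<eta> g l x) \<le> ennreal e)"
    by (elim exE conjE)
  define y where "y = 2 powr (- \<alpha>)"
  have y: "0 < y" "y < 1" using \<alpha> by (auto simp: y_def powr_less_one)
  define C where "C = C0 / (1 - y)"
  have bound: "norm (F l x) \<le> c" if "mixed_norm \<infinity> F \<le> ennreal c" "0 \<le> c" for F l x c
  proof -
    have "ennreal (norm (F l x)) \<le> mixed_norm \<infinity> F"
      unfolding mixed_norm_top by (rule SUP_upper2[of l]) (auto intro: SUP_upper)
    also note that(1)
    finally show ?thesis using that(2) by (simp add: ennreal_le_iff)
  qed
  show ?thesis
  proof (intro exI[of _ C] conjI allI ballI impI)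
    show "0 \<le> C" using sch(1) y by (simp add: C_def)
    fix n :: nat and g and A :: real assume n: "1 \<le> n" and g: "g \<in> Lspace \<infinity>" and A: "0 \<le> A" and tc: "translation_continuous \<infinity> g"
      and bd: "\<forall>h>0. Lnorm \<infinity> (diff_op r h g) \<le> ennreal (A * h powr \<alpha>)"
    define \<delta> where "\<delta> = mesh (6 * n)"
    have \<delta>: "0 < \<delta>" using n by (simp add: \<delta>_def)
    define N where "N k = 6 * n * 2 ^ k" for k
    have N1: "1 \<le> N k" for k using n by (simp add: N_def)
    let ?T = "\<lambda>k. sample_op (N k) \<eta> g"
    let ?c = "C0 * (A * \<delta> powr \<alpha>)"
    have c0: "0 \<le> ?c" using sch(1) A by simp
    have D: "norm (?T (Suc k) l x - ?T k l x) \<le> ?c * y ^ k" for k l x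
    proof (rule bound)
      have h: "mesh (2 * N k) = \<delta> / 2 ^ Suc k" unfolding N_def \<delta>_def by (rule mesh_dyadic)
      have NS: "N (Suc k) = 2 * N k" by (simp add: N_def)
      have hp: "(\<delta> / 2 ^ Suc k) powr \<alpha> \<le> \<delta> powr \<alpha> * y ^ k"
      proof -
        have "(\<delta> / 2 ^ Suc k) powr \<alpha> \<le> (\<delta> / 2 ^ k) powr \<alpha>"
          using \<delta> \<alpha> by (intro powr_mono2 divide_left_mono) auto
        also have "\<dots> = \<delta> powr \<alpha> / (2 ^ k) powr \<alpha>" by (rule powr_divide)
        also have "(2 ^ k :: real) powr \<alpha> = 2 powr (real k * \<alpha>)"
          by (subst powr_realpow[symmetric]) (simp_all add: powr_powr)
        also have "\<delta> powr \<alpha> / \<dots> = \<delta> powr \<alpha> * 2 powr (- (real k * \<alpha>))"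
          by (simp add: powr_minus divide_inverse)
        also have "2 powr (- (real k * \<alpha>)) = y ^ k"
          unfolding y_def by (simp add: powr_powr mult_ac flip: powr_realpow)
        finally show ?thesis .
      qed
      have "mixed_norm \<infinity> (\<lambda>l x. ?T (Suc k) l x - ?T k l x) \<le> ennreal C0 * Lnorm \<infinity> (diff_op r (\<delta> / 2 ^ Suc k) g)"
        using sch(3) N1 g h NS by metis
      also have "\<dots> \<le> ennreal C0 * ennreal (A * (\<delta> / 2 ^ Suc k) powr \<alpha>)"
        using \<delta> bd by (intro mult_left_mono) auto
      also have "\<dots> = ennreal (C0 * (A * (\<delta> / 2 ^ Suc k) powr \<alpha>))"
        using sch(1) A by (intro ennreal_mult[symmetric]) auto
      also have "\<dots> \<le> ennreal (?c * y ^ k)"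
      proof (rule ennreal_leI)
        have "C0 * (A * (\<delta> / 2 ^ Suc k) powr \<alpha>) \<le> C0 * (A * (\<delta> powr \<alpha> * y ^ k))"
          using hp sch(1) A by (intro mult_left_mono)
        then show "C0 * (A * (\<delta> / 2 ^ Suc k) powr \<alpha>) \<le> ?c * y ^ k" by (simp only: mult.assoc)
      qed
      finally show "mixed_norm \<infinity> (\<lambda>l x. ?T (Suc k) l x - ?T k l x) \<le> ennreal (?c * y ^ k)" .
      show "0 \<le> ?c * y ^ k" using c0 y by simp
    qed
    have main: "norm (g x - ?T 0 l x) \<le> C * A * \<delta> powr \<alpha>" for l x
    proof (rule field_le_epsilon)
      fix e :: real assume e: "0 < e"
      then obtain N0 where N0: "\<And>N. N0 \<le> N \<Longrightarrow> 1 \<le> N \<Longrightarrow> mixed_norm \<infinity> (\<lambda>l x. g x - sample_op N \<eta> g l x) \<le> ennreal e"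
        using sch(4) g tc by meson
      have "N0 \<le> 2 ^ N0" by (rule less_imp_le[OF less_exp])
      also have "\<dots> \<le> N N0" using n by (simp add: N_def)
      finally have "N0 \<le> N N0" .
      then have lim: "norm (g x - ?T N0 l x) \<le> e"
        using bound[OF N0[OF \<open>N0 \<le> N N0\<close> N1], where l=l and x=x] e by simp
      have "(\<Sum>k<N0. ?T (Suc k) l x - ?T k l x) = ?T N0 l x - ?T 0 l x" by (rule sum_lessThan_telescope)
      then have "g x - ?T 0 l x = (g x - ?T N0 l x) + (\<Sum>k<N0. ?T (Suc k) l x - ?T k l x)" by simp
      then have "norm (g x - ?T 0 l x) \<le> norm (g x - ?T N0 l x) + norm (\<Sum>k<N0. ?T (Suc k) l x - ?T k l x)"
        by (simp only: norm_triangle_ineq)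
      moreover have "norm (\<Sum>k<N0. ?T (Suc k) l x - ?T k l x) \<le> (\<Sum>k<N0. ?c * y ^ k)"
        by (rule sum_norm_le) (rule D)
      moreover have "(\<Sum>k<N0. ?c * y ^ k) \<le> ?c * (1 / (1 - y))"
        unfolding sum_distrib_left[symmetric]
        using sum_le_suminf[OF summable_geometric, of y "{..<N0}"] y c0
        by (intro mult_left_mono) (auto simp: suminf_geometric)
      moreover have "?c * (1 / (1 - y)) = C * A * \<delta> powr \<alpha>" by (simp add: C_def)
      ultimately show "norm (g x - ?T 0 l x) \<le> C * A * \<delta> powr \<alpha> + e" using lim by linarith
    qed
    \<comment> \<open>The bound being uniform, any grid position will do.\<close>
    have "?T 0 0 \<in> trig_polys n"
      using sample_op_in_trig_polys[OF n, of \<eta> g 0] sch(2) by (simp add: N_def)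
    moreover have "Lnorm \<infinity> (\<lambda>x. g x - ?T 0 0 x) \<le> ennreal (C * A * \<delta> powr \<alpha>)"
      by (rule Lnorm_le_bound[OF p main])
    ultimately show "\<exists>Q\<in>trig_polys n. Lnorm \<infinity> (\<lambda>x. g x - Q x) \<le> ennreal (C * A * mesh (6 * n) powr \<alpha>)"
      unfolding \<delta>_def by blast
  qed
qed

lemma jackson:
  assumes p: "0 < p" and \<alpha>: "0 < \<alpha>"
  shows "\<exists>C\<ge>0. \<forall>n\<ge>1. \<forall>g\<in>Lspace p. \<forall>A\<ge>0. translation_continuous p g \<longrightarrow>
    (\<forall>h>0. Lnorm p (diff_op r h g) \<le> ennreal (A * h powr \<alpha>)) \<longrightarrow>
    (\<exists>Q\<in>trig_polys n. Lnorm p (\<lambda>x. g x - Q x) \<le> ennreal (C * A * mesh (6 * n) powr \<alpha>))"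
proof (cases "p = \<infinity>")
  case True
  then show ?thesis using jackson_top[OF \<alpha>, where r=r] by simp
next
  case False
  from jackson_mixed[OF p False \<alpha>, where r=r]
  obtain C where C: "0 \<le> C" "\<forall>n\<ge>1. \<forall>F. \<forall>M\<ge>0. family F \<longrightarrow> (\<forall>l. F l \<in> Lspace p \<and> translation_continuous p (F l)) \<longrightarrow>
    (\<forall>h>0. mixed_norm p (\<lambda>l. diff_op r h (F l)) \<le> ennreal (M * h powr \<alpha>)) \<longrightarrow>
    (\<exists>l. \<exists>Q\<in>trig_polys n. Lnorm p (\<lambda>x. F l x - Q x) \<le> ennreal (C * M * mesh (6 * n) powr \<alpha>))"
    by (elim exE conjE)
  show ?thesis
  proof (intro exI[of _ C] conjI allI ballI impI C(1))
    fix n :: nat and g and A :: real assume n: "1 \<le> n" and g: "g \<in> Lspace p" and A: "0 \<le> A" and tc: "translation_continuous p g"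
      and bd: "\<forall>h>0. Lnorm p (diff_op r h g) \<le> ennreal (A * h powr \<alpha>)"
    have "\<forall>h>0. mixed_norm p (\<lambda>l. diff_op r h g) \<le> ennreal (A * h powr \<alpha>)"
      using bd by (simp add: mixed_norm_const[OF p])
    then show "\<exists>Q\<in>trig_polys n. Lnorm p (\<lambda>x. g x - Q x) \<le> ennreal (C * A * mesh (6 * n) powr \<alpha>)"
      using C(2)[rule_format, OF n A, of "\<lambda>_. g"] Lspace_family[OF g] g tc by blast
  qed
qed

section \<open>The commutator of means and differences\<close>

lemma translation_continuous_diff:
  assumes p: "0 < p" and f: "f \<in> Lspace p" "translation_continuous p f" and g: "g \<in> Lspace p" "translation_continuous p g"
  shows "translation_continuous p (\<lambda>x. f x - g x)"
  unfolding translation_continuous_def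
proof (intro allI impI)
  fix e :: real assume e: "0 < e"
  let ?q = "quasi_const p"
  have q: "1 \<le> ?q" by (rule quasi_const_ge_1)
  define e' where "e' = e / (2 * ?q)"
  have e': "0 < e'" "?q * (e' + e') = e" using e q by (auto simp: e'_def)
  from f(2) e'(1) obtain \<rho>1 where \<rho>1: "0 < \<rho>1" "\<forall>u. norm (1 - cis u) < \<rho>1 \<longrightarrow> Lnorm p (\<lambda>x. f x - f (x + u)) \<le> ennreal e'"
    unfolding translation_continuous_def by meson
  from g(2) e'(1) obtain \<rho>2 where \<rho>2: "0 < \<rho>2" "\<forall>u. norm (1 - cis u) < \<rho>2 \<longrightarrow> Lnorm p (\<lambda>x. g x - g (x + u)) \<le> ennreal e'"
    unfolding translation_continuous_def by meson
  show "\<exists>\<rho>>0. \<forall>u. norm (1 - cis u) < \<rho> \<longrightarrow> Lnorm p (\<lambda>x. f x - g x - (f (x + u) - g (x + u))) \<le> ennreal e"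
  proof (intro exI[of _ "min \<rho>1 \<rho>2"] conjI allI impI)
    show "0 < min \<rho>1 \<rho>2" using \<rho>1 \<rho>2 by simp
    fix u assume u: "norm (1 - cis u) < min \<rho>1 \<rho>2"
    have "Lnorm p (\<lambda>x. f x - g x - (f (x + u) - g (x + u))) \<le> ennreal ?q * (Lnorm p (\<lambda>x. f x - f (x + u)) + Lnorm p (\<lambda>x. g x - g (x + u)))"
    proof (intro Lspace_norm_add_le p Lspace_diff Lspace_shift f g)
      fix x
      have "f x - g x - (f (x + u) - g (x + u)) = (f x - f (x + u)) - (g x - g (x + u))" by simp
      then show "norm (f x - g x - (f (x + u) - g (x + u))) \<le> norm (f x - f (x + u)) + norm (g x - g (x + u))"
        by (simp only: norm_triangle_ineq4)
    qed
    also have "\<dots> \<le> ennreal ?q * (ennreal e' + ennreal e')"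
      using u \<rho>1(2) \<rho>2(2) by (intro mult_left_mono add_mono) auto
    also have "\<dots> = ennreal e"
      using e' q by (subst ennreal_plus[symmetric], simp, simp, subst ennreal_mult[symmetric], simp, simp) simp
    finally show "Lnorm p (\<lambda>x. f x - g x - (f (x + u) - g (x + u))) \<le> ennreal e" .
  qed
qed

text \<open>The bound forces the r-th differences to vanish with the step; the descent to first
  differences gives continuity of translations.\<close>

lemma translation_continuous_holder:
  assumes p: "0 < p" and f: "f \<in> Lspace p" and r: "1 \<le> r" and \<alpha>: "0 < \<alpha>" and A: "0 \<le> A"
    and bd: "\<forall>h>0. Lnorm p (diff_op r h f) \<le> ennreal (A * h powr \<alpha>)"
  shows "translation_continuous p f"
proof (rule translation_continuousI[OF p f vanishing_diff_op_1[OF p f r]])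
  show "vanishing (\<lambda>h. Lnorm p (diff_op r h f))"
    unfolding vanishing_def
  proof (intro allI impI)
    fix e :: real assume e: "0 < e"
    define \<rho> where "\<rho> = (e / (A + 1)) powr (1 / \<alpha>)"
    have eA: "0 < e / (A + 1)" using e A by (intro divide_pos_pos) auto
    show "\<exists>\<rho>>0. \<forall>h. 0 < h \<longrightarrow> h \<le> \<rho> \<longrightarrow> Lnorm p (diff_op r h f) \<le> ennreal e"
    proof (intro exI[of _ \<rho>] conjI allI impI)
      show "0 < \<rho>" unfolding \<rho>_def powr_gt_zero using eA by linarith
      fix h :: real assume h: "0 < h" "h \<le> \<rho>"
      have "h powr \<alpha> \<le> \<rho> powr \<alpha>" using h \<alpha> by (intro powr_mono2) auto
      also have "\<dots> = e / (A + 1)" unfolding \<rho>_def using \<alpha> e A by (simp add: powr_powr)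
      finally have "A * h powr \<alpha> \<le> (A + 1) * (e / (A + 1))"
        using A eA by (intro mult_mono) auto
      then have "A * h powr \<alpha> \<le> e" using A by simp
      then show "Lnorm p (diff_op r h f) \<le> ennreal e"
        using bd h(1) by (meson ennreal_leI order_trans)
    qed
  qed
qed

text \<open>A polynomial is Lipschitz with constant the sum of |c \<nu>| |\<nu>|, so the previous
  lemma applies with order 1 and exponent 1.\<close>

lemma translation_continuous_trig_poly:
  assumes p: "0 < p" and T: "T \<in> trig_polys n"
  shows "translation_continuous p T"
proof -
  obtain c where Tc: "T = (\<lambda>x. \<Sum>\<nu>\<in>{- int n..int n}. c \<nu> * expo \<nu> x)"
    using T by (auto simp: trig_polys_def)
  define A where "A = (\<Sum>\<nu>\<in>{- int n..int n}. norm (c \<nu>) * \<bar>real_of_int \<nu>\<bar>)"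
  have A0: "0 \<le> A" unfolding A_def by (intro sum_nonneg) auto
  have "\<forall>h>0. Lnorm p (diff_op 1 h T) \<le> ennreal (A * h powr 1)"
  proof (intro allI impI)
    fix h :: real assume h: "0 < h"
    have "norm (diff_op 1 h T x) \<le> A * h powr 1" for x
    proof -
      have eq: "diff_op 1 h T x = (\<Sum>\<nu>\<in>{- int n..int n}. c \<nu> * ((1 - cis (of_int \<nu> * h)) ^ 1 * expo \<nu> x))"
        unfolding Tc by (simp only: diff_op_sum diff_op_cmult diff_op_expo)
      have "norm (diff_op 1 h T x) \<le> (\<Sum>\<nu>\<in>{- int n..int n}. norm (c \<nu>) * (\<bar>real_of_int \<nu>\<bar> * h))"
        unfolding eq
      proof (rule sum_norm_le)
        fix \<nu>
        have "norm (1 - cis (of_int \<nu> * h)) \<le> \<bar>real_of_int \<nu>\<bar> * h"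
          using norm_cis_minus_1_le[of "of_int \<nu> * h"] h by (simp add: norm_minus_commute abs_mult)
        then show "norm (c \<nu> * ((1 - cis (of_int \<nu> * h)) ^ 1 * expo \<nu> x)) \<le> norm (c \<nu>) * (\<bar>real_of_int \<nu>\<bar> * h)"
          by (simp add: norm_mult mult_left_mono)
      qed
      also have "\<dots> = A * h powr 1" using h by (simp add: A_def sum_distrib_right mult.assoc)
      finally show ?thesis .
    qed
    then show "Lnorm p (diff_op 1 h T) \<le> ennreal (A * h powr 1)" by (rule Lnorm_le_bound[OF p])
  qed
  then show ?thesis
    by (rule translation_continuous_holder[OF p trig_polys_Lspace[OF p T] _ _ A0, rotated 2]) auto
qed

text \<open>The common form of the suprema in \<open>Hnorm\<close>, \<open>mixed_Hnorm\<close> and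
  \<open>w_H\<close>, so that they can be compared step by step in \<open>h\<close>.\<close>

definition holder_sup :: "real \<Rightarrow> (real \<Rightarrow> ennreal) \<Rightarrow> ennreal" where
  "holder_sup \<alpha> X = (SUP h\<in>{0<..}. X h / ennreal (h powr \<alpha>))"

lemma holder_sup_le_iff:
  "holder_sup \<alpha> X \<le> c \<longleftrightarrow> (\<forall>h>0. X h \<le> c * ennreal (h powr \<alpha>))"
proof -
  have "a / b \<le> c \<longleftrightarrow> a \<le> c * b" if "b \<noteq> 0" "b \<noteq> top" for a b :: ennreal
  proof
    assume "a / b \<le> c"
    then have "a / b * b \<le> c * b" by (rule mult_right_mono) simp
    moreover have "b / b = 1" using that by (intro ennreal_divide_self) (auto simp: less_top)
    ultimately show "a \<le> c * b" by (simp add: ennreal_divide_times)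
  next
    assume "a \<le> c * b"
    then have "a / b \<le> c * b / b" by (rule divide_right_mono_ennreal)
    then show "a / b \<le> c" using that by (simp add: ennreal_mult_divide_eq)
  qed
  from this[of "ennreal (h powr \<alpha>)" for h] have "X h / ennreal (h powr \<alpha>) \<le> c \<longleftrightarrow> X h \<le> c * ennreal (h powr \<alpha>)" if "0 < h" for h
    using that by simp
  then show ?thesis unfolding holder_sup_def by (auto simp: SUP_le_iff)
qed

lemma holder_sup_upper: "0 < h \<Longrightarrow> X h \<le> holder_sup \<alpha> X * ennreal (h powr \<alpha>)"
  using holder_sup_le_iff[of \<alpha> X "holder_sup \<alpha> X"] by simp

lemma holder_sup_mono: "(\<And>h. X h \<le> Y h) \<Longrightarrow> holder_sup \<alpha> X \<le> holder_sup \<alpha> Y"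
  by (auto simp: holder_sup_def intro!: SUP_mono' divide_right_mono_ennreal)

lemma holder_sup_leI:
  assumes "0 \<le> A" "\<And>h. 0 < h \<Longrightarrow> X h \<le> ennreal (A * h powr \<alpha>)" shows "holder_sup \<alpha> X \<le> ennreal A"
  using assms by (simp add: holder_sup_le_iff ennreal_mult)

lemma holder_sup_real:
  assumes "holder_sup \<alpha> X \<le> ennreal A" "0 \<le> A" "0 < h" shows "X h \<le> ennreal (A * h powr \<alpha>)"
  using assms by (simp add: holder_sup_le_iff ennreal_mult)

text \<open>For \<open>h\<close> below the mesh, the r-th power of their ratio is at most the power
  \<alpha>, because \<alpha> \<le> r. A bound at the single step \<open>mesh (6 * n)\<close> thus
  spreads to all smaller steps.\<close>

lemma bernstein_family:
  assumes p: "0 < p" and \<alpha>: "\<alpha> \<le> real r"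
  shows "\<exists>C\<ge>0. \<forall>n\<ge>1. \<forall>G. \<forall>b\<ge>0. family G \<longrightarrow> (\<forall>l. G l \<in> trig_polys n) \<longrightarrow>
    mixed_norm p (\<lambda>l. diff_op r (mesh (6 * n)) (G l)) \<le> ennreal (b * mesh (6 * n) powr \<alpha>) \<longrightarrow>
    (\<forall>h. 0 < h \<longrightarrow> h \<le> mesh (6 * n) \<longrightarrow> mixed_norm p (\<lambda>l. diff_op r h (G l)) \<le> ennreal (C * b * h powr \<alpha>))"
proof -
  from bernstein[OF p, where r=r]
  obtain C where C: "0 \<le> C" "\<forall>n\<ge>1. \<forall>T\<in>trig_polys n. \<forall>h. 0 < h \<longrightarrow> h \<le> mesh (6 * n) \<longrightarrow>
    Lnorm p (diff_op r h T) \<le> ennreal (C * (h / mesh (6 * n)) ^ r) * Lnorm p (diff_op r (mesh (6 * n)) T)"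
    by (elim exE conjE)
  show ?thesis
  proof (rule exI[of _ C], intro conjI allI impI C(1))
    fix n :: nat and G and b h :: real
    assume n: "1 \<le> n" and b: "0 \<le> b" and fam: "family G" and G: "\<forall>l. G l \<in> trig_polys n"
      and bd: "mixed_norm p (\<lambda>l. diff_op r (mesh (6 * n)) (G l)) \<le> ennreal (b * mesh (6 * n) powr \<alpha>)"
      and h: "0 < h" "h \<le> mesh (6 * n)"
    define \<delta> where "\<delta> = mesh (6 * n)"
    have \<delta>: "0 < \<delta>" "h \<le> \<delta>" using n h by (auto simp: \<delta>_def)
    have "mixed_norm p (\<lambda>l. diff_op r h (G l)) \<le> ennreal (C * (h / \<delta>) ^ r) * mixed_norm p (\<lambda>l. diff_op r \<delta> (G l))"
    proof (rule mixed_norm_le_cmult_Lnorm[OF p family_diff_op[OF fam]])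
      fix l
      show "Lnorm p (diff_op r h (G l)) \<le> ennreal (C * (h / \<delta>) ^ r) * Lnorm p (diff_op r \<delta> (G l))"
        unfolding \<delta>_def using C(2) n G h by blast
    qed
    also have "\<dots> \<le> ennreal (C * (h / \<delta>) ^ r) * ennreal (b * \<delta> powr \<alpha>)"
      using bd unfolding \<delta>_def by (rule mult_left_mono) simp
    also have "\<dots> = ennreal (C * (h / \<delta>) ^ r * (b * \<delta> powr \<alpha>))"
      using C(1) b h \<delta> by (intro ennreal_mult[symmetric]) auto
    also have "\<dots> \<le> ennreal (C * b * h powr \<alpha>)"
    proof (rule ennreal_leI)
      have "(h / \<delta>) ^ r = (h / \<delta>) powr (real r)" using h \<delta> by (simp add: powr_realpow)
      also have "\<dots> \<le> (h / \<delta>) powr \<alpha>" using h \<delta> \<alpha> by (intro powr_mono') auto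
      also have "\<dots> = h powr \<alpha> / \<delta> powr \<alpha>" by (rule powr_divide)
      finally have "(h / \<delta>) ^ r * \<delta> powr \<alpha> \<le> h powr \<alpha>" using \<delta> by (simp add: le_divide_eq)
      then have "C * b * ((h / \<delta>) ^ r * \<delta> powr \<alpha>) \<le> C * b * h powr \<alpha>"
        using C(1) b by (intro mult_left_mono) auto
      then show "C * (h / \<delta>) ^ r * (b * \<delta> powr \<alpha>) \<le> C * b * h powr \<alpha>" by (simp only: mult_ac)
    qed
    finally show "mixed_norm p (\<lambda>l. diff_op r h (G l)) \<le> ennreal (C * b * h powr \<alpha>)" .
  qed
qed

lemma mixed_norm_add_real:
  assumes "0 < p" "family F" "family G" "\<And>l x. norm (H l x) \<le> norm (F l x) + norm (G l x)"
    and "mixed_norm p F \<le> ennreal a" "mixed_norm p G \<le> ennreal b" "0 \<le> a" "0 \<le> b"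
  shows "mixed_norm p H \<le> ennreal ((quasi_const p)\<^sup>2 * (a + b))"
proof -
  have "mixed_norm p H \<le> ennreal ((quasi_const p)\<^sup>2) * (mixed_norm p F + mixed_norm p G)"
    by (rule mixed_norm_add_le[OF assms(1-4)])
  also have "\<dots> \<le> ennreal ((quasi_const p)\<^sup>2) * (ennreal a + ennreal b)"
    by (intro mult_left_mono add_mono assms) simp
  also have "\<dots> = ennreal ((quasi_const p)\<^sup>2 * (a + b))"
    using assms(7,8) by (simp add: ennreal_mult ennreal_plus)
  finally show ?thesis .
qed

lemma cmult_bound_real:
  assumes "X \<le> ennreal c * Y" "Y \<le> ennreal b" "0 \<le> c" "0 \<le> b" shows "X \<le> ennreal (c * b)"
proof -
  have "X \<le> ennreal c * ennreal b" using assms(1,2) by (meson mult_left_mono order_trans zero_le)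
  then show ?thesis using assms(3,4) by (simp add: ennreal_mult)
qed

text \<open>The two ranges \<open>h \<le> \<delta>\<close> (Bernstein) and \<open>h \<ge> \<delta>\<close> (trivial bound of the difference operator).\<close>

lemma trig_family_holder:
  assumes p: "0 < p" and \<alpha>: "0 < \<alpha>" "\<alpha> \<le> real r"
  shows "\<exists>C\<ge>0. \<forall>n\<ge>1. \<forall>G. \<forall>b\<ge>0. family G \<longrightarrow> (\<forall>l. G l \<in> trig_polys n) \<longrightarrow>
    mixed_norm p G \<le> ennreal (b * mesh (6 * n) powr \<alpha>) \<longrightarrow>
    (\<forall>h>0. mixed_norm p (\<lambda>l. diff_op r h (G l)) \<le> ennreal (C * b * h powr \<alpha>))"
proof -
  from bernstein_family[OF p \<alpha>(2)]
  obtain C where C: "0 \<le> C" "\<forall>n\<ge>1. \<forall>G. \<forall>b\<ge>0. family G \<longrightarrow> (\<forall>l. G l \<in> trig_polys n) \<longrightarrow>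
    mixed_norm p (\<lambda>l. diff_op r (mesh (6 * n)) (G l)) \<le> ennreal (b * mesh (6 * n) powr \<alpha>) \<longrightarrow>
    (\<forall>h. 0 < h \<longrightarrow> h \<le> mesh (6 * n) \<longrightarrow> mixed_norm p (\<lambda>l. diff_op r h (G l)) \<le> ennreal (C * b * h powr \<alpha>))"
    by (elim exE conjE)
  from mixed_norm_diff_op_le[OF p, where r=r]
  obtain K where K: "1 \<le> K" "\<forall>F h. family F \<longrightarrow> mixed_norm p (\<lambda>l. diff_op r h (F l)) \<le> ennreal K * mixed_norm p F"
    by (elim exE conjE)
  let ?C = "max (C * K) K"
  show ?thesis
  proof (rule exI[of _ ?C], intro conjI allI impI)
    show "0 \<le> ?C" using K(1) by simp
    fix n :: nat and G and b h :: real
    assume n: "1 \<le> n" and b: "0 \<le> b" and fam: "family G" and G: "\<forall>l. G l \<in> trig_polys n"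
      and bd: "mixed_norm p G \<le> ennreal (b * mesh (6 * n) powr \<alpha>)" and h: "0 < h"
    have bd': "mixed_norm p (\<lambda>l. diff_op r h (G l)) \<le> ennreal (K * b * mesh (6 * n) powr \<alpha>)" for h
      using cmult_bound_real[OF K(2)[rule_format, OF fam] bd, of h] K(1) b by (simp add: mult.assoc)
    show "mixed_norm p (\<lambda>l. diff_op r h (G l)) \<le> ennreal (?C * b * h powr \<alpha>)"
    proof (cases "h \<le> mesh (6 * n)")
      case True
      have "mixed_norm p (\<lambda>l. diff_op r h (G l)) \<le> ennreal (C * (K * b) * h powr \<alpha>)"
        using C(2)[rule_format, OF n _ fam G[rule_format] bd' h True] K(1) b by simp
      also have "\<dots> \<le> ennreal (?C * b * h powr \<alpha>)"
        unfolding mult.assoc[symmetric] using b by (intro ennreal_leI mult_right_mono) auto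
      finally show ?thesis .
    next
      case False
      have "mesh (6 * n) powr \<alpha> \<le> h powr \<alpha>" using False \<alpha> by (intro powr_mono2) auto
      then have "K * b * mesh (6 * n) powr \<alpha> \<le> ?C * b * h powr \<alpha>"
        using K(1) b by (intro mult_mono) auto
      then show ?thesis using bd'[of h] by (meson ennreal_leI order_trans)
    qed
  qed
qed

text \<open>The Jackson approximant inherits the seminorm bound. For steps above the mesh it is
  compared with \<open>u\<close>, the error being of order mesh^\<alpha>; from the step equal to the
  mesh Bernstein's inequality goes down to all smaller ones.\<close>

lemma holder_approximation:
  assumes p: "0 < p" and r: "1 \<le> r" and \<alpha>: "0 < \<alpha>" "\<alpha> \<le> real r"
  shows "\<exists>C\<ge>0. \<forall>n\<ge>1. \<forall>u\<in>Lspace p. \<forall>A\<ge>0. (\<forall>h>0. Lnorm p (diff_op r h u) \<le> ennreal (A * h powr \<alpha>)) \<longrightarrow>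
    (\<exists>Q\<in>trig_polys n. Lnorm p (\<lambda>x. u x - Q x) \<le> ennreal (C * A * mesh (6 * n) powr \<alpha>) \<and>
      (\<forall>h>0. Lnorm p (diff_op r h Q) \<le> ennreal (C * A * h powr \<alpha>)))"
proof -
  from jackson[OF p \<alpha>(1), where r=r]
  obtain C where C: "0 \<le> C" "\<forall>n\<ge>1. \<forall>g\<in>Lspace p. \<forall>A\<ge>0. translation_continuous p g \<longrightarrow>
    (\<forall>h>0. Lnorm p (diff_op r h g) \<le> ennreal (A * h powr \<alpha>)) \<longrightarrow>
    (\<exists>Q\<in>trig_polys n. Lnorm p (\<lambda>x. g x - Q x) \<le> ennreal (C * A * mesh (6 * n) powr \<alpha>))"
    by (elim exE conjE)
  from bernstein_family[OF p \<alpha>(2)]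
  obtain D where D: "0 \<le> D" "\<forall>n\<ge>1. \<forall>G. \<forall>b\<ge>0. family G \<longrightarrow> (\<forall>l. G l \<in> trig_polys n) \<longrightarrow>
    mixed_norm p (\<lambda>l. diff_op r (mesh (6 * n)) (G l)) \<le> ennreal (b * mesh (6 * n) powr \<alpha>) \<longrightarrow>
    (\<forall>h. 0 < h \<longrightarrow> h \<le> mesh (6 * n) \<longrightarrow> mixed_norm p (\<lambda>l. diff_op r h (G l)) \<le> ennreal (D * b * h powr \<alpha>))"
    by (elim exE conjE)
  from mixed_norm_diff_op_le[OF p, where r=r]
  obtain K where K: "1 \<le> K" "\<forall>F h. family F \<longrightarrow> mixed_norm p (\<lambda>l. diff_op r h (F l)) \<le> ennreal K * mixed_norm p F"
    by (elim exE conjE)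
  let ?q = "(quasi_const p)\<^sup>2"
  define E where "E = ?q * (1 + K * C)"
  have E0: "0 \<le> E" using K(1) C(1) by (simp add: E_def)
  let ?C = "max C (max E (D * E))"
  show ?thesis
  proof (rule exI[of _ ?C], intro conjI allI ballI impI)
    show "0 \<le> ?C" using C(1) by simp
    fix n :: nat and u and A :: real
    assume n: "1 \<le> n" and u: "u \<in> Lspace p" and A: "0 \<le> A" and bd: "\<forall>h>0. Lnorm p (diff_op r h u) \<le> ennreal (A * h powr \<alpha>)"
    let ?\<delta> = "mesh (6 * n)"
    have \<delta>0: "0 < ?\<delta>" using n by simp
    have "translation_continuous p u" by (rule translation_continuous_holder[OF p u r \<alpha>(1) A bd])
    then obtain Q where Q: "Q \<in> trig_polys n" "Lnorm p (\<lambda>x. u x - Q x) \<le> ennreal (C * A * ?\<delta> powr \<alpha>)"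
      using C(2)[rule_format, OF n u A _ bd[rule_format]] by blast
    have QL: "Q \<in> Lspace p" by (rule trig_polys_Lspace[OF p Q(1)])
    have uQ: "(\<lambda>x. u x - Q x) \<in> Lspace p" by (rule Lspace_diff[OF p u QL])
    have first: "Lnorm p (diff_op r h Q) \<le> ennreal (?q * (A * h powr \<alpha> + K * (C * A * ?\<delta> powr \<alpha>)))" if h: "0 < h" for h
    proof -
      have "mixed_norm p (\<lambda>l. diff_op r h Q) \<le> ennreal (?q * (A * h powr \<alpha> + K * (C * A * ?\<delta> powr \<alpha>)))"
      proof (rule mixed_norm_add_real[OF p])
        show "family (\<lambda>l. diff_op r h u)" by (rule family_diff_op[OF Lspace_family[OF u]])
        show "family (\<lambda>l. diff_op r h (\<lambda>x. u x - Q x))" by (rule family_diff_op[OF Lspace_family[OF uQ]])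
        show "norm (diff_op r h Q x) \<le> norm (diff_op r h u x) + norm (diff_op r h (\<lambda>x. u x - Q x) x)" for x
          unfolding diff_op_diff using norm_triangle_ineq4[of "diff_op r h u x" "diff_op r h u x - diff_op r h Q x"] by simp
        show "mixed_norm p (\<lambda>l. diff_op r h u) \<le> ennreal (A * h powr \<alpha>)"
          using bd h by (simp add: mixed_norm_const[OF p])
        show "mixed_norm p (\<lambda>l. diff_op r h (\<lambda>x. u x - Q x)) \<le> ennreal (K * (C * A * ?\<delta> powr \<alpha>))"
        proof (rule cmult_bound_real[OF K(2)[rule_format, OF Lspace_family[OF uQ]]])
          show "mixed_norm p (\<lambda>l x. u x - Q x) \<le> ennreal (C * A * ?\<delta> powr \<alpha>)"
            using Q(2) by (simp only: mixed_norm_const[OF p])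
        qed (use K(1) C(1) A in auto)
      qed (use K(1) C(1) A in auto)
      then show ?thesis by (simp only: mixed_norm_const[OF p])
    qed
    have large: "Lnorm p (diff_op r h Q) \<le> ennreal (E * A * h powr \<alpha>)" if h: "?\<delta> \<le> h" for h
    proof -
      have h0: "0 < h" using h \<delta>0 by linarith
      have "?\<delta> powr \<alpha> \<le> h powr \<alpha>" using h \<delta>0 \<alpha> by (intro powr_mono2) auto
      then have "?q * (A * h powr \<alpha> + K * (C * A * ?\<delta> powr \<alpha>)) \<le> ?q * (A * h powr \<alpha> + K * (C * A * h powr \<alpha>))"
        using K(1) C(1) A by (intro mult_left_mono add_left_mono) auto
      also have "\<dots> = E * A * h powr \<alpha>" by (simp add: E_def algebra_simps)
      finally show ?thesis using first[OF h0] by (meson ennreal_leI order_trans)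
    qed
    have "Lnorm p (diff_op r h Q) \<le> ennreal (?C * A * h powr \<alpha>)" if h: "0 < h" for h
    proof (cases "h \<le> ?\<delta>")
      case True
      have "mixed_norm p (\<lambda>l. diff_op r ?\<delta> Q) \<le> ennreal (E * A * ?\<delta> powr \<alpha>)"
        unfolding mixed_norm_const[OF p] by (rule large) simp
      then have "mixed_norm p (\<lambda>l. diff_op r h Q) \<le> ennreal (D * (E * A) * h powr \<alpha>)"
        using D(2)[rule_format, OF n _ Lspace_family[OF QL] Q(1) _ h True, of "E * A"] E0 A by simp
      then have "Lnorm p (diff_op r h Q) \<le> ennreal (D * E * A * h powr \<alpha>)"
        by (simp only: mixed_norm_const[OF p] mult.assoc)
      also have "\<dots> \<le> ennreal (?C * A * h powr \<alpha>)"
        using A by (intro ennreal_leI mult_right_mono) auto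
      finally show ?thesis .
    next
      case False
      then have "Lnorm p (diff_op r h Q) \<le> ennreal (E * A * h powr \<alpha>)" by (intro large) simp
      also have "\<dots> \<le> ennreal (?C * A * h powr \<alpha>)"
        using A by (intro ennreal_leI mult_right_mono) auto
      finally show ?thesis .
    qed
    moreover have "Lnorm p (\<lambda>x. u x - Q x) \<le> ennreal (?C * A * ?\<delta> powr \<alpha>)"
    proof -
      have "C * A * ?\<delta> powr \<alpha> \<le> ?C * A * ?\<delta> powr \<alpha>"
        using A by (intro mult_right_mono) auto
      then show ?thesis using Q(2) by (meson ennreal_leI order_trans)
    qed
    ultimately show "\<exists>Q\<in>trig_polys n. Lnorm p (\<lambda>x. u x - Q x) \<le> ennreal (?C * A * ?\<delta> powr \<alpha>) \<and>
      (\<forall>h>0. Lnorm p (diff_op r h Q) \<le> ennreal (?C * A * h powr \<alpha>))"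
      using Q(1) by blast
  qed
qed

text \<open>Split \<open>u\<close> into \<open>u - Q\<close> and \<open>Q\<close>. The means of
  \<open>u - Q\<close> are a family of polynomials of size mesh^\<alpha>, to which
  \<open>trig_family_holder\<close> applies; on \<open>Q\<close> means and differences commute, so
  boundedness of the means is used for the difference of \<open>Q\<close>.\<close>

lemma mean_holder_bound:
  assumes p: "0 < p" and r: "1 \<le> r" and \<alpha>: "0 < \<alpha>" "\<alpha> \<le> real r" and bm: "bounded_means p a"
  shows "\<exists>C\<ge>0. \<forall>n\<ge>1. \<forall>u\<in>Lspace p. \<forall>A\<ge>0. (\<forall>h>0. Lnorm p (diff_op r h u) \<le> ennreal (A * h powr \<alpha>)) \<longrightarrow>
    (\<forall>h>0. mixed_norm p (\<lambda>l. diff_op r h (poly_mean a n l u)) \<le> ennreal (C * A * h powr \<alpha>))"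
proof -
  from holder_approximation[OF p r \<alpha>]
  obtain J where J: "0 \<le> J" "\<forall>n\<ge>1. \<forall>u\<in>Lspace p. \<forall>A\<ge>0. (\<forall>h>0. Lnorm p (diff_op r h u) \<le> ennreal (A * h powr \<alpha>)) \<longrightarrow>
    (\<exists>Q\<in>trig_polys n. Lnorm p (\<lambda>x. u x - Q x) \<le> ennreal (J * A * mesh (6 * n) powr \<alpha>) \<and>
      (\<forall>h>0. Lnorm p (diff_op r h Q) \<le> ennreal (J * A * h powr \<alpha>)))"
    by (elim exE conjE)
  from bounded_means_imp[OF p bm]
  obtain L where L: "0 \<le> L" "\<forall>n\<ge>1. \<forall>f\<in>Lspace p. mixed_norm p (\<lambda>l. poly_mean a n l f) \<le> ennreal L * Lnorm p f"
    by (elim exE conjE)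
  from trig_family_holder[OF p \<alpha>]
  obtain D where D: "0 \<le> D" "\<forall>n\<ge>1. \<forall>G. \<forall>b\<ge>0. family G \<longrightarrow> (\<forall>l. G l \<in> trig_polys n) \<longrightarrow>
    mixed_norm p G \<le> ennreal (b * mesh (6 * n) powr \<alpha>) \<longrightarrow>
    (\<forall>h>0. mixed_norm p (\<lambda>l. diff_op r h (G l)) \<le> ennreal (D * b * h powr \<alpha>))"
    by (elim exE conjE)
  let ?q = "(quasi_const p)\<^sup>2"
  let ?C = "?q * (D * (L * J) + L * J)"
  show ?thesis
  proof (rule exI[of _ ?C], intro conjI allI ballI impI)
    show "0 \<le> ?C" using D(1) L(1) J(1) by simp
    fix n :: nat and u and A h :: real
    assume n: "1 \<le> n" and u: "u \<in> Lspace p" and A: "0 \<le> A"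
      and bd: "\<forall>h>0. Lnorm p (diff_op r h u) \<le> ennreal (A * h powr \<alpha>)" and h: "0 < h"
    obtain Q where Q: "Q \<in> trig_polys n" "Lnorm p (\<lambda>x. u x - Q x) \<le> ennreal (J * A * mesh (6 * n) powr \<alpha>)"
      "\<forall>h>0. Lnorm p (diff_op r h Q) \<le> ennreal (J * A * h powr \<alpha>)"
      using J(2)[rule_format, OF n u A bd[rule_format]] by blast
    have QL: "Q \<in> Lspace p" by (rule trig_polys_Lspace[OF p Q(1)])
    have uQ: "(\<lambda>x. u x - Q x) \<in> Lspace p" by (rule Lspace_diff[OF p u QL])
    have DQ: "diff_op r h Q \<in> Lspace p" by (rule Lspace_diff_op[OF p QL])
    let ?G = "\<lambda>l. poly_mean a n l (\<lambda>x. u x - Q x)"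
    have famG: "family ?G" by (rule family_poly_mean[OF uQ])
    have "mixed_norm p ?G \<le> ennreal (L * (J * A * mesh (6 * n) powr \<alpha>))"
      by (rule cmult_bound_real[OF L(2)[rule_format, OF n uQ] Q(2) L(1)]) (use J(1) A in auto)
    then have "mixed_norm p ?G \<le> ennreal (L * J * A * mesh (6 * n) powr \<alpha>)" by (simp only: mult.assoc)
    then have 1: "mixed_norm p (\<lambda>l. diff_op r h (?G l)) \<le> ennreal (D * (L * J * A) * h powr \<alpha>)"
      using D(2)[rule_format, OF n _ famG poly_mean_in_trig_polys _ h, of "L * J * A"] L(1) J(1) A by simp
    have 2: "mixed_norm p (\<lambda>l. poly_mean a n l (diff_op r h Q)) \<le> ennreal (L * (J * A * h powr \<alpha>))"
      by (rule cmult_bound_real[OF L(2)[rule_format, OF n DQ] Q(3)[rule_format, OF h] L(1)]) (use J(1) A in auto)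
    have "mixed_norm p (\<lambda>l. diff_op r h (poly_mean a n l u)) \<le> ennreal (?q * (D * (L * J * A) * h powr \<alpha> + L * (J * A * h powr \<alpha>)))"
    proof (rule mixed_norm_add_real[OF p _ _ _ 1 2])
      show "family (\<lambda>l. diff_op r h (?G l))" by (rule family_diff_op[OF famG])
      show "family (\<lambda>l. poly_mean a n l (diff_op r h Q))" by (rule family_poly_mean[OF DQ])
      fix l x
      have "?G l = (\<lambda>x. poly_mean a n l u x - poly_mean a n l Q x)" by (rule ext) (rule poly_mean_diff)
      then have "diff_op r h (poly_mean a n l u) x = diff_op r h (?G l) x + poly_mean a n l (diff_op r h Q) x"
        by (simp add: diff_op_diff poly_mean_diff_op_trig_poly[OF Q(1)])
      then show "norm (diff_op r h (poly_mean a n l u) x) \<le> norm (diff_op r h (?G l) x) + norm (poly_mean a n l (diff_op r h Q) x)"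
        by (simp only: norm_triangle_ineq)
    qed (use D(1) L(1) J(1) A in auto)
    also have "?q * (D * (L * J * A) * h powr \<alpha> + L * (J * A * h powr \<alpha>)) = ?C * A * h powr \<alpha>"
      by (simp add: algebra_simps)
    finally show "mixed_norm p (\<lambda>l. diff_op r h (poly_mean a n l u)) \<le> ennreal (?C * A * h powr \<alpha>)" .
  qed
qed

text \<open>With \<open>4n + 1\<close> nodes the means are exact Fourier multipliers on \<open>trig_polys n\<close> and commute with
  differences there, hence the commutator only sees \<open>f - T\<close>.\<close>

lemma mean_commutator_bound:
  assumes p: "0 < p" and r: "1 \<le> r" and \<alpha>: "0 < \<alpha>" "\<alpha> \<le> real r" and bm: "bounded_means p a"
  shows "\<exists>C\<ge>0. \<forall>n\<ge>1. \<forall>f\<in>Lspace p. \<forall>T\<in>trig_polys n. \<forall>A\<ge>0.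
    (\<forall>h>0. Lnorm p (diff_op r h (\<lambda>x. f x - T x)) \<le> ennreal (A * h powr \<alpha>)) \<longrightarrow>
    (\<forall>h>0. mixed_norm p (\<lambda>l x. poly_mean a n l (diff_op r h f) x - diff_op r h (poly_mean a n l f) x) \<le> ennreal (C * A * h powr \<alpha>))"
proof -
  from mean_holder_bound[OF p r \<alpha> bm]
  obtain B where B: "0 \<le> B" "\<forall>n\<ge>1. \<forall>u\<in>Lspace p. \<forall>A\<ge>0. (\<forall>h>0. Lnorm p (diff_op r h u) \<le> ennreal (A * h powr \<alpha>)) \<longrightarrow>
    (\<forall>h>0. mixed_norm p (\<lambda>l. diff_op r h (poly_mean a n l u)) \<le> ennreal (B * A * h powr \<alpha>))"
    by (elim exE conjE)
  from bounded_means_imp[OF p bm]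
  obtain L where L: "0 \<le> L" "\<forall>n\<ge>1. \<forall>f\<in>Lspace p. mixed_norm p (\<lambda>l. poly_mean a n l f) \<le> ennreal L * Lnorm p f"
    by (elim exE conjE)
  let ?q = "(quasi_const p)\<^sup>2"
  let ?C = "?q * (L + B)"
  show ?thesis
  proof (rule exI[of _ ?C], intro conjI allI ballI impI)
    show "0 \<le> ?C" using L(1) B(1) by simp
    fix n :: nat and f T and A h :: real
    assume n: "1 \<le> n" and f: "f \<in> Lspace p" and T: "T \<in> trig_polys n" and A: "0 \<le> A"
      and bd: "\<forall>h>0. Lnorm p (diff_op r h (\<lambda>x. f x - T x)) \<le> ennreal (A * h powr \<alpha>)" and h: "0 < h"
    let ?u = "\<lambda>x. f x - T x"
    have u: "?u \<in> Lspace p" by (rule Lspace_diff[OF p f trig_polys_Lspace[OF p T]])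
    have Du: "diff_op r h ?u \<in> Lspace p" by (rule Lspace_diff_op[OF p u])
    have 1: "mixed_norm p (\<lambda>l. poly_mean a n l (diff_op r h ?u)) \<le> ennreal (L * (A * h powr \<alpha>))"
      by (rule cmult_bound_real[OF L(2)[rule_format, OF n Du] bd[rule_format, OF h] L(1)]) (use A in auto)
    have 2: "mixed_norm p (\<lambda>l. diff_op r h (poly_mean a n l ?u)) \<le> ennreal (B * A * h powr \<alpha>)"
      by (rule B(2)[rule_format, OF n u A bd[rule_format] h])
    have "mixed_norm p (\<lambda>l x. poly_mean a n l (diff_op r h f) x - diff_op r h (poly_mean a n l f) x) \<le> ennreal (?q * (L * (A * h powr \<alpha>) + B * A * h powr \<alpha>))"
    proof (rule mixed_norm_add_real[OF p _ _ _ 1 2])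
      show "family (\<lambda>l. poly_mean a n l (diff_op r h ?u))" by (rule family_poly_mean[OF Du])
      show "family (\<lambda>l. diff_op r h (poly_mean a n l ?u))" by (rule family_diff_op[OF family_poly_mean[OF u]])
      fix l x
      have "diff_op r h ?u = (\<lambda>x. diff_op r h f x - diff_op r h T x)" by (rule ext) (rule diff_op_diff)
      then have e1: "poly_mean a n l (diff_op r h ?u) x = poly_mean a n l (diff_op r h f) x - diff_op r h (poly_mean a n l T) x"
        by (simp add: poly_mean_diff poly_mean_diff_op_trig_poly[OF T])
      have "poly_mean a n l ?u = (\<lambda>x. poly_mean a n l f x - poly_mean a n l T x)" by (rule ext) (rule poly_mean_diff)
      then have e2: "diff_op r h (poly_mean a n l ?u) x = diff_op r h (poly_mean a n l f) x - diff_op r h (poly_mean a n l T) x"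
        by (simp add: diff_op_diff)
      have "poly_mean a n l (diff_op r h f) x - diff_op r h (poly_mean a n l f) x = poly_mean a n l (diff_op r h ?u) x - diff_op r h (poly_mean a n l ?u) x"
        unfolding e1 e2 by simp
      then show "norm (poly_mean a n l (diff_op r h f) x - diff_op r h (poly_mean a n l f) x) \<le> norm (poly_mean a n l (diff_op r h ?u) x) + norm (diff_op r h (poly_mean a n l ?u) x)"
        by (simp only: norm_triangle_ineq4)
    qed (use L(1) B(1) A in auto)
    also have "?q * (L * (A * h powr \<alpha>) + B * A * h powr \<alpha>) = ?C * A * h powr \<alpha>"
      by (simp add: algebra_simps)
    finally show "mixed_norm p (\<lambda>l x. poly_mean a n l (diff_op r h f) x - diff_op r h (poly_mean a n l f) x) \<le> ennreal (?C * A * h powr \<alpha>)" .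
  qed
qed

section \<open>Averaged means\<close>

text \<open>Complex counterpart of \<open>avg\<close>, applied for 1 \<le> p, where functions in
  \<open>Lspace p\<close> are integrable over a period.\<close>

definition cavg :: "(real \<Rightarrow> complex) \<Rightarrow> complex" where
  "cavg F = integral\<^sup>L (lebesgue_on {0..2*pi}) F / of_real (2*pi)"

abbreviation torus_integrable :: "(real \<Rightarrow> complex) \<Rightarrow> bool" where
  "torus_integrable \<equiv> integrable (lebesgue_on {0..2*pi})"

lemma avg_eq_nn_integral: "avg F = integral\<^sup>N (lebesgue_on {0..2*pi}) F / ennreal (2*pi)"
  unfolding avg_def by (subst nn_integral_restrict_space) auto

lemma torus_integrableI:
  assumes "F \<in> borel_measurable lebesgue" "avg (\<lambda>x. ennreal (norm (F x))) < top"
  shows "torus_integrable F"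
proof (rule integrableI_bounded)
  show "F \<in> borel_measurable (lebesgue_on {0..2*pi})"
    using assms(1) by (rule measurable_restrict_space1)
  show "(\<integral>\<^sup>+ x. ennreal (norm (F x)) \<partial>lebesgue_on {0..2*pi}) < \<infinity>"
    using assms(2) unfolding avg_eq_nn_integral
    by (metis ennreal_less_top ennreal_top_divide infinity_ennreal_def less_top)
qed

lemma norm_cavg_le:
  assumes "torus_integrable F"
  shows "ennreal (norm (cavg F)) \<le> avg (\<lambda>x. ennreal (norm (F x)))"
proof -
  have "ennreal (norm (cavg F)) = ennreal (norm (integral\<^sup>L (lebesgue_on {0..2*pi}) F)) / ennreal (2*pi)"
    unfolding cavg_def norm_divide by (subst divide_ennreal[symmetric]) auto
  also have "\<dots> \<le> integral\<^sup>N (lebesgue_on {0..2*pi}) (\<lambda>x. ennreal (norm (F x))) / ennreal (2*pi)"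
    by (intro divide_right_mono_ennreal integral_norm_bound_ennreal assms)
  finally show ?thesis unfolding avg_eq_nn_integral .
qed

lemma cavg_const: "cavg (\<lambda>_. c) = c"
  by (simp add: cavg_def measure_restrict_space scaleR_conv_of_real)

lemma torus_integrable_const: "torus_integrable (\<lambda>_. c)"
  by (rule torus_integrableI) auto

lemma cavg_diff: "torus_integrable F \<Longrightarrow> torus_integrable G \<Longrightarrow> cavg (\<lambda>l. F l - G l) = cavg F - cavg G"
  by (simp add: cavg_def diff_divide_distrib)

lemma cavg_sum: "(\<And>i. i \<in> I \<Longrightarrow> torus_integrable (F i)) \<Longrightarrow> cavg (\<lambda>l. \<Sum>i\<in>I. F i l) = (\<Sum>i\<in>I. cavg (F i))"
  by (simp add: cavg_def sum_divide_distrib)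

lemma cavg_cmult: "cavg (\<lambda>l. c * F l) = c * cavg F"
  by (simp add: cavg_def)

lemma cavg_multc: "cavg (\<lambda>l. F l * c) = cavg F * c"
  by (simp add: cavg_def)

text \<open>Expresses a signed integral by \<open>avg\<close> of the positive and negative parts, so
  that shift invariance of \<open>avg\<close> carries over to \<open>cavg\<close>.\<close>

lemma torus_integral_real_eq:
  fixes G :: "real \<Rightarrow> real"
  assumes "integrable (lebesgue_on {0..2*pi}) G"
  shows "integral\<^sup>L (lebesgue_on {0..2*pi}) G / (2*pi) = enn2real (avg (\<lambda>x. ennreal (G x))) - enn2real (avg (\<lambda>x. ennreal (- G x)))"
proof -
  have e: "enn2real (X / ennreal (2*pi)) = enn2real X / (2*pi)" for X
    by (cases X) (auto simp: divide_ennreal ennreal_top_divide)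
  show ?thesis
    unfolding real_lebesgue_integral_def[OF assms] avg_eq_nn_integral e by (simp add: diff_divide_distrib)
qed

lemma cavg_shift:
  assumes F: "F \<in> borel_measurable lebesgue" "periodic F" "avg (\<lambda>x. ennreal (norm (F x))) < top"
  shows "cavg (\<lambda>l. F (l + h)) = cavg F"
proof -
  note [measurable] = F(1)
  have sh: "avg (\<lambda>x. \<phi> (F (x + h))) = avg (\<lambda>x. \<phi> (F x))" if [measurable]: "\<phi> \<in> borel_measurable borel" for \<phi> :: "complex \<Rightarrow> ennreal"
    by (rule avg_shift[where F="\<lambda>x. \<phi> (F x)"]) (measurable, rule periodic_comp[OF F(2)])
  have i: "torus_integrable F" by (rule torus_integrableI[OF F(1,3)])
  have ih: "torus_integrable (\<lambda>x. F (x + h))"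
    by (rule torus_integrableI[OF measurable_shift[OF F(1)]]) (use F(3) sh[of "\<lambda>z. ennreal (norm z)"] in simp)
  have Re: "Re (cavg G) = integral\<^sup>L (lebesgue_on {0..2*pi}) (\<lambda>x. Re (G x)) / (2*pi)"
    and Im: "Im (cavg G) = integral\<^sup>L (lebesgue_on {0..2*pi}) (\<lambda>x. Im (G x)) / (2*pi)" if "torus_integrable G" for G
    unfolding cavg_def using that by (simp_all add: Re_divide_of_real Im_divide_of_real)
  show ?thesis
  proof (rule complex_eqI)
    show "Re (cavg (\<lambda>l. F (l + h))) = Re (cavg F)"
      unfolding Re[OF i] Re[OF ih]
      using sh[of "\<lambda>z. ennreal (Re z)"] sh[of "\<lambda>z. ennreal (- Re z)"] i ih
      by (subst (1 2) torus_integral_real_eq) auto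
    show "Im (cavg (\<lambda>l. F (l + h))) = Im (cavg F)"
      unfolding Im[OF i] Im[OF ih]
      using sh[of "\<lambda>z. ennreal (Im z)"] sh[of "\<lambda>z. ennreal (- Im z)"] i ih
      by (subst (1 2) torus_integral_real_eq) auto
  qed
qed

text \<open>The tangent of the power at the mean value is integrated. The mean has to be known
  finite beforehand, as the common term is cancelled in \<open>ennreal\<close>.\<close>

lemma avg_jensen:
  assumes F: "F \<in> borel_measurable lebesgue" and P: "1 \<le> P"
  shows "ennpowr (avg (\<lambda>x. ennreal (norm (F x)))) P \<le> avg (\<lambda>x. ennreal (norm (F x :: complex) powr P))"
proof -
  note [measurable] = F
  let ?b = "avg (\<lambda>x. ennreal (norm (F x)))" and ?c = "avg (\<lambda>x. ennreal (norm (F x) powr P))"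
  show ?thesis
  proof (cases "?c = top")
    case False
    \<comment> \<open>The elementary bound of a number by 1 plus its P-th power gives finiteness of
      the mean.\<close>
    have "?b \<le> avg (\<lambda>x. 1 + ennreal (norm (F x) powr P))"
    proof (rule avg_mono)
      fix x
      have "norm (F x) \<le> 1 + norm (F x) powr P"
      proof (cases "norm (F x) \<le> 1")
        case True
        then show ?thesis using powr_ge_zero[of "norm (F x)" P] by linarith
      next
        case False
        then have "norm (F x) powr 1 \<le> norm (F x) powr P" using P by (intro powr_mono) auto
        then show ?thesis using False by simp
      qed
      then show "ennreal (norm (F x)) \<le> 1 + ennreal (norm (F x) powr P)"
        by (simp add: ennreal_leI flip: ennreal_1 ennreal_plus)
    qed
    also have "\<dots> = 1 + ?c" by (subst avg_add) auto
    finally have "?b \<le> 1 + ?c" .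
    moreover have "1 + ?c < top" using False by (simp add: less_top)
    ultimately have "?b < top" by (rule le_less_trans)
    then obtain b where b: "0 \<le> b" "?b = ennreal b" by (cases ?b) auto
    show ?thesis
    proof (cases "b = 0")
      case True
      then show ?thesis using b by simp
    next
      case False
      then have b0: "0 < b" using b by simp
      \<comment> \<open>The slope of the tangent at \<open>b\<close>; the linear term is kept on the
        other side to avoid subtraction.\<close>
      define k where "k = P * b powr (P - 1)"
      have k: "0 \<le> k" using P by (simp add: k_def)
      have kb: "k * b = P * b powr P" using b0 powr_mult_base[of b "P - 1"] by (simp add: k_def mult.commute)
      have "avg (\<lambda>x. ennreal (b powr P) + ennreal k * ennreal (norm (F x))) \<le> avg (\<lambda>x. ennreal (norm (F x) powr P) + ennreal (k * b))"
      proof (rule avg_mono)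
        fix x
        have "b powr P + k * (norm (F x) - b) \<le> norm (F x) powr P"
          unfolding k_def using P b0 by (intro powr_tangent) auto
        then have "b powr P + k * norm (F x) \<le> norm (F x) powr P + k * b" by (simp add: right_diff_distrib)
        then have "ennreal (b powr P + k * norm (F x)) \<le> ennreal (norm (F x) powr P + k * b)" by (rule ennreal_leI)
        then show "ennreal (b powr P) + ennreal k * ennreal (norm (F x)) \<le> ennreal (norm (F x) powr P) + ennreal (k * b)"
          using k b0 by (simp add: ennreal_mult)
      qed
      moreover have "avg (\<lambda>x. ennreal (b powr P) + ennreal k * ennreal (norm (F x))) = ennreal (b powr P) + ennreal k * ?b"
        by (subst avg_add) (auto simp: avg_cmult)
      moreover have "avg (\<lambda>x. ennreal (norm (F x) powr P) + ennreal (k * b)) = ?c + ennreal (k * b)"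
        by (subst avg_add) auto
      moreover have "ennreal k * ?b = ennreal (k * b)" unfolding b(2) using k b(1) by (simp add: ennreal_mult)
      ultimately have "ennreal (b powr P) + ennreal (k * b) \<le> ?c + ennreal (k * b)" by simp
      then have "ennreal (k * b) + ennreal (b powr P) \<le> ennreal (k * b) + ?c" by (simp only: add.commute)
      then have "ennreal (b powr P) \<le> ?c" unfolding ennreal_add_left_cancel_le by simp
      then show ?thesis unfolding b(2) using b(1) by (simp add: ennpowr_ennreal)
    qed
  qed simp
qed

lemma enn2real_ge_1: "1 \<le> p \<Longrightarrow> p \<noteq> \<infinity> \<Longrightarrow> 1 \<le> enn2real p"
  by (cases p) (auto simp flip: ennreal_1 simp: ennreal_le_iff)

lemma Lspace_avg_finite:
  assumes p: "1 \<le> p" and f: "f \<in> Lspace p"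
  shows "avg (\<lambda>x. ennreal (norm (f x))) < top"
proof -
  have p0: "0 < p" using p by (meson less_le_trans zero_less_one)
  show ?thesis
  proof (cases "p = \<infinity>")
    case True
    have "avg (\<lambda>x. ennreal (norm (f x))) \<le> avg (\<lambda>x. Lnorm p f)"
      using Lnorm_top_bound[of f] f unfolding True by (intro avg_mono) auto
    then show ?thesis using Lspace_finite[OF p0 f] by (simp add: le_less_trans)
  next
    case False
    let ?P = "enn2real p"
    have P: "1 \<le> ?P" by (rule enn2real_ge_1[OF p False])
    have "ennpowr (avg (\<lambda>x. ennreal (norm (f x)))) ?P \<le> ennpowr (Lnorm p f) ?P"
      unfolding Lnorm_def ennpowr_pnorm[OF p0 False] ennpowr_norm
      by (rule avg_jensen[OF Lspace_measurable[OF f] P])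
    then have "avg (\<lambda>x. ennreal (norm (f x))) \<le> Lnorm p f"
      using ennpowr_le_iff[of ?P] P by simp
    then show ?thesis using Lspace_finite[OF p0 f] by (rule le_less_trans)
  qed
qed

text \<open>Jensen's inequality in the parameter for each fixed \<open>x\<close>, followed by
  Tonelli; this is where exponents from 1 upwards are needed.\<close>

lemma Lnorm_cavg_le:
  assumes p: "1 \<le> p" and fam: "family G" and i: "\<And>x. torus_integrable (\<lambda>l. G l x)"
  shows "Lnorm p (\<lambda>x. cavg (\<lambda>l. G l x)) \<le> mixed_norm p G"
proof -
  have p0: "0 < p" using p by (meson less_le_trans zero_less_one)
  show ?thesis
  proof (cases "p = \<infinity>")
    case True
    have "ennreal (norm (cavg (\<lambda>l. G l x))) \<le> mixed_norm \<infinity> G" for x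
    proof -
      have "ennreal (norm (cavg (\<lambda>l. G l x))) \<le> avg (\<lambda>l. ennreal (norm (G l x)))" by (rule norm_cavg_le[OF i])
      also have "\<dots> \<le> avg (\<lambda>l. mixed_norm \<infinity> G)"
      proof (rule avg_mono)
        show "ennreal (norm (G l x)) \<le> mixed_norm \<infinity> G" for l
          unfolding mixed_norm_top by (rule SUP_upper2[of l]) (auto intro: SUP_upper)
      qed
      finally show ?thesis by simp
    qed
    then show ?thesis unfolding True Lnorm_def pnorm_top_exp by (intro SUP_least)
  next
    case False
    let ?P = "enn2real p"
    have P: "1 \<le> ?P" by (rule enn2real_ge_1[OF p False])
    note [measurable] = family_measurable[OF fam]
    have "ennpowr (Lnorm p (\<lambda>x. cavg (\<lambda>l. G l x))) ?P = avg (\<lambda>x. ennpowr (ennreal (norm (cavg (\<lambda>l. G l x)))) ?P)"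
      unfolding Lnorm_def by (rule ennpowr_pnorm[OF p0 False])
    also have "\<dots> \<le> avg (\<lambda>x. avg (\<lambda>l. ennreal (norm (G l x) powr ?P)))"
    proof (rule avg_mono)
      fix x
      have "ennpowr (ennreal (norm (cavg (\<lambda>l. G l x)))) ?P \<le> ennpowr (avg (\<lambda>l. ennreal (norm (G l x)))) ?P"
        using P by (intro ennpowr_mono norm_cavg_le i) auto
      also have "\<dots> \<le> avg (\<lambda>l. ennreal (norm (G l x) powr ?P))"
        by (rule avg_jensen[OF _ P]) measurable
      finally show "ennpowr (ennreal (norm (cavg (\<lambda>l. G l x)))) ?P \<le> avg (\<lambda>l. ennreal (norm (G l x) powr ?P))" .
    qed
    also have "\<dots> = avg (\<lambda>l. avg (\<lambda>x. ennreal (norm (G l x) powr ?P)))"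
      by (rule avg_swap[symmetric]) measurable
    also have "\<dots> = ennpowr (mixed_norm p G) ?P" by (rule ennpowr_mixed_norm[OF p0 False, symmetric])
    finally show ?thesis using ennpowr_le_iff[of ?P] P by simp
  qed
qed

text \<open>The coefficient of \<open>expo \<nu>\<close> in the mean, as a function of the grid
  position. Samples and exponentials are combined so that periodicity in \<open>l\<close> is
  evident.\<close>

definition mean_coeff :: "(int \<Rightarrow> nat \<Rightarrow> complex) \<Rightarrow> nat \<Rightarrow> (real \<Rightarrow> complex) \<Rightarrow> int \<Rightarrow> real \<Rightarrow> complex" where
  "mean_coeff a n f \<nu> l = (\<Sum>j\<le>4*n. (1 / of_nat (4*n+1) * a \<nu> n) * (f (l + node n j) * expo (- \<nu>) (l + node n j)))"

lemma poly_mean_eq_coeff: "poly_mean a n l f x = (\<Sum>\<nu>\<in>{- int n..int n}. mean_coeff a n f \<nu> l * expo \<nu> x)"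
proof -
  have "expo \<nu> (x - node n j - l) = expo \<nu> x * expo (- \<nu>) (l + node n j)" for \<nu> j
    unfolding cis_mult by (rule arg_cong[where f=cis]) (simp add: algebra_simps)
  then have "poly_mean a n l f x = (\<Sum>j\<le>4*n. \<Sum>\<nu>\<in>{- int n..int n}. (1 / of_nat (4*n+1) * a \<nu> n) * (f (l + node n j) * expo (- \<nu>) (l + node n j)) * expo \<nu> x)"
    unfolding poly_mean_def kernel_def sum_distrib_left add.commute[of _ l]
    by (intro sum.cong refl) (simp only: mult_ac)
  then show ?thesis unfolding mean_coeff_def sum_distrib_right by (subst sum.swap) simp
qed

lemma mean_coeff_integrable:
  assumes f: "f \<in> borel_measurable lebesgue" "periodic f" "avg (\<lambda>x. ennreal (norm (f x))) < top"
  shows "torus_integrable (mean_coeff a n f \<nu>)" "periodic (mean_coeff a n f \<nu>)" "mean_coeff a n f \<nu> \<in> borel_measurable lebesgue"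
proof -
  let ?g = "\<lambda>l. f l * expo (- \<nu>) l"
  have c: "expo (- \<nu>) \<in> borel_measurable lebesgue"
    by (intro continuous_measurable_lebesgue continuous_intros)
  have gm: "?g \<in> borel_measurable lebesgue" by (rule borel_measurable_times[OF f(1) c])
  have gp: "periodic ?g" using f(2) expo_periodic[of "- \<nu>"] unfolding periodic_def by simp
  have "torus_integrable (\<lambda>l. ?g (l + t))" for t
  proof (rule torus_integrableI[OF measurable_shift[OF gm]])
    have "avg (\<lambda>x. ennreal (norm (?g (x + t)))) = avg (\<lambda>x. ennreal (norm (?g x)))"
    proof (rule avg_shift[where F="\<lambda>x. ennreal (norm (?g x))"])
      show "(\<lambda>x. ennreal (norm (?g x))) \<in> borel_measurable lebesgue" using gm by measurable
    qed (rule periodic_comp[OF gp])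
    then show "avg (\<lambda>x. ennreal (norm (?g (x + t)))) < top" using f(3) by (simp add: norm_mult)
  qed
  then show "torus_integrable (mean_coeff a n f \<nu>)"
    unfolding mean_coeff_def[abs_def] by (intro Bochner_Integration.integrable_sum integrable_mult_right)
  show "periodic (mean_coeff a n f \<nu>)"
    using periodic_add[OF gp] unfolding mean_coeff_def[abs_def] periodic_def by simp
  show "mean_coeff a n f \<nu> \<in> borel_measurable lebesgue"
    unfolding mean_coeff_def[abs_def]
    by (intro borel_measurable_sum borel_measurable_times borel_measurable_const measurable_shift[OF f(1)] measurable_shift[OF c])
qed

lemma torus_integrable_imp_avg:
  assumes "torus_integrable F" shows "avg (\<lambda>x. ennreal (norm (F x))) < top"
proof -
  have "integral\<^sup>N (lebesgue_on {0..2*pi}) (\<lambda>x. ennreal (norm (F x))) < top"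
    using assms by (simp add: integrable_iff_bounded)
  then show ?thesis unfolding avg_eq_nn_integral by (simp add: ennreal_divide_eq_top_iff less_top[symmetric])
qed

lemma poly_mean_param:
  assumes f: "f \<in> borel_measurable lebesgue" "periodic f" "avg (\<lambda>x. ennreal (norm (f x))) < top"
  shows "torus_integrable (\<lambda>l. poly_mean a n l f x)" "cavg (\<lambda>l. poly_mean a n (l + h) f x) = cavg (\<lambda>l. poly_mean a n l f x)"
    "torus_integrable (\<lambda>l. poly_mean a n (l + h) f x)"
proof -
  let ?H = "\<lambda>l. poly_mean a n l f x"
  note mc = mean_coeff_integrable[OF f, where a=a and n=n]
  show i: "torus_integrable ?H"
    unfolding poly_mean_eq_coeff by (intro Bochner_Integration.integrable_sum integrable_mult_left mc)
  have m: "?H \<in> borel_measurable lebesgue"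
    unfolding poly_mean_eq_coeff by (intro borel_measurable_sum borel_measurable_times borel_measurable_const mc)
  have per: "periodic ?H"
    using mc(2) unfolding poly_mean_eq_coeff periodic_def by simp
  show "cavg (\<lambda>l. poly_mean a n (l + h) f x) = cavg ?H"
    by (rule cavg_shift[OF m per torus_integrable_imp_avg[OF i]])
  show "torus_integrable (\<lambda>l. ?H (l + h))"
  proof (rule torus_integrableI[OF measurable_shift[OF m]])
    have "avg (\<lambda>l. ennreal (norm (?H (l + h)))) = avg (\<lambda>l. ennreal (norm (?H l)))"
    proof (rule avg_shift[where F="\<lambda>l. ennreal (norm (?H l))"])
      show "(\<lambda>l. ennreal (norm (?H l))) \<in> borel_measurable lebesgue" using m by measurable
    qed (rule periodic_comp[OF per])
    then show "avg (\<lambda>l. ennreal (norm (?H (l + h)))) < top" using torus_integrable_imp_avg[OF i] by simp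
  qed
qed

text \<open>A shift of the function is a simultaneous shift of grid position and argument. Averaging
  over the position removes the former, which is why averaged means commute with
  translations.\<close>

lemma poly_mean_shift: "poly_mean a n l (\<lambda>x. f (x + h)) x = poly_mean a n (l + h) f (x + h)"
  unfolding poly_mean_def by (simp add: algebra_simps)

text \<open>The average of the means over the parameter is a convolution, hence commutes with differences.\<close>

lemma averaged_mean:
  assumes p: "1 \<le> p" and f: "f \<in> Lspace p"
  shows "\<exists>T\<in>trig_polys n. Lnorm p (\<lambda>x. f x - T x) \<le> mixed_norm p (\<lambda>l x. f x - poly_mean a n l f x) \<and>
    (\<forall>h. Lnorm p (diff_op r h (\<lambda>x. f x - T x)) \<le> mixed_norm p (\<lambda>l x. diff_op r h f x - poly_mean a n l (diff_op r h f) x)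
       \<and> Lnorm p (diff_op r h (\<lambda>x. f x - T x)) \<le> mixed_norm p (\<lambda>l. diff_op r h (\<lambda>x. f x - poly_mean a n l f x)))"
proof -
  have p0: "0 < p" using p by (meson less_le_trans zero_less_one)
  define V where "V g x = cavg (\<lambda>l. poly_mean a n l g x)" for g x
  have ok: "g \<in> borel_measurable lebesgue" "periodic g" "avg (\<lambda>x. ennreal (norm (g x))) < top" if "g \<in> Lspace p" for g
    using that Lspace_measurable Lspace_periodic Lspace_avg_finite[OF p] by auto
  have err: "Lnorm p (\<lambda>x. g x - V g x) \<le> mixed_norm p (\<lambda>l x. g x - poly_mean a n l g x)" if g: "g \<in> Lspace p" for g
  proof -
    have i: "torus_integrable (\<lambda>l. poly_mean a n l g x)" for x by (rule poly_mean_param(1)[OF ok[OF g]])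
    have "g x - V g x = cavg (\<lambda>l. g x - poly_mean a n l g x)" for x
      unfolding V_def by (simp add: cavg_diff[OF torus_integrable_const i] cavg_const)
    then have "Lnorm p (\<lambda>x. g x - V g x) = Lnorm p (\<lambda>x. cavg (\<lambda>l. g x - poly_mean a n l g x))" by simp
    also have "\<dots> \<le> mixed_norm p (\<lambda>l x. g x - poly_mean a n l g x)"
    proof (rule Lnorm_cavg_le[OF p])
      show "family (\<lambda>l x. g x - poly_mean a n l g x)"
        by (rule family_diff[OF Lspace_family[OF g] family_poly_mean[OF g]])
      show "torus_integrable (\<lambda>l. g x - poly_mean a n l g x)" for x
        by (rule Bochner_Integration.integrable_diff[OF torus_integrable_const i])
    qed
    finally show ?thesis .
  qed
  have VT: "V f \<in> trig_polys n"
  proof (rule trig_polysI)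
    show "V f = (\<lambda>x. \<Sum>\<nu>\<in>{- int n..int n}. cavg (mean_coeff a n f \<nu>) * expo \<nu> x)"
      unfolding V_def[abs_def] poly_mean_eq_coeff
      using mean_coeff_integrable(1)[OF ok[OF f]] by (subst cavg_sum) (auto simp: cavg_multc)
  qed
  have comm: "V (diff_op r h f) x = diff_op r h (V f) x" for h x
  proof -
    let ?b = "\<lambda>i. (-1) ^ i * of_nat (r choose i) :: complex"
    have "poly_mean a n l (diff_op r h f) x = (\<Sum>i\<le>r. ?b i * poly_mean a n (l + real i * h) f (x + real i * h))" for l
      unfolding diff_op_def[abs_def] poly_mean_sum poly_mean_cmult poly_mean_shift ..
    then have "V (diff_op r h f) x = cavg (\<lambda>l. \<Sum>i\<le>r. ?b i * poly_mean a n (l + real i * h) f (x + real i * h))"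
      unfolding V_def by simp
    also have "\<dots> = (\<Sum>i\<le>r. cavg (\<lambda>l. ?b i * poly_mean a n (l + real i * h) f (x + real i * h)))"
      by (intro cavg_sum integrable_mult_right poly_mean_param(3) ok[OF f])
    also have "\<dots> = (\<Sum>i\<le>r. ?b i * V f (x + real i * h))"
      unfolding cavg_cmult poly_mean_param(2)[OF ok[OF f]] V_def ..
    finally show ?thesis by (simp add: diff_op_def)
  qed
  have "Lnorm p (diff_op r h (\<lambda>x. f x - V f x)) \<le> mixed_norm p (\<lambda>l x. diff_op r h f x - poly_mean a n l (diff_op r h f) x)" for h
  proof -
    have "diff_op r h (\<lambda>x. f x - V f x) = (\<lambda>x. diff_op r h f x - V (diff_op r h f) x)"
      by (rule ext) (simp add: diff_op_diff comm)
    then show ?thesis using err[OF Lspace_diff_op[OF p0 f]] by simp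
  qed
  moreover have "Lnorm p (diff_op r h (\<lambda>x. f x - V f x)) \<le> mixed_norm p (\<lambda>l. diff_op r h (\<lambda>x. f x - poly_mean a n l f x))" for h
  proof -
    let ?b = "\<lambda>i. (-1) ^ i * of_nat (r choose i) :: complex"
    let ?g = "\<lambda>l x. f x - poly_mean a n l f x"
    have i: "torus_integrable (\<lambda>l. ?g l x)" for x
      by (rule Bochner_Integration.integrable_diff[OF torus_integrable_const poly_mean_param(1)[OF ok[OF f]]])
    have fg: "f x - V f x = cavg (\<lambda>l. ?g l x)" for x
      unfolding V_def by (simp add: cavg_diff[OF torus_integrable_const poly_mean_param(1)[OF ok[OF f]]] cavg_const)
    have it: "torus_integrable (\<lambda>l. ?b k * ?g l (x + real k * h))" for k x by (intro integrable_mult_right i)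
    have "diff_op r h (\<lambda>x. f x - V f x) x = cavg (\<lambda>l. diff_op r h (?g l) x)" for x
      unfolding diff_op_def fg using it by (subst cavg_sum) (auto simp: cavg_cmult)
    then have "diff_op r h (\<lambda>x. f x - V f x) = (\<lambda>x. cavg (\<lambda>l. diff_op r h (?g l) x))" by (rule ext)
    moreover have "Lnorm p (\<lambda>x. cavg (\<lambda>l. diff_op r h (?g l) x)) \<le> mixed_norm p (\<lambda>l. diff_op r h (?g l))"
    proof (rule Lnorm_cavg_le[OF p])
      show "family (\<lambda>l. diff_op r h (?g l))"
        by (intro family_diff_op family_diff Lspace_family[OF f] family_poly_mean[OF f])
      show "torus_integrable (\<lambda>l. diff_op r h (?g l) x)" for x
        unfolding diff_op_def by (intro Bochner_Integration.integrable_sum it)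
    qed
    ultimately show ?thesis by simp
  qed
  ultimately show ?thesis using VT err[OF f] by blast
qed

section \<open>Equivalence of the two errors\<close>

lemma Hnorm_holder_sup: "Hnorm p r \<alpha> f = Lnorm p f + holder_sup \<alpha> (\<lambda>h. Lnorm p (diff_op r h f))"
  by (simp add: Hnorm_def holder_sup_def)

lemma mixed_Hnorm_holder_sup:
  "mixed_Hnorm p r \<alpha> F = mixed_norm p F + holder_sup \<alpha> (\<lambda>h. mixed_norm p (\<lambda>l. diff_op r h (F l)))"
  by (simp add: mixed_Hnorm_def holder_sup_def)

lemma w_H_holder_sup:
  "w_H w r \<alpha> f \<delta> = ennreal (w f \<delta>) + holder_sup \<alpha> (\<lambda>h. ennreal (w (diff_op r h f) \<delta>))"
  by (simp add: w_H_def holder_sup_def)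

text \<open>Passes from a bound for every approximant to the best approximation. Subtraction in
  \<open>ennreal\<close> is safe only for finite \<open>Y\<close>, hence the case splits.\<close>

lemma le_const_add_INF:
  fixes X Y :: ennreal
  assumes c: "0 < c" and X: "\<And>T. T \<in> S \<Longrightarrow> X \<le> ennreal c * (Y + F T)"
  shows "X \<le> ennreal c * (Y + (INF T\<in>S. F T))"
proof (cases "S = {}")
  case True
  then show ?thesis using c by (simp add: ennreal_mult_top)
next
  case S: False
  have inv: "ennreal c * ennreal (1 / c) = 1" "ennreal (1 / c) * ennreal c = 1" using c by (simp_all flip: ennreal_mult)
  have "ennreal (1 / c) * X \<le> (INF T\<in>S. Y + F T)"
  proof (rule INF_greatest)
    fix T assume "T \<in> S"
    from mult_left_mono[OF X[OF this], of "ennreal (1 / c)"]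
    show "ennreal (1 / c) * X \<le> Y + F T" by (simp add: inv flip: mult.assoc)
  qed
  also have "\<dots> \<le> Y + (INF T\<in>S. F T)"
  proof (cases "Y = top")
    case False
    have "(INF T\<in>S. Y + F T) - Y \<le> (INF T\<in>S. F T)"
      by (rule INF_greatest) (use False in \<open>auto simp: ennreal_minus_le_iff intro: INF_lower\<close>)
    then show ?thesis using False by (simp add: ennreal_minus_le_iff)
  qed simp
  finally have "ennreal c * (ennreal (1 / c) * X) \<le> ennreal c * (Y + (INF T\<in>S. F T))" by (rule mult_left_mono) simp
  then show ?thesis by (simp add: inv flip: mult.assoc)
qed

lemma le_mult_ge_1: "1 \<le> c \<Longrightarrow> x \<le> c * (x :: ennreal)"
  using mult_right_mono[of 1 c x] by simp

lemma mean_error_commute: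
  assumes p: "0 < p" and r: "1 \<le> r" and \<alpha>: "0 < \<alpha>" "\<alpha> \<le> real r" and bm: "bounded_means p a"
  shows "\<exists>C\<ge>1. \<forall>n\<ge>1. \<forall>f\<in>Lspace p.
    holder_sup \<alpha> (\<lambda>h. mixed_norm p (\<lambda>l. diff_op r h (\<lambda>x. f x - poly_mean a n l f x)))
      \<le> ennreal C * (holder_sup \<alpha> (\<lambda>h. mixed_norm p (\<lambda>l x. diff_op r h f x - poly_mean a n l (diff_op r h f) x)) + best_approx_H p r \<alpha> f n) \<and>
    holder_sup \<alpha> (\<lambda>h. mixed_norm p (\<lambda>l x. diff_op r h f x - poly_mean a n l (diff_op r h f) x))
      \<le> ennreal C * (holder_sup \<alpha> (\<lambda>h. mixed_norm p (\<lambda>l. diff_op r h (\<lambda>x. f x - poly_mean a n l f x))) + best_approx_H p r \<alpha> f n)"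
proof -
  from mean_commutator_bound[OF p r \<alpha> bm]
  obtain B where B: "0 \<le> B" "\<forall>n\<ge>1. \<forall>f\<in>Lspace p. \<forall>T\<in>trig_polys n. \<forall>A\<ge>0.
    (\<forall>h>0. Lnorm p (diff_op r h (\<lambda>x. f x - T x)) \<le> ennreal (A * h powr \<alpha>)) \<longrightarrow>
    (\<forall>h>0. mixed_norm p (\<lambda>l x. poly_mean a n l (diff_op r h f) x - diff_op r h (poly_mean a n l f) x) \<le> ennreal (B * A * h powr \<alpha>))"
    by (elim exE conjE)
  let ?q = "(quasi_const p)\<^sup>2"
  have q: "1 \<le> ?q" using quasi_const_ge_1[of p] by (simp add: one_le_power)
  define C where "C = ?q * (1 + B)"
  have C1: "1 \<le> C" using mult_mono[OF q, of 1 "1 + B"] B(1) q by (simp add: C_def)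
  \<comment> \<open>\<open>G\<close> and \<open>H\<close> stand for the two orders of mean and
    difference. The commutator enters through its modulus only, so one argument covers both
    directions.\<close>
  have main: "holder_sup \<alpha> (\<lambda>h. mixed_norm p (H h)) \<le> ennreal C * (holder_sup \<alpha> (\<lambda>h. mixed_norm p (G h)) + best_approx_H p r \<alpha> f n)"
    if n: "1 \<le> n" and f: "f \<in> Lspace p" and G: "\<And>h. family (G h)"
      and H: "\<And>h l x. norm (H h l x) \<le> norm (G h l x) + norm (poly_mean a n l (diff_op r h f) x - diff_op r h (poly_mean a n l f) x)"
    for n f and G H :: "real \<Rightarrow> real \<Rightarrow> real \<Rightarrow> complex"
    unfolding best_approx_H_def
  proof (rule le_const_add_INF)
    show "0 < C" using C1 by simp
    fix T assume T: "T \<in> trig_polys n"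
    let ?N = "Hnorm p r \<alpha> (\<lambda>x. f x - T x)" and ?S = "holder_sup \<alpha> (\<lambda>h. mixed_norm p (G h))"
    show "holder_sup \<alpha> (\<lambda>h. mixed_norm p (H h)) \<le> ennreal C * (?S + ?N)"
    proof (cases "?N = top")
      case True
      then show ?thesis using C1 by (simp add: ennreal_mult_top)
    next
      case False
      then obtain A where A: "0 \<le> A" "?N = ennreal A" by (cases ?N) auto
      have Ab: "\<forall>h>0. Lnorm p (diff_op r h (\<lambda>x. f x - T x)) \<le> ennreal (A * h powr \<alpha>)"
      proof (intro allI impI, rule holder_sup_real[OF _ A(1)])
        show "holder_sup \<alpha> (\<lambda>h. Lnorm p (diff_op r h (\<lambda>x. f x - T x))) \<le> ennreal A"
          unfolding A(2)[symmetric] Hnorm_holder_sup by simp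
      qed
      have "mixed_norm p (H h) \<le> ennreal C * (?S + ?N) * ennreal (h powr \<alpha>)" if h: "0 < h" for h
      proof -
        have K: "mixed_norm p (\<lambda>l x. poly_mean a n l (diff_op r h f) x - diff_op r h (poly_mean a n l f) x) \<le> ennreal (B * A * h powr \<alpha>)"
          by (rule B(2)[rule_format, OF n f T A(1) _ h]) (use Ab in blast)
        have "mixed_norm p (H h) \<le> ennreal ?q * (mixed_norm p (G h) + mixed_norm p (\<lambda>l x. poly_mean a n l (diff_op r h f) x - diff_op r h (poly_mean a n l f) x))"
          by (rule mixed_norm_add_le[OF p G _ H]) (intro family_diff family_diff_op family_poly_mean[where p=p] Lspace_diff_op p f)
        also have "\<dots> \<le> ennreal ?q * (?S * ennreal (h powr \<alpha>) + ennreal B * ?N * ennreal (h powr \<alpha>))"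
        proof (intro mult_left_mono add_mono)
          show "mixed_norm p (G h) \<le> ?S * ennreal (h powr \<alpha>)" by (rule holder_sup_upper[OF h])
          show "mixed_norm p (\<lambda>l x. poly_mean a n l (diff_op r h f) x - diff_op r h (poly_mean a n l f) x) \<le> ennreal B * ?N * ennreal (h powr \<alpha>)"
            using K B(1) A by (simp add: ennreal_mult)
        qed simp
        also have "\<dots> = ennreal ?q * (?S + ennreal B * ?N) * ennreal (h powr \<alpha>)" by (simp add: algebra_simps)
        also have "\<dots> \<le> ennreal ?q * (ennreal (1 + B) * (?S + ?N)) * ennreal (h powr \<alpha>)"
        proof (intro mult_right_mono mult_left_mono)
          have "?S + ennreal B * ?N \<le> ennreal (1 + B) * ?S + ennreal (1 + B) * ?N"
            using B(1) by (intro add_mono le_mult_ge_1 mult_right_mono) (auto simp flip: ennreal_1 intro: ennreal_leI)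
          then show "?S + ennreal B * ?N \<le> ennreal (1 + B) * (?S + ?N)" by (simp add: distrib_left)
        qed auto
        also have "\<dots> = ennreal C * (?S + ?N) * ennreal (h powr \<alpha>)"
          using B(1) unfolding C_def by (subst ennreal_mult) (auto simp: mult.assoc)
        finally show ?thesis .
      qed
      then show ?thesis unfolding holder_sup_le_iff by blast
    qed
  qed
  show ?thesis
  proof (rule exI[of _ C], intro conjI C1 allI ballI impI)
    fix n :: nat and f assume n: "1 \<le> n" and f: "f \<in> Lspace p"
    show "holder_sup \<alpha> (\<lambda>h. mixed_norm p (\<lambda>l. diff_op r h (\<lambda>x. f x - poly_mean a n l f x)))
      \<le> ennreal C * (holder_sup \<alpha> (\<lambda>h. mixed_norm p (\<lambda>l x. diff_op r h f x - poly_mean a n l (diff_op r h f) x)) + best_approx_H p r \<alpha> f n)"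
    proof (rule main[OF n f])
      show "family (\<lambda>l x. diff_op r h f x - poly_mean a n l (diff_op r h f) x)" for h
        by (intro family_diff Lspace_family[where p=p] family_poly_mean[where p=p] Lspace_diff_op p f)
      show "norm (diff_op r h (\<lambda>x. f x - poly_mean a n l f x) x) \<le> norm (diff_op r h f x - poly_mean a n l (diff_op r h f) x)
        + norm (poly_mean a n l (diff_op r h f) x - diff_op r h (poly_mean a n l f) x)" for h l x
        unfolding diff_op_diff using norm_triangle_ineq[of "diff_op r h f x - poly_mean a n l (diff_op r h f) x" "poly_mean a n l (diff_op r h f) x - diff_op r h (poly_mean a n l f) x"] by simp
    qed
    show "holder_sup \<alpha> (\<lambda>h. mixed_norm p (\<lambda>l x. diff_op r h f x - poly_mean a n l (diff_op r h f) x))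
      \<le> ennreal C * (holder_sup \<alpha> (\<lambda>h. mixed_norm p (\<lambda>l. diff_op r h (\<lambda>x. f x - poly_mean a n l f x))) + best_approx_H p r \<alpha> f n)"
    proof (rule main[OF n f])
      show "family (\<lambda>l. diff_op r h (\<lambda>x. f x - poly_mean a n l f x))" for h
        by (intro family_diff_op family_diff Lspace_family[where p=p] family_poly_mean[where p=p] f)
      show "norm (diff_op r h f x - poly_mean a n l (diff_op r h f) x) \<le> norm (diff_op r h (\<lambda>x. f x - poly_mean a n l f x) x)
        + norm (poly_mean a n l (diff_op r h f) x - diff_op r h (poly_mean a n l f) x)" for h l x
        unfolding diff_op_diff using norm_triangle_ineq4[of "diff_op r h f x - diff_op r h (poly_mean a n l f) x" "poly_mean a n l (diff_op r h f) x - diff_op r h (poly_mean a n l f) x"] by simp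
    qed
  qed
qed

text \<open>Small steps are the difficulty: the seminorm of f - L_\<lambda> f is controlled on
  average, not at the selected \<lambda>. Therefore the fixed function f - T is written as (f -
  L_\<lambda> f) + (L_\<lambda> f - T) for all \<lambda>, and Bernstein's inequality is applied to
  the second, polynomial family. Steps above the mesh follow from Jackson's bound alone.\<close>

lemma best_approx_le_mixed:
  assumes p: "0 < p" "p \<noteq> \<infinity>" and r: "1 \<le> r" and \<alpha>: "0 < \<alpha>" "\<alpha> \<le> real r"
  shows "\<exists>C\<ge>0. \<forall>n\<ge>1. \<forall>f\<in>Hspace p r \<alpha>.
    best_approx_H p r \<alpha> f n \<le> ennreal C * mixed_Hnorm p r \<alpha> (\<lambda>l x. f x - poly_mean a n l f x)"
proof -
  from jackson_mixed[OF p \<alpha>(1), where r=r]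
  obtain J where J: "0 \<le> J" "\<forall>n\<ge>1. \<forall>F. \<forall>M\<ge>0. family F \<longrightarrow> (\<forall>l. F l \<in> Lspace p \<and> translation_continuous p (F l)) \<longrightarrow>
    (\<forall>h>0. mixed_norm p (\<lambda>l. diff_op r h (F l)) \<le> ennreal (M * h powr \<alpha>)) \<longrightarrow>
    (\<exists>l. \<exists>Q\<in>trig_polys n. Lnorm p (\<lambda>x. F l x - Q x) \<le> ennreal (J * M * mesh (6 * n) powr \<alpha>))"
    by (elim exE conjE)
  from bernstein_family[OF p(1) \<alpha>(2)]
  obtain B where B: "0 \<le> B" "\<forall>n\<ge>1. \<forall>G. \<forall>b\<ge>0. family G \<longrightarrow> (\<forall>l. G l \<in> trig_polys n) \<longrightarrow>
    mixed_norm p (\<lambda>l. diff_op r (mesh (6 * n)) (G l)) \<le> ennreal (b * mesh (6 * n) powr \<alpha>) \<longrightarrow>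
    (\<forall>h. 0 < h \<longrightarrow> h \<le> mesh (6 * n) \<longrightarrow> mixed_norm p (\<lambda>l. diff_op r h (G l)) \<le> ennreal (B * b * h powr \<alpha>))"
    by (elim exE conjE)
  from mixed_norm_diff_op_le[OF p(1), where r=r]
  obtain K where K: "1 \<le> K" "\<forall>F h. family F \<longrightarrow> mixed_norm p (\<lambda>l. diff_op r h (F l)) \<le> ennreal K * mixed_norm p F"
    by (elim exE conjE)
  define q where "q = (quasi_const p)\<^sup>2"
  have q: "1 \<le> q" using quasi_const_ge_1[of p] by (simp add: q_def one_le_power)
  define D where "D = K * J + q * (1 + B * (q * (K * J + 1)))"
  have KJ: "0 \<le> K * J" using K(1) J(1) by simp
  have D2: "0 \<le> q * (1 + B * (q * (K * J + 1)))" using q B(1) KJ by simp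
  have D: "0 \<le> D" using KJ D2 by (simp add: D_def)
  define C where "C = J * (2*pi) powr \<alpha> + D + 1"
  have C0: "0 < C" using J(1) D by (auto simp: C_def intro!: add_nonneg_pos add_nonneg_nonneg)
  show ?thesis
  proof (rule exI[of _ C], intro conjI less_imp_le[OF C0] allI ballI impI)
    fix n :: nat and f assume n: "1 \<le> n" and fH: "f \<in> Hspace p r \<alpha>"
    have f: "f \<in> Lspace p" and fN: "Hnorm p r \<alpha> f \<noteq> top" using fH by (auto simp: Hspace_def)
    let ?g = "\<lambda>l x. f x - poly_mean a n l f x"
    let ?\<delta> = "mesh (6 * n)"
    have \<delta>: "0 < ?\<delta>" "?\<delta> \<le> 2*pi" using n by (auto simp: divide_le_eq)
    have gfam: "family ?g" by (intro family_diff Lspace_family[where p=p] family_poly_mean[where p=p] f)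
    show "best_approx_H p r \<alpha> f n \<le> ennreal C * mixed_Hnorm p r \<alpha> ?g"
    proof (cases "mixed_Hnorm p r \<alpha> ?g = top")
      case True
      then show ?thesis using C0 by (simp add: ennreal_mult_top)
    next
      case False
      then obtain M where M: "0 \<le> M" "mixed_Hnorm p r \<alpha> ?g = ennreal M" by (cases "mixed_Hnorm p r \<alpha> ?g") auto
      have gM: "mixed_norm p (\<lambda>l. diff_op r h (?g l)) \<le> ennreal (M * h powr \<alpha>)" if "0 < h" for h
      proof (rule holder_sup_real[OF _ M(1) that])
        show "holder_sup \<alpha> (\<lambda>h. mixed_norm p (\<lambda>l. diff_op r h (?g l))) \<le> ennreal M"
          unfolding M(2)[symmetric] mixed_Hnorm_holder_sup by simp
      qed
      \<comment> \<open>Finiteness yields continuity of translations for \<open>f\<close>, which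
        Jackson's inequality requires; the size \<open>A\<close> does not enter the
        constant.\<close>
      obtain A where A: "0 \<le> A" "Hnorm p r \<alpha> f = ennreal A" using fN by (cases "Hnorm p r \<alpha> f") auto
      have "holder_sup \<alpha> (\<lambda>h. Lnorm p (diff_op r h f)) \<le> ennreal A"
        unfolding A(2)[symmetric] Hnorm_holder_sup by simp
      from holder_sup_real[OF this A(1)]
      have tc: "translation_continuous p f"
        by (intro translation_continuous_holder[OF p(1) f r \<alpha>(1) A(1)] allI impI)
      have gL: "?g l \<in> Lspace p \<and> translation_continuous p (?g l)" for l
        by (intro conjI Lspace_diff translation_continuous_diff p(1) f tc trig_polys_Lspace[OF p(1) poly_mean_in_trig_polys]
            translation_continuous_trig_poly[OF p(1) poly_mean_in_trig_polys])
      have "\<exists>l. \<exists>Q\<in>trig_polys n. Lnorm p (\<lambda>x. ?g l x - Q x) \<le> ennreal (J * M * ?\<delta> powr \<alpha>)"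
      proof (rule J(2)[rule_format, OF n M(1) gfam])
        show "?g l \<in> Lspace p \<and> translation_continuous p (?g l)" for l by (rule gL)
        show "mixed_norm p (\<lambda>l. diff_op r h (?g l)) \<le> ennreal (M * h powr \<alpha>)" if "0 < h" for h by (rule gM[OF that])
      qed
      then obtain l Q where Q: "Q \<in> trig_polys n" "Lnorm p (\<lambda>x. ?g l x - Q x) \<le> ennreal (J * M * ?\<delta> powr \<alpha>)" by blast
      \<comment> \<open>The selected \<open>l\<close> is frozen in \<open>T\<close>; the parameter
        is free again from here on.\<close>
      define T where "T x = Q x + poly_mean a n l f x" for x
      define u where "u x = f x - T x" for x
      have T: "T \<in> trig_polys n" unfolding T_def[abs_def] by (rule trig_polys_add[OF Q(1) poly_mean_in_trig_polys])
      have u: "u \<in> Lspace p" unfolding u_def[abs_def] by (rule Lspace_diff[OF p(1) f trig_polys_Lspace[OF p(1) T]])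
      have ufam: "family (\<lambda>_. u)" by (rule Lspace_family[OF u])
      have u\<delta>: "mixed_norm p (\<lambda>_. u) \<le> ennreal (J * M * ?\<delta> powr \<alpha>)"
        using Q(2) unfolding mixed_norm_const[OF p(1)] u_def[abs_def] T_def by (simp add: algebra_simps)
      have uK: "mixed_norm p (\<lambda>_. diff_op r h u) \<le> ennreal (K * J * M * ?\<delta> powr \<alpha>)" for h
        using cmult_bound_real[OF K(2)[rule_format, OF ufam, of h] u\<delta>] K(1) J(1) M(1) by (simp add: mult.assoc)
      \<comment> \<open>For every \<open>l\<close> the sum of \<open>?g l\<close> and
        \<open>?G l\<close> is \<open>u\<close>, so averages over \<open>l\<close> give information
        on \<open>u\<close>.\<close>
      let ?G = "\<lambda>l x. poly_mean a n l f x - T x"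
      have Gfam: "family ?G"
        by (intro family_diff family_poly_mean[OF f] Lspace_family[OF trig_polys_Lspace[OF p(1) T]])
      have GT: "?G l \<in> trig_polys n" for l by (rule trig_polys_diff[OF poly_mean_in_trig_polys T])
      define b where "b = q * (K * J + 1) * M"
      have b: "0 \<le> b" using q KJ M(1) by (simp add: b_def)
      have "mixed_norm p (\<lambda>l. diff_op r ?\<delta> (?G l)) \<le> ennreal (q * (K * J * M * ?\<delta> powr \<alpha> + M * ?\<delta> powr \<alpha>))"
        unfolding q_def
      proof (rule mixed_norm_add_real[OF p(1) family_diff_op[OF ufam] family_diff_op[OF gfam] _ uK gM[OF \<delta>(1)]])
        have "?G l x = u x - ?g l x" for l x by (simp add: u_def)
        then show "norm (diff_op r ?\<delta> (?G l) x) \<le> norm (diff_op r ?\<delta> u x) + norm (diff_op r ?\<delta> (?g l) x)" for l x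
          by (simp only: diff_op_diff norm_triangle_ineq4)
        show "0 \<le> K * J * M * ?\<delta> powr \<alpha>" using K(1) J(1) M(1) by (intro mult_nonneg_nonneg) auto
        show "0 \<le> M * ?\<delta> powr \<alpha>" using M(1) by (intro mult_nonneg_nonneg) auto
      qed
      also have "q * (K * J * M * ?\<delta> powr \<alpha> + M * ?\<delta> powr \<alpha>) = b * ?\<delta> powr \<alpha>" by (simp only: b_def distrib_left distrib_right mult.assoc mult_1_left)
      finally have G\<delta>: "mixed_norm p (\<lambda>l. diff_op r ?\<delta> (?G l)) \<le> ennreal (b * ?\<delta> powr \<alpha>)" .
      have "Lnorm p (diff_op r h u) \<le> ennreal (D * M * h powr \<alpha>)" if h: "0 < h" for h
      proof (cases "h \<le> ?\<delta>")
        case True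
        have "mixed_norm p (\<lambda>_. diff_op r h u) \<le> ennreal (q * (M * h powr \<alpha> + B * b * h powr \<alpha>))"
          unfolding q_def
        proof (rule mixed_norm_add_real[OF p(1) family_diff_op[OF gfam] family_diff_op[OF Gfam] _ gM[OF h]])
          have eq: "diff_op r h u x = diff_op r h (?g l) x + diff_op r h (?G l) x" for l x
            unfolding diff_op_add[symmetric] u_def[abs_def] by simp
          show "norm (diff_op r h u x) \<le> norm (diff_op r h (?g l) x) + norm (diff_op r h (?G l) x)" for l x
            unfolding eq[of x l] by (rule norm_triangle_ineq)
          show "mixed_norm p (\<lambda>l. diff_op r h (?G l)) \<le> ennreal (B * b * h powr \<alpha>)"
            by (rule B(2)[rule_format, OF n b Gfam _ G\<delta> h True]) (rule GT)
          show "0 \<le> M * h powr \<alpha>" using M(1) by simp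
          show "0 \<le> B * b * h powr \<alpha>" using B(1) b by simp
        qed
        also have "\<dots> \<le> ennreal (D * M * h powr \<alpha>)"
        proof (rule ennreal_leI)
          have "q * (M * h powr \<alpha> + B * b * h powr \<alpha>) = q * (1 + B * (q * (K * J + 1))) * (M * h powr \<alpha>)"
            by (simp add: b_def algebra_simps)
          also have "\<dots> \<le> D * (M * h powr \<alpha>)"
            using KJ M(1) by (intro mult_right_mono) (auto simp: D_def)
          finally show "q * (M * h powr \<alpha> + B * b * h powr \<alpha>) \<le> D * M * h powr \<alpha>" by (simp add: mult.assoc)
        qed
        finally show ?thesis unfolding mixed_norm_const[OF p(1)] .
      next
        case False
        have "K * J * M * ?\<delta> powr \<alpha> \<le> D * M * h powr \<alpha>"
          using False \<delta>(1) \<alpha>(1) KJ D2 M(1) D by (intro mult_mono powr_mono2 mult_right_mono mult_nonneg_nonneg) (auto simp: D_def)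
        then show ?thesis using uK[of h] unfolding mixed_norm_const[OF p(1)] by (meson ennreal_leI order_trans)
      qed
      then have "holder_sup \<alpha> (\<lambda>h. Lnorm p (diff_op r h u)) \<le> ennreal (D * M)"
        using D M(1) by (intro holder_sup_leI) auto
      moreover have "Lnorm p u \<le> ennreal (J * (2*pi) powr \<alpha> * M)"
      proof -
        have "J * M * ?\<delta> powr \<alpha> \<le> J * M * (2*pi) powr \<alpha>"
          using \<delta> \<alpha>(1) J(1) M(1) by (intro mult_left_mono powr_mono2) auto
        then have "ennreal (J * M * ?\<delta> powr \<alpha>) \<le> ennreal (J * (2*pi) powr \<alpha> * M)"
          by (intro ennreal_leI) (simp only: mult_ac)
        then show ?thesis using u\<delta> unfolding mixed_norm_const[OF p(1)] by (rule order_trans[rotated])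
      qed
      ultimately have "Hnorm p r \<alpha> u \<le> ennreal (J * (2*pi) powr \<alpha> * M) + ennreal (D * M)"
        unfolding Hnorm_holder_sup by (rule add_mono[rotated])
      also have "\<dots> = ennreal ((J * (2*pi) powr \<alpha> + D) * M)"
        using J(1) M(1) D by (simp add: distrib_right flip: ennreal_plus)
      also have "\<dots> \<le> ennreal (C * M)"
        using M(1) by (intro ennreal_leI mult_right_mono) (auto simp: C_def)
      also have "\<dots> = ennreal C * mixed_Hnorm p r \<alpha> ?g" using C0 M by (simp add: ennreal_mult)
      finally have "Hnorm p r \<alpha> u \<le> ennreal C * mixed_Hnorm p r \<alpha> ?g" .
      then show ?thesis
        unfolding best_approx_H_def u_def[abs_def] by (rule INF_lower2[OF T])
    qed
  qed
qed

lemma best_approx_le_average: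
  assumes p: "1 \<le> p" and f: "f \<in> Lspace p"
  shows "best_approx_H p r \<alpha> f n \<le> mixed_norm p (\<lambda>l x. f x - poly_mean a n l f x)
      + holder_sup \<alpha> (\<lambda>h. mixed_norm p (\<lambda>l x. diff_op r h f x - poly_mean a n l (diff_op r h f) x))"
    and "best_approx_H p r \<alpha> f n \<le> mixed_Hnorm p r \<alpha> (\<lambda>l x. f x - poly_mean a n l f x)"
proof -
  from averaged_mean[OF p f, where n=n and a=a and r=r]
  obtain T where T: "T \<in> trig_polys n" "Lnorm p (\<lambda>x. f x - T x) \<le> mixed_norm p (\<lambda>l x. f x - poly_mean a n l f x)"
    "\<And>h. Lnorm p (diff_op r h (\<lambda>x. f x - T x)) \<le> mixed_norm p (\<lambda>l x. diff_op r h f x - poly_mean a n l (diff_op r h f) x)"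
    "\<And>h. Lnorm p (diff_op r h (\<lambda>x. f x - T x)) \<le> mixed_norm p (\<lambda>l. diff_op r h (\<lambda>x. f x - poly_mean a n l f x))"
    by (elim bexE conjE) blast
  show "best_approx_H p r \<alpha> f n \<le> mixed_norm p (\<lambda>l x. f x - poly_mean a n l f x)
      + holder_sup \<alpha> (\<lambda>h. mixed_norm p (\<lambda>l x. diff_op r h f x - poly_mean a n l (diff_op r h f) x))"
    unfolding best_approx_H_def Hnorm_holder_sup by (rule INF_lower2[OF T(1)]) (intro add_mono holder_sup_mono T)
  show "best_approx_H p r \<alpha> f n \<le> mixed_Hnorm p r \<alpha> (\<lambda>l x. f x - poly_mean a n l f x)"
    unfolding best_approx_H_def Hnorm_holder_sup mixed_Hnorm_holder_sup by (rule INF_lower2[OF T(1)]) (intro add_mono holder_sup_mono T)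
qed

text \<open>For \<open>p < 1\<close> the term \<open>P\<close> is the best approximation \<open>E\<close>; for \<open>p \<ge> 1\<close> it is zero and \<open>E\<close> is controlled by both errors.\<close>

lemma equivalence_arith:
  fixes X M1 M2 E P c d :: ennreal
  assumes c: "1 \<le> c" and d: "1 \<le> d" and M1: "M1 \<le> c * (M2 + E)" and M2: "M2 \<le> c * (M1 + E)"
    and E: "E \<le> d * (X + M1 + P)" "E \<le> d * (X + M2)" and P: "P \<le> E"
  shows "X + M2 \<le> (2 * c * d) * (X + M1 + P)" "X + M1 + P \<le> ((c + 1) * (1 + d)) * (X + M2)"
proof -
  have "X + M2 \<le> c * X + c * (M1 + E)" by (intro add_mono le_mult_ge_1 c M2)
  also have "\<dots> = c * ((X + M1) + E)" by (simp add: algebra_simps)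
  also have "\<dots> \<le> c * (d * (X + M1 + P) + d * (X + M1 + P))"
  proof (intro mult_left_mono add_mono E)
    have "X + M1 \<le> X + M1 + P" by simp
    also have "\<dots> \<le> d * (X + M1 + P)" by (rule le_mult_ge_1[OF d])
    finally show "X + M1 \<le> d * (X + M1 + P)" .
  qed simp
  also have "\<dots> = (2 * c * d) * (X + M1 + P)" by (simp only: mult_2[symmetric] mult_ac)
  finally show "X + M2 \<le> (2 * c * d) * (X + M1 + P)" .
  have "X + M1 + P \<le> c * X + c * (M2 + E) + E" by (intro add_mono le_mult_ge_1 c M1 P)
  also have "\<dots> = c * (X + M2 + E) + E" by (simp add: algebra_simps)
  also have "\<dots> \<le> c * (X + M2 + E) + 1 * (X + M2 + E)" by (intro add_mono) auto
  also have "\<dots> = (c + 1) * (1 * (X + M2) + E)" by (simp only: distrib_right mult_1_left)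
  also have "\<dots> \<le> (c + 1) * (1 * (X + M2) + d * (X + M2))" by (intro mult_left_mono add_mono E) auto
  also have "\<dots> = ((c + 1) * (1 + d)) * (X + M2)" by (simp only: distrib_right[symmetric] mult.assoc)
  finally show "X + M1 + P \<le> ((c + 1) * (1 + d)) * (X + M2)" .
qed

theorem theorem4p1:
  fixes p :: ennreal and r :: nat and \<alpha> :: real
    and a :: "int \<Rightarrow> nat \<Rightarrow> complex"
    and w :: "(real \<Rightarrow> complex) \<Rightarrow> real \<Rightarrow> real"
  assumes "0 < p" and "1 \<le> r" and "0 < \<alpha>" and "\<alpha> \<le> real r"
    and "\<And>n. 1 \<le> n \<Longrightarrow> a 0 n = 1"
    and "bounded_means p a"
    and "w \<in> Omega_class p"
    and "equivalent_on (Lspace p)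
           (\<lambda>f n. mixed_norm p (\<lambda>l x. f x - poly_mean a n l f x))
           (\<lambda>f n. ennreal (w f (1 / real n)))"
  shows "equivalent_on (Hspace p r \<alpha>)
           (\<lambda>f n. mixed_Hnorm p r \<alpha> (\<lambda>l x. f x - poly_mean a n l f x))
           (\<lambda>f n. w_H w r \<alpha> f (1 / real n)
                    + (if p < 1 then best_approx_H p r \<alpha> f n else 0))"
proof -
  let ?X = "\<lambda>f n. mixed_norm p (\<lambda>l x. f x - poly_mean a n l f x)"
  let ?A = "\<lambda>f n. mixed_Hnorm p r \<alpha> (\<lambda>l x. f x - poly_mean a n l f x)"
  let ?M1 = "\<lambda>f n. holder_sup \<alpha> (\<lambda>h. mixed_norm p (\<lambda>l x. diff_op r h f x - poly_mean a n l (diff_op r h f) x))"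
  let ?M2 = "\<lambda>f n. holder_sup \<alpha> (\<lambda>h. mixed_norm p (\<lambda>l. diff_op r h (\<lambda>x. f x - poly_mean a n l f x)))"
  let ?E = "\<lambda>f n. best_approx_H p r \<alpha> f n"
  let ?P = "\<lambda>f n. if p < 1 then ?E f n else 0"
  \<comment> \<open>The right-hand side with the error of the means in place of \<open>w\<close>.
    Passing between \<open>?R\<close> and \<open>?B\<close> costs only the constants of the assumed
    equivalence.\<close>
  let ?R = "\<lambda>f n. ?X f n + ?M1 f n + ?P f n"
  let ?B = "\<lambda>f n. w_H w r \<alpha> f (1 / real n) + ?P f n"
  from assms(8) obtain c1 c2 where c: "0 < c1" "0 < c2"
      "\<forall>f\<in>Lspace p. \<forall>n\<ge>1. ennreal c1 * ?X f n \<le> ennreal (w f (1 / real n)) \<and> ennreal (w f (1 / real n)) \<le> ennreal c2 * ?X f n"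
    unfolding equivalent_on_def by (elim exE conjE)
  from mean_error_commute[OF assms(1-4,6)]
  obtain C where C: "1 \<le> C" "\<forall>n\<ge>1. \<forall>f\<in>Lspace p. ?M2 f n \<le> ennreal C * (?M1 f n + ?E f n) \<and> ?M1 f n \<le> ennreal C * (?M2 f n + ?E f n)"
    by (elim exE conjE)
  have "\<exists>D\<ge>1. \<forall>n\<ge>1. \<forall>f\<in>Hspace p r \<alpha>. ?E f n \<le> ennreal D * ?R f n \<and> ?E f n \<le> ennreal D * ?A f n"
  proof (cases "p < 1")
    case True
    then have "p \<noteq> \<infinity>" by auto
    from best_approx_le_mixed[OF assms(1) this assms(2-4), where a=a]
    obtain D where D: "0 \<le> D" "\<forall>n\<ge>1. \<forall>f\<in>Hspace p r \<alpha>. ?E f n \<le> ennreal D * ?A f n"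
      by (elim exE conjE)
    show ?thesis
    proof (rule exI[of _ "D + 1"], intro conjI allI impI ballI)
      show "1 \<le> D + 1" using D(1) by simp
      fix n :: nat and f assume n: "1 \<le> n" and f: "f \<in> Hspace p r \<alpha>"
      have D1: "1 \<le> ennreal (D + 1)" "ennreal D \<le> ennreal (D + 1)" using D(1) by (auto simp flip: ennreal_1 intro!: ennreal_leI)
      \<comment> \<open>Here the best approximation is itself a summand of
        \<open>?R\<close>.\<close>
      have "?E f n \<le> ?R f n" using True by simp
      also have "\<dots> \<le> ennreal (D + 1) * ?R f n" by (rule le_mult_ge_1[OF D1(1)])
      finally show "?E f n \<le> ennreal (D + 1) * ?R f n" .
      have "?E f n \<le> ennreal D * ?A f n" using D(2) n f by blast
      also have "\<dots> \<le> ennreal (D + 1) * ?A f n" by (intro mult_right_mono D1) simp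
      finally show "?E f n \<le> ennreal (D + 1) * ?A f n" .
    qed
  next
    case False
    then have p: "1 \<le> p" by simp
    show ?thesis
      by (rule exI[of _ 1]) (use best_approx_le_average[OF p] False in \<open>auto simp: Hspace_def\<close>)
  qed
  then obtain D where D: "1 \<le> D" "\<forall>n\<ge>1. \<forall>f\<in>Hspace p r \<alpha>. ?E f n \<le> ennreal D * ?R f n \<and> ?E f n \<le> ennreal D * ?A f n"
    by (elim exE conjE)
  \<comment> \<open>With \<open>m \<le> 1 \<le> k\<close> the summand \<open>?P\<close>, common to
    \<open>?R\<close> and \<open>?B\<close>, passes through both estimates.\<close>
  define m where "m = min c1 1"
  define k where "k = max c2 1"
  define K1 where "K1 = 2 * C * D"
  define K2 where "K2 = (C + 1) * (1 + D)"
  have pos: "0 < m" "0 < k" "0 < K1" "0 < K2" using c C(1) D(1) by (auto simp: m_def k_def K1_def K2_def)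
  have "ennreal (m / K1) * ?A f n \<le> ?B f n \<and> ?B f n \<le> ennreal (k * K2) * ?A f n"
    if n: "1 \<le> n" and fH: "f \<in> Hspace p r \<alpha>" for f n
  proof -
    have f: "f \<in> Lspace p" using fH by (simp add: Hspace_def)
    have A: "?A f n = ?X f n + ?M2 f n" by (rule mixed_Hnorm_holder_sup)
    have K: "ennreal K1 = 2 * ennreal C * ennreal D" "ennreal K2 = (ennreal C + 1) * (1 + ennreal D)"
      using C(1) D(1) by (simp_all add: K1_def K2_def ennreal_mult ennreal_plus)
    have C': "1 \<le> ennreal C" and D': "1 \<le> ennreal D" using C(1) D(1) by (simp_all flip: ennreal_1 add: ennreal_le_iff)
    have MM: "?M1 f n \<le> ennreal C * (?M2 f n + ?E f n)" "?M2 f n \<le> ennreal C * (?M1 f n + ?E f n)"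
      by (rule C(2)[rule_format, OF n f, THEN conjunct2] C(2)[rule_format, OF n f, THEN conjunct1])+
    have EE: "?E f n \<le> ennreal D * ?R f n" "?E f n \<le> ennreal D * (?X f n + ?M2 f n)"
      by (rule D(2)[rule_format, OF n fH, THEN conjunct1] D(2)[rule_format, OF n fH, THEN conjunct2, unfolded A])+
    have PE: "?P f n \<le> ?E f n" by simp
    have AR: "?A f n \<le> ennreal K1 * ?R f n" "?R f n \<le> ennreal K2 * ?A f n"
      unfolding K A by (rule equivalence_arith[OF C' D' MM EE PE])+
    have wh: "ennreal m * ?X g n \<le> ennreal (w g (1 / real n))" "ennreal (w g (1 / real n)) \<le> ennreal k * ?X g n" if "g \<in> Lspace p" for g
    proof -
      have "ennreal m * ?X g n \<le> ennreal c1 * ?X g n" by (intro mult_right_mono ennreal_leI) (auto simp: m_def)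
      then show "ennreal m * ?X g n \<le> ennreal (w g (1 / real n))" using c(3) that n by (meson order_trans)
      have "ennreal c2 * ?X g n \<le> ennreal k * ?X g n" by (intro mult_right_mono ennreal_leI) (auto simp: k_def)
      then show "ennreal (w g (1 / real n)) \<le> ennreal k * ?X g n" using c(3) that n by (meson order_trans)
    qed
    let ?W = "holder_sup \<alpha> (\<lambda>h. ennreal (w (diff_op r h f) (1 / real n)))"
    have d: "diff_op r h f \<in> Lspace p" for h by (rule Lspace_diff_op[OF assms(1) f])
    have scale: "holder_sup \<alpha> (\<lambda>h. ennreal c * X h) = ennreal c * holder_sup \<alpha> X" for c X
      by (simp add: holder_sup_def ennreal_times_divide SUP_mult_left_ennreal)
    have W: "ennreal m * ?M1 f n \<le> ?W" "?W \<le> ennreal k * ?M1 f n"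
      unfolding scale[symmetric] by (intro holder_sup_mono wh d)+
    have mk: "ennreal m \<le> 1" "1 \<le> ennreal k" by (auto simp: m_def k_def)
    have "ennreal m * ?R f n = ennreal m * ?X f n + ennreal m * ?M1 f n + ennreal m * ?P f n" by (simp only: distrib_left)
    also have "\<dots> \<le> ennreal (w f (1 / real n)) + ?W + 1 * ?P f n"
      by (intro add_mono wh f W mult_right_mono mk) simp
    also have "\<dots> = ?B f n" by (simp only: w_H_holder_sup mult_1_left)
    finally have lower: "ennreal m * ?R f n \<le> ?B f n" .
    have "?B f n = ennreal (w f (1 / real n)) + ?W + ?P f n" by (simp only: w_H_holder_sup)
    also have "\<dots> \<le> ennreal k * ?X f n + ennreal k * ?M1 f n + ennreal k * ?P f n"
      by (intro add_mono wh f W le_mult_ge_1 mk)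
    also have "\<dots> = ennreal k * ?R f n" by (simp only: distrib_left)
    finally have upper: "?B f n \<le> ennreal k * ?R f n" .
    have "ennreal (m / K1) * ?A f n \<le> ennreal (m / K1) * (ennreal K1 * ?R f n)" by (intro mult_left_mono AR) simp
    also have "\<dots> = ennreal m * ?R f n" using pos by (simp flip: mult.assoc ennreal_mult)
    finally have low: "ennreal (m / K1) * ?A f n \<le> ?B f n" using lower by (rule order_trans)
    have "?B f n \<le> ennreal k * ?R f n" by (rule upper)
    also have "\<dots> \<le> ennreal k * (ennreal K2 * ?A f n)" by (intro mult_left_mono AR) simp
    also have "\<dots> = ennreal (k * K2) * ?A f n" using pos by (simp add: ennreal_mult mult.assoc)
    finally show ?thesis by (rule conjI[OF low])
  qed
  note main = this
  show ?thesis
    unfolding equivalent_on_def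
  proof (rule exI[of _ "m / K1"], rule conjI, simp add: pos, rule exI[of _ "k * K2"], rule conjI, simp add: pos, intro ballI allI impI)
    show "ennreal (m / K1) * ?A f n \<le> ?B f n \<and> ?B f n \<le> ennreal (k * K2) * ?A f n"
      if "f \<in> Hspace p r \<alpha>" "1 \<le> n" for f n by (rule main[OF that(2,1)])
  qed
qed

end
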